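(* (Exact dimensionality of conditional measures in fibers) Let $T:\hat Y\to\hat Y$ be a Hölder conformal skew product Smale endomorphism, and let $\psi:E_A\to\mathbb R$ be a Hölder continuous summable potential with equilibrium (Gibbs) state $\mu_\psi$ on $E_A$; put $m_\psi=\mu_\psi\circ\pi_0^{-1}$. Then for $m_\psi$-a.e. $\omega\in E_A^+$ the projection $\bar\mu_\psi^\omega\circ\hat\pi_2^{-1}$ of the conditional measure to the fiber $J_\omega$ satisfies $$\mathrm{HD}(\bar\mu_\psi^\omega\circ\hat\pi_2^{-1})=\frac{h_{\mu_\psi}(\sigma)}{\chi_{\mu_\psi}(\sigma)}=\frac{\mathrm P_\sigma(\psi)-\int\psi\,d\mu_\psi}{\chi_{\mu_\psi}(\sigma)} .$$ Moreover, for $m_\psi$-a.e. $\omega\in E_A^+$ the measure $\bar\mu_\psi^\omega\circ\hat\pi_2^{-1}$ is exact dimensional, and $$\lim_{r\to0}\frac{\log\bar\mu_\psi^\omega\circ\hat\pi_2^{-1}(B(z,r))}{\log r}=\frac{h_{\mu_\psi}(\sigma)}{\chi_{\mu_\psi}(\sigma)}$$ for $m_\psi$-a.e. $\omega\in E_A^+$ and $\bar\mu_\psi^\omega\circ\hat\pi_2^{-1}$-a.e. $z\in J_\omega$.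
   Context: Shifts. $E$ is a countable set and $A:E\times E\to\{0,1\}$ a finitely irreducible matrix (a word is admissible if $A_{ab}=1$ for consecutive letters; finite irreducibility: there is a finite set $\Phi$ of finite admissible words such that for all $a,b\in E$ some $\gamma\in\Phi$ makes $a\gamma b$ admissible). $E_A\subset E^{\mathbb Z}$, $E_A^+\subset E^{\{0,1,\dots\}}$: spaces of admissible sequences, left shift $\sigma$, $\pi_0(\tau)=\tau|_0^\infty$, where $\tau|_{-k}^\infty=(\tau_{-k},\tau_{-k+1},\dots)\in E_A^+$. Metrics on $E_A$: $d_\beta(\omega,\tau)=e^{-\beta n}$, $n\ge0$ maximal with $\omega_k=\tau_k$ for $|k|\le n$ ($n=-1$ if $\omega_0\ne\tau_0$; $d_\beta=0$ if $\omega=\tau$); analogously on $E_A^+$. $g:E_A\to\mathbb R$ is Hölder continuous if for some $\beta>0$, $L<\infty$: $|g(\omega)-g(\tau)|\le L d_\beta(\omega,\tau)$ whenever $\omega_0=\tau_0$; $\psi$ is summable if $\sum_{e\in E}\exp(\sup\psi|_{[e]})<\infty$, $[e]=\{\tau\in E_A:\tau_0=e\}$. $\mathrm P_\sigma(\psi)=\lim_n\frac1n\log\sum_{|\omega|=n}\exp(\sup S_n\psi|_{[\omega]})$, with $S_n\psi=\sum_{j<n}\psi\circ\sigma^j$, $[\omega]=\{\tau\in E_A:\tau_j=\omega_j,0\le j<n\}$. $\mu_\psi$ is the unique $\sigma$-invariant Borel probability for which there is $C\ge1$ with $C^{-1}\le\mu_\psi([\omega_0\dots\omega_{n-1}])/\exp(S_n\psi(\omega)-\mathrm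 P_\sigma(\psi)n)\le C$ for all $n\ge1$, $\omega\in E_A$; it is the unique equilibrium state of $\psi$. $\bar\mu_\psi^\omega$, $\omega\in E_A^+$, are the Rokhlin conditional measures of $\mu_\psi$ for the partition of $E_A$ into the sets $[\omega]=\{\tau\in E_A:\tau|_0^\infty=\omega\}$. Skew product Smale endomorphism. $Y\subset\mathbb R^d$ is bounded and complete; for each $\omega\in E_A^+$ there are $Y_\omega\subset Y$ and a continuous injective $T_\omega:Y_\omega\to Y_{\sigma(\omega)}$, with $\|T_\omega(y_1)-T_\omega(y_2)\|\le\lambda^{-1}\|y_1-y_2\|$ for a $\lambda>1$ independent of $\omega$. $\hat Y=\bigcup_\omega\{\omega\}\times Y_\omega$, $T(\omega,y)=(\sigma(\omega),T_\omega(y))$. For $\tau\in E_A$, $T_\tau^n=T_{\tau|_{-1}^\infty}\circ\dots\circ T_{\tau|_{-n}^\infty}$; $\hat\pi_2(\tau)$ is the unique point of $\bigcap_{n\ge1}\overline{T_\tau^n(Y_{\tau|_{-n}^\infty})}$; $\hat\pi(\tau)=(\tau|_0^\infty,\hat\pi_2(\tau))$; $J_\omega=\hat\pi_2([\omega])$; $J=\hat\pi(E_A)$. It is Hölder if $T:J\to J$ is continuous and $\hat\pi:E_A\to J$ is Hölder continuous. Conformal means: (a) each $Y_\omega$ is a closed bounded subset of $\mathbb R^d$ ($d\ge1$) with $\overline{\mathrm{Int}(Y_\omega)}=Y_\omega$; (b) each $T_\omega$ extends to a $C^1$ conformal embedding $Y_\omega^*\to Y_{\sigma(\omega)}^*$,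 with $Y_\omega^*\supset Y_\omega$ bounded, connected, open in $\mathbb R^d$; (c) the uniform contraction inequality holds on the $Y_\omega^*$ (perhaps with a smaller $\lambda>1$); (d) there are $\alpha,H>0$ with $|\log|T_\omega'(y)|-\log|T_\omega'(z)||\le H\|y-z\|^\alpha$ for all $\omega$, $y,z\in Y_\omega^*$; (e) $E_A\ni\tau\mapsto\log|T_{\tau|_0^\infty}'(\hat\pi_2(\tau))|$ is Hölder continuous; (f) for all $\omega\in E_A^+$ and $a\ne b$ in $E$ with $A_{a\omega_0}=A_{b\omega_0}=1$: $T_{a\omega}(\mathrm{Int}(Y_{a\omega}))\cap T_{b\omega}(\mathrm{Int}(Y_{b\omega}))=\emptyset$; (g) there is a measurable $\delta:E_A^+\to(0,\infty)$ with $J_\omega\cap(Y_\omega\setminus\overline{B(Y_\omega^c,\delta(\omega))})\ne\emptyset$ for every $\omega$ ($B(S,\delta)$ is the $\delta$-neighbourhood of $S$). Here $|T_\omega'(y)|$ is the similarity factor of the derivative. Lyapunov exponent: $\chi_\mu(\sigma)=-\int_{E_A}\log|T_{\tau|_0^\infty}'(\hat\pi_2(\tau))|\,d\mu(\tau)$. $\mathrm{HD}(\nu)=\inf\{\mathrm{HD}(B):B\text{ Borel},\ \nu(B^c)=0\}$. A measure $\nu$ is exact dimensional if $\lim_{r\to0}\log\nu(B(x,r))/\log r$ exists for $\nu$-a.e. $x$ and is $\nu$-a.e. constant. *)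

theory Defs
  imports "HOL-Probability.Information" "HOL-Probability.Giry_Monad"
begin

section \<open>Countable shifts\<close>

text \<open>The alphabet is the whole type \<open>'e :: countable\<close> (finite or infinite), and \<open>A a b\<close>
  stands for \<open>A_ab = 1\<close>.\<close>

abbreviation admissible :: "('e \<Rightarrow> 'e \<Rightarrow> bool) \<Rightarrow> 'e list \<Rightarrow> bool" where
  "admissible A w \<equiv> successively A w"

definition finitely_irreducible :: "('e \<Rightarrow> 'e \<Rightarrow> bool) \<Rightarrow> bool" where
  "finitely_irreducible A \<longleftrightarrow>
    (\<exists>\<Phi>. finite \<Phi> \<and> (\<forall>\<gamma>\<in>\<Phi>. admissible A \<gamma>) \<and>
         (\<forall>a b. \<exists>\<gamma>\<in>\<Phi>. admissible A (a # \<gamma> @ [b])))"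

definition two_sided :: "('e \<Rightarrow> 'e \<Rightarrow> bool) \<Rightarrow> (int \<Rightarrow> 'e) set" where
  "two_sided A = {\<tau>. \<forall>k. A (\<tau> k) (\<tau> (k + 1))}"

definition one_sided :: "('e \<Rightarrow> 'e \<Rightarrow> bool) \<Rightarrow> (nat \<Rightarrow> 'e) set" where
  "one_sided A = {\<omega>. \<forall>k. A (\<omega> k) (\<omega> (k + 1))}"

text \<open>Used both on two-sided sequences (\<open>'i = int\<close>) and on one-sided ones (\<open>'i = nat\<close>).\<close>

definition shift :: "('i :: {plus, one} \<Rightarrow> 'e) \<Rightarrow> 'i \<Rightarrow> 'e" where
  "shift \<tau> = (\<lambda>k. \<tau> (k + 1))"

text \<open>\<open>tail_from k \<tau>\<close> is the one-sided sequence starting at the coordinate \<open>- k\<close> of \<open>\<tau>\<close>.\<close>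

definition tail_from :: "nat \<Rightarrow> (int \<Rightarrow> 'e) \<Rightarrow> nat \<Rightarrow> 'e" where
  "tail_from k \<tau> = (\<lambda>j. \<tau> (int j - int k))"

abbreviation pi0 :: "(int \<Rightarrow> 'e) \<Rightarrow> nat \<Rightarrow> 'e" where
  "pi0 \<equiv> tail_from 0"

text \<open>The greatest integer below ranges over all of \<open>int\<close>; the condition is vacuous for negative
  \<open>n\<close>, so it equals \<open>- 1\<close> when the zeroth coordinates differ.\<close>

definition two_sided_dist :: "real \<Rightarrow> (int \<Rightarrow> 'e) \<Rightarrow> (int \<Rightarrow> 'e) \<Rightarrow> real" where
  "two_sided_dist \<beta> \<omega> \<tau> =
    (if \<omega> = \<tau> then 0
     else exp (- \<beta> * real_of_int (GREATEST n. \<forall>k. \<bar>k\<bar> \<le> n \<longrightarrow> \<omega> k = \<tau> k)))"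

definition one_sided_dist :: "real \<Rightarrow> (nat \<Rightarrow> 'e) \<Rightarrow> (nat \<Rightarrow> 'e) \<Rightarrow> real" where
  "one_sided_dist \<beta> \<omega> \<tau> =
    (if \<omega> = \<tau> then 0
     else exp (- \<beta> * real_of_int (GREATEST n. \<forall>k. int k \<le> n \<longrightarrow> \<omega> k = \<tau> k)))"

text \<open>The topology does not depend on the exponent \<open>\<beta> > 0\<close>; we use \<open>\<beta> = 1\<close>.\<close>

definition two_sided_top :: "('e \<Rightarrow> 'e \<Rightarrow> bool) \<Rightarrow> (int \<Rightarrow> 'e) topology" where
  "two_sided_top A = Metric_space.mtopology (two_sided A) (two_sided_dist 1)"

definition one_sided_top :: "('e \<Rightarrow> 'e \<Rightarrow> bool) \<Rightarrow> (nat \<Rightarrow> 'e) topology" where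
  "one_sided_top A = Metric_space.mtopology (one_sided A) (one_sided_dist 1)"

definition two_sided_borel :: "('e \<Rightarrow> 'e \<Rightarrow> bool) \<Rightarrow> (int \<Rightarrow> 'e) measure" where
  "two_sided_borel A = sigma (two_sided A) {U. openin (two_sided_top A) U}"

definition one_sided_borel :: "('e \<Rightarrow> 'e \<Rightarrow> bool) \<Rightarrow> (nat \<Rightarrow> 'e) measure" where
  "one_sided_borel A = sigma (one_sided A) {U. openin (one_sided_top A) U}"

definition cylinder :: "('e \<Rightarrow> 'e \<Rightarrow> bool) \<Rightarrow> 'e list \<Rightarrow> (int \<Rightarrow> 'e) set" where
  "cylinder A w = {\<tau> \<in> two_sided A. \<forall>j < length w. \<tau> (int j) = w ! j}"

definition past_fiber :: "('e \<Rightarrow> 'e \<Rightarrow> bool) \<Rightarrow> (nat \<Rightarrow> 'e) \<Rightarrow> (int \<Rightarrow> 'e) set" where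
  "past_fiber A \<omega> = {\<tau> \<in> two_sided A. pi0 \<tau> = \<omega>}"


section \<open>Potentials, pressure, Gibbs states and conditional measures\<close>

definition hoelder :: "('e \<Rightarrow> 'e \<Rightarrow> bool) \<Rightarrow> ((int \<Rightarrow> 'e) \<Rightarrow> real) \<Rightarrow> bool" where
  "hoelder A g \<longleftrightarrow>
    (\<exists>\<beta>>0. \<exists>L. \<forall>\<omega>\<in>two_sided A. \<forall>\<tau>\<in>two_sided A. \<omega> 0 = \<tau> 0 \<longrightarrow>
       \<bar>g \<omega> - g \<tau>\<bar> \<le> L * two_sided_dist \<beta> \<omega> \<tau>)"

text \<open>Boundedness above is part of the definition because a real \<open>SUP\<close> of an unbounded set is an
  arbitrary value, whereas the supremum meant here would be infinite.\<close>

definition summable_potential ::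
    "('e :: countable \<Rightarrow> 'e \<Rightarrow> bool) \<Rightarrow> ((int \<Rightarrow> 'e) \<Rightarrow> real) \<Rightarrow> bool" where
  "summable_potential A \<psi> \<longleftrightarrow>
    (\<forall>e. bdd_above (\<psi> ` cylinder A [e])) \<and>
    (\<lambda>e. exp (SUP \<tau>\<in>cylinder A [e]. \<psi> \<tau>)) summable_on UNIV"

definition birkhoff_sum :: "((int \<Rightarrow> 'e) \<Rightarrow> real) \<Rightarrow> nat \<Rightarrow> (int \<Rightarrow> 'e) \<Rightarrow> real" where
  "birkhoff_sum \<psi> n \<tau> = (\<Sum>j<n. \<psi> ((shift ^^ j) \<tau>))"

definition pressure ::
    "('e :: countable \<Rightarrow> 'e \<Rightarrow> bool) \<Rightarrow> ((int \<Rightarrow> 'e) \<Rightarrow> real) \<Rightarrow> real" where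
  "pressure A \<psi> =
    lim (\<lambda>n. 1 / real n *
      ln (\<Sum>\<^sub>\<infinity>w\<in>{w. length w = n \<and> admissible A w}.
            exp (SUP \<tau>\<in>cylinder A w. birkhoff_sum \<psi> n \<tau>)))"

definition gibbs_state ::
    "('e :: countable \<Rightarrow> 'e \<Rightarrow> bool) \<Rightarrow> ((int \<Rightarrow> 'e) \<Rightarrow> real) \<Rightarrow> (int \<Rightarrow> 'e) measure \<Rightarrow> bool" where
  "gibbs_state A \<psi> \<mu> \<longleftrightarrow>
    prob_space \<mu> \<and> sets \<mu> = sets (two_sided_borel A) \<and>
    distr \<mu> (two_sided_borel A) shift = \<mu> \<and>
    (\<exists>C\<ge>1. \<forall>n\<ge>1. \<forall>\<omega>\<in>two_sided A.
       (let q = measure \<mu> (cylinder A (map (\<lambda>j. \<omega> (int j)) [0..<n])) /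
                exp (birkhoff_sum \<psi> n \<omega> - pressure A \<psi> * real n)
        in 1 / C \<le> q \<and> q \<le> C))"

text \<open>A Rokhlin system of conditional measures for the partition into the sets
  \<open>past_fiber A \<omega>\<close>, whose quotient is identified with the one-sided shift through \<open>pi0\<close>.\<close>

definition rokhlin_conditionals ::
    "('e \<Rightarrow> 'e \<Rightarrow> bool) \<Rightarrow> (int \<Rightarrow> 'e) measure \<Rightarrow> ((nat \<Rightarrow> 'e) \<Rightarrow> (int \<Rightarrow> 'e) measure) \<Rightarrow> bool" where
  "rokhlin_conditionals A \<mu> \<mu>c \<longleftrightarrow>
    \<mu>c \<in> measurable (one_sided_borel A) (prob_algebra (two_sided_borel A)) \<and>
    (AE \<omega> in distr \<mu> (one_sided_borel A) pi0. emeasure (\<mu>c \<omega>) (past_fiber A \<omega>) = 1) \<and>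
    (\<forall>B\<in>sets (two_sided_borel A).
       emeasure \<mu> B =
         (\<integral>\<^sup>+\<omega>. emeasure (\<mu>c \<omega>) B \<partial>(distr \<mu> (one_sided_borel A) pi0)))"


section \<open>Entropy\<close>

text \<open>Kolmogorov--Sinai entropy of a measure preserving map. A finite measurable partition is
  given by a labelling \<open>\<xi>\<close> of the points with finitely many labels; the labelling by words
  of length \<open>n\<close> below then represents the join of its first \<open>n\<close> preimages.\<close>

definition itinerary :: "('x \<Rightarrow> 'x) \<Rightarrow> ('x \<Rightarrow> nat) \<Rightarrow> nat \<Rightarrow> 'x \<Rightarrow> nat list" where
  "itinerary f \<xi> n x = map (\<lambda>j. \<xi> ((f ^^ j) x)) [0..<n]"

definition partition_entropy :: "'x measure \<Rightarrow> ('x \<Rightarrow> 'b) \<Rightarrow> real" where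
  "partition_entropy M \<xi> = prob_space.entropy M (exp 1) (count_space (\<xi> ` space M)) \<xi>"

definition ks_entropy :: "'x measure \<Rightarrow> ('x \<Rightarrow> 'x) \<Rightarrow> ereal" where
  "ks_entropy M f =
    (SUP \<xi>\<in>{\<xi> :: 'x \<Rightarrow> nat. simple_function M \<xi>}.
       ereal (lim (\<lambda>n. 1 / real n * partition_entropy M (itinerary f \<xi> n))))"


section \<open>Hausdorff dimension and exact dimensionality\<close>

definition hausdorff_premeasure :: "real \<Rightarrow> real \<Rightarrow> 'a :: metric_space set \<Rightarrow> ennreal" where
  "hausdorff_premeasure s \<epsilon> S =
    (INF U\<in>{U :: nat \<Rightarrow> 'a set. (\<forall>i. bounded (U i) \<and> diameter (U i) \<le> \<epsilon>) \<and> S \<subseteq> (\<Union>i. U i)}.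
       \<Sum>i. ennreal (diameter (U i) powr s))"

definition hausdorff_measure :: "real \<Rightarrow> 'a :: metric_space set \<Rightarrow> ennreal" where
  "hausdorff_measure s S = (SUP \<epsilon>\<in>{0<..}. hausdorff_premeasure s \<epsilon> S)"

text \<open>Only \<open>s > 0\<close> is used, since \<open>0 powr 0 = 0\<close>; this does not change the infimum.\<close>

definition hausdorff_dim :: "'a :: metric_space set \<Rightarrow> ereal" where
  "hausdorff_dim S = (INF s\<in>{s. 0 < s \<and> hausdorff_measure s S = 0}. ereal s)"

definition measure_dim :: "'a :: metric_space measure \<Rightarrow> ereal" where
  "measure_dim \<nu> = (INF B\<in>{B \<in> sets borel. emeasure \<nu> (- B) = 0}. hausdorff_dim B)"

definition local_dim_ratio :: "'a :: metric_space measure \<Rightarrow> 'a \<Rightarrow> real \<Rightarrow> real" where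
  "local_dim_ratio \<nu> x r = ln (measure \<nu> (ball x r)) / ln r"

definition exact_dimensional :: "'a :: metric_space measure \<Rightarrow> bool" where
  "exact_dimensional \<nu> \<longleftrightarrow>
    (\<exists>D :: real. AE x in \<nu>. (local_dim_ratio \<nu> x \<longlongrightarrow> D) (at_right 0))"


section \<open>Skew product Smale endomorphisms\<close>

text \<open>The family \<open>T \<omega> : Y \<omega> \<rightarrow> Y (shift \<omega>)\<close> is a family of total functions of which only the
  values on \<open>Y \<omega>\<close> (later: on a larger set \<open>Ystar \<omega>\<close>) matter.\<close>

definition skew_map :: "((nat \<Rightarrow> 'e) \<Rightarrow> 'a \<Rightarrow> 'a) \<Rightarrow> (nat \<Rightarrow> 'e) \<times> 'a \<Rightarrow> (nat \<Rightarrow> 'e) \<times> 'a" where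
  "skew_map T = (\<lambda>(\<omega>, y). (shift \<omega>, T \<omega> y))"

primrec past_comp :: "((nat \<Rightarrow> 'e) \<Rightarrow> 'a \<Rightarrow> 'a) \<Rightarrow> (int \<Rightarrow> 'e) \<Rightarrow> nat \<Rightarrow> 'a \<Rightarrow> 'a" where
  "past_comp T \<tau> 0 = id"
| "past_comp T \<tau> (Suc n) = past_comp T \<tau> n \<circ> T (tail_from (Suc n) \<tau>)"

definition pihat2 ::
    "((nat \<Rightarrow> 'e) \<Rightarrow> 'a :: euclidean_space set) \<Rightarrow> ((nat \<Rightarrow> 'e) \<Rightarrow> 'a \<Rightarrow> 'a) \<Rightarrow> (int \<Rightarrow> 'e) \<Rightarrow> 'a" where
  "pihat2 Y T \<tau> =
    the_elem (\<Inter>n\<in>{1..}. closure (past_comp T \<tau> n ` Y (tail_from n \<tau>)))"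

definition pihat ::
    "((nat \<Rightarrow> 'e) \<Rightarrow> 'a :: euclidean_space set) \<Rightarrow> ((nat \<Rightarrow> 'e) \<Rightarrow> 'a \<Rightarrow> 'a) \<Rightarrow>
     (int \<Rightarrow> 'e) \<Rightarrow> (nat \<Rightarrow> 'e) \<times> 'a" where
  "pihat Y T \<tau> = (pi0 \<tau>, pihat2 Y T \<tau>)"

definition limit_fiber ::
    "('e \<Rightarrow> 'e \<Rightarrow> bool) \<Rightarrow> ((nat \<Rightarrow> 'e) \<Rightarrow> 'a :: euclidean_space set) \<Rightarrow>
     ((nat \<Rightarrow> 'e) \<Rightarrow> 'a \<Rightarrow> 'a) \<Rightarrow> (nat \<Rightarrow> 'e) \<Rightarrow> 'a set" where
  "limit_fiber A Y T \<omega> = pihat2 Y T ` past_fiber A \<omega>"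

definition limit_set ::
    "('e \<Rightarrow> 'e \<Rightarrow> bool) \<Rightarrow> ((nat \<Rightarrow> 'e) \<Rightarrow> 'a :: euclidean_space set) \<Rightarrow>
     ((nat \<Rightarrow> 'e) \<Rightarrow> 'a \<Rightarrow> 'a) \<Rightarrow> ((nat \<Rightarrow> 'e) \<times> 'a) set" where
  "limit_set A Y T = pihat Y T ` two_sided A"

definition limit_set_top ::
    "('e \<Rightarrow> 'e \<Rightarrow> bool) \<Rightarrow> ((nat \<Rightarrow> 'e) \<Rightarrow> 'a :: euclidean_space set) \<Rightarrow>
     ((nat \<Rightarrow> 'e) \<Rightarrow> 'a \<Rightarrow> 'a) \<Rightarrow> ((nat \<Rightarrow> 'e) \<times> 'a) topology" where
  "limit_set_top A Y T =
    subtopology (prod_topology (one_sided_top A) euclidean) (limit_set A Y T)"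

text \<open>The projection of the conditional measure at \<open>\<omega>\<close> to the fiber \<open>limit_fiber A Y T \<omega>\<close>,
  as a Borel measure on the ambient Euclidean space.\<close>

definition fiber_measure ::
    "((nat \<Rightarrow> 'e) \<Rightarrow> 'a :: euclidean_space set) \<Rightarrow> ((nat \<Rightarrow> 'e) \<Rightarrow> 'a \<Rightarrow> 'a) \<Rightarrow>
     ((nat \<Rightarrow> 'e) \<Rightarrow> (int \<Rightarrow> 'e) measure) \<Rightarrow> (nat \<Rightarrow> 'e) \<Rightarrow> 'a measure" where
  "fiber_measure Y T \<mu>c \<omega> = distr (\<mu>c \<omega>) borel (pihat2 Y T)"

locale skew_product_smale =
  fixes A :: "'e :: countable \<Rightarrow> 'e \<Rightarrow> bool"
    and Y0 :: "'a :: euclidean_space set"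
    and Y :: "(nat \<Rightarrow> 'e) \<Rightarrow> 'a set"
    and T :: "(nat \<Rightarrow> 'e) \<Rightarrow> 'a \<Rightarrow> 'a"
  assumes irreducible: "finitely_irreducible A"
    and Y0_bounded: "bounded Y0"
    and Y0_complete: "complete Y0"
    and Y_subset: "\<And>\<omega>. \<omega> \<in> one_sided A \<Longrightarrow> Y \<omega> \<subseteq> Y0"
    and T_maps: "\<And>\<omega>. \<omega> \<in> one_sided A \<Longrightarrow> T \<omega> ` Y \<omega> \<subseteq> Y (shift \<omega>)"
    and T_continuous: "\<And>\<omega>. \<omega> \<in> one_sided A \<Longrightarrow> continuous_on (Y \<omega>) (T \<omega>)"
    and T_injective: "\<And>\<omega>. \<omega> \<in> one_sided A \<Longrightarrow> inj_on (T \<omega>) (Y \<omega>)"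
    and T_contracting:
      "\<exists>c>1. \<forall>\<omega>\<in>one_sided A. \<forall>y\<in>Y \<omega>. \<forall>z\<in>Y \<omega>.
         norm (T \<omega> y - T \<omega> z) \<le> inverse c * norm (y - z)"

text \<open>The limit set carries the sum of the metric of the one-sided shift and the Euclidean one.\<close>

locale hoelder_skew_product_smale = skew_product_smale +
  assumes skew_continuous:
      "continuous_map (limit_set_top A Y T) (limit_set_top A Y T) (skew_map T)"
    and pihat_hoelder:
      "\<exists>\<beta>>0. \<exists>L. \<forall>\<omega>\<in>two_sided A. \<forall>\<tau>\<in>two_sided A. \<omega> 0 = \<tau> 0 \<longrightarrow>
         one_sided_dist \<beta> (fst (pihat Y T \<omega>)) (fst (pihat Y T \<tau>)) +
         norm (snd (pihat Y T \<omega>) - snd (pihat Y T \<tau>))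
           \<le> L * two_sided_dist \<beta> \<omega> \<tau>"


section \<open>Conformality\<close>

text \<open>A linear map is a similarity with factor \<open>s\<close>; orientation reversal is allowed.\<close>

definition is_similarity :: "('a :: euclidean_space \<Rightarrow> 'a) \<Rightarrow> real \<Rightarrow> bool" where
  "is_similarity L s \<longleftrightarrow> linear L \<and> (\<forall>v. norm (L v) = s * norm v)"

definition C1_conformal_embedding ::
    "('a :: euclidean_space \<Rightarrow> 'a) \<Rightarrow> 'a set \<Rightarrow> 'a set \<Rightarrow> bool" where
  "C1_conformal_embedding f U V \<longleftrightarrow>
    f ` U \<subseteq> V \<and> (\<exists>g. homeomorphism U (f ` U) f g) \<and>
    (\<exists>D :: 'a \<Rightarrow> 'a \<Rightarrow>\<^sub>L 'a. continuous_on U D \<and>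
       (\<forall>x\<in>U. (f has_derivative blinfun_apply (D x)) (at x) \<and>
              (\<exists>s>0. is_similarity (blinfun_apply (D x)) s)))"

definition similarity_factor :: "('a :: euclidean_space \<Rightarrow> 'a) \<Rightarrow> 'a \<Rightarrow> real" where
  "similarity_factor f y = (THE s. is_similarity (frechet_derivative f (at y)) s)"

definition log_deriv ::
    "((nat \<Rightarrow> 'e) \<Rightarrow> 'a :: euclidean_space set) \<Rightarrow> ((nat \<Rightarrow> 'e) \<Rightarrow> 'a \<Rightarrow> 'a) \<Rightarrow> (int \<Rightarrow> 'e) \<Rightarrow> real" where
  "log_deriv Y T \<tau> = ln (similarity_factor (T (pi0 \<tau>)) (pihat2 Y T \<tau>))"

definition set_nbhd :: "'a :: metric_space set \<Rightarrow> real \<Rightarrow> 'a set" where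
  "set_nbhd S \<delta> = (\<Union>x\<in>S. ball x \<delta>)"

text \<open>\<open>T \<omega>\<close> denotes at the same time the map on \<open>Y \<omega>\<close> and its conformal extension to
  \<open>Ystar \<omega>\<close>. The sequence \<open>case_nat a \<omega>\<close> is \<open>\<omega>\<close> with the letter \<open>a\<close> put in front.\<close>

locale hoelder_conformal_smale = hoelder_skew_product_smale A Y0 Y T
  for A :: "'e :: countable \<Rightarrow> 'e \<Rightarrow> bool"
    and Y0 :: "'a :: euclidean_space set"
    and Y :: "(nat \<Rightarrow> 'e) \<Rightarrow> 'a set"
    and T :: "(nat \<Rightarrow> 'e) \<Rightarrow> 'a \<Rightarrow> 'a" +
  fixes Ystar :: "(nat \<Rightarrow> 'e) \<Rightarrow> 'a set"
  assumes Y_closed: "\<And>\<omega>. \<omega> \<in> one_sided A \<Longrightarrow> closed (Y \<omega>)"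
    and Y_bounded: "\<And>\<omega>. \<omega> \<in> one_sided A \<Longrightarrow> bounded (Y \<omega>)"
    and Y_regular: "\<And>\<omega>. \<omega> \<in> one_sided A \<Longrightarrow> closure (interior (Y \<omega>)) = Y \<omega>"
    and Ystar_superset: "\<And>\<omega>. \<omega> \<in> one_sided A \<Longrightarrow> Y \<omega> \<subseteq> Ystar \<omega>"
    and Ystar_domain:
      "\<And>\<omega>. \<omega> \<in> one_sided A \<Longrightarrow> bounded (Ystar \<omega>) \<and> connected (Ystar \<omega>) \<and> open (Ystar \<omega>)"
    and T_conformal:
      "\<And>\<omega>. \<omega> \<in> one_sided A \<Longrightarrow> C1_conformal_embedding (T \<omega>) (Ystar \<omega>) (Ystar (shift \<omega>))"
    and T_contracting_star:
      "\<exists>c>1. \<forall>\<omega>\<in>one_sided A. \<forall>y\<in>Ystar \<omega>. \<forall>z\<in>Ystar \<omega>.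
         norm (T \<omega> y - T \<omega> z) \<le> inverse c * norm (y - z)"
    and bounded_distortion:
      "\<exists>\<alpha>>0. \<exists>H>0. \<forall>\<omega>\<in>one_sided A. \<forall>y\<in>Ystar \<omega>. \<forall>z\<in>Ystar \<omega>.
         \<bar>ln (similarity_factor (T \<omega>) y) - ln (similarity_factor (T \<omega>) z)\<bar>
           \<le> H * norm (y - z) powr \<alpha>"
    and log_deriv_hoelder: "hoelder A (log_deriv Y T)"
    and open_set_condition:
      "\<And>\<omega> a b. \<omega> \<in> one_sided A \<Longrightarrow> a \<noteq> b \<Longrightarrow> A a (\<omega> 0) \<Longrightarrow> A b (\<omega> 0) \<Longrightarrow>
         T (case_nat a \<omega>) ` interior (Y (case_nat a \<omega>)) \<inter>
         T (case_nat b \<omega>) ` interior (Y (case_nat b \<omega>)) = {}"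
    and inner_point_condition:
      "\<exists>\<delta>. \<delta> \<in> borel_measurable (one_sided_borel A) \<and>
           (\<forall>\<omega>\<in>one_sided A. 0 < \<delta> \<omega> \<and>
              limit_fiber A Y T \<omega> \<inter> (Y \<omega> - closure (set_nbhd (- Y \<omega>) (\<delta> \<omega>))) \<noteq> {})"

text \<open>An integral with values in the extended reals; the exponent below may be infinite when the
  alphabet is infinite, and a finite entropy divided by it is then \<open>0\<close>.\<close>

definition ext_integral :: "'x measure \<Rightarrow> ('x \<Rightarrow> real) \<Rightarrow> ereal" where
  "ext_integral M f =
    enn2ereal (\<integral>\<^sup>+x. ennreal (f x) \<partial>M) - enn2ereal (\<integral>\<^sup>+x. ennreal (- f x) \<partial>M)"

definition lyapunov_exponent ::
    "((nat \<Rightarrow> 'e) \<Rightarrow> 'a :: euclidean_space set) \<Rightarrow> ((nat \<Rightarrow> 'e) \<Rightarrow> 'a \<Rightarrow> 'a) \<Rightarrow>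
     (int \<Rightarrow> 'e) measure \<Rightarrow> ereal" where
  "lyapunov_exponent Y T \<mu> = - ext_integral \<mu> (log_deriv Y T)"

end

theory Submission
  imports Defs "HOL-Real_Asymp.Real_Asymp" "HOL-Analysis.Further_Topology"
begin

text \<open>
  By quasi-independence of cylinders the conditional measure of almost every fiber inherits the Gibbs
  property: it gives the past cylinder of length \<open>n\<close> around \<open>\<tau>\<close> the mass
  \<open>exp (S_n \<psi> - n P)\<close> at \<open>\<sigma>\<^sup>-\<^sup>n \<tau>\<close>, up to a constant factor. By bounded distortion the image of
  this cylinder under the coding map has size about \<open>exp (S_n g)\<close>, where \<open>g\<close> is the logarithm of
  the derivative, but neighbouring cylinders may come arbitrarily close to it. The inner point
  condition provides a good set of positive measure such that at every time \<open>n\<close> at which the backward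
  orbit of \<open>\<tau>\<close> visits this set, the cylinder is comparable to a ball. The shift being ergodic, these
  times have positive frequency almost surely, so consecutive ones have ratio tending to \<open>1\<close>; the
  balls at these scales therefore determine the local dimension, and Birkhoff's theorem identifies it
  as the quotient of \<open>P - \<integral>\<psi>\<close> and the Lyapunov exponent (\<open>0\<close> if the latter is infinite).
  The same Gibbs estimate, applied to partitions into finitely many letters, shows that
  \<open>P - \<integral>\<psi>\<close> is the entropy. A constant local dimension is the dimension of the measure by the mass
  distribution principle and a covering argument.
\<close>

section \<open>Ergodic theorems\<close>

text \<open>A conditional measure only sees pasts, so the almost sure statements are taken along the
  inverse shift. Two obstacles forbid comparing balls with cylinders at every time: the radius of
  the inner balls of a fiber set depends on the sequence, and for an infinite alphabet the logarithm
  of the derivative is unbounded, so one step may shrink a cylinder by an arbitrarily large factor.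
  Both disappear in ratios. The mass of a ball is monotone in its radius, and the logarithms of size
  and mass, divided by time, have limits; between neighbouring good times they change by a factor
  tending to 1. When the exponent is infinite only the upper estimate is at stake, since a local
  dimension is never negative.

  The good set has positive measure because it contains a whole past cylinder of each fiber, which
  the lower Gibbs bound charges. For the entropy, the partition into letters may be infinite;
  integrability of \<psi> still makes its entropy finite, and merging all but finitely many letters
  approximates it.\<close>

definition ergodic_sum :: "('x \<Rightarrow> 'x) \<Rightarrow> ('x \<Rightarrow> real) \<Rightarrow> nat \<Rightarrow> 'x \<Rightarrow> real" where
  "ergodic_sum f g n x = (\<Sum>j<n. g ((f ^^ j) x))"

lemma ergodic_sum_0 [simp]: "ergodic_sum f g 0 x = 0"
  by (simp add: ergodic_sum_def)

lemma ergodic_sum_Suc: "ergodic_sum f g (Suc n) x = g x + ergodic_sum f g n (f x)"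
  by (simp add: ergodic_sum_def sum.lessThan_Suc_shift funpow_swap1 del: sum.lessThan_Suc)

section \<open>The maximal ergodic inequality\<close>

text \<open>The maximum of \<open>ergodic_sum f g k x\<close> over \<open>0 \<le> k \<le> n\<close>,
  given by its recursion, which is all that the proof of the maximal inequality uses.\<close>

primrec maximal_sum :: "('x \<Rightarrow> 'x) \<Rightarrow> ('x \<Rightarrow> real) \<Rightarrow> nat \<Rightarrow> 'x \<Rightarrow> real" where
  "maximal_sum f g 0 = (\<lambda>x. 0)"
| "maximal_sum f g (Suc n) = (\<lambda>x. max 0 (g x + maximal_sum f g n (f x)))"

lemma maximal_sum_nonneg: "0 \<le> maximal_sum f g n x"
  by (cases n) auto

lemma maximal_sum_mono: "maximal_sum f g n x \<le> maximal_sum f g (Suc n) x"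
proof (induction n arbitrary: x)
  case (Suc n)
  show ?case
    using Suc[of "f x"] by (auto simp del: maximal_sum.simps(2) simp: maximal_sum.simps(2)[of f g n] maximal_sum.simps(2)[of f g "Suc n"])
qed simp

lemma ergodic_sum_le_maximal_sum: "ergodic_sum f g n x \<le> maximal_sum f g n x"
proof (induction n arbitrary: x)
  case (Suc n)
  show ?case using Suc[of "f x"] by (simp add: ergodic_sum_Suc)
qed simp

text \<open>Where the maximum is positive, the recursion writes it as \<open>g x\<close> plus the
  maximum of one order less at \<open>f x\<close>, which monotonicity in the order bounds. Elsewhere
  it is 0 and the subtracted term is nonnegative.\<close>

lemma maximal_sum_le:
  "maximal_sum f g n x - maximal_sum f g n (f x) \<le> indicator {x. 0 < maximal_sum f g n x} x * g x"
proof (cases n)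
  case (Suc m)
  show ?thesis
  proof (cases "0 < maximal_sum f g n x")
    case True
    then have "maximal_sum f g n x = g x + maximal_sum f g m (f x)"
      by (auto simp: Suc split: if_splits simp: max_def)
    with True maximal_sum_mono[of f g m "f x"] Suc show ?thesis
      by (simp del: maximal_sum.simps)
  next
    case False
    with maximal_sum_nonneg[of f g n x] maximal_sum_nonneg[of f g n "f x"] show ?thesis
      by simp
  qed
qed simp

locale mpt = prob_space M for M :: "'x measure" +
  fixes f :: "'x \<Rightarrow> 'x"
  assumes f_measurable [measurable]: "f \<in> measurable M M"
    and f_invariant: "distr M M f = M"
begin

lemma funpow_measurable [measurable]: "f ^^ n \<in> measurable M M"
  by (induction n) auto

lemma funpow_invariant: "distr M M (f ^^ n) = M"
proof (induction n)
  case 0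
  then show ?case by (simp add: distr_id2 id_def)
next
  case (Suc n)
  have "distr M M (f ^^ Suc n) = distr (distr M M (f ^^ n)) M f"
    by (subst distr_distr) auto
  then show ?case by (simp only: Suc f_invariant)
qed

lemma integrable_comp_funpow:
  fixes g :: "'x \<Rightarrow> real" shows "integrable M g \<Longrightarrow> integrable M (\<lambda>x. g ((f ^^ n) x))"
  by (subst integrable_distr_eq[where M=M and N=M and g="f ^^ n", symmetric])
     (auto simp: funpow_invariant)

lemma integral_comp_funpow:
  fixes g :: "'x \<Rightarrow> real"
  shows "g \<in> borel_measurable M \<Longrightarrow> (LINT x|M. g ((f ^^ n) x)) = (LINT x|M. g x)"
  by (subst integral_distr[where M=M and N=M and g="f ^^ n", symmetric])
     (auto simp: funpow_invariant)

lemma integrable_comp: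
  fixes g :: "'x \<Rightarrow> real" shows "integrable M g \<Longrightarrow> integrable M (\<lambda>x. g (f x))"
  using integrable_comp_funpow[of g 1] by simp

lemma integral_comp:
  fixes g :: "'x \<Rightarrow> real"
  shows "g \<in> borel_measurable M \<Longrightarrow> (LINT x|M. g (f x)) = (LINT x|M. g x)"
  using integral_comp_funpow[of g 1] by simp

lemma measurable_ergodic_sum [measurable]:
  "g \<in> borel_measurable M \<Longrightarrow> ergodic_sum f g n \<in> borel_measurable M"
  unfolding ergodic_sum_def[abs_def]
  by (intro borel_measurable_sum measurable_compose[OF funpow_measurable])

lemma integrable_ergodic_sum: "integrable M g \<Longrightarrow> integrable M (ergodic_sum f g n)"
  unfolding ergodic_sum_def[abs_def] by (intro Bochner_Integration.integrable_sum integrable_comp_funpow)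

lemma integral_ergodic_sum:
  "integrable M g \<Longrightarrow> (LINT x|M. ergodic_sum f g n x) = real n * (LINT x|M. g x)"
  unfolding ergodic_sum_def
  by (subst Bochner_Integration.integral_sum) (auto intro: integrable_comp_funpow simp: integral_comp_funpow)

lemma integrable_maximal_sum: "integrable M g \<Longrightarrow> integrable M (maximal_sum f g n)"
proof (induction n)
  case (Suc n)
  show ?case
    using Suc by (auto intro!: integrable_max Bochner_Integration.integrable_add integrable_comp)
qed simp

text \<open>Garsia's argument: the maximum and its composition with \<open>f\<close> have the same
  integral, so integrating \<open>maximal_sum_le\<close> leaves 0 on the left.\<close>

lemma maximal_ergodic:
  assumes g: "integrable M g"
  shows "0 \<le> (LINT x|M. indicator {x. 0 < maximal_sum f g n x} x * g x)"
proof -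
  note F = integrable_maximal_sum[OF g, of n]
  have [measurable]: "maximal_sum f g n \<in> borel_measurable M" "g \<in> borel_measurable M"
    using F g by auto
  have "0 = (LINT x|M. maximal_sum f g n x - maximal_sum f g n (f x))"
    by (subst Bochner_Integration.integral_diff[OF F integrable_comp[OF F]]) (simp add: integral_comp)
  also have "\<dots> \<le> (LINT x|M. indicator {x. 0 < maximal_sum f g n x} x * g x)"
  proof (intro integral_mono maximal_sum_le Bochner_Integration.integrable_diff F integrable_comp)
    show "integrable M (\<lambda>x. indicator {x. 0 < maximal_sum f g n x} x * g x)"
      by (rule Bochner_Integration.integrable_bound[OF g]) (auto simp: indicator_def)
  qed
  finally show ?thesis .
qed

section \<open>Ergodicity and Birkhoff's theorem\<close>

definition ergodic :: bool where
  "ergodic \<longleftrightarrow> (\<forall>B\<in>sets M. f -` B \<inter> space M = B \<longrightarrow> prob B = 0 \<or> prob B = 1)"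

text \<open>The set \<open>C\<close> of points with unbounded sums is exactly invariant. If it had
  full measure, the sets where \<open>maximal_sum\<close> is positive would exhaust the space, and
  the maximal inequality would give a nonnegative integral of \<open>g\<close> in the limit.\<close>

lemma ergodic_sums_bounded_above:
  assumes erg: ergodic and g: "integrable M g" and neg: "(LINT x|M. g x) < 0"
  shows "AE x in M. bdd_above (range (\<lambda>n. ergodic_sum f g n x))"
proof -
  have [measurable]: "g \<in> borel_measurable M" using g by auto
  have [measurable]: "maximal_sum f g n \<in> borel_measurable M" for n
    using integrable_maximal_sum[OF g] by auto
  \<comment> \<open>Natural numbers as bounds make \<open>C\<close> a countable combination of
    measurable sets.\<close>
  define C where "C = {x \<in> space M. \<not> (\<exists>K::nat. \<forall>n. ergodic_sum f g n x \<le> real K)}"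
  have C_eq: "C = {x \<in> space M. \<not> bdd_above (range (\<lambda>n. ergodic_sum f g n x))}"
  proof -
    have "bdd_above (range s) \<longleftrightarrow> (\<exists>K::nat. \<forall>n. s n \<le> real K)" for s :: "nat \<Rightarrow> real"
      unfolding bdd_above_def by (auto intro: order_trans real_arch_simple) (meson order_trans real_arch_simple)
    then show ?thesis by (auto simp: C_def)
  qed
  have [measurable]: "C \<in> sets M" unfolding C_def by measurable
  have bdd_iff: "bdd_above (range (\<lambda>n. ergodic_sum f g n (f x))) \<longleftrightarrow>
      bdd_above (range (\<lambda>n. ergodic_sum f g n x))" for x
  proof
    assume "bdd_above (range (\<lambda>n. ergodic_sum f g n (f x)))"
    then obtain K where K: "\<And>n. ergodic_sum f g n (f x) \<le> K" by (auto simp: bdd_above_def)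
    have "ergodic_sum f g n x \<le> max 0 (g x + K)" for n
      using K[of "n - 1"] by (cases n) (auto simp: ergodic_sum_Suc)
    then show "bdd_above (range (\<lambda>n. ergodic_sum f g n x))" by (auto simp: bdd_above_def)
  next
    assume "bdd_above (range (\<lambda>n. ergodic_sum f g n x))"
    then obtain K where K: "\<And>n. ergodic_sum f g n x \<le> K" by (auto simp: bdd_above_def)
    have "ergodic_sum f g n (f x) \<le> K - g x" for n
      using K[of "Suc n"] by (auto simp: ergodic_sum_Suc)
    then show "bdd_above (range (\<lambda>n. ergodic_sum f g n (f x)))" by (auto simp: bdd_above_def)
  qed
  have "f -` C \<inter> space M = C"
    unfolding C_eq using measurable_space[OF f_measurable] by (auto simp: bdd_iff)
  then have "prob C = 0 \<or> prob C = 1" using erg by (auto simp: ergodic_def)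
  moreover have "prob C \<noteq> 1"
  proof
    assume "prob C = 1"
    then have AE_C: "AE x in M. x \<in> C" by (simp add: AE_in_set_eq_1)
    have "(\<lambda>n. LINT x|M. indicator {x. 0 < maximal_sum f g n x} x * g x) \<longlonglongrightarrow> (LINT x|M. g x)"
    proof (rule integral_dominated_convergence[where w="\<lambda>x. \<bar>g x\<bar>"])
      show "AE x in M. (\<lambda>n. indicator {x. 0 < maximal_sum f g n x} x * g x) \<longlonglongrightarrow> g x"
        using AE_C
      proof eventually_elim
        case (elim x)
        then obtain n where "ergodic_sum f g n x > 0" unfolding C_def
          by (auto simp: not_le) (metis of_nat_0)
        then have n: "0 < maximal_sum f g n x"
          using ergodic_sum_le_maximal_sum[of f g n x] by linarith
        have "maximal_sum f g n x \<le> maximal_sum f g m x" if "n \<le> m" for m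
          using that by (rule lift_Suc_mono_le[rotated]) (rule maximal_sum_mono)
        with n have "\<forall>m\<ge>n. 0 < maximal_sum f g m x" by (meson less_le_trans)
        then have "\<forall>\<^sub>F m in sequentially. indicator {x. 0 < maximal_sum f g m x} x * g x = g x"
          unfolding eventually_sequentially by (intro exI[of _ n]) auto
        then show ?case by (rule tendsto_eventually)
      qed
    qed (use g in \<open>auto simp: indicator_def\<close>)
    then have "0 \<le> (LINT x|M. g x)"
      by (rule LIMSEQ_le_const) (use maximal_ergodic[OF g] in auto)
    with neg show False by simp
  qed
  ultimately have "AE x in M. x \<notin> C"
    by (subst AE_iff_measurable[where N=C]) (use sets.sets_into_space in \<open>auto simp: emeasure_eq_measure C_def\<close>)
  then show ?thesis
    using AE_space by eventually_elim (auto simp: C_eq)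
qed

text \<open>The sums of \<open>g - b\<close>, for \<open>b\<close> strictly between the integral and
  \<open>a\<close>, are bounded above almost surely; the slack \<open>(a - b) * real n\<close>
  finally exceeds the bound.\<close>

lemma ergodic_average_upper:
  assumes erg: ergodic and g: "integrable M g" and a: "(LINT x|M. g x) < a"
  shows "AE x in M. \<forall>\<^sub>F n in sequentially. ergodic_sum f g n x \<le> a * real n"
proof -
  obtain b where b: "(LINT x|M. g x) < b" "b < a" using dense[OF a] by auto
  have "AE x in M. bdd_above (range (\<lambda>n. ergodic_sum f (\<lambda>x. g x - b) n x))"
    by (rule ergodic_sums_bounded_above[OF erg]) (use g b in \<open>auto simp: prob_space\<close>)
  then show ?thesis
  proof eventually_elim
    case (elim x)
    then obtain K where K: "\<And>n. ergodic_sum f (\<lambda>x. g x - b) n x \<le> K" by (auto simp: bdd_above_def)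
    have sum_eq: "ergodic_sum f (\<lambda>x. g x - b) n x = ergodic_sum f g n x - b * real n" for n
      by (simp add: ergodic_sum_def sum_subtractf)
    obtain N where N: "K / (a - b) \<le> real N" using real_arch_simple by blast
    show ?case unfolding eventually_sequentially
    proof (intro exI[of _ N] allI impI)
      fix n assume "N \<le> n"
      with N have "K / (a - b) \<le> real n" by linarith
      with b have "K \<le> (a - b) * real n" by (simp add: field_simps)
      with K[of n] show "ergodic_sum f g n x \<le> a * real n" by (simp add: sum_eq algebra_simps)
    qed
  qed
qed

theorem birkhoff_ergodic:
  assumes erg: ergodic and g: "integrable M g"
  shows "AE x in M. (\<lambda>n. ergodic_sum f g n x / real n) \<longlonglongrightarrow> (LINT x|M. g x)"
proof -
  let ?I = "LINT x|M. g x"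
  have up: "AE x in M. \<forall>k. \<forall>\<^sub>F n in sequentially. ergodic_sum f g n x \<le> (?I + 1 / real (Suc k)) * real n"
    unfolding AE_all_countable by (intro allI ergodic_average_upper erg g) simp
  have lo: "AE x in M. \<forall>k. \<forall>\<^sub>F n in sequentially. ergodic_sum f (\<lambda>x. - g x) n x \<le> (- ?I + 1 / real (Suc k)) * real n"
    unfolding AE_all_countable using g by (intro allI ergodic_average_upper erg) auto
  from up lo show ?thesis
  proof eventually_elim
    case (elim x)
    have neg: "ergodic_sum f (\<lambda>x. - g x) n x = - ergodic_sum f g n x" for n
      by (simp add: ergodic_sum_def sum_negf)
    show ?case
    proof (rule tendstoI)
      fix e :: real assume "0 < e"
      then obtain k where k: "1 / real (Suc k) < e" using nat_approx_posE by blast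
      from elim(1)[rule_format, of k] elim(2)[rule_format, of k] eventually_gt_at_top[of 0]
      show "\<forall>\<^sub>F n in sequentially. dist (ergodic_sum f g n x / real n) ?I < e"
      proof eventually_elim
        case (elim n)
        have "ergodic_sum f g n x / real n \<le> ?I + 1 / real (Suc k)"
             "?I - 1 / real (Suc k) \<le> ergodic_sum f g n x / real n"
          using elim by (auto simp: neg divide_le_eq le_divide_eq left_diff_distrib distrib_right simp del: of_nat_Suc times_divide_eq_left)
        with k show ?case by (auto simp: dist_real_def abs_less_iff)
      qed
    qed
  qed
qed

end

section \<open>Entropy\<close>

text \<open>Writing \<open>n = q * k + r\<close> with \<open>r < k\<close> bounds \<open>u n\<close>
  by \<open>q * u k + B\<close>, where \<open>B\<close> controls the finitely many remainders. The
  limit is therefore the infimum of the quotients.\<close>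

lemma fekete:
  fixes u :: "nat \<Rightarrow> real"
  assumes sub: "\<And>m n. u (m + n) \<le> u m + u n" and nonneg: "\<And>n. 0 \<le> u n"
  shows "convergent (\<lambda>n. u n / real n)"
proof -
  define L where "L = (INF n\<in>{1..}. u n / real n)"
  have bdd: "bdd_below ((\<lambda>n. u n / real n) ` {1..})"
    by (rule bdd_belowI[of _ 0]) (use nonneg in auto)
  have L_le: "L \<le> u n / real n" if "n \<ge> 1" for n
    unfolding L_def using that by (intro cINF_lower[OF bdd]) auto
  have mult: "u (q * k) \<le> real q * u k" if "q \<ge> 1" for q k
    using that
  proof (induction q rule: nat_induct_at_least)
    case (Suc q)
    then show ?case using sub[of k "q * k"] by (simp add: algebra_simps)
  qed simp
  have "(\<lambda>n. u n / real n) \<longlonglongrightarrow> L"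
  proof (rule LIMSEQ_I)
    fix e :: real assume "0 < e"
    then obtain k where k: "k \<ge> 1" "u k / real k < L + e / 2"
      unfolding L_def using cInf_lessD[of "(\<lambda>n. u n / real n) ` {1..}" "L + e/2"]
      by (force simp: L_def)
    define B where "B = Max (u ` {..<k})"
    have B: "u r \<le> B" if "r < k" for r unfolding B_def using that by (intro Max_ge) auto
    have B0: "0 \<le> B" using B[of 0] nonneg[of 0] k by simp
    obtain N where N: "2 * B / e < real N" using reals_Archimedean2 by blast
    have "norm (u n / real n - L) < e" if n: "n \<ge> N + k" for n
    proof -
      define q r where "q = n div k" and "r = n mod k"
      have nqr: "n = q * k + r" "r < k" "q \<ge> 1"
        using k n by (auto simp: q_def r_def div_greater_zero_iff Suc_le_eq)
      have "u n \<le> real q * u k + B"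
        using sub[of "q * k" r] mult[OF nqr(3), of k] B[OF nqr(2)] nqr(1) by simp
      also have "real q * u k \<le> real n * (u k / real k)"
      proof -
        have "real q * real k \<le> real n" using nqr(1) by (simp flip: of_nat_mult)
        from mult_right_mono[OF this nonneg[of k]] show ?thesis
          using k by (simp add: field_simps)
      qed
      finally have "u n / real n \<le> u k / real k + B / real n"
        using k n by (simp add: field_simps)
      also have "B / real n \<le> e / 2"
      proof -
        have "2 * B < e * real n"
        proof -
          have "2 * B / e < real n" using N n by linarith
          then show ?thesis using \<open>0 < e\<close> by (simp add: pos_divide_less_eq mult.commute)
        qed
        then show ?thesis using k n by (simp add: field_simps)
      qed
      finally show ?thesis using k L_le[of n] n by (auto simp: abs_less_iff)
    qed
    then show "\<exists>no. \<forall>n\<ge>no. norm (u n / real n - L) < e" by blast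
  qed
  then show ?thesis by (auto simp: convergent_def)
qed

text \<open>Only \<open>q = 0\<close> is delicate: \<open>x * ln x\<close> tends to 0 from the
  right, and this agrees with the value \<open>0 * ln 0 = 0\<close>.\<close>

lemma tendsto_x_ln_x:
  fixes p :: "nat \<Rightarrow> real"
  assumes p: "p \<longlonglongrightarrow> q" and nonneg: "\<And>n. 0 \<le> p n"
  shows "(\<lambda>n. p n * ln (p n)) \<longlonglongrightarrow> q * ln q"
proof -
  have q: "0 \<le> q" using LIMSEQ_le_const[OF p] nonneg by auto
  have "((\<lambda>x. x * ln x) \<longlongrightarrow> q * ln q) (at q within {0..})"
  proof (cases "q = 0")
    case True
    have "((\<lambda>x::real. x * ln x) \<longlongrightarrow> 0) (at_right 0)" by real_asymp
    moreover have "at (0::real) within {0..} = at_right 0"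
      by (rule at_within_nhd[where S=UNIV]) auto
    ultimately show ?thesis using True by simp
  next
    case False
    then have "isCont (\<lambda>x. x * ln x) q" using q by (intro continuous_intros) auto
    then have "((\<lambda>x. x * ln x) \<longlongrightarrow> q * ln q) (at q)" by (simp only: isCont_def)
    then show ?thesis by (rule tendsto_within_subset) simp
  qed
  then have "continuous (at q within {0..}) (\<lambda>x::real. x * ln x)" by (simp add: continuous_within)
  then show ?thesis
    by (rule continuous_within_tendsto_compose) (use nonneg p in auto)
qed

text \<open>The labelling \<open>itinerary\<close> with labels of any type, so that words and pairs
  can serve as labels themselves.\<close>

definition orbit_word :: "('x \<Rightarrow> 'x) \<Rightarrow> ('x \<Rightarrow> 'b) \<Rightarrow> nat \<Rightarrow> 'x \<Rightarrow> 'b list" where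
  "orbit_word f \<xi> n x = map (\<lambda>j. \<xi> ((f ^^ j) x)) [0..<n]"

lemma orbit_word_eq_iff:
  "orbit_word f \<xi> n x = orbit_word f \<xi> n y \<longleftrightarrow> (\<forall>j<n. \<xi> ((f ^^ j) x) = \<xi> ((f ^^ j) y))"
  by (auto simp: orbit_word_def)

section \<open>Shannon entropy of finite partitions\<close>

context prob_space
begin

definition atom_of :: "('a \<Rightarrow> 'b) \<Rightarrow> 'a \<Rightarrow> 'a set" where
  "atom_of X x = {y \<in> space M. X y = X x}"

text \<open>Entropy as the integral of the information function. Only the atoms matter and not their
  labels, so partitions with labels of different types compare directly, and entropy inequalities
  reduce to pointwise ones.\<close>

definition shannon :: "('a \<Rightarrow> 'b) \<Rightarrow> real" where
  "shannon X = (LINT x|M. - ln (prob (atom_of X x)))"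

lemma atom_of_sets: "simple_function M X \<Longrightarrow> atom_of X x \<in> sets M"
proof -
  assume "simple_function M X"
  moreover have "atom_of X x = X -` {X x} \<inter> space M" by (auto simp: atom_of_def)
  ultimately show "atom_of X x \<in> sets M" by (simp add: simple_functionD(2))
qed

lemma simple_function_atom_comp:
  assumes "simple_function M X" shows "simple_function M (\<lambda>x. g (atom_of X x))"
proof -
  have "simple_function M (\<lambda>x. (\<lambda>v. g {y \<in> space M. X y = v}) (X x))"
    using assms by (rule simple_function_compose1)
  then show ?thesis by (simp add: atom_of_def)
qed

lemma simple_function_integrable: "simple_function M (h :: 'a \<Rightarrow> real) \<Longrightarrow> integrable M h"
  by (rule integrable_simple_function) (simp_all add: emeasure_eq_measure)

text \<open>There are finitely many atoms, so the null ones form a null set. They have to be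
  excluded wherever logarithms are compared, because \<open>ln 0 = 0\<close>.\<close>

lemma AE_atom_pos:
  assumes X: "simple_function M X" shows "AE x in M. 0 < prob (atom_of X x)"
proof -
  have "AE x in M. \<forall>v\<in>X ` space M. prob (X -` {v} \<inter> space M) = 0 \<longrightarrow> x \<notin> X -` {v} \<inter> space M"
  proof (rule AE_finite_allI)
    show "finite (X ` space M)" using X by (simp add: simple_functionD)
    fix v
    show "AE x in M. prob (X -` {v} \<inter> space M) = 0 \<longrightarrow> x \<notin> X -` {v} \<inter> space M"
      using simple_functionD(2)[OF X, of "{v}"] AE_not_in[of "X -` {v} \<inter> space M" M]
      by (cases "prob (X -` {v} \<inter> space M) = 0") (auto simp: emeasure_eq_measure null_sets_def)
  qed
  then show ?thesis using AE_space
  proof eventually_elim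
    case (elim x)
    have "atom_of X x = X -` {X x} \<inter> space M" by (auto simp: atom_of_def)
    with elim have "prob (atom_of X x) \<noteq> 0" by auto
    then show ?case using measure_nonneg[of M "atom_of X x"] by linarith
  qed
qed

lemma integral_simple_comp:
  fixes g :: "'b \<Rightarrow> real"
  assumes X: "simple_function M X"
  shows "(LINT x|M. g (X x)) = (\<Sum>v\<in>X ` space M. prob (X -` {v} \<inter> space M) * g v)"
proof -
  note fin = simple_functionD(1)[OF X] and sets = simple_functionD(2)[OF X]
  have "(LINT x|M. g (X x)) = (LINT x|M. (\<Sum>v\<in>X ` space M. indicator (X -` {v} \<inter> space M) x * g v))"
  proof (rule Bochner_Integration.integral_cong[OF refl])
    fix x assume "x \<in> space M"
    then have "(\<Sum>v\<in>X ` space M. indicator (X -` {v} \<inter> space M) x * g v) =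
        (\<Sum>v\<in>X ` space M. if v = X x then g v else 0)"
      by (intro sum.cong) (auto simp: indicator_def)
    then show "g (X x) = (\<Sum>v\<in>X ` space M. indicator (X -` {v} \<inter> space M) x * g v)"
      using fin \<open>x \<in> space M\<close> by (simp add: sum.delta)
  qed
  also have "\<dots> = (\<Sum>v\<in>X ` space M. prob (X -` {v} \<inter> space M) * g v)"
    by (subst Bochner_Integration.integral_sum)
       (auto intro!: integrable_mult_left integrable_real_indicator simp: sets emeasure_eq_measure)
  finally show ?thesis .
qed

lemma shannon_sum:
  assumes X: "simple_function M X"
  shows "shannon X = - (\<Sum>v\<in>X ` space M. prob (X -` {v} \<inter> space M) * ln (prob (X -` {v} \<inter> space M)))"
proof -
  have eq: "atom_of X x = X -` {X x} \<inter> space M" for x by (auto simp: atom_of_def)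
  show ?thesis
    unfolding shannon_def eq
    by (subst integral_simple_comp[OF X, of "\<lambda>v. - ln (prob (X -` {v} \<inter> space M))"]) (simp add: sum_negf)
qed

lemma partition_entropy_eq_shannon:
  assumes X: "simple_function M X" shows "partition_entropy M X = shannon X"
proof -
  interpret information_space M "exp 1" by standard simp
  show ?thesis
    unfolding partition_entropy_def shannon_sum[OF X]
    by (subst entropy_simple_distributed[OF simple_distributedI[OF X measure_nonneg refl]])
       (simp add: log_def)
qed

lemma shannon_integrable:
  "simple_function M X \<Longrightarrow> integrable M (\<lambda>x. - ln (prob (atom_of X x)))"
  by (rule simple_function_integrable[OF simple_function_atom_comp[where g="\<lambda>S. - ln (prob S)"]])

lemma shannon_nonneg: "0 \<le> shannon X"
proof -
  have "ln (prob S) \<le> 0" for S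
    using prob_le_1[of S] measure_nonneg[of M S] by (cases "prob S = 0") (auto simp: less_le)
  then show ?thesis unfolding shannon_def by (intro Bochner_Integration.integral_nonneg) simp
qed

lemma shannon_mono:
  assumes X: "simple_function M X" and Y: "simple_function M Y"
    and ref: "\<And>x y. x \<in> space M \<Longrightarrow> y \<in> space M \<Longrightarrow> Y x = Y y \<Longrightarrow> X x = X y"
  shows "shannon X \<le> shannon Y"
  unfolding shannon_def
proof (rule integral_mono_AE)
  show "AE x in M. - ln (prob (atom_of X x)) \<le> - ln (prob (atom_of Y x))"
    using AE_atom_pos[OF Y] AE_space
  proof eventually_elim
    case (elim x)
    have "atom_of Y x \<subseteq> atom_of X x" using elim(2) ref unfolding atom_of_def by blast
    then have "prob (atom_of Y x) \<le> prob (atom_of X x)"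
      using atom_of_sets[OF X] by (rule finite_measure_mono)
    with elim show ?case by (auto intro!: ln_mono)
  qed
qed (rule shannon_integrable X Y)+

lemma shannon_cong:
  assumes "\<And>x y. x \<in> space M \<Longrightarrow> y \<in> space M \<Longrightarrow> Y x = Y y \<longleftrightarrow> X x = X y"
  shows "shannon X = shannon Y"
proof -
  have "atom_of X x = atom_of Y x" if "x \<in> space M" for x
    using assms[of _ x] that by (auto simp: atom_of_def)
  then show ?thesis unfolding shannon_def by (intro Bochner_Integration.integral_cong) auto
qed

text \<open>Nonnegativity of the conditional mutual information of \<open>X\<close> and
  \<open>Y\<close> given \<open>Z\<close>. The left side minus the right side is the integral of
  \<open>ln R\<close>, where \<open>R\<close> is the ratio
  \<open>p(x,z) p(y,z) / (p(x,y,z) p(z))\<close>. Now \<open>ln R \<le> R - 1\<close>, and the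
  integral of \<open>R\<close> is at most 1.\<close>

lemma shannon_strong_subadditive:
  assumes X: "simple_function M X" and Y: "simple_function M Y" and Z: "simple_function M Z"
  shows "shannon (\<lambda>x. (X x, Y x, Z x)) + shannon Z \<le> shannon (\<lambda>x. (X x, Z x)) + shannon (\<lambda>x. (Y x, Z x))"
proof -
  let ?W = "\<lambda>x. (X x, Y x, Z x)"
  let ?XZ = "\<lambda>x. (X x, Z x)" and ?YZ = "\<lambda>x. (Y x, Z x)"
  have W: "simple_function M ?W" and XZ: "simple_function M ?XZ" and YZ: "simple_function M ?YZ"
    using X Y Z by (auto intro!: simple_function_Pair)
  define a where "a u w = prob {y \<in> space M. X y = u \<and> Z y = w}" for u w
  define b where "b v w = prob {y \<in> space M. Y y = v \<and> Z y = w}" for v w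
  define c where "c w = prob {y \<in> space M. Z y = w}" for w
  define d where "d u v w = prob {y \<in> space M. X y = u \<and> Y y = v \<and> Z y = w}" for u v w
  define R where "R = (\<lambda>(u, v, w). a u w * b v w / (d u v w * c w))"
  have eqs: "prob (atom_of ?XZ x) = a (X x) (Z x)" "prob (atom_of ?YZ x) = b (Y x) (Z x)"
    "prob (atom_of Z x) = c (Z x)" "prob (atom_of ?W x) = d (X x) (Y x) (Z x)" for x
    by (auto simp: atom_of_def a_def b_def c_def d_def)
  have nonneg: "0 \<le> a u w" "0 \<le> b v w" "0 \<le> c w" "0 \<le> d u v w" for u v w
    by (auto simp: a_def b_def c_def d_def)
  have sumX: "(\<Sum>u\<in>X ` space M. a u w) = c w" for w
  proof -
    have "c w = prob (\<Union>u\<in>X ` space M. {y \<in> space M. X y = u \<and> Z y = w})"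
      unfolding c_def by (rule arg_cong[where f=prob]) auto
    also have "\<dots> = (\<Sum>u\<in>X ` space M. a u w)"
      unfolding a_def using simple_functionD[OF X] simple_functionD(2)[OF XZ, of "{(u, w)}" for u]
      by (intro finite_measure_finite_Union) (auto simp: disjoint_family_on_def vimage_def Int_def conj_commute conj_left_commute)
    finally show ?thesis by simp
  qed
  have sumY: "(\<Sum>v\<in>Y ` space M. b v w) = c w" for w
  proof -
    have "c w = prob (\<Union>v\<in>Y ` space M. {y \<in> space M. Y y = v \<and> Z y = w})"
      unfolding c_def by (rule arg_cong[where f=prob]) auto
    also have "\<dots> = (\<Sum>v\<in>Y ` space M. b v w)"
      unfolding b_def using simple_functionD[OF Y] simple_functionD(2)[OF YZ, of "{(v, w)}" for v]
      by (intro finite_measure_finite_Union) (auto simp: disjoint_family_on_def vimage_def Int_def conj_commute conj_left_commute)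
    finally show ?thesis by simp
  qed
  have sumZ: "(\<Sum>w\<in>Z ` space M. c w) = 1"
  proof -
    have "1 = prob (\<Union>w\<in>Z ` space M. {y \<in> space M. Z y = w})"
      unfolding prob_space[symmetric] by (rule arg_cong[where f=prob]) auto
    also have "\<dots> = (\<Sum>w\<in>Z ` space M. c w)"
      unfolding c_def using simple_functionD[OF Z] simple_functionD(2)[OF Z, of "{w}" for w]
      by (intro finite_measure_finite_Union) (auto simp: disjoint_family_on_def vimage_def Int_def conj_commute)
    finally show ?thesis by simp
  qed
  have fin: "finite (X ` space M)" "finite (Y ` space M)" "finite (Z ` space M)"
    using X Y Z by (auto simp: simple_functionD)
  have "(LINT x|M. R (?W x)) = (\<Sum>t\<in>?W ` space M. prob (?W -` {t} \<inter> space M) * R t)"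
    by (rule integral_simple_comp[OF W])
  also have "\<dots> \<le> (\<Sum>t\<in>?W ` space M. (\<lambda>(u, v, w). a u w * b v w / c w) t)"
  proof (rule sum_mono, clarify)
    fix x assume "x \<in> space M"
    have "prob (?W -` {?W x} \<inter> space M) = d (X x) (Y x) (Z x)"
      unfolding d_def by (rule arg_cong[where f=prob]) auto
    then show "prob (?W -` {?W x} \<inter> space M) * R (?W x) \<le> a (X x) (Z x) * b (Y x) (Z x) / c (Z x)"
      using nonneg by (simp add: R_def)
  qed
  \<comment> \<open>Triples of values that never occur together are added; their terms are
    nonnegative, and the sum over the full product can be evaluated.\<close>
  also have "\<dots> \<le> (\<Sum>t\<in>X ` space M \<times> Y ` space M \<times> Z ` space M. (\<lambda>(u, v, w). a u w * b v w / c w) t)"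
    using fin nonneg by (intro sum_mono2) auto
  also have "\<dots> = (\<Sum>w\<in>Z ` space M. \<Sum>u\<in>X ` space M. \<Sum>v\<in>Y ` space M. a u w * b v w / c w)"
    by (simp add: sum.cartesian_product[symmetric] sum.swap[of _ "Z ` space M"])
  also have "\<dots> = (\<Sum>w\<in>Z ` space M. c w)"
  proof (rule sum.cong[OF refl])
    fix w
    have "(\<Sum>u\<in>X ` space M. \<Sum>v\<in>Y ` space M. a u w * b v w / c w) = c w * c w / c w"
      by (simp add: sum_divide_distrib[symmetric] sum_product[symmetric] sumX sumY)
    then show "(\<Sum>u\<in>X ` space M. \<Sum>v\<in>Y ` space M. a u w * b v w / c w) = c w" by simp
  qed
  finally have R_le: "(LINT x|M. R (?W x)) \<le> 1" by (simp add: sumZ)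
  have iR: "integrable M (\<lambda>x. R (?W x))"
    by (intro simple_function_integrable simple_function_compose1[OF W])
  note ints = shannon_integrable[OF W] shannon_integrable[OF Z] shannon_integrable[OF XZ] shannon_integrable[OF YZ]
  have "shannon ?W + shannon Z - shannon ?XZ - shannon ?YZ =
    (LINT x|M. - ln (prob (atom_of ?W x)) + - ln (prob (atom_of Z x)) - - ln (prob (atom_of ?XZ x)) - - ln (prob (atom_of ?YZ x)))"
    unfolding shannon_def by (simp only: ints Bochner_Integration.integral_diff Bochner_Integration.integral_add
      Bochner_Integration.integrable_diff Bochner_Integration.integrable_add)
  also have "\<dots> \<le> (LINT x|M. R (?W x) - 1)"
  proof (rule integral_mono_AE)
    show "AE x in M. - ln (prob (atom_of ?W x)) + - ln (prob (atom_of Z x)) - - ln (prob (atom_of ?XZ x)) - - ln (prob (atom_of ?YZ x)) \<le> R (?W x) - 1"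
      using AE_atom_pos[OF W] AE_atom_pos[OF Z] AE_atom_pos[OF XZ] AE_atom_pos[OF YZ]
    proof eventually_elim
      case (elim x)
      then have pos: "0 < a (X x) (Z x)" "0 < b (Y x) (Z x)" "0 < c (Z x)" "0 < d (X x) (Y x) (Z x)"
        by (simp_all add: eqs)
      then have "ln (R (?W x)) \<le> R (?W x) - 1" by (intro ln_le_minus_one) (simp add: R_def)
      moreover have "ln (R (?W x)) = ln (a (X x) (Z x)) + ln (b (Y x) (Z x)) - (ln (d (X x) (Y x) (Z x)) + ln (c (Z x)))"
        using pos by (simp add: R_def ln_mult ln_div)
      ultimately show ?case by (simp add: eqs)
    qed
  qed (use ints iR in auto)
  also have "\<dots> \<le> 0" using R_le iR by (simp add: prob_space)
  finally show ?thesis by simp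
qed

lemma shannon_const: "shannon (\<lambda>x. k) = 0"
  by (simp add: shannon_def atom_of_def prob_space)

lemma shannon_subadditive:
  assumes X: "simple_function M X" and Y: "simple_function M Y"
  shows "shannon (\<lambda>x. (X x, Y x)) \<le> shannon X + shannon Y"
proof -
  have "shannon (\<lambda>x. (X x, Y x, ())) = shannon (\<lambda>x. (X x, Y x))"
       "shannon (\<lambda>x. (X x, ())) = shannon X" "shannon (\<lambda>x. (Y x, ())) = shannon Y"
    by (auto intro!: shannon_cong)
  then show ?thesis
    using shannon_strong_subadditive[OF X Y, of "\<lambda>x. ()"] by (simp add: shannon_const)
qed

text \<open>Continuity of the finite entropy function makes the conditional entropy
  \<open>H(\<xi> | \<zeta>) = H(\<xi>, \<zeta>) - H(\<zeta>)\<close> vanish in the limit \<open>\<zeta> \<rightarrow> \<xi>\<close>.\<close>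

lemma conditional_shannon_tendsto_0:
  fixes \<xi> :: "'a \<Rightarrow> 'b" and \<zeta> :: "nat \<Rightarrow> 'a \<Rightarrow> 'b"
  assumes \<xi>: "simple_function M \<xi>" and \<zeta>: "\<And>k. simple_function M (\<zeta> k)"
    and V: "finite V" "\<xi> ` space M \<subseteq> V" "\<And>k. \<zeta> k ` space M \<subseteq> V"
    and lim: "(\<lambda>k. prob {x \<in> space M. \<xi> x \<noteq> \<zeta> k x}) \<longlonglongrightarrow> 0"
  shows "(\<lambda>k. shannon (\<lambda>x. (\<xi> x, \<zeta> k x)) - shannon (\<zeta> k)) \<longlonglongrightarrow> 0"
proof -
  define p where "p v = prob {x \<in> space M. \<xi> x = v}" for v
  have D: "{x \<in> space M. \<xi> x \<noteq> \<zeta> k x} \<in> sets M" for k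
    using simple_functionD(2)[OF simple_function_compose1[OF simple_function_Pair[OF \<xi> \<zeta>[of k]], of "\<lambda>(a, b). a \<noteq> b"], of "{True}"]
    by (simp add: vimage_def Int_def conj_commute)
  have sx: "{x \<in> space M. \<xi> x = v} \<in> sets M" for v
    using simple_functionD(2)[OF \<xi>, of "{v}"] by (simp add: vimage_def Int_def conj_commute)
  have sz: "{x \<in> space M. \<zeta> k x = v} \<in> sets M" for k v
    using simple_functionD(2)[OF \<zeta>[of k], of "{v}"] by (simp add: vimage_def Int_def conj_commute)
  have sxz: "{x \<in> space M. \<xi> x = u \<and> \<zeta> k x = v} \<in> sets M" for k u v
  proof -
    have "{x \<in> space M. \<xi> x = u \<and> \<zeta> k x = v} = {x \<in> space M. \<xi> x = u} \<inter> {x \<in> space M. \<zeta> k x = v}"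
      by auto
    then show ?thesis using sx sz by simp
  qed
  have close: "\<bar>prob S - prob S'\<bar> \<le> prob {x \<in> space M. \<xi> x \<noteq> \<zeta> k x}"
    if "S \<in> sets M" "S' \<in> sets M" "S \<subseteq> S' \<union> {x \<in> space M. \<xi> x \<noteq> \<zeta> k x}" "S' \<subseteq> S \<union> {x \<in> space M. \<xi> x \<noteq> \<zeta> k x}" for S S' k
    using finite_measure_mono[OF that(3)] finite_measure_mono[OF that(4)]
      measure_Un_le[OF that(1) D[of k]] measure_Un_le[OF that(2) D[of k]] that D[of k]
    by (auto simp: abs_le_iff)
  have lim_close: "(\<lambda>k. a k) \<longlonglongrightarrow> l"
    if "\<And>k. \<bar>a k - l\<bar> \<le> prob {x \<in> space M. \<xi> x \<noteq> \<zeta> k x}" for a :: "nat \<Rightarrow> real" and l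
    by (rule LIM_zero_cancel, rule Lim_null_comparison[OF _ lim]) (use that in auto)
  have limv: "(\<lambda>k. prob {x \<in> space M. \<zeta> k x = v}) \<longlonglongrightarrow> p v" for v
    unfolding p_def by (intro lim_close close sx sz) auto
  \<comment> \<open>The limit law of the pair is concentrated on the diagonal. Its entropy is that
    of \<xi> alone, and so is the limit of the entropies of \<open>\<zeta> k\<close>.\<close>
  define q where "q u v = (if u = v then p u else 0)" for u v
  have limuv: "(\<lambda>k. prob {x \<in> space M. \<xi> x = u \<and> \<zeta> k x = v}) \<longlonglongrightarrow> q u v" for u v
  proof (cases "u = v")
    case True
    then show ?thesis unfolding p_def q_def by (auto intro!: lim_close close sx sxz)
  next
    case False
    have "\<bar>prob {x \<in> space M. \<xi> x = u \<and> \<zeta> k x = v} - prob {}\<bar> \<le> prob {x \<in> space M. \<xi> x \<noteq> \<zeta> k x}" for k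
      using False by (intro close sxz) auto
    with False show ?thesis unfolding q_def by (auto intro!: lim_close)
  qed
  \<comment> \<open>Values that are not attained contribute \<open>0 * ln 0 = 0\<close>, so one
    index set serves all \<open>k\<close>.\<close>
  have sum_eq: "shannon X = - (\<Sum>v\<in>W. prob {x \<in> space M. X x = v} * ln (prob {x \<in> space M. X x = v}))"
    if "simple_function M X" "X ` space M \<subseteq> W" "finite W" for X :: "'a \<Rightarrow> 'c" and W
  proof -
    have "X -` {v} \<inter> space M = {x \<in> space M. X x = v}" for v by auto
    moreover have "prob {x \<in> space M. X x = v} = 0" if "v \<notin> X ` space M" for v
    proof -
      have "{x \<in> space M. X x = v} = {}" using that by auto
      then show ?thesis by (simp only: measure_empty)
    qed
    ultimately show ?thesis
      unfolding shannon_sum[OF that(1)] using that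
      by (intro arg_cong[where f=uminus] sum.mono_neutral_cong_left) simp_all
  qed
  have joint: "(\<lambda>k. shannon (\<lambda>x. (\<xi> x, \<zeta> k x))) \<longlonglongrightarrow> - (\<Sum>(u, v)\<in>V \<times> V. q u v * ln (q u v))"
  proof -
    have "shannon (\<lambda>x. (\<xi> x, \<zeta> k x)) = - (\<Sum>(u, v)\<in>V \<times> V. prob {x \<in> space M. \<xi> x = u \<and> \<zeta> k x = v} * ln (prob {x \<in> space M. \<xi> x = u \<and> \<zeta> k x = v}))" for k
    proof -
      have sub: "(\<lambda>x. (\<xi> x, \<zeta> k x)) ` space M \<subseteq> V \<times> V" using V by auto
      have fin: "finite (V \<times> V)" using V by simp
      show ?thesis
        unfolding sum_eq[OF simple_function_Pair[OF \<xi> \<zeta>[of k]] sub fin] by (simp add: case_prod_beta prod_eq_iff)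
    qed
    then show ?thesis
      by (auto simp: case_prod_beta intro!: tendsto_minus tendsto_sum tendsto_x_ln_x limuv)
  qed
  have single: "(\<lambda>k. shannon (\<zeta> k)) \<longlonglongrightarrow> - (\<Sum>v\<in>V. p v * ln (p v))"
  proof -
    have "shannon (\<zeta> k) = - (\<Sum>v\<in>V. prob {x \<in> space M. \<zeta> k x = v} * ln (prob {x \<in> space M. \<zeta> k x = v}))" for k
      by (rule sum_eq[OF \<zeta> V(3,1)])
    then show ?thesis
      by (auto intro!: tendsto_minus tendsto_sum tendsto_x_ln_x limv)
  qed
  have "(\<Sum>(u, v)\<in>V \<times> V. q u v * ln (q u v)) = (\<Sum>u\<in>V. \<Sum>v\<in>V. if u = v then p u * ln (p u) else 0)"
    unfolding sum.cartesian_product[symmetric] by (intro sum.cong) (auto simp: q_def)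
  also have "\<dots> = (\<Sum>v\<in>V. p v * ln (p v))" using V(1) by (simp add: sum.delta)
  finally show ?thesis using tendsto_diff[OF joint single] by simp
qed

end

section \<open>Entropy rates under a measure preserving map\<close>

context mpt
begin

lemma simple_function_comp_funpow: "simple_function M X \<Longrightarrow> simple_function M (\<lambda>x. X ((f ^^ n) x))"
  by (rule simple_function_comp[OF funpow_measurable])

text \<open>The atoms of the composition are preimages of atoms of \<open>X\<close>, so its
  information function is that of \<open>X\<close> composed with \<open>f ^^ n\<close>.\<close>

lemma shannon_comp_funpow:
  assumes X: "simple_function M X" shows "shannon (\<lambda>x. X ((f ^^ n) x)) = shannon X"
proof -
  have meas: "(\<lambda>x. - ln (prob (atom_of X x))) \<in> borel_measurable M"
    using shannon_integrable[OF X] by auto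
  have "prob (atom_of (\<lambda>x. X ((f ^^ n) x)) x) = prob (atom_of X ((f ^^ n) x))" for x
  proof -
    have "prob (atom_of X ((f ^^ n) x)) = measure (distr M M (f ^^ n)) (atom_of X ((f ^^ n) x))"
      by (simp add: funpow_invariant)
    also have "\<dots> = prob ((f ^^ n) -` atom_of X ((f ^^ n) x) \<inter> space M)"
      by (rule measure_distr[OF funpow_measurable atom_of_sets[OF X]])
    also have "(f ^^ n) -` atom_of X ((f ^^ n) x) \<inter> space M = atom_of (\<lambda>x. X ((f ^^ n) x)) x"
      using measurable_space[OF funpow_measurable[of n]] by (auto simp: atom_of_def)
    finally show ?thesis by simp
  qed
  then show ?thesis
    unfolding shannon_def by (simp only: integral_comp_funpow[OF meas])
qed

lemma simple_function_orbit_word: "simple_function M \<xi> \<Longrightarrow> simple_function M (orbit_word f \<xi> n)"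
proof (induction n)
  case 0
  then show ?case by (simp add: orbit_word_def)
next
  case (Suc n)
  have eq: "orbit_word f \<xi> (Suc n) = (\<lambda>x. (\<lambda>(u, v). u @ [v]) (orbit_word f \<xi> n x, \<xi> ((f ^^ n) x)))"
    by (auto simp: orbit_word_def)
  show ?case
    unfolding eq
    by (rule simple_function_compose1[OF simple_function_Pair[OF Suc(1)[OF Suc(2)] simple_function_comp_funpow[OF Suc(2)]]])
qed

lemma shannon_orbit_word_subadditive:
  assumes \<xi>: "simple_function M \<xi>"
  shows "shannon (orbit_word f \<xi> (m + n)) \<le> shannon (orbit_word f \<xi> m) + shannon (orbit_word f \<xi> n)"
proof -
  have "orbit_word f \<xi> (m + n) x = orbit_word f \<xi> (m + n) y \<longleftrightarrow>
      (orbit_word f \<xi> m x, orbit_word f \<xi> n ((f ^^ m) x)) = (orbit_word f \<xi> m y, orbit_word f \<xi> n ((f ^^ m) y))" for x y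
  proof -
    have "\<xi> ((f ^^ j) x) = \<xi> ((f ^^ j) y)"
      if "\<forall>j<n. \<xi> ((f ^^ (j + m)) x) = \<xi> ((f ^^ (j + m)) y)" "\<not> j < m" "j < m + n" for j
      using that(1)[rule_format, of "j - m"] that(2,3) by auto
    then show ?thesis
      by (auto simp: orbit_word_eq_iff funpow_add[unfolded comp_def, THEN fun_cong, symmetric])
  qed
  then have "shannon (orbit_word f \<xi> (m + n)) = shannon (\<lambda>x. (orbit_word f \<xi> m x, orbit_word f \<xi> n ((f ^^ m) x)))"
    by (intro shannon_cong) simp
  also have "\<dots> \<le> shannon (orbit_word f \<xi> m) + shannon (\<lambda>x. orbit_word f \<xi> n ((f ^^ m) x))"
    by (intro shannon_subadditive simple_function_orbit_word \<xi> simple_function_comp_funpow)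
  also have "shannon (\<lambda>x. orbit_word f \<xi> n ((f ^^ m) x)) = shannon (orbit_word f \<xi> n)"
    by (intro shannon_comp_funpow simple_function_orbit_word \<xi>)
  finally show ?thesis .
qed

definition entropy_rate :: "('x \<Rightarrow> 'b) \<Rightarrow> real" where
  "entropy_rate \<xi> = lim (\<lambda>n. shannon (orbit_word f \<xi> n) / real n)"

text \<open>Subadditivity provides the convergence without which \<open>lim\<close> would be an
  arbitrary value.\<close>

lemma entropy_rate_LIMSEQ:
  "simple_function M \<xi> \<Longrightarrow> (\<lambda>n. shannon (orbit_word f \<xi> n) / real n) \<longlonglongrightarrow> entropy_rate \<xi>"
  unfolding entropy_rate_def convergent_LIMSEQ_iff[symmetric]
  by (intro fekete shannon_orbit_word_subadditive shannon_nonneg)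

lemma ks_entropy_eq: "ks_entropy M f = (SUP \<xi>\<in>{\<xi> :: 'x \<Rightarrow> nat. simple_function M \<xi>}. ereal (entropy_rate \<xi>))"
  unfolding ks_entropy_def entropy_rate_def
proof (intro SUP_cong refl arg_cong[where f=ereal] arg_cong[where f=lim] ext)
  fix \<xi> :: "'x \<Rightarrow> nat" and n assume "\<xi> \<in> {\<xi>. simple_function M \<xi>}"
  moreover have "itinerary f \<xi> n = orbit_word f \<xi> n"
    by (simp add: fun_eq_iff itinerary_def orbit_word_def)
  ultimately show "1 / real n * partition_entropy M (itinerary f \<xi> n) = shannon (orbit_word f \<xi> n) / real n"
    by (simp add: partition_entropy_eq_shannon simple_function_orbit_word)
qed

text \<open>The conditional entropy of \<xi> given \<eta> is paid once per time step. The induction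
  adds one letter of each word and uses strong subadditivity twice.\<close>

lemma shannon_orbit_word_le:
  assumes \<xi>: "simple_function M \<xi>" and \<eta>: "simple_function M \<eta>"
  shows "shannon (orbit_word f \<xi> n) \<le> shannon (orbit_word f \<eta> n) + real n * (shannon (\<lambda>x. (\<xi> x, \<eta> x)) - shannon \<eta>)"
proof -
  let ?c = "shannon (\<lambda>x. (\<xi> x, \<eta> x)) - shannon \<eta>"
  let ?X = "\<lambda>n. orbit_word f \<xi> n" and ?Y = "\<lambda>n. orbit_word f \<eta> n"
  note sf = simple_function_orbit_word[OF \<xi>] simple_function_orbit_word[OF \<eta>]
    simple_function_comp_funpow[OF \<xi>] simple_function_comp_funpow[OF \<eta>]
  have "shannon (\<lambda>x. (?X n x, ?Y n x)) \<le> shannon (?Y n) + real n * ?c"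
  proof (induction n)
    case 0
    have "shannon (\<lambda>x. (?X 0 x, ?Y 0 x)) = shannon (?Y 0)"
      by (rule shannon_cong) (auto simp: orbit_word_def)
    then show ?case by simp
  next
    case (Suc n)
    let ?x = "\<lambda>x. \<xi> ((f ^^ n) x)" and ?y = "\<lambda>x. \<eta> ((f ^^ n) x)"
    have "shannon (\<lambda>x. (?X (Suc n) x, ?Y (Suc n) x)) = shannon (\<lambda>x. (?x x, (?X n x, ?Y n x), ?y x))"
      by (rule shannon_cong) (auto simp: orbit_word_eq_iff less_Suc_eq)
    \<comment> \<open>Given the new \<eta>-letter, the new \<xi>-letter costs at most its
      conditional entropy; the earlier letters are dropped from the condition.\<close>
    also have "\<dots> \<le> shannon (\<lambda>x. (?x x, ?y x)) + shannon (\<lambda>x. ((?X n x, ?Y n x), ?y x)) - shannon ?y"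
      using shannon_strong_subadditive[OF sf(3)[of n] simple_function_Pair[OF sf(1,2)[of n]] sf(4)[of n]] by simp
    also have "shannon (\<lambda>x. (?x x, ?y x)) = shannon (\<lambda>x. (\<xi> x, \<eta> x))"
      using shannon_comp_funpow[OF simple_function_Pair[OF \<xi> \<eta>]] by simp
    also have "shannon ?y = shannon \<eta>" by (rule shannon_comp_funpow[OF \<eta>])
    also have "shannon (\<lambda>x. ((?X n x, ?Y n x), ?y x)) = shannon (\<lambda>x. (?X n x, ?y x, ?Y n x))"
      by (rule shannon_cong) auto
    \<comment> \<open>Adding the new \<eta>-letter to both words costs at most what it costs when
      added to the \<eta>-word alone.\<close>
    also have "\<dots> \<le> shannon (\<lambda>x. (?X n x, ?Y n x)) + shannon (\<lambda>x. (?y x, ?Y n x)) - shannon (?Y n)"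
      using shannon_strong_subadditive[OF sf(1)[of n] sf(4)[of n] sf(2)[of n]] by simp
    also have "shannon (\<lambda>x. (?y x, ?Y n x)) = shannon (?Y (Suc n))"
      by (rule shannon_cong) (auto simp: orbit_word_eq_iff less_Suc_eq)
    finally show ?case using Suc by (simp add: algebra_simps)
  qed
  moreover have "shannon (?X n) \<le> shannon (\<lambda>x. (?X n x, ?Y n x))"
    using sf by (intro shannon_mono simple_function_Pair) auto
  ultimately show ?thesis by linarith
qed

text \<open>Conditioning on the finer \<eta> leaves no more entropy than conditioning on \<zeta>.
  Thus \<zeta> measures the error of approximating \<xi>, while \<eta> may be a much finer partition
  whose rate is known.\<close>

lemma entropy_rate_le:
  assumes \<xi>: "simple_function M \<xi>" and \<eta>: "simple_function M \<eta>" and \<zeta>: "simple_function M \<zeta>"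
    and ref: "\<And>x y. x \<in> space M \<Longrightarrow> y \<in> space M \<Longrightarrow> \<eta> x = \<eta> y \<Longrightarrow> \<zeta> x = \<zeta> y"
  shows "entropy_rate \<xi> \<le> entropy_rate \<eta> + (shannon (\<lambda>x. (\<xi> x, \<zeta> x)) - shannon \<zeta>)"
proof -
  have "shannon (\<lambda>x. (\<xi> x, \<eta> x)) \<le> shannon (\<lambda>x. (\<xi> x, \<eta> x, \<zeta> x))"
    by (intro shannon_mono simple_function_Pair \<xi> \<eta> \<zeta>) auto
  also have "\<dots> \<le> shannon (\<lambda>x. (\<xi> x, \<zeta> x)) + shannon (\<lambda>x. (\<eta> x, \<zeta> x)) - shannon \<zeta>"
    using shannon_strong_subadditive[OF \<xi> \<eta> \<zeta>] by simp
  also have "shannon (\<lambda>x. (\<eta> x, \<zeta> x)) = shannon \<eta>"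
    by (rule shannon_cong, unfold prod.inject) (use ref in blast)
  finally have le: "shannon (\<lambda>x. (\<xi> x, \<eta> x)) - shannon \<eta> \<le> shannon (\<lambda>x. (\<xi> x, \<zeta> x)) - shannon \<zeta>" by simp
  show ?thesis
  proof (rule LIMSEQ_le[OF entropy_rate_LIMSEQ[OF \<xi>] tendsto_add[OF entropy_rate_LIMSEQ[OF \<eta>] tendsto_const]])
    show "\<exists>N. \<forall>n\<ge>N. shannon (orbit_word f \<xi> n) / real n
        \<le> shannon (orbit_word f \<eta> n) / real n + (shannon (\<lambda>x. (\<xi> x, \<zeta> x)) - shannon \<zeta>)"
    proof (intro exI[of _ 1] allI impI)
      fix n :: nat assume "1 \<le> n"
      have "shannon (orbit_word f \<xi> n) \<le> shannon (orbit_word f \<eta> n) + real n * (shannon (\<lambda>x. (\<xi> x, \<zeta> x)) - shannon \<zeta>)"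
        using shannon_orbit_word_le[OF \<xi> \<eta>, of n] mult_left_mono[OF le, of "real n"] by linarith
      then show "shannon (orbit_word f \<xi> n) / real n
        \<le> shannon (orbit_word f \<eta> n) / real n + (shannon (\<lambda>x. (\<xi> x, \<zeta> x)) - shannon \<zeta>)"
        using \<open>1 \<le> n\<close> divide_right_mono[of "shannon (orbit_word f \<xi> n)" _ "real n"] by (fastforce simp: add_divide_distrib)
    qed
  qed
qed

end

section \<open>Local dimension and Hausdorff dimension\<close>

text \<open>Interpolation between scales: if \<open>x k \<le> t < x (Suc k)\<close>, then
  \<open>F t \<ge> F (x k) \<ge> y k\<close>, while dividing by \<open>x (Suc k)\<close> instead of
  \<open>t\<close> only decreases a nonnegative bound. For \<open>D < e\<close> the claim is just
  \<open>F t \<ge> 0\<close>.\<close>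

lemma mono_growth_lower:
  fixes F :: "real \<Rightarrow> real" and x y :: "nat \<Rightarrow> real"
  assumes F: "mono F" "\<And>t. 0 \<le> F t" and x: "filterlim x at_top sequentially"
    and le: "\<forall>\<^sub>F k in sequentially. y k \<le> F (x k)"
    and lim: "(\<lambda>k. y k / x (Suc k)) \<longlonglongrightarrow> D" and "0 < e"
  shows "\<forall>\<^sub>F t in at_top. D - e \<le> F t / t"
proof -
  have "\<forall>\<^sub>F k in sequentially. y k / x (Suc k) > D - e"
    using order_tendstoD(1)[OF lim] \<open>0 < e\<close> by simp
  moreover have "\<forall>\<^sub>F k in sequentially. 0 < x k"
    using x by (auto simp: filterlim_at_top_dense)
  ultimately have "\<forall>\<^sub>F k in sequentially. y k / x (Suc k) > D - e \<and> 0 < x k \<and> y k \<le> F (x k)"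
    using le by eventually_elim auto
  then obtain k0 where k0: "\<And>k. k \<ge> k0 \<Longrightarrow> y k / x (Suc k) > D - e \<and> 0 < x k \<and> y k \<le> F (x k)"
    by (auto simp: eventually_sequentially)
  show ?thesis
    using eventually_ge_at_top[of "x k0"]
  proof eventually_elim
    case (elim t)
    have "\<forall>\<^sub>F k in sequentially. t < x k" using x by (auto simp: filterlim_at_top_dense)
    then obtain n where n: "\<And>k. k \<ge> n \<Longrightarrow> t < x k" by (auto simp: eventually_sequentially)
    \<comment> \<open>The scales \<open>x\<close> need not be monotone. Minimality of the first
      index beyond \<open>k0\<close> with \<open>t < x m\<close> still yields
      \<open>x (m - 1) \<le> t\<close>.\<close>
    define m where "m = (LEAST m. k0 < m \<and> t < x m)"
    have m: "k0 < m \<and> t < x m"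
      unfolding m_def by (rule LeastI[of _ "max (Suc k0) n"]) (use n in auto)
    then obtain k where k: "m = Suc k" "k0 \<le> k" by (cases m) auto
    have xk: "x k \<le> t"
    proof (cases "k = k0")
      case False
      then have "\<not> (k0 < k \<and> t < x k)" using not_less_Least[of k "\<lambda>m. k0 < m \<and> t < x m"] k by (auto simp: m_def)
      with False k show ?thesis by auto
    qed (use elim in auto)
    have t: "0 < t" using k0[OF k(2)] xk by linarith
    show ?case
    proof (cases "D - e \<ge> 0")
      case True
      have "(D - e) * t \<le> (D - e) * x (Suc k)" using True m k by (intro mult_left_mono) auto
      also have "\<dots> \<le> y k" using k0[OF k(2)] k0[of "Suc k"] k by (simp add: field_simps)
      also have "\<dots> \<le> F (x k)" using k0[OF k(2)] by simp
      also have "\<dots> \<le> F t" by (rule monoD[OF F(1) xk])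
      finally show ?thesis using t by (simp add: field_simps)
    next
      case False
      moreover have "0 \<le> F t / t" using F(2)[of t] t by simp
      ultimately show ?thesis by linarith
    qed
  qed
qed

text \<open>The same interpolation from the other end:
  \<open>F t \<le> F (x (Suc k)) \<le> y (Suc k)\<close>, and division by \<open>x k\<close> instead
  of \<open>t\<close> gives the larger quotient.\<close>

lemma mono_growth_upper:
  fixes F :: "real \<Rightarrow> real" and x y :: "nat \<Rightarrow> real"
  assumes F: "mono F" and x: "filterlim x at_top sequentially"
    and le: "\<forall>\<^sub>F k in sequentially. F (x k) \<le> y k"
    and lim: "(\<lambda>k. y (Suc k) / x k) \<longlonglongrightarrow> D" and "0 \<le> D" "0 < e"
  shows "\<forall>\<^sub>F t in at_top. F t / t \<le> D + e"
proof -
  have "\<forall>\<^sub>F k in sequentially. y (Suc k) / x k < D + e"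
    using order_tendstoD(2)[OF lim] \<open>0 < e\<close> by simp
  moreover have "\<forall>\<^sub>F k in sequentially. 0 < x k"
    using x by (auto simp: filterlim_at_top_dense)
  ultimately have "\<forall>\<^sub>F k in sequentially. y (Suc k) / x k < D + e \<and> 0 < x k \<and> F (x k) \<le> y k"
    using le by eventually_elim auto
  then obtain k0 where k0: "\<And>k. k \<ge> k0 \<Longrightarrow> y (Suc k) / x k < D + e \<and> 0 < x k \<and> F (x k) \<le> y k"
    by (auto simp: eventually_sequentially)
  show ?thesis
    using eventually_ge_at_top[of "x k0"]
  proof eventually_elim
    case (elim t)
    have "\<forall>\<^sub>F k in sequentially. t < x k" using x by (auto simp: filterlim_at_top_dense)
    then obtain n where n: "\<And>k. k \<ge> n \<Longrightarrow> t < x k" by (auto simp: eventually_sequentially)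
    define m where "m = (LEAST m. k0 < m \<and> t < x m)"
    have m: "k0 < m \<and> t < x m"
      unfolding m_def by (rule LeastI[of _ "max (Suc k0) n"]) (use n in auto)
    then obtain k where k: "m = Suc k" "k0 \<le> k" by (cases m) auto
    have xk: "x k \<le> t"
    proof (cases "k = k0")
      case False
      then have "\<not> (k0 < k \<and> t < x k)" using not_less_Least[of k "\<lambda>m. k0 < m \<and> t < x m"] k by (auto simp: m_def)
      with False k show ?thesis by auto
    qed (use elim in auto)
    have t: "0 < t" using k0[OF k(2)] xk by linarith
    have "F t \<le> F (x (Suc k))" using m k by (intro monoD[OF F]) simp
    also have "\<dots> \<le> y (Suc k)" using k0[of "Suc k"] k by simp
    also have "\<dots> \<le> (D + e) * x k" using k0[OF k(2)] pos_divide_less_eq[of "x k" "y (Suc k)" "D + e"] by auto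
    also have "\<dots> \<le> (D + e) * t" using xk assms by (intro mult_left_mono) auto
    finally show ?case using t by (simp add: field_simps)
  qed
qed

section \<open>Hausdorff measure and the masses of balls\<close>

lemma hausdorff_measure_eq_0I:
  assumes "\<And>\<epsilon> \<eta>. 0 < \<epsilon> \<Longrightarrow> 0 < \<eta> \<Longrightarrow> \<exists>U. (\<forall>i::nat. bounded (U i) \<and> diameter (U i) \<le> \<epsilon>) \<and> S \<subseteq> (\<Union>i. U i) \<and>
      (\<Sum>i. ennreal (diameter (U i) powr s)) \<le> ennreal \<eta>"
  shows "hausdorff_measure s S = 0"
proof -
  have "hausdorff_premeasure s \<epsilon> S \<le> 0" if "0 < \<epsilon>" for \<epsilon>
  proof (rule ennreal_le_epsilon)
    fix \<eta> :: real assume "0 < \<eta>"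
    with assms[OF \<open>0 < \<epsilon>\<close>] obtain U where U: "(\<forall>i::nat. bounded (U i) \<and> diameter (U i) \<le> \<epsilon>) \<and> S \<subseteq> (\<Union>i. U i)"
      and le: "(\<Sum>i. ennreal (diameter (U i) powr s)) \<le> ennreal \<eta>" by blast
    have "hausdorff_premeasure s \<epsilon> S \<le> (\<Sum>i. ennreal (diameter (U i) powr s))"
      unfolding hausdorff_premeasure_def using U by (intro INF_lower) simp
    with le show "hausdorff_premeasure s \<epsilon> S \<le> 0 + ennreal \<eta>" by simp
  qed
  then show ?thesis unfolding hausdorff_measure_def by (auto simp: SUP_eq_const bot_ennreal intro!: antisym SUP_least)
qed

lemma hausdorff_measure_eq_0D:
  assumes "hausdorff_measure s S = 0" "0 < \<epsilon>" "0 < (\<eta>::ennreal)"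
  shows "\<exists>U. (\<forall>i::nat. bounded (U i) \<and> diameter (U i) \<le> \<epsilon>) \<and> S \<subseteq> (\<Union>i. U i) \<and>
      (\<Sum>i. ennreal (diameter (U i) powr s)) < \<eta>"
proof -
  have "hausdorff_premeasure s \<epsilon> S \<le> hausdorff_measure s S"
    unfolding hausdorff_measure_def using assms by (intro SUP_upper) simp
  then have "hausdorff_premeasure s \<epsilon> S < \<eta>" using assms by simp
  then show ?thesis unfolding hausdorff_premeasure_def INF_less_iff by auto
qed

text \<open>The \<open>n\<close>-th set is covered at cost \<open>\<eta> / 2 ^ Suc n\<close>; the
  double sequence of covering sets is enumerated by \<open>prod_decode\<close>.\<close>

lemma hausdorff_measure_UN_eq_0:
  assumes "\<And>n::nat. hausdorff_measure s (S n) = 0"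
  shows "hausdorff_measure s (\<Union>n. S n) = 0"
proof (rule hausdorff_measure_eq_0I)
  fix \<epsilon> \<eta> :: real assume "0 < \<epsilon>" "0 < \<eta>"
  have "\<exists>U. (\<forall>i::nat. bounded (U i) \<and> diameter (U i) \<le> \<epsilon>) \<and> S n \<subseteq> (\<Union>i. U i) \<and>
      (\<Sum>i. ennreal (diameter (U i) powr s)) < ennreal (\<eta> * (1/2) ^ Suc n)" for n
    using \<open>0 < \<epsilon>\<close> \<open>0 < \<eta>\<close> by (intro hausdorff_measure_eq_0D[OF assms]) auto
  then obtain U where U: "\<And>n i. bounded (U n i)" "\<And>n i. diameter (U n i) \<le> \<epsilon>"
    "\<And>n. S n \<subseteq> (\<Union>i. U n i)"
    "\<And>n. (\<Sum>i. ennreal (diameter (U n i) powr s)) < ennreal (\<eta> * (1/2) ^ Suc n)" by metis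
  let ?V = "\<lambda>k. case prod_decode k of (n, i) \<Rightarrow> U n i"
  have "(\<Sum>k. ennreal (diameter (?V k) powr s)) =
      (\<integral>\<^sup>+k. ennreal (diameter (case prod_decode k of (n, i) \<Rightarrow> U n i) powr s) \<partial>count_space UNIV)"
    by (simp add: nn_integral_count_space_nat)
  also have "\<dots> = (\<integral>\<^sup>+p. ennreal (diameter (case p of (n, i) \<Rightarrow> U n i) powr s) \<partial>count_space UNIV)"
    by (rule nn_integral_bij_count_space[OF bij_prod_decode])
  also have "\<dots> = (\<integral>\<^sup>+n. \<integral>\<^sup>+i. ennreal (diameter (U n i) powr s) \<partial>count_space UNIV \<partial>count_space UNIV)"
    by (subst nn_integral_fst_count_space[symmetric]) simp
  also have "\<dots> = (\<Sum>n. \<Sum>i. ennreal (diameter (U n i) powr s))"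
    by (simp add: nn_integral_count_space_nat)
  also have "\<dots> \<le> (\<Sum>n. ennreal (\<eta> * (1/2) ^ Suc n))"
    using U(4) by (intro suminf_le summableI) (auto intro: less_imp_le)
  also have "\<dots> = ennreal \<eta>"
    using sums_mult[OF power_half_series, of \<eta>] \<open>0 < \<eta>\<close>
    by (subst suminf_ennreal_eq[where x=\<eta>]) auto
  finally have sum: "(\<Sum>k. ennreal (diameter (?V k) powr s)) \<le> ennreal \<eta>" .
  have cover: "(\<Union>n. S n) \<subseteq> (\<Union>k. ?V k)"
  proof
    fix x assume "x \<in> (\<Union>n. S n)"
    then obtain n i where "x \<in> U n i" using U(3) by blast
    then have "x \<in> ?V (prod_encode (n, i))" by simp
    then show "x \<in> (\<Union>k. ?V k)" by (rule UN_I[OF UNIV_I])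
  qed
  show "\<exists>V. (\<forall>i::nat. bounded (V i) \<and> diameter (V i) \<le> \<epsilon>) \<and> (\<Union>n. S n) \<subseteq> (\<Union>i. V i) \<and>
      (\<Sum>i. ennreal (diameter (V i) powr s)) \<le> ennreal \<eta>"
    by (intro exI[of _ ?V] conjI allI sum cover) (simp_all add: U split: prod.split)
qed

text \<open>The set is split into countably many pieces with a uniform range of radii. In a piece, a
  maximal \<open>2 * r\<close>-separated set has at most \<open>r powr (- s)\<close> points, since
  the balls of radius \<open>r\<close> are disjoint and each has mass at least
  \<open>r powr s\<close>. The balls of radius \<open>2 * r\<close> around these points cover the
  piece, at a cost tending to 0 because \<open>s < s'\<close>.\<close>

lemma hausdorff_measure_0_of_ball_lower_bound:
  fixes \<nu> :: "'a :: euclidean_space measure"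
  assumes "prob_space \<nu>" and sets: "sets \<nu> = sets borel" and s: "0 < s" "s < s'"
    and low: "\<And>x. x \<in> B \<Longrightarrow> \<exists>\<delta>>0. \<forall>r. 0 < r \<longrightarrow> r < \<delta> \<longrightarrow> r powr s \<le> measure \<nu> (ball x r)"
  shows "hausdorff_measure s' B = 0"
proof -
  interpret prob_space \<nu> by fact
  define S where "S N = {x \<in> B. \<forall>r. 0 < r \<longrightarrow> r < 1 / real (Suc N) \<longrightarrow> r powr s \<le> measure \<nu> (ball x r)}" for N
  have "B \<subseteq> (\<Union>N. S N)"
  proof
    fix x assume "x \<in> B"
    then obtain \<delta> where \<delta>: "\<delta> > 0" "\<forall>r. 0 < r \<longrightarrow> r < \<delta> \<longrightarrow> r powr s \<le> measure \<nu> (ball x r)" using low by blast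
    obtain N where "1 / real (Suc N) < \<delta>" using nat_approx_posE[OF \<delta>(1)] by blast
    with \<delta> \<open>x \<in> B\<close> have "x \<in> S N" unfolding S_def by simp
    then show "x \<in> (\<Union>N. S N)" by blast
  qed
  moreover have "hausdorff_measure s' (S N) = 0" for N
  proof (rule hausdorff_measure_eq_0I)
    fix \<epsilon> \<eta> :: real assume pos: "0 < \<epsilon>" "0 < \<eta>"
    \<comment> \<open>This is the bound \<open>r powr (- s) * (4 * r) powr s'\<close> for the cost
      of the cover found below.\<close>
    have "((\<lambda>r. 4 powr s' * r powr (s' - s)) \<longlongrightarrow> 0) (at_right 0)"
      using s by (auto intro!: tendsto_mult_right_zero tendsto_zero_powrI[where b="s' - s"] simp: eventually_at_right_less eventually_at_filter)
    then have "\<forall>\<^sub>F r in at_right 0. 4 powr s' * r powr (s' - s) < \<eta>"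
      by (rule order_tendstoD(2)[OF _ pos(2)])
    moreover have "\<forall>\<^sub>F r in at_right 0. r < min (1 / real (Suc N)) (\<epsilon> / 4)"
      using pos by (intro order_tendstoD(2)[OF tendsto_ident_at]) simp
    moreover have "\<forall>\<^sub>F r in at_right (0::real). 0 < r" by (simp add: eventually_at_right_less)
    ultimately have "\<forall>\<^sub>F r in at_right 0. 0 < r \<and> r < 1 / real (Suc N) \<and> 4 * r \<le> \<epsilon> \<and> 4 powr s' * r powr (s' - s) < \<eta>"
      by eventually_elim auto
    then obtain r where r: "0 < r" "r < 1 / real (Suc N)" "4 * r \<le> \<epsilon>" "4 powr s' * r powr (s' - s) < \<eta>"
      using eventually_happens[of _ "at_right (0::real)"] by (auto simp: trivial_limit_at_right_real)
    define sep where "sep F \<longleftrightarrow> finite F \<and> F \<subseteq> S N \<and> (\<forall>x\<in>F. \<forall>y\<in>F. x \<noteq> y \<longrightarrow> 2 * r \<le> dist x y)" for F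
    have card_le: "real (card F) * r powr s \<le> 1" if "sep F" for F
    proof -
      have disj: "disjoint_family_on (\<lambda>x. ball x r) F"
        unfolding disjoint_family_on_def
      proof (intro ballI impI)
        fix x y assume xy: "x \<in> F" "y \<in> F" "x \<noteq> y"
        have "2 * r \<le> dist x y" using that xy by (auto simp: sep_def)
        then show "ball x r \<inter> ball y r = {}"
          by (intro disjoint_ballI) simp
      qed
      have "real (card F) * r powr s = (\<Sum>x\<in>F. r powr s)" by simp
      also have "\<dots> \<le> (\<Sum>x\<in>F. prob (ball x r))"
        using that r by (intro sum_mono) (auto simp: sep_def S_def)
      also have "\<dots> = prob (\<Union>x\<in>F. ball x r)"
        using that disj by (intro finite_measure_finite_Union[symmetric]) (auto simp: sep_def sets)
      also have "\<dots> \<le> 1" by (rule prob_le_1)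
      finally show ?thesis .
    qed
    \<comment> \<open>A common bound on the number of separated points makes a maximal separated set
      exist.\<close>
    obtain K where K: "1 / r powr s < real K" using reals_Archimedean2 by blast
    have "card F < K" if "sep F" for F
    proof -
      have "real (card F) \<le> 1 / r powr s" using card_le[OF that] r by (simp add: field_simps)
      with K show ?thesis by linarith
    qed
    moreover have "sep {}" by (simp add: sep_def)
    ultimately obtain F where F: "sep F" and max: "\<And>G. sep G \<Longrightarrow> card G \<le> card F"
      using ex_has_greatest_nat[of sep "{}" card K] by (meson less_imp_le)
    then have fin: "finite F" by (simp add: sep_def)
    obtain p where p: "bij_betw p {..<card F} F" using ex_bij_betw_nat_finite[OF fin] by (auto simp: atLeast0LessThan)
    define U where "U i = (if i < card F then ball (p i) (2 * r) else {})" for i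
    have diam: "diameter (ball x (2 * r)) \<le> 4 * r" for x :: 'a using r by simp
    have "S N \<subseteq> (\<Union>i. U i)"
    proof
      fix x assume x: "x \<in> S N"
      have "\<exists>y\<in>F. dist x y < 2 * r"
      proof (rule ccontr)
        assume "\<not> (\<exists>y\<in>F. dist x y < 2 * r)"
        then have far: "\<forall>y\<in>F. 2 * r \<le> dist x y" by (auto simp: not_less)
        then have "x \<notin> F" using r by auto
        have "sep (insert x F)" using F x far by (auto simp: sep_def dist_commute)
        then show False using max[of "insert x F"] fin \<open>x \<notin> F\<close> by simp
      qed
      then obtain y where "y \<in> F" "dist x y < 2 * r" by blast
      then obtain i where "i < card F" "y = p i" using p by (auto simp: bij_betw_def)
      then have "x \<in> U i" using \<open>dist x y < 2 * r\<close> by (simp add: U_def dist_commute)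
      then show "x \<in> (\<Union>i. U i)" by blast
    qed
    moreover have "(\<Sum>i. ennreal (diameter (U i) powr s')) \<le> ennreal \<eta>"
    proof -
      have "(\<Sum>i. ennreal (diameter (U i) powr s')) = (\<Sum>i<card F. ennreal (diameter (U i) powr s'))"
        using s by (intro suminf_finite) (auto simp: U_def diameter_empty)
      also have "\<dots> \<le> (\<Sum>i<card F. ennreal ((4 * r) powr s'))"
        using s diam by (intro sum_mono ennreal_leI powr_mono2) (auto simp: U_def diameter_ge_0)
      also have "\<dots> = ennreal (real (card F) * (4 * r) powr s')"
        by (simp add: ennreal_of_nat_eq_real_of_nat ennreal_mult)
      also have "\<dots> \<le> ennreal \<eta>"
      proof (rule ennreal_leI)
        have "real (card F) * (4 * r) powr s' = (real (card F) * r powr s) * (4 powr s' * r powr (s' - s))"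
          using r by (simp add: powr_mult powr_diff)
        also have "\<dots> \<le> 1 * (4 powr s' * r powr (s' - s))"
          using card_le[OF F] by (intro mult_right_mono) auto
        finally show "real (card F) * (4 * r) powr s' \<le> \<eta>" using r by simp
      qed
      finally show ?thesis .
    qed
    moreover have "bounded (U i) \<and> diameter (U i) \<le> \<epsilon>" for i
      using r diam[of "p i"] pos by (auto simp: U_def diameter_empty)
    ultimately show "\<exists>U. (\<forall>i::nat. bounded (U i) \<and> diameter (U i) \<le> \<epsilon>) \<and> S N \<subseteq> (\<Union>i. U i) \<and>
      (\<Sum>i. ennreal (diameter (U i) powr s')) \<le> ennreal \<eta>" by blast
  qed
  then have "hausdorff_measure s' (\<Union>N. S N) = 0" by (rule hausdorff_measure_UN_eq_0)
  moreover have "(\<Union>N. S N) \<subseteq> B" by (auto simp: S_def)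
  ultimately show ?thesis by (metis subset_antisym)
qed

text \<open>The mass distribution principle by contradiction: a cheap cover of \<open>B\<close> is
  replaced by balls centred at points where the upper bound holds, so that their total mass is
  small. The sets \<open>G N\<close> of such points need not be measurable and are enclosed in
  measurable sets of arbitrarily small mass.\<close>

lemma hausdorff_measure_neq_0_of_ball_upper_bound:
  fixes \<nu> :: "'a :: euclidean_space measure"
  assumes "prob_space \<nu>" and sets: "sets \<nu> = sets borel" and s: "0 < s"
    and up: "AE x in \<nu>. \<exists>\<delta>>0. \<forall>r. 0 < r \<longrightarrow> r < \<delta> \<longrightarrow> measure \<nu> (ball x r) \<le> r powr s"
    and B: "B \<in> sets borel" "emeasure \<nu> (- B) = 0"
  shows "hausdorff_measure s B \<noteq> 0"
proof
  interpret prob_space \<nu> by fact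
  have space: "space \<nu> = UNIV" using sets_eq_imp_space_eq[OF sets] by simp
  assume zero: "hausdorff_measure s B = 0"
  define G where "G N = {x \<in> B. \<forall>r. 0 < r \<longrightarrow> r < 1 / real (Suc N) \<longrightarrow> prob (ball x r) \<le> r powr s}" for N
  \<comment> \<open>Covering sets of diameter 0 cannot be enlarged to balls of proportional radius.
    They are replaced by points, which have no mass here.\<close>
  have single: "prob {x} = 0" if "x \<in> G N" for x N
  proof -
    have "((\<lambda>r. r powr s) \<longlongrightarrow> 0) (at_right 0)"
      using s by (auto intro!: tendsto_zero_powrI[where b=s] simp: eventually_at_filter)
    moreover have "\<forall>\<^sub>F r in at_right 0. prob {x} \<le> r powr s"
    proof -
      have "\<forall>\<^sub>F r in at_right (0::real). r < 1 / real (Suc N)"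
        by (intro order_tendstoD(2)[OF tendsto_ident_at]) simp
      moreover have "\<forall>\<^sub>F r in at_right (0::real). 0 < r" by (simp add: eventually_at_right_less)
      ultimately show ?thesis
      proof eventually_elim
        case (elim r)
        have "prob {x} \<le> prob (ball x r)"
          using elim by (intro finite_measure_mono) (auto simp: sets)
        also have "\<dots> \<le> r powr s" using that elim by (simp add: G_def)
        finally show ?case .
      qed
    qed
    ultimately have "prob {x} \<le> 0" by (intro tendsto_lowerbound) (auto simp: trivial_limit_at_right_real)
    then show ?thesis using measure_nonneg[of \<nu> "{x}"] by linarith
  qed
  have "AE x in \<nu>. x \<notin> G N" for N
  proof -
    have "\<exists>W. W \<in> sets \<nu> \<and> G N \<subseteq> W \<and> emeasure \<nu> W \<le> ennreal (2 powr s) * ennreal (1 / real (Suc k))" for k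
    proof -
      have "\<exists>U. (\<forall>i::nat. bounded (U i) \<and> diameter (U i) \<le> 1 / (4 * real (Suc N))) \<and> B \<subseteq> (\<Union>i. U i) \<and>
          (\<Sum>i. ennreal (diameter (U i) powr s)) < ennreal (1 / real (Suc k))"
        by (rule hausdorff_measure_eq_0D[OF zero]) auto
      then obtain U where U: "\<And>i::nat. bounded (U i)" "\<And>i. diameter (U i) \<le> 1 / (4 * real (Suc N))"
          "B \<subseteq> (\<Union>i. U i)" "(\<Sum>i. ennreal (diameter (U i) powr s)) < ennreal (1 / real (Suc k))"
        by blast
      define c where "c i = (SOME x. x \<in> U i \<inter> G N)" for i
      have c: "c i \<in> U i" "c i \<in> G N" if "U i \<inter> G N \<noteq> {}" for i
        using someI_ex[of "\<lambda>x. x \<in> U i \<inter> G N"] that by (auto simp: c_def)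
      \<comment> \<open>Radius twice the diameter makes the open ball contain all of
        \<open>U i\<close>; the bound \<open>1 / (4 * real (Suc N))\<close> on diameters keeps this
        radius within the range where \<open>G N\<close> controls masses.\<close>
      define V where "V i = (if U i \<inter> G N = {} then {} else if diameter (U i) = 0 then {c i}
          else ball (c i) (2 * diameter (U i)))" for i
      have V_sets: "V i \<in> sets \<nu>" for i by (simp add: V_def sets)
      have sub: "U i \<inter> G N \<subseteq> V i" for i
      proof
        fix x assume x: "x \<in> U i \<inter> G N"
        have "dist (c i) x \<le> diameter (U i)"
          using x c[of i] by (intro diameter_bounded_bound U) auto
        moreover have "0 \<le> diameter (U i)" by (rule diameter_ge_0[OF U(1)])
        ultimately show "x \<in> V i" using x by (auto simp: V_def)
      qed
      have V_le: "emeasure \<nu> (V i) \<le> ennreal (2 powr s) * ennreal (diameter (U i) powr s)" for i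
      proof (cases "U i \<inter> G N = {} \<or> diameter (U i) = 0")
        case True
        then have "emeasure \<nu> (V i) = 0"
          using single[OF c(2)[of i]] by (cases "U i \<inter> G N = {}") (auto simp: V_def emeasure_eq_measure)
        then show ?thesis by simp
      next
        case False
        then have d: "0 < diameter (U i)" using diameter_ge_0[OF U(1), of i] by linarith
        have "2 * diameter (U i) < 1 / real (Suc N)"
          using U(2)[of i] by (simp add: field_simps)
        then have "prob (V i) \<le> (2 * diameter (U i)) powr s"
          using False c(2)[of i] d by (simp add: V_def G_def)
        also have "\<dots> = 2 powr s * diameter (U i) powr s" using d by (simp add: powr_mult)
        finally show ?thesis by (simp add: emeasure_eq_measure ennreal_mult' [symmetric] ennreal_leI)
      qed
      have "emeasure \<nu> (\<Union>i. V i) \<le> (\<Sum>i. emeasure \<nu> (V i))"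
        using V_sets by (intro emeasure_subadditive_countably) auto
      also have "\<dots> \<le> (\<Sum>i. ennreal (2 powr s) * ennreal (diameter (U i) powr s))"
        by (intro suminf_le V_le) auto
      also have "\<dots> = ennreal (2 powr s) * (\<Sum>i. ennreal (diameter (U i) powr s))" by simp
      also have "\<dots> \<le> ennreal (2 powr s) * ennreal (1 / real (Suc k))"
        using U(4) by (intro mult_left_mono) auto
      finally have "emeasure \<nu> (\<Union>i. V i) \<le> ennreal (2 powr s) * ennreal (1 / real (Suc k))" .
      moreover have "G N \<subseteq> (\<Union>i. V i)"
      proof
        fix x assume x: "x \<in> G N"
        then have "x \<in> B" by (simp add: G_def)
        then obtain i where "x \<in> U i" using U(3) by blast
        then show "x \<in> (\<Union>i. V i)" using sub[of i] x by blast
      qed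
      ultimately show ?thesis using V_sets by (intro exI[of _ "\<Union>i. V i"]) auto
    qed
    then obtain W where W: "\<And>k. W k \<in> sets \<nu>" "\<And>k. G N \<subseteq> W k"
      "\<And>k. emeasure \<nu> (W k) \<le> ennreal (2 powr s) * ennreal (1 / real (Suc k))" by metis
    have "prob (\<Inter>k. W k) \<le> 2 powr s * (1 / real (Suc k))" for k
    proof -
      have "prob (\<Inter>k. W k) \<le> prob (W k)" using W(1) by (intro finite_measure_mono) auto
      also have "\<dots> \<le> 2 powr s * (1 / real (Suc k))"
      proof -
        have "ennreal (prob (W k)) \<le> ennreal (2 powr s * (1 / real (Suc k)))"
          using W(3)[of k] by (simp only: emeasure_eq_measure ennreal_mult' powr_ge_zero)
        then show ?thesis by (subst (asm) ennreal_le_iff) auto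
      qed
      finally show ?thesis .
    qed
    moreover have "(\<lambda>k. 2 powr s * (1 / real (Suc k))) \<longlonglongrightarrow> 2 powr s * 0"
      by (intro tendsto_mult tendsto_const LIMSEQ_inverse_real_of_nat[unfolded inverse_eq_divide])
    ultimately have "prob (\<Inter>k. W k) \<le> 2 powr s * 0" by (intro LIMSEQ_le_const) auto
    then have "prob (\<Inter>k. W k) = 0" using measure_nonneg[of \<nu> "\<Inter>k. W k"] by linarith
    then have "(\<Inter>k. W k) \<in> null_sets \<nu>" using W(1) by (auto simp: null_sets_def emeasure_eq_measure)
    then show ?thesis
      by (rule AE_I') (use W(2) in auto)
  qed
  then have not_G: "AE x in \<nu>. \<forall>N. x \<notin> G N" by (simp add: AE_all_countable)
  have "- B \<in> null_sets \<nu>" using B by (auto simp: null_sets_def sets)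
  then have "AE x in \<nu>. x \<in> B" by (rule AE_I') auto
  with not_G up have "AE x in \<nu>. False"
  proof eventually_elim
    case (elim x)
    then obtain \<delta> where \<delta>: "\<delta> > 0" "\<forall>r. 0 < r \<longrightarrow> r < \<delta> \<longrightarrow> prob (ball x r) \<le> r powr s" by blast
    obtain N where "1 / real (Suc N) < \<delta>" using nat_approx_posE[OF \<delta>(1)] by blast
    with \<delta> elim have "x \<in> G N" unfolding G_def by simp
    with elim show False by blast
  qed
  then show False by simp
qed

text \<open>A point with a null ball around it lies in a null member of a countable basis, and these
  members form a null set together.\<close>

lemma AE_ball_pos:
  fixes \<nu> :: "'a :: euclidean_space measure"
  assumes "prob_space \<nu>" and sets: "sets \<nu> = sets borel"
  shows "AE x in \<nu>. \<forall>r>0. 0 < measure \<nu> (ball x r)"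
proof -
  interpret prob_space \<nu> by fact
  obtain \<B> :: "'a set set" where \<B>: "countable \<B>" "topological_basis \<B>" using ex_countable_basis by blast
  have "AE x in \<nu>. \<forall>U\<in>\<B>. prob U = 0 \<longrightarrow> x \<notin> U"
    unfolding AE_ball_countable[OF \<B>(1)]
  proof
    fix U assume "U \<in> \<B>"
    then have "U \<in> sets \<nu>" using topological_basis_open[OF \<B>(2)] by (simp add: sets)
    then show "AE x in \<nu>. prob U = 0 \<longrightarrow> x \<notin> U"
      by (cases "prob U = 0") (auto intro!: AE_not_in simp: null_sets_def emeasure_eq_measure)
  qed
  then show ?thesis
  proof eventually_elim
    case (elim x)
    show ?case
    proof (intro allI impI)
      fix r :: real assume "0 < r"
      obtain U where U: "U \<in> \<B>" "x \<in> U" "U \<subseteq> ball x r"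
        by (rule topological_basisE[OF \<B>(2), of "ball x r" x]) (use \<open>0 < r\<close> in auto)
      have "0 < prob U" using elim U measure_nonneg[of \<nu> U] by (metis less_le)
      also have "\<dots> \<le> prob (ball x r)" using U by (intro finite_measure_mono) (auto simp: sets)
      finally show "0 < prob (ball x r)" .
    qed
  qed
qed

text \<open>For \<open>r < 1\<close> the denominator \<open>ln r\<close> is negative and turns the
  inequalities round. Positive masses are required since \<open>ln 0 = 0\<close> would fake a small
  ratio.\<close>

lemma local_dim_ratio_bounds:
  assumes lim: "(local_dim_ratio \<nu> x \<longlongrightarrow> D) (at_right 0)" and pos: "\<forall>r>0. 0 < measure \<nu> (ball x r)"
  shows "D < s \<Longrightarrow> \<exists>\<delta>>0. \<forall>r. 0 < r \<longrightarrow> r < \<delta> \<longrightarrow> r powr s \<le> measure \<nu> (ball x r)"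
    and "s < D \<Longrightarrow> \<exists>\<delta>>0. \<forall>r. 0 < r \<longrightarrow> r < \<delta> \<longrightarrow> measure \<nu> (ball x r) \<le> r powr s"
proof -
  have neg: "ln r < 0" if "0 < r" "r < 1" for r :: real using that by simp
  have conv: "\<exists>\<delta>>0. \<forall>r. 0 < r \<longrightarrow> r < \<delta> \<longrightarrow> Q r"
    if ev: "\<forall>\<^sub>F r in at_right 0. P r" and imp: "\<And>r. 0 < r \<Longrightarrow> r < 1 \<Longrightarrow> P r \<Longrightarrow> Q r" for P Q :: "real \<Rightarrow> bool"
  proof -
    from ev obtain b where "0 < b" "\<forall>y>0. y < b \<longrightarrow> P y" by (auto simp: eventually_at_right_field)
    then show ?thesis using imp by (intro exI[of _ "min b 1"]) auto
  qed
  {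
    assume "D < s"
    from order_tendstoD(2)[OF lim this] show "\<exists>\<delta>>0. \<forall>r. 0 < r \<longrightarrow> r < \<delta> \<longrightarrow> r powr s \<le> measure \<nu> (ball x r)"
    proof (rule conv)
      fix r :: real assume r: "0 < r" "r < 1" "local_dim_ratio \<nu> x r < s"
      then have "s * ln r < ln (measure \<nu> (ball x r))"
        using neg[of r] by (simp add: local_dim_ratio_def neg_divide_less_eq)
      then show "r powr s \<le> measure \<nu> (ball x r)"
        using pos r by (simp add: powr_def ln_ge_iff[symmetric] less_imp_le)
    qed
  }
  {
    assume "s < D"
    from order_tendstoD(1)[OF lim this] show "\<exists>\<delta>>0. \<forall>r. 0 < r \<longrightarrow> r < \<delta> \<longrightarrow> measure \<nu> (ball x r) \<le> r powr s"
    proof (rule conv)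
      fix r :: real assume r: "0 < r" "r < 1" "s < local_dim_ratio \<nu> x r"
      then have "ln (measure \<nu> (ball x r)) < s * ln r"
        using neg[of r] by (simp add: local_dim_ratio_def neg_less_divide_eq)
      then have "exp (ln (measure \<nu> (ball x r))) \<le> exp (s * ln r)" by simp
      then show "measure \<nu> (ball x r) \<le> r powr s"
        using pos r by (simp add: powr_def)
    qed
  }
qed

text \<open>The covering bound applied to the regular points gives dimension at most
  \<open>D + e\<close> for each \<open>e > 0\<close>. Conversely, a set of full measure with
  vanishing \<open>s\<close>-dimensional measure for some \<open>s < D\<close> contradicts the mass
  distribution principle.\<close>

theorem measure_dim_eq_local_dim:
  fixes \<nu> :: "'a :: euclidean_space measure"
  assumes prob: "prob_space \<nu>" and sets: "sets \<nu> = sets borel" and "0 \<le> D"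
    and lim: "AE x in \<nu>. (local_dim_ratio \<nu> x \<longlongrightarrow> D) (at_right 0)"
  shows "measure_dim \<nu> = ereal D"
proof (rule antisym)
  interpret prob_space \<nu> by fact
  have space: "space \<nu> = UNIV" using sets_eq_imp_space_eq[OF sets] by simp
  have both: "AE x in \<nu>. (local_dim_ratio \<nu> x \<longlongrightarrow> D) (at_right 0) \<and> (\<forall>r>0. 0 < prob (ball x r))"
    using lim AE_ball_pos[OF prob sets] by eventually_elim blast
  \<comment> \<open>A Borel null set containing all exceptional points: its complement competes in
    the infimum that defines \<open>measure_dim\<close>.\<close>
  from both obtain N where N': "{x \<in> space \<nu>. \<not> ((local_dim_ratio \<nu> x \<longlongrightarrow> D) (at_right 0) \<and> (\<forall>r>0. 0 < prob (ball x r)))} \<subseteq> N"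
    "emeasure \<nu> N = 0" "N \<in> sets \<nu>" by (rule AE_E)
  have N: "N \<in> null_sets \<nu>"
    "\<And>x. x \<notin> N \<Longrightarrow> (local_dim_ratio \<nu> x \<longlongrightarrow> D) (at_right 0)"
    "\<And>x. x \<notin> N \<Longrightarrow> \<forall>r>0. 0 < prob (ball x r)"
    using N' by (auto simp: space null_sets_def)
  show "measure_dim \<nu> \<le> ereal D"
  proof -
    have "measure_dim \<nu> \<le> hausdorff_dim (- N)"
      unfolding measure_dim_def using N by (intro INF_lower) (auto simp: null_sets_def sets)
    also have "\<dots> \<le> ereal D"
    proof (rule ereal_le_epsilon2)
      fix e :: real assume "0 < e"
      have "hausdorff_measure (D + e) (- N) = 0"
        by (rule hausdorff_measure_0_of_ball_lower_bound[OF prob sets, where s="D + e / 2"])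
           (use \<open>0 \<le> D\<close> \<open>0 < e\<close> N(2,3) in \<open>auto intro!: local_dim_ratio_bounds(1)\<close>)
      then show "hausdorff_dim (- N) \<le> ereal D + ereal e"
        unfolding hausdorff_dim_def using \<open>0 \<le> D\<close> \<open>0 < e\<close> by (auto intro!: INF_lower2[of "D + e"])
    qed
    finally show ?thesis .
  qed
  show "ereal D \<le> measure_dim \<nu>"
    unfolding measure_dim_def
  proof (rule INF_greatest)
    fix B :: "'a set" assume B: "B \<in> {B \<in> sets borel. emeasure \<nu> (- B) = 0}"
    show "ereal D \<le> hausdorff_dim B"
      unfolding hausdorff_dim_def
    proof (rule INF_greatest)
      fix s :: real assume s: "s \<in> {s. 0 < s \<and> hausdorff_measure s B = 0}"
      show "ereal D \<le> ereal s"
      proof (rule ccontr)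
        assume "\<not> ereal D \<le> ereal s"
        then have "s < D" by simp
        have "AE x in \<nu>. \<exists>\<delta>>0. \<forall>r. 0 < r \<longrightarrow> r < \<delta> \<longrightarrow> prob (ball x r) \<le> r powr s"
          using both by eventually_elim (rule local_dim_ratio_bounds(2)[OF _ _ \<open>s < D\<close>]; simp)
        from hausdorff_measure_neq_0_of_ball_upper_bound[OF prob sets _ this, of B] s B show False by auto
      qed
    qed
  qed
qed

text \<open>With \<open>t = - ln r\<close> the logarithmic mass becomes a nondecreasing function of
  \<open>t\<close>, and the local dimension is its linear growth rate at infinity.\<close>

definition ball_log :: "'a :: metric_space measure \<Rightarrow> 'a \<Rightarrow> real \<Rightarrow> real" where
  "ball_log \<nu> z t = - ln (measure \<nu> (ball z (exp (- t))))"

lemma local_dim_ratio_tendstoI: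
  assumes "\<And>e. 0 < e \<Longrightarrow> \<forall>\<^sub>F t in at_top. D - e \<le> ball_log \<nu> z t / t"
    and "\<And>e. 0 < e \<Longrightarrow> \<forall>\<^sub>F t in at_top. ball_log \<nu> z t / t \<le> D + e"
  shows "(local_dim_ratio \<nu> z \<longlongrightarrow> D) (at_right 0)"
proof -
  have "((\<lambda>t. ball_log \<nu> z t / t) \<longlongrightarrow> D) at_top"
  proof (rule tendstoI)
    fix e :: real assume "0 < e"
    with assms[of "e / 2"] have "\<forall>\<^sub>F t in at_top. D - e / 2 \<le> ball_log \<nu> z t / t"
      "\<forall>\<^sub>F t in at_top. ball_log \<nu> z t / t \<le> D + e / 2" by auto
    then show "\<forall>\<^sub>F t in at_top. dist (ball_log \<nu> z t / t) D < e"
      by eventually_elim (use \<open>0 < e\<close> in \<open>auto simp: dist_real_def abs_less_iff\<close>)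
  qed
  moreover have "filterlim (\<lambda>r::real. - ln r) at_top (at_right 0)"
    using ln_at_0 by (simp add: filterlim_uminus_at_bot)
  ultimately have "((\<lambda>r. ball_log \<nu> z (- ln r) / (- ln r)) \<longlongrightarrow> D) (at_right 0)"
    by (rule filterlim_compose)
  moreover have "\<forall>\<^sub>F r in at_right 0. ball_log \<nu> z (- ln r) / (- ln r) = local_dim_ratio \<nu> z r"
    using eventually_at_right_less[of "0::real"]
    by eventually_elim (auto simp: ball_log_def local_dim_ratio_def)
  ultimately show ?thesis by (rule Lim_transform_eventually)
qed

lemma mono_ball_log:
  fixes z :: "'a :: euclidean_space"
  assumes "prob_space \<nu>" and sets: "sets \<nu> = sets borel" and pos: "\<forall>r>0. 0 < measure \<nu> (ball z r)"
  shows "mono (ball_log \<nu> z)" "0 \<le> ball_log \<nu> z t"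
proof -
  interpret prob_space \<nu> by fact
  show "mono (ball_log \<nu> z)"
  proof (rule monoI)
    fix s t :: real assume "s \<le> t"
    then have "prob (ball z (exp (- t))) \<le> prob (ball z (exp (- s)))"
      by (intro finite_measure_mono subset_ball) (auto simp: sets)
    then show "ball_log \<nu> z s \<le> ball_log \<nu> z t" using pos by (simp add: ball_log_def)
  qed
  show "0 \<le> ball_log \<nu> z t" using pos prob_le_1 by (simp add: ball_log_def)
qed

text \<open>A null set of the shift may have a non-measurable image in Euclidean space, so
  almost sure statements can only be pushed forward for measurable predicates.\<close>

lemma AE_distr_local_dim:
  fixes \<pi> :: "'x \<Rightarrow> 'a :: euclidean_space"
  assumes prob: "prob_space M" and [measurable]: "\<pi> \<in> borel_measurable M" and "0 \<le> D"
    and ae: "AE x in M. (\<forall>r>0. 0 < measure (distr M borel \<pi>) (ball (\<pi> x) r)) \<and>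
        (local_dim_ratio (distr M borel \<pi>) (\<pi> x) \<longlongrightarrow> D) (at_right 0)"
  shows "AE z in distr M borel \<pi>. (local_dim_ratio (distr M borel \<pi>) z \<longlongrightarrow> D) (at_right 0)"
proof -
  let ?\<nu> = "distr M borel \<pi>"
  interpret M: prob_space M by fact
  interpret \<nu>: prob_space ?\<nu> by (rule M.prob_space_distr) measurable
  \<comment> \<open>The balls are sections of an open subset of the product, so their mass depends
    measurably on the centre.\<close>
  have meas [measurable]: "(\<lambda>z. measure ?\<nu> (ball z r)) \<in> borel_measurable borel" for r
  proof -
    have "{p \<in> space (borel \<Otimes>\<^sub>M borel). dist (fst p) (snd p :: 'a) < r} \<in> sets (borel \<Otimes>\<^sub>M borel)" by measurable
    then have "{p. dist (fst p) (snd p :: 'a) < r} \<in> sets (borel \<Otimes>\<^sub>M ?\<nu>)"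
      by (simp add: space_pair_measure sets_pair_measure_cong[OF refl sets_distr])
    from \<nu>.measurable_emeasure_Pair[OF this]
    have "(\<lambda>z. emeasure ?\<nu> (ball z r)) \<in> borel_measurable borel" by (simp add: vimage_def ball_def)
    then show ?thesis unfolding measure_def by measurable
  qed
  \<comment> \<open>Convergence along the radii \<open>exp (- real n)\<close> is a measurable
    condition on \<open>z\<close>, hence can be pushed forward; monotonicity of
    \<open>ball_log\<close> restores all radii afterwards.\<close>
  define P where "P z \<longleftrightarrow> (\<lambda>n. ball_log ?\<nu> z (real n) / real n) \<longlonglongrightarrow> D" for z
  have P_iff: "P z \<longleftrightarrow> (\<forall>m. \<exists>k. \<forall>n\<ge>k. \<bar>ball_log ?\<nu> z (real n) / real n - D\<bar> < 1 / real (Suc m))" for z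
  proof
    assume "P z"
    then show "\<forall>m. \<exists>k. \<forall>n\<ge>k. \<bar>ball_log ?\<nu> z (real n) / real n - D\<bar> < 1 / real (Suc m)"
      unfolding P_def LIMSEQ_def dist_real_def by auto
  next
    assume ev: "\<forall>m. \<exists>k. \<forall>n\<ge>k. \<bar>ball_log ?\<nu> z (real n) / real n - D\<bar> < 1 / real (Suc m)"
    show "P z" unfolding P_def LIMSEQ_def dist_real_def
    proof (intro allI impI)
      fix e :: real assume "0 < e"
      then obtain m where "1 / real (Suc m) < e" using nat_approx_posE by blast
      with ev show "\<exists>k. \<forall>n\<ge>k. \<bar>ball_log ?\<nu> z (real n) / real n - D\<bar> < e" by (meson less_trans)
    qed
  qed
  have [measurable]: "Measurable.pred borel P"
    unfolding P_iff[abs_def] ball_log_def by measurable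
  have "AE x in M. P (\<pi> x)"
    using ae
  proof eventually_elim
    case (elim x)
    then have lim: "(local_dim_ratio ?\<nu> (\<pi> x) \<longlongrightarrow> D) (at_right 0)" by simp
    have "filterlim (\<lambda>n. exp (- real n)) (at_right 0) sequentially"
      by real_asymp
    from filterlim_compose[OF lim this] show ?case
      by (simp add: P_def ball_log_def local_dim_ratio_def)
  qed
  then have "AE z in ?\<nu>. P z" by (subst AE_distr_iff) auto
  then show ?thesis
    using AE_ball_pos[OF \<nu>.prob_space_axioms sets_distr]
  proof eventually_elim
    case (elim z)
    note F = mono_ball_log[OF \<nu>.prob_space_axioms sets_distr elim(2)]
    have ratio: "(\<lambda>n. real n / real (Suc n)) \<longlonglongrightarrow> 1" "(\<lambda>n. real (Suc n) / real n) \<longlonglongrightarrow> 1"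
      by real_asymp+
    have P: "(\<lambda>n. ball_log ?\<nu> z (real n) / real n) \<longlonglongrightarrow> D" using elim by (simp add: P_def)
    have l1: "(\<lambda>n. ball_log ?\<nu> z (real n) / real (Suc n)) \<longlonglongrightarrow> D"
    proof (rule Lim_transform_eventually)
      show "(\<lambda>n. ball_log ?\<nu> z (real n) / real n * (real n / real (Suc n))) \<longlonglongrightarrow> D"
        using tendsto_mult[OF P ratio(1)] by simp
    qed (rule eventually_mono[OF eventually_gt_at_top[of 0]], simp)
    have l2: "(\<lambda>n. ball_log ?\<nu> z (real (Suc n)) / real n) \<longlonglongrightarrow> D"
    proof (rule Lim_transform_eventually)
      show "(\<lambda>n. ball_log ?\<nu> z (real (Suc n)) / real (Suc n) * (real (Suc n) / real n)) \<longlonglongrightarrow> D"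
        using tendsto_mult[OF LIMSEQ_Suc[OF P] ratio(2)] by simp
    qed (rule eventually_mono[OF eventually_gt_at_top[of 0]], simp)
    show ?case
      by (intro local_dim_ratio_tendstoI mono_growth_lower[OF F filterlim_real_sequentially _ l1]
            mono_growth_upper[OF F(1) filterlim_real_sequentially _ l2 \<open>0 \<le> D\<close>]) auto
  qed
qed

section \<open>Topology and measurability on shifts\<close>

text \<open>The last index of agreement is one less than the first index of disagreement, which
  covers the value \<open>- 1\<close> for sequences that differ at 0.\<close>

lemma one_sided_dist_eq:
  assumes "x \<noteq> y"
  shows "one_sided_dist \<beta> x y = exp (- \<beta> * (real (LEAST j. x j \<noteq> y j) - 1))"
proof -
  let ?d = "LEAST j. x j \<noteq> y j"
  have "\<exists>j. x j \<noteq> y j" using assms by auto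
  then have d: "x ?d \<noteq> y ?d" by (rule LeastI_ex)
  have "(GREATEST n::int. \<forall>k. int k \<le> n \<longrightarrow> x k = y k) = int ?d - 1"
  proof (rule Greatest_equality)
    show "\<forall>k. int k \<le> int ?d - 1 \<longrightarrow> x k = y k"
    proof (intro allI impI)
      fix k assume "int k \<le> int ?d - 1"
      then have "k < ?d" by linarith
      then show "x k = y k" using not_less_Least by blast
    qed
    fix n :: int assume agree: "\<forall>k. int k \<le> n \<longrightarrow> x k = y k"
    have "\<not> int ?d \<le> n"
    proof
      assume "int ?d \<le> n"
      with agree have "x ?d = y ?d" by blast
      with d show False by blast
    qed
    then show "n \<le> int ?d - 1" by linarith
  qed
  then show ?thesis using assms by (simp add: one_sided_dist_def)
qed

text \<open>Folding a sequence at the origin into pairs turns symmetric windows into initial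
  segments; the metric facts then need proof for one-sided sequences only.\<close>

lemma two_sided_dist_eq_one_sided_dist:
  "two_sided_dist \<beta> x y = one_sided_dist \<beta> (\<lambda>j. (x (int j), x (- int j))) (\<lambda>j. (y (int j), y (- int j)))"
proof -
  have nat_iff: "(\<forall>k::nat. int k \<le> n \<longrightarrow> (x (int k), x (- int k)) = (y (int k), y (- int k))) \<longleftrightarrow>
      (\<forall>k. \<bar>k\<bar> \<le> n \<longrightarrow> x k = y k)" for n
  proof
    assume *: "\<forall>k::nat. int k \<le> n \<longrightarrow> (x (int k), x (- int k)) = (y (int k), y (- int k))"
    show "\<forall>k. \<bar>k\<bar> \<le> n \<longrightarrow> x k = y k"
    proof (intro allI impI)
      fix k assume "\<bar>k\<bar> \<le> n"
      with *[rule_format, of "nat \<bar>k\<bar>"] show "x k = y k" by (cases "k \<ge> 0") auto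
    qed
  qed auto
  have eq: "(\<lambda>j. (x (int j), x (- int j))) = (\<lambda>j. (y (int j), y (- int j))) \<longleftrightarrow> x = y"
  proof
    assume *: "(\<lambda>j. (x (int j), x (- int j))) = (\<lambda>j. (y (int j), y (- int j)))"
    show "x = y"
    proof
      fix k show "x k = y k" using fun_cong[OF *, of "nat \<bar>k\<bar>"] by (cases "k \<ge> 0") auto
    qed
  qed simp
  show ?thesis unfolding two_sided_dist_def one_sided_dist_def eq nat_iff ..
qed

lemma one_sided_dist_le:
  assumes "0 \<le> \<beta>" "\<And>j. j < n \<Longrightarrow> x j = y j"
  shows "one_sided_dist \<beta> x y \<le> exp (- \<beta> * (real n - 1))"
proof (cases "x = y")
  case True
  then show ?thesis by (simp add: one_sided_dist_def)
next
  case False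
  then have "\<exists>j. x j \<noteq> y j" by auto
  then have "n \<le> (LEAST j. x j \<noteq> y j)" using assms(2) LeastI_ex[of "\<lambda>j. x j \<noteq> y j"] by (meson not_le)
  then show ?thesis using assms(1) False by (auto simp: one_sided_dist_eq intro!: mult_left_mono)
qed

lemma one_sided_dist_less:
  assumes "0 < \<beta>" "one_sided_dist \<beta> x y < exp (- \<beta> * (real n - 1))" "j \<le> n"
  shows "x j = y j"
proof (rule ccontr)
  assume "x j \<noteq> y j"
  then have "(LEAST j. x j \<noteq> y j) \<le> n" using assms(3) by (meson Least_le order_trans)
  moreover have "x \<noteq> y" using \<open>x j \<noteq> y j\<close> by auto
  ultimately have "one_sided_dist \<beta> x y \<ge> exp (- \<beta> * (real n - 1))"
    using assms(1) by (auto simp: one_sided_dist_eq intro!: mult_left_mono)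
  with assms show False by simp
qed

lemma two_sided_dist_le:
  assumes "0 \<le> \<beta>" "\<And>k. \<bar>k\<bar> \<le> int n \<Longrightarrow> x k = y k"
  shows "two_sided_dist \<beta> x y \<le> exp (- \<beta> * real n)"
  using one_sided_dist_le[OF assms(1), of "Suc n" "\<lambda>j. (x (int j), x (- int j))" "\<lambda>j. (y (int j), y (- int j))"] assms(2)
  by (auto simp: two_sided_dist_eq_one_sided_dist)

lemma two_sided_dist_less:
  assumes "0 < \<beta>" "two_sided_dist \<beta> x y < exp (- \<beta> * (real n - 1))" "\<bar>k\<bar> \<le> int n"
  shows "x k = y k"
  using one_sided_dist_less[OF assms(1) assms(2)[unfolded two_sided_dist_eq_one_sided_dist], of "nat \<bar>k\<bar>"] assms(3)
  by (cases "k \<ge> 0") auto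

lemma one_sided_dist_nonneg: "0 \<le> one_sided_dist \<beta> x y"
  by (simp add: one_sided_dist_def)

text \<open>At the first index where \<open>x\<close> and \<open>z\<close> differ, \<open>y\<close>
  must differ from one of them.\<close>

lemma one_sided_dist_ultra:
  assumes "0 < \<beta>"
  shows "one_sided_dist \<beta> x z \<le> max (one_sided_dist \<beta> x y) (one_sided_dist \<beta> y z)"
proof (cases "x = z")
  case True
  then show ?thesis using one_sided_dist_nonneg[of \<beta> y z] by (auto simp: one_sided_dist_def)
next
  case False
  define n where "n = (LEAST j. x j \<noteq> z j)"
  have xz: "one_sided_dist \<beta> x z = exp (- \<beta> * (real n - 1))"
    using False by (simp add: one_sided_dist_eq n_def)
  have "x n \<noteq> z n" using False unfolding n_def by (intro LeastI_ex[of "\<lambda>j. x j \<noteq> z j"]) auto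
  then have "x n \<noteq> y n \<or> y n \<noteq> z n" by auto
  then have "\<not> one_sided_dist \<beta> x y < exp (- \<beta> * (real n - 1)) \<or> \<not> one_sided_dist \<beta> y z < exp (- \<beta> * (real n - 1))"
    using one_sided_dist_less[OF assms, of _ _ n n] by blast
  then show ?thesis unfolding xz by linarith
qed

lemma one_sided_dist_commute: "one_sided_dist \<beta> x y = one_sided_dist \<beta> y x"
  by (auto simp: one_sided_dist_def eq_commute)

lemma one_sided_dist_eq_0_iff: "one_sided_dist \<beta> x y = 0 \<longleftrightarrow> x = y"
  by (auto simp: one_sided_dist_def)

lemma one_sided_dist_triangle:
  "0 < \<beta> \<Longrightarrow> one_sided_dist \<beta> x z \<le> one_sided_dist \<beta> x y + one_sided_dist \<beta> y z"
  using one_sided_dist_ultra[of \<beta> x z y] one_sided_dist_nonneg[of \<beta> x y] one_sided_dist_nonneg[of \<beta> y z] by linarith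

lemma two_sided_dist_eq_0_iff: "two_sided_dist \<beta> x y = 0 \<longleftrightarrow> x = y"
  by (auto simp: two_sided_dist_def)

lemma Metric_space_one_sided: "Metric_space (one_sided A) (one_sided_dist 1)"
  by standard (auto simp: one_sided_dist_nonneg one_sided_dist_commute one_sided_dist_eq_0_iff intro!: one_sided_dist_triangle)

lemma Metric_space_two_sided: "Metric_space (two_sided A) (two_sided_dist 1)"
  by standard (auto simp: two_sided_dist_eq_0_iff, auto simp: two_sided_dist_eq_one_sided_dist one_sided_dist_nonneg one_sided_dist_commute intro!: one_sided_dist_triangle)

text \<open>These relations give a neighbourhood base independent of the exponent of the metric, so
  that continuity can be discussed without distances.\<close>

definition agree_upto :: "nat \<Rightarrow> (int \<Rightarrow> 'e) \<Rightarrow> (int \<Rightarrow> 'e) \<Rightarrow> bool" where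
  "agree_upto n x y \<longleftrightarrow> (\<forall>k. \<bar>k\<bar> \<le> int n \<longrightarrow> x k = y k)"

lemma openin_two_sided_top:
  "openin (two_sided_top A) U \<longleftrightarrow>
    U \<subseteq> two_sided A \<and> (\<forall>x\<in>U. \<exists>n. \<forall>y\<in>two_sided A. agree_upto n x y \<longrightarrow> y \<in> U)"
proof -
  interpret Metric_space "two_sided A" "two_sided_dist 1" by (rule Metric_space_two_sided)
  have "(\<exists>r>0. mball x r \<subseteq> U) \<longleftrightarrow> (\<exists>n. \<forall>y\<in>two_sided A. agree_upto n x y \<longrightarrow> y \<in> U)" if "x \<in> two_sided A" for x
  proof
    assume "\<exists>r>0. mball x r \<subseteq> U"
    then obtain r where r: "0 < r" "mball x r \<subseteq> U" by blast
    obtain n :: nat where "- ln r < real n" using reals_Archimedean2 by blast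
    then have "exp (- real n) < r" using r(1) by (metis exp_less_cancel_iff exp_ln minus_less_iff)
    then have "two_sided_dist 1 x y < r" if "agree_upto n x y" for y
      using two_sided_dist_le[of 1 n x y] that by (simp add: agree_upto_def)
    then show "\<exists>n. \<forall>y\<in>two_sided A. agree_upto n x y \<longrightarrow> y \<in> U" using r(2) that unfolding mball_def by blast
  next
    assume "\<exists>n. \<forall>y\<in>two_sided A. agree_upto n x y \<longrightarrow> y \<in> U"
    then obtain n where "\<forall>y\<in>two_sided A. agree_upto n x y \<longrightarrow> y \<in> U" by blast
    then have "mball x (exp (- 1 * (real n - 1))) \<subseteq> U"
      using two_sided_dist_less[of 1 x _ n] by (auto simp: mball_def agree_upto_def)
    then show "\<exists>r>0. mball x r \<subseteq> U" by (meson exp_gt_zero)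
  qed
  then show ?thesis unfolding two_sided_top_def openin_mtopology by blast
qed

lemma openin_one_sided_top:
  "openin (one_sided_top A) U \<longleftrightarrow>
    U \<subseteq> one_sided A \<and> (\<forall>x\<in>U. \<exists>n. \<forall>y\<in>one_sided A. (\<forall>j<n. x j = y j) \<longrightarrow> y \<in> U)"
proof -
  interpret Metric_space "one_sided A" "one_sided_dist 1" by (rule Metric_space_one_sided)
  have "(\<exists>r>0. mball x r \<subseteq> U) \<longleftrightarrow> (\<exists>n. \<forall>y\<in>one_sided A. (\<forall>j<n. x j = y j) \<longrightarrow> y \<in> U)" if "x \<in> one_sided A" for x
  proof
    assume "\<exists>r>0. mball x r \<subseteq> U"
    then obtain r where r: "0 < r" "mball x r \<subseteq> U" by blast
    obtain n :: nat where "- ln r < real n" using reals_Archimedean2 by blast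
    then have "exp (- real n) < r" using r(1) by (metis exp_less_cancel_iff exp_ln minus_less_iff)
    then have "one_sided_dist 1 x y < r" if "\<forall>j<Suc n. x j = y j" for y
      using one_sided_dist_le[of 1 "Suc n" x y] that by simp
    then show "\<exists>n. \<forall>y\<in>one_sided A. (\<forall>j<n. x j = y j) \<longrightarrow> y \<in> U" using r(2) that
      unfolding mball_def by blast
  next
    assume "\<exists>n. \<forall>y\<in>one_sided A. (\<forall>j<n. x j = y j) \<longrightarrow> y \<in> U"
    then obtain n where "\<forall>y\<in>one_sided A. (\<forall>j<n. x j = y j) \<longrightarrow> y \<in> U" by blast
    then have "mball x (exp (- 1 * (real n - 1))) \<subseteq> U"
      using one_sided_dist_less[of 1 x _ n] by (auto simp: mball_def)
    then show "\<exists>r>0. mball x r \<subseteq> U" by (meson exp_gt_zero)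
  qed
  then show ?thesis unfolding one_sided_top_def openin_mtopology by blast
qed

lemma space_two_sided_borel [simp]: "space (two_sided_borel A) = two_sided A"
  by (simp add: two_sided_borel_def space_measure_of_conv)

lemma space_one_sided_borel [simp]: "space (one_sided_borel A) = one_sided A"
  by (simp add: one_sided_borel_def space_measure_of_conv)

lemma open_two_sided_borel:
  assumes "U \<subseteq> two_sided A" "\<And>x. x \<in> U \<Longrightarrow> \<exists>n. \<forall>y\<in>two_sided A. agree_upto n x y \<longrightarrow> y \<in> U"
  shows "U \<in> sets (two_sided_borel A)"
proof -
  have "{U. openin (two_sided_top A) U} \<subseteq> Pow (two_sided A)" by (auto simp: openin_two_sided_top)
  moreover have "openin (two_sided_top A) U" using assms by (simp add: openin_two_sided_top)
  ultimately show ?thesis by (auto simp: two_sided_borel_def)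
qed

lemma open_one_sided_borel:
  assumes "U \<subseteq> one_sided A" "\<And>x. x \<in> U \<Longrightarrow> \<exists>n. \<forall>y\<in>one_sided A. (\<forall>j<n. x j = y j) \<longrightarrow> y \<in> U"
  shows "U \<in> sets (one_sided_borel A)"
proof -
  have "{U. openin (one_sided_top A) U} \<subseteq> Pow (one_sided A)" by (auto simp: openin_one_sided_top)
  moreover have "openin (one_sided_top A) U" using assms by (simp add: openin_one_sided_top)
  ultimately show ?thesis by (auto simp: one_sided_borel_def)
qed

lemma coordinate_set_two_sided: "{x \<in> two_sided A. x k = e} \<in> sets (two_sided_borel A)"
  by (rule open_two_sided_borel) (auto simp: agree_upto_def intro!: exI[of _ "nat \<bar>k\<bar>"])

lemma coordinate_set_one_sided: "{x \<in> one_sided A. x k = e} \<in> sets (one_sided_borel A)"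
  by (rule open_one_sided_borel) (auto intro!: exI[of _ "Suc k"])

lemma measurable_coordinate [measurable]:
  "(\<lambda>x. x k) \<in> measurable (two_sided_borel (A :: 'e::countable \<Rightarrow> _)) (count_space UNIV)"
  using coordinate_set_two_sided[of A k] by (auto simp: measurable_count_space_eq_countable vimage_def Int_def conj_commute)

text \<open>An open set is the union of the window cylinders it contains, and a countable alphabet
  has only countably many of these.\<close>

lemma sets_two_sided_borel:
  fixes A :: "'e::countable \<Rightarrow> 'e \<Rightarrow> bool"
  shows "sets (two_sided_borel A) = sigma_sets (two_sided A) (range (\<lambda>(k, e). {x \<in> two_sided A. x k = e}))"
    (is "_ = sigma_sets _ ?C")
proof
  have C: "?C \<subseteq> Pow (two_sided A)" by auto
  interpret sigma_algebra "two_sided A" "sigma_sets (two_sided A) ?C"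
    by (rule sigma_algebra_sigma_sets[OF C])
  have "U \<in> sigma_sets (two_sided A) ?C" if U: "openin (two_sided_top A) U" for U
  proof -
    \<comment> \<open>The word \<open>w\<close> lists the letters at the coordinates from
      \<open>- n\<close> to \<open>n\<close>, so its index \<open>j\<close> belongs to the
      coordinate \<open>j - n\<close>.\<close>
    let ?W = "\<lambda>(n, w). {x \<in> two_sided A. \<forall>j\<le>2 * n. x (int j - int n) = w ! j}"
    have W: "?W (n, w) \<in> sigma_sets (two_sided A) ?C" for n w
    proof -
      have "?W (n, w) = (\<Inter>j\<in>{..2 * n}. {x \<in> two_sided A. x (int j - int n) = w ! j})" by auto
      also have "\<dots> \<in> sigma_sets (two_sided A) ?C"
        by (intro finite_INT) (auto intro!: sigma_sets.Basic)
      finally show ?thesis .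
    qed
    have "U = (\<Union>p\<in>{p. ?W p \<subseteq> U}. ?W p)"
    proof (intro subset_antisym subsetI)
      fix x assume x: "x \<in> U"
      then obtain n where n: "\<forall>y\<in>two_sided A. agree_upto n x y \<longrightarrow> y \<in> U" and xA: "x \<in> two_sided A"
        using U unfolding openin_two_sided_top by blast
      let ?w = "map (\<lambda>j. x (int j - int n)) [0..<Suc (2 * n)]"
      have nth: "?w ! j = x (int j - int n)" if "j \<le> 2 * n" for j
        using that by (simp del: upt_Suc)
      have "y \<in> U" if "y \<in> ?W (n, ?w)" for y
      proof -
        have "x k = y k" if "\<bar>k\<bar> \<le> int n" for k
        proof -
          let ?j = "nat (k + int n)"
          have j: "?j \<le> 2 * n" "int ?j - int n = k" using that by auto
          have "y (int ?j - int n) = ?w ! ?j" using \<open>y \<in> ?W (n, ?w)\<close> j(1) by blast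
          then show ?thesis unfolding nth[OF j(1)] j(2) by simp
        qed
        then show ?thesis using n that by (auto simp: agree_upto_def)
      qed
      then have "(n, ?w) \<in> {p. ?W p \<subseteq> U}" by blast
      moreover have "x \<in> ?W (n, ?w)" using nth xA by simp
      ultimately show "x \<in> (\<Union>p\<in>{p. ?W p \<subseteq> U}. ?W p)" by blast
    qed blast
    also have "\<dots> \<in> sigma_sets (two_sided A) ?C"
      using W by (intro countable_UN') auto
    finally show ?thesis .
  qed
  then show "sets (two_sided_borel A) \<subseteq> sigma_sets (two_sided A) ?C"
    unfolding two_sided_borel_def
    by (subst sets_measure_of) (auto simp: openin_two_sided_top intro!: sigma_sets_subset)
  have "?C \<subseteq> sets (two_sided_borel A)" by (auto intro: coordinate_set_two_sided)
  from sets.sigma_sets_subset[OF this]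
  show "sigma_sets (two_sided A) ?C \<subseteq> sets (two_sided_borel A)" by simp
qed

lemma sets_one_sided_borel:
  fixes A :: "'e::countable \<Rightarrow> 'e \<Rightarrow> bool"
  shows "sets (one_sided_borel A) =
    sigma_sets (one_sided A) (range (\<lambda>w. {x \<in> one_sided A. \<forall>j<length w. x j = w ! j}))"
    (is "_ = sigma_sets _ ?C")
proof
  have C: "?C \<subseteq> Pow (one_sided A)" by auto
  interpret sigma_algebra "one_sided A" "sigma_sets (one_sided A) ?C"
    by (rule sigma_algebra_sigma_sets[OF C])
  have "U \<in> sigma_sets (one_sided A) ?C" if U: "openin (one_sided_top A) U" for U
  proof -
    let ?W = "\<lambda>w. {x \<in> one_sided A. \<forall>j<length w. x j = w ! j}"
    have "U = (\<Union>p\<in>{p. ?W p \<subseteq> U}. ?W p)"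
    proof (intro subset_antisym subsetI)
      fix x assume x: "x \<in> U"
      then obtain n where n: "\<forall>y\<in>one_sided A. (\<forall>j<n. x j = y j) \<longrightarrow> y \<in> U" and xA: "x \<in> one_sided A"
        using U unfolding openin_one_sided_top by blast
      then have "map x [0..<n] \<in> {p. ?W p \<subseteq> U}" by auto
      moreover have "x \<in> ?W (map x [0..<n])" using xA by simp
      ultimately show "x \<in> (\<Union>p\<in>{p. ?W p \<subseteq> U}. ?W p)" by blast
    qed blast
    also have "\<dots> \<in> sigma_sets (one_sided A) ?C"
      by (intro countable_UN') (auto intro: sigma_sets.Basic)
    finally show ?thesis .
  qed
  then show "sets (one_sided_borel A) \<subseteq> sigma_sets (one_sided A) ?C"
    unfolding one_sided_borel_def
    by (subst sets_measure_of) (auto simp: openin_one_sided_top intro!: sigma_sets_subset)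
  have "?C \<subseteq> sets (one_sided_borel A)"
  proof clarify
    fix w
    show "{x \<in> one_sided A. \<forall>j<length w. x j = w ! j} \<in> sets (one_sided_borel A)"
      by (rule open_one_sided_borel) (auto intro!: exI[of _ "length w"])
  qed
  from sets.sigma_sets_subset[OF this]
  show "sigma_sets (one_sided A) ?C \<subseteq> sets (one_sided_borel A)" by simp
qed

lemma measurable_two_sidedI:
  fixes A :: "'e::countable \<Rightarrow> 'e \<Rightarrow> bool"
  assumes "\<And>x. x \<in> space M \<Longrightarrow> f x \<in> two_sided A" "\<And>k e. {x \<in> space M. f x k = e} \<in> sets M"
  shows "f \<in> measurable M (two_sided_borel A)"
proof (rule measurable_sigma_sets[OF sets_two_sided_borel])
  fix C assume "C \<in> range (\<lambda>(k, e). {x \<in> two_sided A. x k = e})"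
  then obtain k e where "C = {x \<in> two_sided A. x k = e}" by auto
  then have "f -` C \<inter> space M = {x \<in> space M. f x k = e}" using assms(1) by auto
  then show "f -` C \<inter> space M \<in> sets M" using assms(2) by simp
qed (use assms in auto)

lemma measurable_one_sidedI:
  fixes A :: "'e::countable \<Rightarrow> 'e \<Rightarrow> bool"
  assumes "\<And>x. x \<in> space M \<Longrightarrow> f x \<in> one_sided A" and sets: "\<And>k e. {x \<in> space M. f x k = e} \<in> sets M"
  shows "f \<in> measurable M (one_sided_borel A)"
proof (rule measurable_sigma_sets[OF sets_one_sided_borel])
  fix C assume "C \<in> range (\<lambda>w. {x \<in> one_sided A. \<forall>j<length w. x j = w ! j})"
  then obtain w where "C = {x \<in> one_sided A. \<forall>j<length w. x j = w ! j}" by auto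
  then have "f -` C \<inter> space M = {x \<in> space M. \<forall>j\<in>{..<length w}. f x j = w ! j}" using assms(1) by auto
  also have "\<dots> \<in> sets M" by (intro sets.sets_Collect_finite_All sets) auto
  finally show "f -` C \<inter> space M \<in> sets M" .
qed (use assms in auto)

lemma borel_measurable_two_sidedI:
  fixes g :: "(int \<Rightarrow> 'e::countable) \<Rightarrow> 'b::metric_space"
  assumes "\<And>x e. x \<in> two_sided A \<Longrightarrow> 0 < e \<Longrightarrow> \<exists>n. \<forall>y\<in>two_sided A. agree_upto n x y \<longrightarrow> dist (g x) (g y) < e"
  shows "g \<in> borel_measurable (two_sided_borel A)"
proof (rule borel_measurableI)
  fix S :: "'b set" assume "open S"
  show "g -` S \<inter> space (two_sided_borel A) \<in> sets (two_sided_borel A)"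
  proof (rule open_two_sided_borel)
    fix x assume x: "x \<in> g -` S \<inter> space (two_sided_borel A)"
    then obtain e where "0 < e" "\<forall>y. dist y (g x) < e \<longrightarrow> y \<in> S" using \<open>open S\<close> by (auto simp: open_dist)
    with assms[of x e] x show "\<exists>n. \<forall>y\<in>two_sided A. agree_upto n x y \<longrightarrow> y \<in> g -` S \<inter> space (two_sided_borel A)"
      by (auto simp: dist_commute)
  qed simp
qed

lemma exp_dist_arbitrarily_small:
  fixes \<beta> L e :: real
  assumes "0 < \<beta>" "0 < e" shows "\<exists>n::nat. L * exp (- \<beta> * real n) < e"
proof -
  have "(\<lambda>n. L * exp (- \<beta> * real n)) \<longlonglongrightarrow> L * 0"
    using assms(1)
    by (intro tendsto_mult tendsto_const filterlim_compose[OF exp_at_bot]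
        filterlim_tendsto_neg_mult_at_bot[OF tendsto_const _ filterlim_real_sequentially]) simp
  from order_tendstoD(2)[OF this, of e] assms(2) show ?thesis
    by (auto simp: eventually_sequentially)
qed

text \<open>Formulated for a function \<open>R\<close> of two points, in order to serve for real
  functions and for the coding map alike. The window \<open>n\<close> is uniform in the
  points.\<close>

lemma hoelder_continuity:
  assumes "\<exists>\<beta>>0. \<exists>L. \<forall>\<omega>\<in>two_sided A. \<forall>\<tau>\<in>two_sided A. \<omega> 0 = \<tau> 0 \<longrightarrow> R \<omega> \<tau> \<le> L * two_sided_dist \<beta> \<omega> \<tau>" "0 < e"
  shows "\<exists>n. \<forall>x\<in>two_sided A. \<forall>y\<in>two_sided A. agree_upto n x y \<longrightarrow> R x y < e"
proof -
  obtain \<beta> L where "0 < \<beta>" and L: "\<And>\<omega> \<tau>. \<omega>\<in>two_sided A \<Longrightarrow> \<tau>\<in>two_sided A \<Longrightarrow> \<omega> 0 = \<tau> 0 \<Longrightarrow> R \<omega> \<tau> \<le> L * two_sided_dist \<beta> \<omega> \<tau>"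
    using assms(1) by blast
  obtain n :: nat where n: "\<bar>L\<bar> * exp (- \<beta> * real n) < e"
    using exp_dist_arbitrarily_small[OF \<open>0 < \<beta>\<close> \<open>0 < e\<close>] by blast
  have "R x y < e" if xy: "x \<in> two_sided A" "y \<in> two_sided A" "agree_upto n x y" for x y
  proof -
    have "R x y \<le> L * two_sided_dist \<beta> x y" using xy by (intro L) (auto simp: agree_upto_def)
    also have "\<dots> \<le> \<bar>L\<bar> * two_sided_dist \<beta> x y"
      by (intro mult_right_mono) (auto simp: two_sided_dist_eq_one_sided_dist one_sided_dist_nonneg)
    also have "\<dots> \<le> \<bar>L\<bar> * exp (- \<beta> * real n)"
      using xy \<open>0 < \<beta>\<close> by (intro mult_left_mono two_sided_dist_le) (auto simp: agree_upto_def)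
    finally show ?thesis using n by simp
  qed
  then show ?thesis by blast
qed

lemma hoelder_measurable:
  assumes "hoelder (A :: 'e::countable \<Rightarrow> _) g" shows "g \<in> borel_measurable (two_sided_borel A)"
proof (rule borel_measurable_two_sidedI)
  fix x and e :: real assume "x \<in> two_sided A" "0 < e"
  with hoelder_continuity[OF assms[unfolded hoelder_def] \<open>0 < e\<close>]
  show "\<exists>n. \<forall>y\<in>two_sided A. agree_upto n x y \<longrightarrow> dist (g x) (g y) < e"
    unfolding dist_real_def by blast
qed

section \<open>The two-sided shift and its inverse\<close>

definition unshift :: "(int \<Rightarrow> 'e) \<Rightarrow> int \<Rightarrow> 'e" where
  "unshift \<tau> = (\<lambda>k. \<tau> (k - 1))"

lemma shift_unshift [simp]: "shift (unshift \<tau>) = \<tau>" "unshift (shift \<tau>) = \<tau>"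
  by (auto simp: shift_def unshift_def)

lemma shift_two_sided [simp]: "shift \<tau> \<in> two_sided A \<longleftrightarrow> \<tau> \<in> two_sided A"
proof
  assume *: "shift \<tau> \<in> two_sided A"
  have "A (\<tau> k) (\<tau> (k + 1))" for k
  proof -
    have "A (shift \<tau> (k - 1)) (shift \<tau> (k - 1 + 1))" using * unfolding two_sided_def by blast
    then show ?thesis by (simp add: shift_def)
  qed
  then show "\<tau> \<in> two_sided A" by (simp add: two_sided_def)
next
  assume "\<tau> \<in> two_sided A"
  then have "\<And>k. A (\<tau> (k + 1)) (\<tau> (k + 1 + 1))" unfolding two_sided_def by blast
  then show "shift \<tau> \<in> two_sided A" unfolding two_sided_def shift_def by simp
qed

lemma unshift_two_sided [simp]: "unshift \<tau> \<in> two_sided A \<longleftrightarrow> \<tau> \<in> two_sided A"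
  using shift_two_sided[of "unshift \<tau>" A] by simp

lemma shift_funpow_apply: "(shift ^^ n) \<tau> k = \<tau> (k + int n)"
  for \<tau> :: "int \<Rightarrow> 'e"
  by (induction n arbitrary: \<tau>) (auto simp: shift_def algebra_simps funpow_swap1)

lemma unshift_funpow_apply: "(unshift ^^ n) \<tau> k = \<tau> (k - int n)"
  by (induction n arbitrary: \<tau>) (auto simp: unshift_def algebra_simps funpow_swap1)

lemma shift_funpow_two_sided [simp]: "(shift ^^ n) \<tau> \<in> two_sided A \<longleftrightarrow> \<tau> \<in> two_sided A"
  by (induction n) auto

lemma unshift_funpow_two_sided [simp]: "(unshift ^^ n) \<tau> \<in> two_sided A \<longleftrightarrow> \<tau> \<in> two_sided A"
  by (induction n) auto

lemma tail_from_one_sided: "\<tau> \<in> two_sided A \<Longrightarrow> tail_from k \<tau> \<in> one_sided A"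
  by (auto simp: tail_from_def two_sided_def one_sided_def) (metis add.commute add_diff_eq)

lemma measurable_shift [measurable]:
  "shift \<in> measurable (two_sided_borel (A :: 'e::countable \<Rightarrow> _)) (two_sided_borel A)"
  by (rule measurable_two_sidedI) (simp, simp add: shift_def coordinate_set_two_sided)

lemma measurable_unshift [measurable]:
  "unshift \<in> measurable (two_sided_borel (A :: 'e::countable \<Rightarrow> _)) (two_sided_borel A)"
  by (rule measurable_two_sidedI) (simp, simp add: unshift_def coordinate_set_two_sided)

lemma measurable_tail_from [measurable]:
  "tail_from k \<in> measurable (two_sided_borel (A :: 'e::countable \<Rightarrow> _)) (one_sided_borel A)"
  by (rule measurable_one_sidedI) (simp add: tail_from_one_sided, simp add: tail_from_def coordinate_set_two_sided)

lemma cylinder_sets [measurable]: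
  "cylinder (A :: 'e::countable \<Rightarrow> _) w \<in> sets (two_sided_borel A)"
  unfolding cylinder_def
  by (rule open_two_sided_borel) (force simp: agree_upto_def intro!: exI[of _ "length w"])+

section \<open>Gibbs states: quasi-independence and ergodicity\<close>

text \<open>The sets that can be approximated with any precision form a \<sigma>-algebra. A
  countable union is first cut off with error \<open>e / 2\<close>, and the other half is
  distributed over the remaining finitely many sets.\<close>

lemma (in finite_measure) approximation_by_algebra:
  assumes alg: "algebra (space M) \<A>" and gen: "sets M = sigma_sets (space M) \<A>"
    and D: "D \<in> sets M" and "0 < e"
  shows "\<exists>S\<in>\<A>. measure M ((D - S) \<union> (S - D)) < e"
proof -
  interpret \<A>: algebra "space M" \<A> by fact
  have \<A>_sets: "S \<in> sets M" if "S \<in> \<A>" for S using that by (auto simp: gen)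
  have "D \<in> sigma_sets (space M) \<A>" using D by (simp add: gen)
  then show ?thesis using \<open>0 < e\<close>
  proof (induction arbitrary: e)
    case (Basic a)
    then show ?case by (intro bexI[of _ a]) auto
  next
    case Empty
    then show ?case by (intro bexI[of _ "{}"]) auto
  next
    case (Compl a)
    from Compl.IH[OF Compl.prems] obtain S where S: "S \<in> \<A>" "measure M ((a - S) \<union> (S - a)) < e" by blast
    have "a \<subseteq> space M" using Compl.hyps sigma_sets_into_sp[OF \<A>.space_closed] by blast
    moreover have "S \<subseteq> space M" using S(1) \<A>.sets_into_space by blast
    ultimately have "(space M - a - (space M - S)) \<union> (space M - S - (space M - a)) = (a - S) \<union> (S - a)" by auto
    with S show ?case by (intro bexI[of _ "space M - S"]) auto
  next
    case (Union a)
    have a: "a i \<in> sets M" for i using Union.hyps by (simp add: gen)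
    have empty: "(\<Inter>n. (\<Union>i. a i) - (\<Union>i<n. a i)) = {}" by blast
    have "(\<lambda>n. measure M ((\<Union>i. a i) - (\<Union>i<n. a i))) \<longlonglongrightarrow> measure M (\<Inter>n. (\<Union>i. a i) - (\<Union>i<n. a i))"
      using a by (intro finite_Lim_measure_decseq) (auto simp: decseq_def)
    then have "(\<lambda>n. measure M ((\<Union>i. a i) - (\<Union>i<n. a i))) \<longlonglongrightarrow> 0" unfolding empty by simp
    then obtain n where n: "measure M ((\<Union>i. a i) - (\<Union>i<n. a i)) < e / 2"
      using order_tendstoD(2)[of _ 0 sequentially "e / 2"] Union.prems by (fastforce simp: eventually_sequentially)
    define e' where "e' = e / (2 * real (Suc n))"
    have "0 < e'" using Union.prems by (simp add: e'_def)
    with Union.IH have "\<forall>i. \<exists>S\<in>\<A>. measure M ((a i - S) \<union> (S - a i)) < e'" by blast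
    then obtain S where S: "\<And>i. S i \<in> \<A>" "\<And>i. measure M ((a i - S i) \<union> (S i - a i)) < e'" by metis
    let ?T = "\<Union>i<n. S i"
    have T: "?T \<in> \<A>" using S(1) by (intro \<A>.finite_UN) auto
    have meas: "((a i - S i) \<union> (S i - a i)) \<in> sets M" for i using a \<A>_sets[OF S(1)] by auto
    have "((\<Union>i. a i) - ?T) \<union> (?T - (\<Union>i. a i)) \<subseteq>
        ((\<Union>i. a i) - (\<Union>i<n. a i)) \<union> (\<Union>i<n. (a i - S i) \<union> (S i - a i))" by blast
    then have "measure M (((\<Union>i. a i) - ?T) \<union> (?T - (\<Union>i. a i))) \<le>
        measure M (((\<Union>i. a i) - (\<Union>i<n. a i)) \<union> (\<Union>i<n. (a i - S i) \<union> (S i - a i)))"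
      using a meas by (intro finite_measure_mono) auto
    also have "\<dots> \<le> measure M ((\<Union>i. a i) - (\<Union>i<n. a i)) + measure M (\<Union>i<n. (a i - S i) \<union> (S i - a i))"
      using a meas by (intro measure_Un_le) auto
    also have "measure M (\<Union>i<n. (a i - S i) \<union> (S i - a i)) \<le> (\<Sum>i<n. measure M ((a i - S i) \<union> (S i - a i)))"
      using meas by (intro measure_UNION_le) auto
    also have "\<dots> \<le> (\<Sum>i<n. e')" using S(2) by (intro sum_mono) (auto intro: less_imp_le)
    also have "\<dots> \<le> e / 2" using Union.prems by (simp add: e'_def field_simps)
    finally have "measure M (((\<Union>i. a i) - ?T) \<union> (?T - (\<Union>i. a i))) < e" using n by simp
    with T show ?case by blast
  qed
qed

text \<open>Sets that only see a finite window and finitely many letters of the alphabet; the latter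
  makes the entropy of the corresponding partitions finite.\<close>

definition truncated_letter :: "nat \<Rightarrow> 'e::countable \<Rightarrow> nat" where
  "truncated_letter N e = min (to_nat e) N"

lemma truncated_letter_mono:
  "truncated_letter N a = truncated_letter N b \<Longrightarrow> M \<le> N \<Longrightarrow> truncated_letter M a = truncated_letter M b"
  by (auto simp: truncated_letter_def min_def split: if_splits)

text \<open>One parameter bounds both the window and the truncation of letters. The relations
  therefore get finer as \<open>N\<close> grows, and finitely many sets share a common
  \<open>N\<close>.\<close>

definition window_agree :: "nat \<Rightarrow> (int \<Rightarrow> 'e::countable) \<Rightarrow> (int \<Rightarrow> 'e) \<Rightarrow> bool" where
  "window_agree N x y \<longleftrightarrow> (\<forall>k. \<bar>k\<bar> \<le> int N \<longrightarrow> truncated_letter N (x k) = truncated_letter N (y k))"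

lemma window_agree_mono: "window_agree N x y \<Longrightarrow> M \<le> N \<Longrightarrow> window_agree M x y"
  unfolding window_agree_def by (meson of_nat_mono order_trans truncated_letter_mono)

lemma window_agree_sym: "window_agree N x y \<Longrightarrow> window_agree N y x"
  by (auto simp: window_agree_def)

lemma agree_upto_imp_window_agree: "agree_upto N x y \<Longrightarrow> window_agree N x y"
  unfolding agree_upto_def window_agree_def by simp

definition window_sets :: "('e::countable \<Rightarrow> 'e \<Rightarrow> bool) \<Rightarrow> (int \<Rightarrow> 'e) set set" where
  "window_sets A = {S. S \<subseteq> two_sided A \<and>
    (\<exists>N. \<forall>x\<in>two_sided A. \<forall>y\<in>two_sided A. window_agree N x y \<longrightarrow> x \<in> S \<longrightarrow> y \<in> S)}"

lemma window_sets_borel: "S \<in> window_sets A \<Longrightarrow> S \<in> sets (two_sided_borel A)"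
proof (rule open_two_sided_borel)
  assume S: "S \<in> window_sets A"
  then show "S \<subseteq> two_sided A" by (simp add: window_sets_def)
  fix x assume "x \<in> S"
  moreover obtain N where "\<forall>x\<in>two_sided A. \<forall>y\<in>two_sided A. window_agree N x y \<longrightarrow> x \<in> S \<longrightarrow> y \<in> S" "S \<subseteq> two_sided A"
    using S unfolding window_sets_def by blast
  ultimately show "\<exists>n. \<forall>y\<in>two_sided A. agree_upto n x y \<longrightarrow> y \<in> S"
    using agree_upto_imp_window_agree by blast
qed

lemma algebra_window_sets: "algebra (two_sided A) (window_sets A)"
  unfolding algebra_iff_Un
proof (intro conjI ballI)
  show "window_sets A \<subseteq> Pow (two_sided A)" "{} \<in> window_sets A" by (auto simp: window_sets_def)
  fix S assume S: "S \<in> window_sets A"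
  then obtain N where N: "\<forall>x\<in>two_sided A. \<forall>y\<in>two_sided A. window_agree N x y \<longrightarrow> x \<in> S \<longrightarrow> y \<in> S" "S \<subseteq> two_sided A"
    unfolding window_sets_def by blast
  then show "two_sided A - S \<in> window_sets A"
    unfolding window_sets_def using window_agree_sym by blast
  fix S' assume "S' \<in> window_sets A"
  then obtain N' where N': "\<forall>x\<in>two_sided A. \<forall>y\<in>two_sided A. window_agree N' x y \<longrightarrow> x \<in> S' \<longrightarrow> y \<in> S'" "S' \<subseteq> two_sided A"
    unfolding window_sets_def by blast
  show "S \<union> S' \<in> window_sets A"
    unfolding window_sets_def mem_Collect_eq
  proof (intro conjI exI[of _ "max N N'"] ballI impI)
    fix x y assume "x \<in> two_sided A" "y \<in> two_sided A" "window_agree (max N N') x y" "x \<in> S \<union> S'"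
    with N N' window_agree_mono[of "max N N'" x y N] window_agree_mono[of "max N N'" x y N'] show "y \<in> S \<union> S'" by auto
  qed (use N N' in auto)
qed

lemma sets_eq_sigma_window_sets: "sets (two_sided_borel A) = sigma_sets (two_sided A) (window_sets A)"
proof
  have "range (\<lambda>(k, e). {x \<in> two_sided A. x k = e}) \<subseteq> window_sets A"
  proof clarify
    fix k :: int and e :: 'a
    \<comment> \<open>Once the truncation level exceeds the code of a letter, that letter is no
      longer merged with any other.\<close>
    have "x k = y k" if "window_agree (max (nat \<bar>k\<bar>) (Suc (to_nat (x k)))) x y" for x y
    proof -
      have "truncated_letter (max (nat \<bar>k\<bar>) (Suc (to_nat (x k)))) (x k) = truncated_letter (max (nat \<bar>k\<bar>) (Suc (to_nat (x k)))) (y k)"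
        using that by (auto simp: window_agree_def)
      then show ?thesis by (auto simp: truncated_letter_def min_def split: if_splits)
    qed
    then have "\<forall>x\<in>two_sided A. \<forall>y\<in>two_sided A. window_agree (max (nat \<bar>k\<bar>) (Suc (to_nat e))) x y \<longrightarrow>
        x \<in> {x \<in> two_sided A. x k = e} \<longrightarrow> y \<in> {x \<in> two_sided A. x k = e}"
      by (metis (mono_tags, lifting) mem_Collect_eq)
    then show "{x \<in> two_sided A. x k = e} \<in> window_sets A"
      unfolding window_sets_def by blast
  qed
  then show "sets (two_sided_borel A) \<subseteq> sigma_sets (two_sided A) (window_sets A)"
    unfolding sets_two_sided_borel by (rule sigma_sets_mono')
  have "window_sets A \<subseteq> sets (two_sided_borel A)" using window_sets_borel by blast
  from sets.sigma_sets_subset[OF this]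
  show "sigma_sets (two_sided A) (window_sets A) \<subseteq> sets (two_sided_borel A)" by simp
qed

abbreviation word_of :: "(int \<Rightarrow> 'e) \<Rightarrow> nat \<Rightarrow> 'e list" where
  "word_of x n \<equiv> map (\<lambda>j. x (int j)) [0..<n]"

lemma cylinder_word_of: "cylinder A (word_of x n) = {y \<in> two_sided A. \<forall>j<n. y (int j) = x (int j)}"
  by (auto simp: cylinder_def)

lemma mem_cylinder_iff: "x \<in> cylinder A w \<longleftrightarrow> x \<in> two_sided A \<and> word_of x (length w) = w"
  unfolding cylinder_def list_eq_iff_nth_eq[of "map _ _"] by simp

lemma birkhoff_sum_add: "birkhoff_sum \<psi> (m + n) x = birkhoff_sum \<psi> m x + birkhoff_sum \<psi> n ((shift ^^ m) x)"
proof -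
  have "(\<Sum>j<m + n. h j) = (\<Sum>j<m. h j) + (\<Sum>j<n. h (m + j))" for h :: "nat \<Rightarrow> real"
    by (induction n) (auto simp: algebra_simps)
  moreover have "(shift ^^ (m + j)) x = (shift ^^ j) ((shift ^^ m) x)" for j
    by (subst add.commute) (simp add: funpow_add)
  ultimately show ?thesis by (simp add: birkhoff_sum_def)
qed

lemma shift_unshift_funpow: "(shift ^^ n) ((unshift ^^ n) x) = x" "(unshift ^^ n) ((shift ^^ n) x) = x"
  by (auto simp: fun_eq_iff shift_funpow_apply unshift_funpow_apply)

text \<open>The constant \<open>P\<close> will be the pressure. Integrability of \<psi> makes its
  Birkhoff averages converge to a finite limit.\<close>

locale gibbs = prob_space \<mu> for \<mu> :: "(int \<Rightarrow> 'e::countable) measure" +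
  fixes A :: "'e \<Rightarrow> 'e \<Rightarrow> bool" and \<psi> :: "(int \<Rightarrow> 'e) \<Rightarrow> real" and P C :: real
  assumes irreducible: "finitely_irreducible A"
    and sets_\<mu> [measurable_cong]: "sets \<mu> = sets (two_sided_borel A)"
    and shift_invariant: "distr \<mu> (two_sided_borel A) shift = \<mu>"
    and C: "1 \<le> C"
    and gibbs_lower: "\<And>n x. 1 \<le> n \<Longrightarrow> x \<in> two_sided A \<Longrightarrow>
      exp (birkhoff_sum \<psi> n x - P * real n) / C \<le> measure \<mu> (cylinder A (word_of x n))"
    and gibbs_upper: "\<And>n x. 1 \<le> n \<Longrightarrow> x \<in> two_sided A \<Longrightarrow>
      measure \<mu> (cylinder A (word_of x n)) \<le> C * exp (birkhoff_sum \<psi> n x - P * real n)"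
    and \<psi>_hoelder: "hoelder A \<psi>"
    and \<psi>_integrable: "integrable \<mu> \<psi>"
begin

lemma space_\<mu> [simp]: "space \<mu> = two_sided A"
  using sets_eq_imp_space_eq[OF sets_\<mu>] by simp

lemma distr_shift: "distr \<mu> \<mu> shift = \<mu>"
  using shift_invariant by (simp add: distr_cong[OF refl sets_\<mu> refl])

lemma distr_unshift: "distr \<mu> \<mu> unshift = \<mu>"
proof -
  have "distr \<mu> \<mu> unshift = distr (distr \<mu> \<mu> shift) \<mu> unshift" by (simp add: distr_shift)
  also have "\<dots> = distr \<mu> \<mu> (unshift \<circ> shift)" by (rule distr_distr) measurable
  also have "unshift \<circ> shift = (\<lambda>x::int \<Rightarrow> 'e. x)" by auto
  finally show ?thesis by (simp add: distr_id2)
qed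

sublocale forward: mpt \<mu> shift
  by standard (auto simp: distr_shift)

sublocale backward: mpt \<mu> unshift
  by standard (auto simp: distr_unshift)

lemma cylinder_sets_\<mu> [measurable, simp]: "cylinder A w \<in> sets \<mu>"
  using cylinder_sets[of A w] by (simp add: sets_\<mu>)

lemma prob_vimage_shift: "S \<in> sets \<mu> \<Longrightarrow> prob ((shift ^^ n) -` S \<inter> two_sided A) = prob S"
  using measure_distr[OF forward.funpow_measurable, of S n] by (simp add: forward.funpow_invariant)

lemma cylinder_empty_word: "cylinder A [] = two_sided A"
  by (simp add: cylinder_def)

lemma prob_cylinder_pos: "x \<in> cylinder A w \<Longrightarrow> 0 < prob (cylinder A w)"
proof (cases "w = []")
  case True
  then show ?thesis using prob_space by (simp add: cylinder_empty_word)
next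
  case False
  assume x: "x \<in> cylinder A w"
  then have "exp (birkhoff_sum \<psi> (length w) x - P * real (length w)) / C \<le> prob (cylinder A w)"
    using gibbs_lower[of "length w" x] False by (simp add: mem_cylinder_iff Suc_le_eq)
  moreover have "0 < exp (birkhoff_sum \<psi> (length w) x - P * real (length w)) / C" using C by simp
  ultimately show ?thesis by linarith
qed

text \<open>The upper Gibbs bound solved for the weight. The empty word is included because
  connecting words may be empty.\<close>

lemma exp_birkhoff_ge:
  assumes "x \<in> cylinder A w"
  shows "prob (cylinder A w) / C \<le> exp (birkhoff_sum \<psi> (length w) x - P * real (length w))"
proof (cases "w = []")
  case True
  then show ?thesis using C prob_le_1[of "two_sided A"]
    by (auto simp: cylinder_empty_word birkhoff_sum_def divide_le_eq intro: order_trans)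
next
  case False
  with assms gibbs_upper[of "length w" x] C show ?thesis
    by (simp add: mem_cylinder_iff Suc_le_eq divide_le_eq mult.commute)
qed

lemma cylinder_append:
  "x \<in> cylinder A (u @ v) \<longleftrightarrow> x \<in> cylinder A u \<and> (shift ^^ length u) x \<in> cylinder A v"
proof -
  have "(\<forall>j<length u + length v. x (int j) = (u @ v) ! j) \<longleftrightarrow>
      (\<forall>j<length u. x (int j) = u ! j) \<and> (\<forall>j<length v. x (int j + int (length u)) = v ! j)"
  proof safe
    fix j assume *: "\<forall>j<length u + length v. x (int j) = (u @ v) ! j"
    { assume "j < length u" with *[rule_format, of j] show "x (int j) = u ! j" by (simp add: nth_append) }
    { assume "j < length v" with *[rule_format, of "j + length u"] show "x (int j + int (length u)) = v ! j" by (simp add: nth_append) }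
  next
    fix j assume *: "\<forall>j<length u. x (int j) = u ! j" "\<forall>j<length v. x (int j + int (length u)) = v ! j" and "j < length u + length v"
    with *(1)[rule_format, of j] *(2)[rule_format, of "j - length u"] show "x (int j) = (u @ v) ! j"
      by (cases "j < length u") (auto simp: nth_append)
  qed
  then show ?thesis by (auto simp: cylinder_def shift_funpow_apply)
qed

text \<open>The point \<open>z\<close> follows \<open>x\<close> through the word \<open>u\<close>,
  then reads \<gamma>, then follows \<open>y\<close> from its origin on.\<close>

lemma admissible_glue:
  assumes x: "x \<in> cylinder A u" and y: "y \<in> cylinder A v" and ne: "u \<noteq> []" "v \<noteq> []"
    and adm: "admissible A (last u # \<gamma> @ [hd v])"
  shows "\<exists>z. z \<in> cylinder A (u @ \<gamma> @ v)"
proof -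
  let ?m = "int (length u)" and ?g = "int (length \<gamma>)"
  define z where "z k = (if k < ?m then x k else if k < ?m + ?g then \<gamma> ! nat (k - ?m) else y (k - ?m - ?g))" for k
  let ?w = "last u # \<gamma> @ [hd v]"
  \<comment> \<open>The junction word occupies the coordinates from \<open>length u - 1\<close> to
    \<open>length u + length \<gamma>\<close> of \<open>z\<close>, which gives the transitions into,
    inside and out of \<gamma>.\<close>
  have w: "?w ! nat (k - ?m + 1) = z k" if kk: "?m - 1 \<le> k" "k \<le> ?m + ?g" for k
  proof -
    consider "k = ?m - 1" | "?m \<le> k" "k < ?m + ?g" | "k = ?m + ?g" using kk by atomize_elim arith
    then show ?thesis
    proof cases
      case 1
      have "x (int (length u - 1)) = u ! (length u - 1)"
        using x ne(1) by (auto simp: cylinder_def)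
      moreover have "k = int (length u - 1)" using 1 ne(1) by (cases u) auto
      moreover have "z k = x k" using 1 by (simp add: z_def)
      moreover have "?w ! nat (k - ?m + 1) = u ! (length u - 1)" using 1 ne(1) by (simp add: last_conv_nth)
      ultimately show ?thesis by metis
    next
      case 2
      then have "nat (k - ?m + 1) = Suc (nat (k - ?m))" "nat (k - ?m) < length \<gamma>" by auto
      then show ?thesis using 2 by (simp add: z_def nth_append)
    next
      case 3
      then have "nat (k - ?m + 1) = Suc (length \<gamma>)" by simp
      moreover have "y 0 = hd v" using y ne(2) by (auto simp: cylinder_def hd_conv_nth)
      ultimately show ?thesis using 3 by (simp add: z_def nth_append)
    qed
  qed
  have adm': "A (?w ! i) (?w ! Suc i)" if "Suc i < length ?w" for i
    using adm that by (metis successively_conv_nth)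
  have "z \<in> two_sided A"
    unfolding two_sided_def
  proof (intro CollectI allI)
    fix k
    consider "k < ?m - 1" | "?m - 1 \<le> k" "k < ?m + ?g" | "?m + ?g \<le> k" by atomize_elim arith
    then show "A (z k) (z (k + 1))"
    proof cases
      case 1
      then show ?thesis using x by (auto simp: z_def cylinder_def two_sided_def)
    next
      case 2
      have "Suc (nat (k - ?m + 1)) = nat (k + 1 - ?m + 1)" using 2 by auto
      moreover have "Suc (nat (k - ?m + 1)) < length ?w" using 2 by auto
      ultimately show ?thesis using adm'[of "nat (k - ?m + 1)"] w[of k] w[of "k + 1"] 2 by simp
    next
      case 3
      have "A (y (k - ?m - ?g)) (y (k - ?m - ?g + 1))" using y by (auto simp: cylinder_def two_sided_def)
      moreover have "k - ?m - ?g + 1 = k + 1 - ?m - ?g" by simp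
      ultimately show ?thesis using 3 by (simp add: z_def)
    qed
  qed
  moreover have "z (int j) = (u @ \<gamma> @ v) ! j" if "j < length (u @ \<gamma> @ v)" for j
  proof -
    consider "j < length u" | "length u \<le> j" "j < length u + length \<gamma>" | "length u + length \<gamma> \<le> j" by atomize_elim arith
    then show ?thesis
    proof cases
      case 1
      then show ?thesis using x by (simp add: z_def nth_append cylinder_def)
    next
      case 2
      then have "nat (int j - ?m) = j - length u" "j - length u < length \<gamma>" by auto
      with 2 show ?thesis by (simp add: z_def nth_append)
    next
      case 3
      then obtain i where i: "j = length u + length \<gamma> + i" using le_Suc_ex by blast
      then have "i < length v" using that by simp
      then have "y (int i) = v ! i" using y by (simp add: cylinder_def)
      then show ?thesis by (simp add: z_def nth_append i)
    qed
  qed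
  ultimately show ?thesis by (auto simp: cylinder_def)
qed

text \<open>Along a glued point the Birkhoff sum splits into those over \<open>u\<close>, \<gamma>
  and \<open>v\<close>, and the Gibbs bounds turn it into a product of masses. The finitely many
  connecting words contribute at least a fixed positive factor.\<close>

lemma quasi_bernoulli:
  obtains c \<Phi> where "0 < c" "finite \<Phi>"
    "\<And>u v. u \<noteq> [] \<Longrightarrow> v \<noteq> [] \<Longrightarrow> cylinder A u \<noteq> {} \<Longrightarrow> cylinder A v \<noteq> {} \<Longrightarrow>
      \<exists>\<gamma>\<in>\<Phi>. c * prob (cylinder A u) * prob (cylinder A v) \<le> prob (cylinder A (u @ \<gamma> @ v))"
proof -
  obtain \<Phi> where \<Phi>: "finite \<Phi>" "\<And>a b. \<exists>\<gamma>\<in>\<Phi>. admissible A (a # \<gamma> @ [b])"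
    using irreducible by (auto simp: finitely_irreducible_def)
  \<comment> \<open>Words with an empty cylinder are left out to keep the minimum positive, and the
    1 keeps the set nonempty.\<close>
  define G where "G = insert 1 ((\<lambda>\<gamma>. prob (cylinder A \<gamma>)) ` {\<gamma>\<in>\<Phi>. cylinder A \<gamma> \<noteq> {}})"
  have G: "finite G" "G \<noteq> {}" using \<Phi>(1) by (auto simp: G_def)
  have Gpos: "0 < Min G" using G prob_cylinder_pos by (auto simp: G_def)
  \<comment> \<open>Three factors \<open>C\<close> come from the upper bounds for \<open>u\<close>,
    \<gamma> and \<open>v\<close>, one from the lower bound for the whole word.\<close>
  define c where "c = Min G / C ^ 4"
  have "0 < c" using Gpos C by (simp add: c_def)
  have "\<exists>\<gamma>\<in>\<Phi>. c * prob (cylinder A u) * prob (cylinder A v) \<le> prob (cylinder A (u @ \<gamma> @ v))"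
    if ne: "u \<noteq> []" "v \<noteq> []" and uv: "cylinder A u \<noteq> {}" "cylinder A v \<noteq> {}" for u v
  proof -
    obtain \<gamma> where \<gamma>: "\<gamma> \<in> \<Phi>" "admissible A (last u # \<gamma> @ [hd v])" using \<Phi>(2) by blast
    from uv obtain x y where "x \<in> cylinder A u" "y \<in> cylinder A v" by blast
    from admissible_glue[OF this ne \<gamma>(2)] obtain z where z: "z \<in> cylinder A (u @ \<gamma> @ v)" by blast
    let ?m = "length u" and ?g = "length \<gamma>" and ?n = "length v"
    have zu: "z \<in> cylinder A u" and z\<gamma>: "(shift ^^ ?m) z \<in> cylinder A \<gamma>" and zv: "(shift ^^ ?g) ((shift ^^ ?m) z) \<in> cylinder A v"
      using z by (auto simp: cylinder_append)
    have \<gamma>G: "Min G \<le> prob (cylinder A \<gamma>)" using G \<gamma>(1) z\<gamma> by (intro Min_le) (auto simp: G_def)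
    have "c * prob (cylinder A u) * prob (cylinder A v) =
      (prob (cylinder A u) / C * (Min G / C) * (prob (cylinder A v) / C)) / C"
      by (simp add: c_def field_simps power_numeral_reduce)
    also have "\<dots> \<le> (exp (birkhoff_sum \<psi> ?m z - P * ?m) * exp (birkhoff_sum \<psi> ?g ((shift ^^ ?m) z) - P * ?g) *
        exp (birkhoff_sum \<psi> ?n ((shift ^^ ?g) ((shift ^^ ?m) z)) - P * ?n)) / C"
    proof (intro divide_right_mono mult_mono)
      show "prob (cylinder A u) / C \<le> exp (birkhoff_sum \<psi> ?m z - P * ?m)" by (rule exp_birkhoff_ge[OF zu])
      have "Min G / C \<le> prob (cylinder A \<gamma>) / C" using \<gamma>G C by (intro divide_right_mono) auto
      also have "\<dots> \<le> exp (birkhoff_sum \<psi> ?g ((shift ^^ ?m) z) - P * ?g)" by (rule exp_birkhoff_ge[OF z\<gamma>])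
      finally show "Min G / C \<le> exp (birkhoff_sum \<psi> ?g ((shift ^^ ?m) z) - P * ?g)" .
      show "prob (cylinder A v) / C \<le> exp (birkhoff_sum \<psi> ?n ((shift ^^ ?g) ((shift ^^ ?m) z)) - P * ?n)"
        by (rule exp_birkhoff_ge[OF zv])
    qed (use C Gpos in auto)
    also have "\<dots> = exp (birkhoff_sum \<psi> (?m + (?g + ?n)) z - P * real (?m + (?g + ?n))) / C"
      unfolding birkhoff_sum_add exp_add[symmetric] by (simp add: algebra_simps)
    also have "\<dots> \<le> prob (cylinder A (word_of z (?m + (?g + ?n))))"
      using ne z by (intro gibbs_lower) (auto simp: cylinder_def Suc_le_eq)
    also have "word_of z (?m + (?g + ?n)) = u @ \<gamma> @ v"
      using z by (simp add: mem_cylinder_iff)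
    finally show ?thesis using \<gamma>(1) by blast
  qed
  then show ?thesis using that \<open>0 < c\<close> \<Phi>(1) by blast
qed

lemma emeasure_union_cylinders:
  assumes S: "S \<subseteq> two_sided A" "\<And>x y. x \<in> S \<Longrightarrow> y \<in> two_sided A \<Longrightarrow> (\<forall>j<n. x (int j) = y (int j)) \<Longrightarrow> y \<in> S"
  shows "emeasure \<mu> S = (\<integral>\<^sup>+w. emeasure \<mu> (cylinder A w) \<partial>count_space {w. length w = n \<and> cylinder A w \<inter> S \<noteq> {}})"
proof -
  let ?I = "{w. length w = n \<and> cylinder A w \<inter> S \<noteq> {}}"
  have "S = (\<Union>w\<in>?I. cylinder A w)"
  proof (intro subset_antisym subsetI)
    fix x assume "x \<in> S"
    moreover from this S(1) have "x \<in> cylinder A (word_of x n)" by (auto simp: mem_cylinder_iff)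
    ultimately show "x \<in> (\<Union>w\<in>?I. cylinder A w)" by (intro UN_I[of "word_of x n"]) auto
  next
    fix x assume "x \<in> (\<Union>w\<in>?I. cylinder A w)"
    then obtain w y where w: "length w = n" "x \<in> cylinder A w" "y \<in> cylinder A w" "y \<in> S" by auto
    then have "\<forall>j<n. y (int j) = x (int j)" by (auto simp: cylinder_def)
    with S(2)[OF w(4)] w(2) show "x \<in> S" by (auto simp: cylinder_def)
  qed
  then have "emeasure \<mu> S = emeasure \<mu> (\<Union>w\<in>?I. cylinder A w)" by simp
  also have "\<dots> = (\<integral>\<^sup>+w. emeasure \<mu> (cylinder A w) \<partial>count_space ?I)"
  proof (rule emeasure_UN_countable)
    show "disjoint_family_on (cylinder A) ?I"
      unfolding disjoint_family_on_def by (auto simp: mem_cylinder_iff)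
  qed auto
  finally show ?thesis .
qed

definition depends_on_first :: "nat \<Rightarrow> (int \<Rightarrow> 'e) set \<Rightarrow> bool" where
  "depends_on_first n S \<longleftrightarrow> S \<subseteq> two_sided A \<and>
    (\<forall>x\<in>S. \<forall>y\<in>two_sided A. (\<forall>j<n. x (int j) = y (int j)) \<longrightarrow> y \<in> S)"

text \<open>The previous estimate summed over all pairs of cylinders making up \<open>S\<close> and
  \<open>S'\<close>. The connecting word, and with it the gap, varies from pair to pair; hence the
  sum over \<Phi>.\<close>

lemma mixing_inequality:
  "\<exists>c>0. \<exists>\<Phi> :: 'e list set. finite \<Phi> \<and> (\<forall>S S' n m.
      0 < n \<longrightarrow> 0 < m \<longrightarrow> depends_on_first n S \<longrightarrow> depends_on_first m S' \<longrightarrow> S \<in> sets \<mu> \<longrightarrow> S' \<in> sets \<mu> \<longrightarrow>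
      c * prob S * prob S' \<le> (\<Sum>\<gamma>\<in>\<Phi>. prob (S \<inter> (shift ^^ (n + length \<gamma>)) -` S')))"
proof -
  obtain c \<Phi> where c: "0 < c" and \<Phi>: "finite \<Phi>"
    and qb: "\<And>u v. u \<noteq> [] \<Longrightarrow> v \<noteq> [] \<Longrightarrow> cylinder A u \<noteq> {} \<Longrightarrow> cylinder A v \<noteq> {} \<Longrightarrow>
      \<exists>\<gamma>\<in>\<Phi>. c * prob (cylinder A u) * prob (cylinder A v) \<le> prob (cylinder A (u @ \<gamma> @ v))"
    using quasi_bernoulli by blast
  show ?thesis
  proof (intro exI[of _ c] exI[of _ \<Phi>] conjI c \<Phi> allI impI)
    fix S S' n m
    assume nm: "0 < n" "0 < m" and dep: "depends_on_first n S" "depends_on_first m S'"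
      and meas: "S \<in> sets \<mu>" "S' \<in> sets \<mu>"
    have S: "S \<subseteq> two_sided A" and S': "S' \<subseteq> two_sided A" using dep by (auto simp: depends_on_first_def)
    have SI: "\<And>x y. x \<in> S \<Longrightarrow> y \<in> two_sided A \<Longrightarrow> (\<forall>j<n. x (int j) = y (int j)) \<Longrightarrow> y \<in> S"
      and SI': "\<And>x y. x \<in> S' \<Longrightarrow> y \<in> two_sided A \<Longrightarrow> (\<forall>j<m. x (int j) = y (int j)) \<Longrightarrow> y \<in> S'"
      using dep unfolding depends_on_first_def by blast+
    let ?I = "{w. length w = n \<and> cylinder A w \<inter> S \<noteq> {}}" and ?I' = "{w. length w = m \<and> cylinder A w \<inter> S' \<noteq> {}}"
    let ?e = "\<lambda>w. emeasure \<mu> (cylinder A w)"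
    have meas': "S \<inter> (shift ^^ k) -` S' \<in> sets \<mu>" for k
    proof -
      have "S \<inter> (shift ^^ k) -` S' = S \<inter> ((shift ^^ k) -` S' \<inter> space \<mu>)" using S by auto
      also have "\<dots> \<in> sets \<mu>" using meas measurable_sets[OF forward.funpow_measurable meas(2), of k] by blast
      finally show ?thesis .
    qed
    have sub: "(\<integral>\<^sup>+p. ?e (fst p @ \<gamma> @ snd p) \<partial>count_space (?I \<times> ?I')) \<le> emeasure \<mu> (S \<inter> (shift ^^ (n + length \<gamma>)) -` S')" for \<gamma>
    proof -
      have "(\<integral>\<^sup>+p. ?e (fst p @ \<gamma> @ snd p) \<partial>count_space (?I \<times> ?I')) = emeasure \<mu> (\<Union>p\<in>?I \<times> ?I'. cylinder A (fst p @ \<gamma> @ snd p))"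
      proof (rule emeasure_UN_countable[symmetric])
        show "disjoint_family_on (\<lambda>p. cylinder A (fst p @ \<gamma> @ snd p)) (?I \<times> ?I')"
          unfolding disjoint_family_on_def
        proof (intro ballI impI, rule ccontr)
          fix p q assume pq: "p \<in> ?I \<times> ?I'" "q \<in> ?I \<times> ?I'" "p \<noteq> q"
            "cylinder A (fst p @ \<gamma> @ snd p) \<inter> cylinder A (fst q @ \<gamma> @ snd q) \<noteq> {}"
          then obtain x where x: "x \<in> cylinder A (fst p @ \<gamma> @ snd p)" "x \<in> cylinder A (fst q @ \<gamma> @ snd q)" by blast
          have len: "length (fst p) = length (fst q)" "length (snd p) = length (snd q)" using pq(1,2) by auto
          then have "length (fst p @ \<gamma> @ snd p) = length (fst q @ \<gamma> @ snd q)" by simp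
          with x have "fst p @ \<gamma> @ snd p = fst q @ \<gamma> @ snd q" unfolding mem_cylinder_iff by metis
          with len pq(3) show False by (simp add: prod_eq_iff)
        qed
      qed auto
      also have "\<dots> \<le> emeasure \<mu> (S \<inter> (shift ^^ (n + length \<gamma>)) -` S')"
      proof (rule emeasure_mono[OF _ meas'], rule UN_least)
        fix p assume p: "p \<in> ?I \<times> ?I'"
        show "cylinder A (fst p @ \<gamma> @ snd p) \<subseteq> S \<inter> (shift ^^ (n + length \<gamma>)) -` S'"
        proof
          fix x assume x: "x \<in> cylinder A (fst p @ \<gamma> @ snd p)"
          then have x1: "x \<in> cylinder A (fst p)" and x2: "(shift ^^ (n + length \<gamma>)) x \<in> cylinder A (snd p)"
          proof -
            have eq: "(shift ^^ (length (fst p) + length \<gamma>)) x = (shift ^^ length \<gamma>) ((shift ^^ length (fst p)) x)"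
              by (simp add: fun_eq_iff shift_funpow_apply algebra_simps)
            have "length (fst p) = n" using p by auto
            then show "x \<in> cylinder A (fst p)" "(shift ^^ (n + length \<gamma>)) x \<in> cylinder A (snd p)"
              using x unfolding cylinder_append eq[symmetric] by simp_all
          qed
          obtain y y' where y: "y \<in> S" "y \<in> cylinder A (fst p)" and y': "y' \<in> S'" "y' \<in> cylinder A (snd p)" using p by auto
          have "x \<in> S" by (rule SI[OF y(1)]) (use x1 y p in \<open>auto simp: cylinder_def\<close>)
          moreover have "(shift ^^ (n + length \<gamma>)) x \<in> S'"
            by (rule SI'[OF y'(1)]) (use x2 y' p in \<open>auto simp: cylinder_def\<close>)
          ultimately show "x \<in> S \<inter> (shift ^^ (n + length \<gamma>)) -` S'" by simp
        qed
      qed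
      finally show ?thesis .
    qed
    have "ennreal (c * prob S * prob S') = ennreal c * (emeasure \<mu> S * emeasure \<mu> S')"
      using c by (simp add: emeasure_eq_measure ennreal_mult' mult.assoc)
    also have "emeasure \<mu> S * emeasure \<mu> S' = (\<integral>\<^sup>+u. \<integral>\<^sup>+v. ?e u * ?e v \<partial>count_space ?I' \<partial>count_space ?I)"
    proof -
      have "emeasure \<mu> S = (\<integral>\<^sup>+w. ?e w \<partial>count_space ?I)" "emeasure \<mu> S' = (\<integral>\<^sup>+w. ?e w \<partial>count_space ?I')"
        by (rule emeasure_union_cylinders[OF S], rule SI, assumption+)
           (rule emeasure_union_cylinders[OF S'], rule SI', assumption+)
      then show ?thesis by (simp add: nn_integral_cmult nn_integral_multc)
    qed
    also have "\<dots> = (\<integral>\<^sup>+p. ?e (fst p) * ?e (snd p) \<partial>count_space (?I \<times> ?I'))"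
    proof -
      have prod: "count_space ?I \<Otimes>\<^sub>M count_space ?I' = count_space (?I \<times> ?I')"
        by (intro pair_measure_countable countableI_type)
      interpret I': sigma_finite_measure "count_space ?I'"
        by (intro sigma_finite_measure_count_space_countable countableI_type)
      show ?thesis
        using I'.nn_integral_fst[of "\<lambda>p. ?e (fst p) * ?e (snd p)" "count_space ?I"] by (simp add: prod)
    qed
    also have "ennreal c * \<dots> = (\<integral>\<^sup>+p. ennreal c * (?e (fst p) * ?e (snd p)) \<partial>count_space (?I \<times> ?I'))"
      by (subst nn_integral_cmult) auto
    also have "\<dots> \<le> (\<integral>\<^sup>+p. (\<Sum>\<gamma>\<in>\<Phi>. ?e (fst p @ \<gamma> @ snd p)) \<partial>count_space (?I \<times> ?I'))"
    proof (rule nn_integral_mono)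
      fix p assume "p \<in> space (count_space (?I \<times> ?I'))"
      then have "fst p \<noteq> []" "snd p \<noteq> []" "cylinder A (fst p) \<noteq> {}" "cylinder A (snd p) \<noteq> {}" using nm by auto
      from qb[OF this] obtain \<gamma> where \<gamma>: "\<gamma> \<in> \<Phi>"
        "c * prob (cylinder A (fst p)) * prob (cylinder A (snd p)) \<le> prob (cylinder A (fst p @ \<gamma> @ snd p))" by blast
      have "ennreal c * (?e (fst p) * ?e (snd p)) = ennreal (c * prob (cylinder A (fst p)) * prob (cylinder A (snd p)))"
        using c by (simp add: emeasure_eq_measure ennreal_mult' mult.assoc)
      also have "\<dots> \<le> ?e (fst p @ \<gamma> @ snd p)" using \<gamma>(2) by (simp add: emeasure_eq_measure ennreal_leI)
      also have "\<dots> \<le> (\<Sum>\<gamma>\<in>\<Phi>. ?e (fst p @ \<gamma> @ snd p))"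
        using \<gamma>(1) \<Phi> by (intro member_le_sum) auto
      finally show "ennreal c * (?e (fst p) * ?e (snd p)) \<le> (\<Sum>\<gamma>\<in>\<Phi>. ?e (fst p @ \<gamma> @ snd p))" .
    qed
    also have "\<dots> = (\<Sum>\<gamma>\<in>\<Phi>. \<integral>\<^sup>+p. ?e (fst p @ \<gamma> @ snd p) \<partial>count_space (?I \<times> ?I'))"
      by (rule nn_integral_sum) auto
    also have "\<dots> \<le> (\<Sum>\<gamma>\<in>\<Phi>. emeasure \<mu> (S \<inter> (shift ^^ (n + length \<gamma>)) -` S'))"
      by (intro sum_mono sub)
    also have "\<dots> = ennreal (\<Sum>\<gamma>\<in>\<Phi>. prob (S \<inter> (shift ^^ (n + length \<gamma>)) -` S'))"
      by (simp add: emeasure_eq_measure sum_nonneg)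
    finally show "c * prob S * prob S' \<le> (\<Sum>\<gamma>\<in>\<Phi>. prob (S \<inter> (shift ^^ (n + length \<gamma>)) -` S'))"
      by (subst (asm) ennreal_le_iff) (auto intro: sum_nonneg)
  qed
qed

lemma approximation_by_window_sets:
  assumes "B \<in> sets \<mu>" "0 < e"
  shows "\<exists>S\<in>window_sets A. prob ((B - S) \<union> (S - B)) < e"
proof (rule approximation_by_algebra[OF _ _ assms])
  show "algebra (space \<mu>) (window_sets A)" by (simp add: algebra_window_sets)
  show "sets \<mu> = sigma_sets (space \<mu>) (window_sets A)" by (simp add: sets_\<mu> sets_eq_sigma_window_sets)
qed

text \<open>A window set depends on coordinates on both sides of 0. Shifting by \<open>N\<close>
  moves its window to \<open>0, ..., 2 * N\<close>, and invariance of \<open>B\<close> preserves the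
  error.\<close>

lemma approximation_by_cylinders:
  assumes B: "B \<in> sets \<mu>" "(shift ^^ 1) -` B \<inter> two_sided A = B" and "0 < e"
  shows "\<exists>S n. 0 < n \<and> S \<in> sets \<mu> \<and> depends_on_first n S \<and> prob ((B - S) \<union> (S - B)) < e"
proof -
  have invB: "(shift ^^ N) -` B \<inter> two_sided A = B" for N
  proof (induction N)
    case 0
    then show ?case using sets.sets_into_space[OF B(1)] by auto
  next
    case (Suc N)
    have "x \<in> (shift ^^ Suc N) -` B \<inter> two_sided A \<longleftrightarrow> x \<in> B" for x
    proof -
      have "x \<in> (shift ^^ Suc N) -` B \<inter> two_sided A \<longleftrightarrow> shift ((shift ^^ N) x) \<in> B \<and> (shift ^^ N) x \<in> two_sided A" by simp
      also have "\<dots> \<longleftrightarrow> (shift ^^ N) x \<in> B \<and> x \<in> two_sided A" using B(2) by auto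
      also have "\<dots> \<longleftrightarrow> x \<in> B" using Suc by blast
      finally show ?thesis .
    qed
    then show ?case by blast
  qed
  obtain S where S: "S \<in> window_sets A" "prob ((B - S) \<union> (S - B)) < e"
    using approximation_by_window_sets[OF B(1) \<open>0 < e\<close>] by blast
  then obtain N where N: "\<And>x y. x\<in>two_sided A \<Longrightarrow> y\<in>two_sided A \<Longrightarrow> window_agree N x y \<Longrightarrow> x \<in> S \<Longrightarrow> y \<in> S" and SA: "S \<subseteq> two_sided A"
    unfolding window_sets_def by blast
  let ?S = "(shift ^^ N) -` S \<inter> two_sided A"
  have S_sets: "S \<in> sets \<mu>" using window_sets_borel[OF S(1)] by (simp add: sets_\<mu>)
  show ?thesis
    unfolding depends_on_first_def
  proof (intro exI[of _ ?S] exI[of _ "Suc (2 * N)"] conjI ballI impI)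
    show "?S \<in> sets \<mu>" using measurable_sets[OF forward.funpow_measurable S_sets, of N] by simp
    fix x y assume xy: "x \<in> ?S" "y \<in> two_sided A" "\<forall>j<Suc (2 * N). x (int j) = y (int j)"
    have "window_agree N ((shift ^^ N) x) ((shift ^^ N) y)"
      unfolding window_agree_def
    proof (intro allI impI)
      fix k assume k: "\<bar>k\<bar> \<le> int N"
      then have "nat (k + int N) < Suc (2 * N)" "int (nat (k + int N)) = k + int N" by auto
      with xy(3) have "x (k + int N) = y (k + int N)" by metis
      then show "truncated_letter N ((shift ^^ N) x k) = truncated_letter N ((shift ^^ N) y k)" by (simp add: shift_funpow_apply)
    qed
    then show "y \<in> ?S" using N[of "(shift ^^ N) x" "(shift ^^ N) y"] xy by auto
  next
    have "(B - ?S) \<union> (?S - B) = (shift ^^ N) -` ((B - S) \<union> (S - B)) \<inter> two_sided A"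
      using invB[of N] by blast
    moreover have "(B - S) \<union> (S - B) \<in> sets \<mu>" using B(1) S_sets by blast
    ultimately have "prob ((B - ?S) \<union> (?S - B)) = prob ((B - S) \<union> (S - B))"
      using prob_vimage_shift[of "(B - S) \<union> (S - B)" N] by (simp only:)
    with S(2) show "prob ((B - ?S) \<union> (?S - B)) < e" by (simp only:)
  qed auto
qed

text \<open>Suppose that \<open>B\<close> and its complement both have positive mass, and
  approximate them by \<open>S\<close> and \<open>S'\<close> up to \<open>e\<close>. Since
  \<open>B\<close> never meets a preimage of its complement, \<open>S\<close> meets a preimage of
  \<open>S'\<close> only inside the two error sets, in mass at most \<open>2 * e\<close>. The mixing
  inequality bounds the same masses from below independently of the gaps, which is impossible for
  small \<open>e\<close>.\<close>

theorem ergodic_backward: "backward.ergodic"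
  unfolding backward.ergodic_def
proof (intro ballI impI)
  fix B assume B: "B \<in> sets \<mu>" and inv: "unshift -` B \<inter> space \<mu> = B"
  have BA: "B \<subseteq> two_sided A" using sets.sets_into_space[OF B] by simp
  have inv_iff: "shift x \<in> B \<longleftrightarrow> x \<in> B" if "x \<in> two_sided A" for x
  proof -
    have "shift x \<in> B \<longleftrightarrow> shift x \<in> unshift -` B \<inter> space \<mu>" using inv by blast
    also have "\<dots> \<longleftrightarrow> x \<in> B" using that by simp
    finally show ?thesis .
  qed
  have invn: "(shift ^^ n) x \<in> B \<longleftrightarrow> x \<in> B" if "x \<in> two_sided A" for x n
    using that by (induction n) (auto simp: inv_iff)
  let ?B' = "two_sided A - B"
  have B': "?B' \<in> sets \<mu>" using B sets.compl_sets[OF B] by simp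
  obtain c and \<Phi> :: "'e list set" where c: "0 < c" and \<Phi>: "finite \<Phi>" and mix: "\<And>S S' n m.
      0 < n \<Longrightarrow> 0 < m \<Longrightarrow> depends_on_first n S \<Longrightarrow> depends_on_first m S' \<Longrightarrow> S \<in> sets \<mu> \<Longrightarrow> S' \<in> sets \<mu> \<Longrightarrow>
      c * prob S * prob S' \<le> (\<Sum>\<gamma>\<in>\<Phi>. prob (S \<inter> (shift ^^ (n + length \<gamma>)) -` S'))"
    using mixing_inequality by blast
  have bound: "c * (prob B - e) * (prob ?B' - e) \<le> real (card \<Phi>) * (2 * e)" if e: "0 < e" "e < prob B" "e < prob ?B'" for e
  proof -
    obtain S n where S: "0 < n" "S \<in> sets \<mu>" "depends_on_first n S" "prob ((B - S) \<union> (S - B)) < e"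
      using approximation_by_cylinders[OF B _ e(1)] inv_iff BA by (fastforce simp: vimage_def)
    obtain S' m where S': "0 < m" "S' \<in> sets \<mu>" "depends_on_first m S'" "prob ((?B' - S') \<union> (S' - ?B')) < e"
      using approximation_by_cylinders[OF B' _ e(1)] inv_iff BA by (fastforce simp: vimage_def)
    have lower: "prob D - e \<le> prob T" if "D \<in> sets \<mu>" "T \<in> sets \<mu>" "prob ((D - T) \<union> (T - D)) < e" for D T
    proof -
      have "prob D \<le> prob (T \<union> ((D - T) \<union> (T - D)))" using that by (intro finite_measure_mono) auto
      also have "\<dots> \<le> prob T + prob ((D - T) \<union> (T - D))" using that by (intro measure_Un_le) auto
      finally show ?thesis using that by simp
    qed
    have "c * (prob B - e) * (prob ?B' - e) \<le> c * prob S * prob S'"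
      using lower[OF B S(2,4)] lower[OF B' S'(2,4)] c e by (intro mult_mono) auto
    also have "\<dots> \<le> (\<Sum>\<gamma>\<in>\<Phi>. prob (S \<inter> (shift ^^ (n + length \<gamma>)) -` S'))"
      by (rule mix[OF S(1) S'(1) S(3) S'(3) S(2) S'(2)])
    also have "\<dots> \<le> (\<Sum>\<gamma>\<in>\<Phi>. 2 * e)"
    proof (rule sum_mono)
      fix \<gamma>
      let ?k = "n + length \<gamma>"
      let ?D = "(B - S) \<union> (S - B)" and ?D' = "(?B' - S') \<union> (S' - ?B')"
      have D: "?D \<in> sets \<mu>" "?D' \<in> sets \<mu>" using B B' S(2) S'(2) by auto
      then have D'': "(shift ^^ ?k) -` ?D' \<inter> two_sided A \<in> sets \<mu>"
        using measurable_sets[OF forward.funpow_measurable D(2), of ?k] by simp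
      have "S \<inter> (shift ^^ ?k) -` S' \<subseteq> ?D \<union> ((shift ^^ ?k) -` ?D' \<inter> two_sided A)"
        using S(3) invn[of _ ?k] by (auto simp: depends_on_first_def)
      then have "prob (S \<inter> (shift ^^ ?k) -` S') \<le> prob (?D \<union> ((shift ^^ ?k) -` ?D' \<inter> two_sided A))"
        using D D'' by (intro finite_measure_mono) auto
      also have "\<dots> \<le> prob ?D + prob ((shift ^^ ?k) -` ?D' \<inter> two_sided A)"
        using D D'' by (intro measure_Un_le) auto
      also have "\<dots> \<le> 2 * e" using S(4) S'(4) prob_vimage_shift[OF D(2), of ?k] by simp
      finally show "prob (S \<inter> (shift ^^ ?k) -` S') \<le> 2 * e" .
    qed
    also have "\<dots> = real (card \<Phi>) * (2 * e)" by simp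
    finally show ?thesis .
  qed
  have "prob B = 0 \<or> prob ?B' = 0"
  proof (rule ccontr)
    assume "\<not> (prob B = 0 \<or> prob ?B' = 0)"
    then have pos: "0 < prob B" "0 < prob ?B'" by (auto simp: less_le)
    have "((\<lambda>e. c * (prob B - e) * (prob ?B' - e)) \<longlongrightarrow> c * (prob B - 0) * (prob ?B' - 0)) (at_right 0)"
      by (intro tendsto_intros)
    moreover have "((\<lambda>e. real (card \<Phi>) * (2 * e)) \<longlongrightarrow> real (card \<Phi>) * (2 * 0)) (at_right 0)"
      by (intro tendsto_intros)
    moreover have "\<forall>\<^sub>F e in at_right 0. c * (prob B - e) * (prob ?B' - e) \<le> real (card \<Phi>) * (2 * e)"
    proof -
      have "\<forall>\<^sub>F e in at_right 0. e < min (prob B) (prob ?B')"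
        using pos by (intro order_tendstoD(2)[OF tendsto_ident_at]) simp
      moreover have "\<forall>\<^sub>F e in at_right (0::real). 0 < e" by (simp add: eventually_at_right_less)
      ultimately show ?thesis by eventually_elim (rule bound; simp)
    qed
    ultimately have "c * (prob B - 0) * (prob ?B' - 0) \<le> real (card \<Phi>) * (2 * 0)"
      by (intro tendsto_le[of "at_right 0"]) (auto simp: trivial_limit_at_right_real)
    moreover have "0 < c * prob B * prob ?B'" using c pos by simp
    ultimately show False by simp
  qed
  moreover have "prob ?B' = 1 - prob B" using prob_compl[OF B] by simp
  ultimately show "prob B = 0 \<or> prob B = 1" by auto
qed

end

section \<open>The entropy of a Gibbs state\<close>

context gibbs
begin

lemma prob_two_sided [simp]: "prob (two_sided A) = 1"
  using prob_space by simp

text \<open>Finite approximations of the partition by the zeroth letter, whose number of atoms may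
  be infinite.\<close>

definition trunc :: "nat \<Rightarrow> (int \<Rightarrow> 'e) \<Rightarrow> nat" where
  "trunc K x = truncated_letter K (x 0)"

abbreviation excess :: real where
  "excess \<equiv> P - (LINT x|\<mu>. \<psi> x)"

lemma simple_function_trunc: "simple_function \<mu> (trunc K)"
proof (rule simple_function_borel_measurable)
  show "finite (trunc K ` space \<mu>)"
    by (rule finite_subset[of _ "{..K}"]) (auto simp: trunc_def truncated_letter_def)
  have "(\<lambda>x. x 0) \<in> measurable \<mu> (count_space UNIV)"
    unfolding measurable_cong_sets[OF sets_\<mu> refl] by (rule measurable_coordinate)
  then show "trunc K \<in> borel_measurable \<mu>"
    unfolding trunc_def[abs_def] by (rule measurable_compose) simp
qed

lemma birkhoff_sum_eq_ergodic_sum: "birkhoff_sum \<psi> n = ergodic_sum shift \<psi> n"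
  by (simp add: fun_eq_iff birkhoff_sum_def ergodic_sum_def)

lemma trunc_word_eq_iff:
  "orbit_word shift (trunc K) n x = orbit_word shift (trunc K) n y \<longleftrightarrow>
    (\<forall>j<n. truncated_letter K (x (int j)) = truncated_letter K (y (int j)))"
  by (simp add: orbit_word_eq_iff trunc_def shift_funpow_apply)

lemma cylinder_subset_atom:
  "cylinder A (word_of x n) \<subseteq> atom_of (orbit_word shift (trunc K) n) x"
  by (auto simp: cylinder_word_of atom_of_def trunc_word_eq_iff)

lemma integrable_gibbs_bound: "integrable \<mu> (\<lambda>x. ln C - birkhoff_sum \<psi> n x + P * real n)"
  unfolding birkhoff_sum_eq_ergodic_sum
  by (intro Bochner_Integration.integrable_add Bochner_Integration.integrable_diff forward.integrable_ergodic_sum \<psi>_integrable) auto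

lemma integral_gibbs_bound:
  "(LINT x|\<mu>. k - birkhoff_sum \<psi> n x + P * real n) = k + real n * excess"
proof -
  have "integrable \<mu> (birkhoff_sum \<psi> n)"
    unfolding birkhoff_sum_eq_ergodic_sum by (rule forward.integrable_ergodic_sum[OF \<psi>_integrable])
  then have "(LINT x|\<mu>. k - birkhoff_sum \<psi> n x + P * real n) = k - (LINT x|\<mu>. birkhoff_sum \<psi> n x) + P * real n"
    by (simp add: prob_space)
  then show ?thesis
    unfolding birkhoff_sum_eq_ergodic_sum forward.integral_ergodic_sum[OF \<psi>_integrable] by (simp add: algebra_simps)
qed

lemma information_le:
  assumes "1 \<le> n" "x \<in> two_sided A"
  shows "- ln (prob (cylinder A (word_of x n))) \<le> ln C - birkhoff_sum \<psi> n x + P * real n"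
    and "- ln C - birkhoff_sum \<psi> n x + P * real n \<le> - ln (prob (cylinder A (word_of x n)))"
proof -
  have pos: "0 < prob (cylinder A (word_of x n))"
    by (rule prob_cylinder_pos[of x]) (use assms in \<open>auto simp: mem_cylinder_iff\<close>)
  have "ln (exp (birkhoff_sum \<psi> n x - P * real n) / C) \<le> ln (prob (cylinder A (word_of x n)))"
    using gibbs_lower[OF assms] pos C by (subst ln_le_cancel_iff) auto
  then show "- ln (prob (cylinder A (word_of x n))) \<le> ln C - birkhoff_sum \<psi> n x + P * real n"
    using C by (simp add: ln_div)
  have "ln (prob (cylinder A (word_of x n))) \<le> ln (C * exp (birkhoff_sum \<psi> n x - P * real n))"
    using gibbs_upper[OF assms] pos C by (subst ln_le_cancel_iff) auto
  then show "- ln C - birkhoff_sum \<psi> n x + P * real n \<le> - ln (prob (cylinder A (word_of x n)))"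
    using C by (simp add: ln_mult)
qed

lemma atom_information_le:
  assumes "x \<in> two_sided A"
  shows "- ln (prob (atom_of (orbit_word shift (trunc K) n) x)) \<le> - ln (prob (cylinder A (word_of x n)))"
proof -
  have "0 < prob (cylinder A (word_of x n))"
    by (rule prob_cylinder_pos[of x]) (use assms in \<open>auto simp: mem_cylinder_iff\<close>)
  moreover have "prob (cylinder A (word_of x n)) \<le> prob (atom_of (orbit_word shift (trunc K) n) x)"
    by (intro finite_measure_mono cylinder_subset_atom atom_of_sets forward.simple_function_orbit_word simple_function_trunc)
  ultimately show ?thesis by (simp add: ln_mono)
qed

text \<open>Merging letters lowers the information, so the Gibbs bound for genuine cylinders can be
  integrated.\<close>

lemma shannon_trunc_le:
  assumes "1 \<le> n" shows "shannon (orbit_word shift (trunc K) n) \<le> ln C + real n * excess"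
proof -
  have "shannon (orbit_word shift (trunc K) n) \<le> (LINT x|\<mu>. ln C - birkhoff_sum \<psi> n x + P * real n)"
    unfolding shannon_def
  proof (rule integral_mono)
    fix x assume "x \<in> space \<mu>"
    then have "x \<in> two_sided A" by simp
    from atom_information_le[OF this, of K n] information_le(1)[OF assms this]
    show "- ln (prob (atom_of (orbit_word shift (trunc K) n) x)) \<le> ln C - birkhoff_sum \<psi> n x + P * real n" by linarith
  qed (intro shannon_integrable forward.simple_function_orbit_word simple_function_trunc integrable_gibbs_bound)+
  then show ?thesis by (simp only: integral_gibbs_bound)
qed

lemma measurable_word_information:
  "(\<lambda>x. - ln (prob (cylinder A (word_of x n)))) \<in> borel_measurable \<mu>"
proof -
  have "(\<lambda>x. word_of x n) -` {w} \<inter> space \<mu> = (if length w = n then cylinder A w else {})" for w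
    by (auto simp: mem_cylinder_iff)
  then have "(\<lambda>x. word_of x n) \<in> measurable \<mu> (count_space UNIV)"
    by (subst measurable_count_space_eq_countable) simp_all
  then show ?thesis by (rule measurable_compose) simp
qed

text \<open>The atoms decrease to cylinders as \<open>K\<close> grows. The Gibbs bound on the
  information is an integrable majorant, and so the possibly infinite partition into words has
  finite entropy.\<close>

lemma shannon_trunc_tendsto:
  assumes "1 \<le> n"
  shows "(\<lambda>K. shannon (orbit_word shift (trunc K) n)) \<longlonglongrightarrow> (LINT x|\<mu>. - ln (prob (cylinder A (word_of x n))))"
  unfolding shannon_def
proof (rule integral_dominated_convergence[where w="\<lambda>x. ln C - birkhoff_sum \<psi> n x + P * real n"])
  let ?a = "\<lambda>K x. atom_of (orbit_word shift (trunc K) n) x"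
  have sets: "?a K x \<in> sets \<mu>" for K x
    by (intro atom_of_sets forward.simple_function_orbit_word simple_function_trunc)
  show "AE x in \<mu>. (\<lambda>K. - ln (prob (?a K x))) \<longlonglongrightarrow> - ln (prob (cylinder A (word_of x n)))"
  proof (rule AE_I2)
    fix x assume "x \<in> space \<mu>"
    then have x: "x \<in> two_sided A" by simp
    have "decseq (\<lambda>K. ?a K x)"
      unfolding decseq_def atom_of_def trunc_word_eq_iff by (blast intro: truncated_letter_mono)
    then have "(\<lambda>K. prob (?a K x)) \<longlonglongrightarrow> prob (\<Inter>K. ?a K x)"
      using sets by (intro finite_Lim_measure_decseq) auto
    also have "(\<Inter>K. ?a K x) = cylinder A (word_of x n)"
    proof
      show "cylinder A (word_of x n) \<subseteq> (\<Inter>K. ?a K x)" using cylinder_subset_atom by blast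
      show "(\<Inter>K. ?a K x) \<subseteq> cylinder A (word_of x n)"
      proof
        fix y assume y: "y \<in> (\<Inter>K. ?a K x)"
        have "y (int j) = x (int j)" if "j < n" for j
        proof -
          let ?K = "Suc (to_nat (x (int j)))"
          have "truncated_letter ?K (y (int j)) = truncated_letter ?K (x (int j))"
            using y that by (auto simp: atom_of_def trunc_word_eq_iff)
          then show ?thesis by (auto simp: truncated_letter_def min_def split: if_splits)
        qed
        with y show "y \<in> cylinder A (word_of x n)" by (auto simp: cylinder_word_of atom_of_def)
      qed
    qed
    finally have lim: "(\<lambda>K. prob (?a K x)) \<longlonglongrightarrow> prob (cylinder A (word_of x n))" .
    have "0 < prob (cylinder A (word_of x n))"
      by (rule prob_cylinder_pos[of x]) (use x in \<open>auto simp: mem_cylinder_iff\<close>)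
    then show "(\<lambda>K. - ln (prob (?a K x))) \<longlonglongrightarrow> - ln (prob (cylinder A (word_of x n)))"
      by (intro tendsto_minus tendsto_ln lim) auto
  qed
  show "AE x in \<mu>. norm (- ln (prob (?a K x))) \<le> ln C - birkhoff_sum \<psi> n x + P * real n" for K
  proof (rule AE_I2)
    fix x assume "x \<in> space \<mu>"
    then have x: "x \<in> two_sided A" by simp
    have pos: "0 < prob (cylinder A (word_of x n))"
      by (rule prob_cylinder_pos[of x]) (use x in \<open>auto simp: mem_cylinder_iff\<close>)
    have "prob (cylinder A (word_of x n)) \<le> prob (?a K x)"
      by (intro finite_measure_mono cylinder_subset_atom sets)
    with pos have "0 < prob (?a K x)" by linarith
    then have "ln (prob (?a K x)) \<le> 0" using prob_le_1[of "?a K x"] by simp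
    with atom_information_le[OF x, of K n] information_le(1)[OF assms x]
    show "norm (- ln (prob (?a K x))) \<le> ln C - birkhoff_sum \<psi> n x + P * real n" by simp
  qed
  show "(\<lambda>x. - ln (prob (?a K x))) \<in> borel_measurable \<mu>" for K
    using shannon_integrable[OF forward.simple_function_orbit_word[OF simple_function_trunc]] by (rule borel_measurable_integrable)
qed (rule measurable_word_information integrable_gibbs_bound)+

lemma integrable_word_information:
  assumes "1 \<le> n" shows "integrable \<mu> (\<lambda>x. - ln (prob (cylinder A (word_of x n))))"
proof (rule Bochner_Integration.integrable_bound[OF integrable_gibbs_bound[of n] measurable_word_information])
  show "AE x in \<mu>. norm (- ln (prob (cylinder A (word_of x n)))) \<le> norm (ln C - birkhoff_sum \<psi> n x + P * real n)"
  proof (rule AE_I2)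
    fix x assume "x \<in> space \<mu>"
    then have x: "x \<in> two_sided A" by simp
    have "0 < prob (cylinder A (word_of x n))"
      by (rule prob_cylinder_pos[of x]) (use x in \<open>auto simp: mem_cylinder_iff\<close>)
    then have "ln (prob (cylinder A (word_of x n))) \<le> 0" using prob_le_1[of "cylinder A (word_of x n)"] by simp
    with information_le(1)[OF assms x]
    show "norm (- ln (prob (cylinder A (word_of x n)))) \<le> norm (ln C - birkhoff_sum \<psi> n x + P * real n)" by simp
  qed
qed

text \<open>For \<open>K \<le> L\<close> the finer partition costs the difference of the two
  entropies per step. Letting \<open>L\<close> and then the word length tend to infinity gives the
  bound, with a defect that vanishes as \<open>K\<close> grows.\<close>

lemma entropy_rate_trunc_ge:
  "excess \<le> forward.entropy_rate (trunc K) + ((LINT x|\<mu>. - ln (prob (cylinder A (word_of x 1)))) - shannon (trunc K))"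
proof -
  let ?H1 = "LINT x|\<mu>. - ln (prob (cylinder A (word_of x 1)))"
  let ?h = "\<lambda>n. shannon (orbit_word shift (trunc K) n)"
  have one: "shannon (orbit_word shift (trunc L) 1) = shannon (trunc L)" for L
    by (rule shannon_cong) (auto simp: orbit_word_eq_iff)
  have le: "- ln C + real n * excess \<le> ?h n + real n * (?H1 - shannon (trunc K))" if n: "1 \<le> n" for n
  proof -
    have "- ln C + real n * excess = (LINT x|\<mu>. - ln C - birkhoff_sum \<psi> n x + P * real n)"
      by (simp only: integral_gibbs_bound)
    also have "\<dots> \<le> (LINT x|\<mu>. - ln (prob (cylinder A (word_of x n))))"
    proof (rule integral_mono[OF _ integrable_word_information[OF n]])
      show "integrable \<mu> (\<lambda>x. - ln C - birkhoff_sum \<psi> n x + P * real n)"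
        unfolding birkhoff_sum_eq_ergodic_sum
        by (intro Bochner_Integration.integrable_add Bochner_Integration.integrable_diff forward.integrable_ergodic_sum \<psi>_integrable) auto
    qed (use information_le(2)[OF n] in simp)
    also have "\<dots> \<le> ?h n + real n * (?H1 - shannon (trunc K))"
    proof (rule LIMSEQ_le[OF shannon_trunc_tendsto[OF n]])
      show "(\<lambda>L. ?h n + real n * (shannon (trunc L) - shannon (trunc K))) \<longlonglongrightarrow> ?h n + real n * (?H1 - shannon (trunc K))"
        using shannon_trunc_tendsto[of 1] unfolding one by (intro tendsto_intros) simp
      show "\<exists>N. \<forall>L\<ge>N. shannon (orbit_word shift (trunc L) n) \<le> ?h n + real n * (shannon (trunc L) - shannon (trunc K))"
      proof (intro exI[of _ K] allI impI)
        fix L assume L: "K \<le> L"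
        have "shannon (\<lambda>x. (trunc L x, trunc K x)) = shannon (trunc L)"
          by (rule shannon_cong) (auto simp: trunc_def intro: truncated_letter_mono[OF _ L])
        then show "shannon (orbit_word shift (trunc L) n) \<le> ?h n + real n * (shannon (trunc L) - shannon (trunc K))"
          using forward.shannon_orbit_word_le[OF simple_function_trunc simple_function_trunc, of L n K] by simp
      qed
    qed
    finally show ?thesis .
  qed
  have "(\<lambda>n. - ln C / real n + excess) \<longlonglongrightarrow> 0 + excess"
    by (intro tendsto_add tendsto_const tendsto_divide_0[OF tendsto_const] filterlim_at_top_imp_at_infinity filterlim_real_sequentially)
  moreover have "(\<lambda>n. ?h n / real n + (?H1 - shannon (trunc K))) \<longlonglongrightarrow> forward.entropy_rate (trunc K) + (?H1 - shannon (trunc K))"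
    by (intro tendsto_add tendsto_const forward.entropy_rate_LIMSEQ simple_function_trunc)
  ultimately have "0 + excess \<le> forward.entropy_rate (trunc K) + (?H1 - shannon (trunc K))"
  proof (rule LIMSEQ_le)
    show "\<exists>N. \<forall>n\<ge>N. - ln C / real n + excess \<le> ?h n / real n + (?H1 - shannon (trunc K))"
    proof (intro exI[of _ 1] allI impI)
      fix n :: nat assume n: "1 \<le> n"
      have "- ln C / real n + excess = (- ln C + real n * excess) / real n"
        using n by (simp add: add_divide_distrib diff_divide_distrib)
      also have "\<dots> \<le> (?h n + real n * (?H1 - shannon (trunc K))) / real n"
        by (intro divide_right_mono le n) simp
      also have "\<dots> = ?h n / real n + (?H1 - shannon (trunc K))"
        using n by (simp only: add_divide_distrib) simp
      finally show "- ln C / real n + excess \<le> ?h n / real n + (?H1 - shannon (trunc K))" .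
    qed
  qed
  then show ?thesis by simp
qed

text \<open>A word of length \<open>n\<close> in \<eta> is determined by \<open>n + m\<close>
  truncated letters, and the additional \<open>m\<close> letters do not affect the rate.\<close>

lemma entropy_rate_block_le:
  assumes \<eta>: "simple_function \<mu> \<eta>"
    and ref: "\<And>x y. x \<in> space \<mu> \<Longrightarrow> y \<in> space \<mu> \<Longrightarrow>
      orbit_word shift (trunc K) m x = orbit_word shift (trunc K) m y \<Longrightarrow> \<eta> x = \<eta> y"
  shows "forward.entropy_rate \<eta> \<le> excess"
proof -
  have le: "shannon (orbit_word shift \<eta> n) \<le> ln C + real (n + m) * excess" if n: "1 \<le> n" for n
  proof -
    have "shannon (orbit_word shift \<eta> n) \<le> shannon (orbit_word shift (trunc K) (n + m))"
    proof (rule shannon_mono)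
      fix x y assume xy: "x \<in> space \<mu>" "y \<in> space \<mu>" "orbit_word shift (trunc K) (n + m) x = orbit_word shift (trunc K) (n + m) y"
      show "orbit_word shift \<eta> n x = orbit_word shift \<eta> n y"
        unfolding orbit_word_eq_iff
      proof (intro allI impI)
        fix j assume "j < n"
        have "orbit_word shift (trunc K) m ((shift ^^ j) x) = orbit_word shift (trunc K) m ((shift ^^ j) y)"
          unfolding trunc_word_eq_iff
        proof (intro allI impI)
          fix i assume "i < m"
          with \<open>j < n\<close> xy(3)[unfolded trunc_word_eq_iff, rule_format, of "i + j"]
          show "truncated_letter K ((shift ^^ j) x (int i)) = truncated_letter K ((shift ^^ j) y (int i))"
            by (simp add: shift_funpow_apply)
        qed
        then show "\<eta> ((shift ^^ j) x) = \<eta> ((shift ^^ j) y)" using xy by (intro ref) auto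
      qed
    qed (intro forward.simple_function_orbit_word simple_function_trunc \<eta>)+
    also have "\<dots> \<le> ln C + real (n + m) * excess" using n by (intro shannon_trunc_le) simp
    finally show ?thesis .
  qed
  have "(\<lambda>n. (ln C + real m * excess) / real n + excess) \<longlonglongrightarrow> 0 + excess"
    by (intro tendsto_add tendsto_const tendsto_divide_0[OF tendsto_const] filterlim_at_top_imp_at_infinity filterlim_real_sequentially)
  then have "forward.entropy_rate \<eta> \<le> 0 + excess"
  proof (rule LIMSEQ_le[OF forward.entropy_rate_LIMSEQ[OF \<eta>]])
    show "\<exists>N. \<forall>n\<ge>N. shannon (orbit_word shift \<eta> n) / real n \<le> (ln C + real m * excess) / real n + excess"
    proof (intro exI[of _ 1] allI impI)
      fix n :: nat assume n: "1 \<le> n"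
      have "ln C + real (n + m) * excess = (ln C + real m * excess) + real n * excess" by (simp add: algebra_simps)
      with le[OF n] have "shannon (orbit_word shift \<eta> n) \<le> (ln C + real m * excess) + real n * excess" by simp
      from divide_right_mono[OF this, of "real n"] n
      show "shannon (orbit_word shift \<eta> n) / real n \<le> (ln C + real m * excess) / real n + excess"
        by (simp only: add_divide_distrib) simp
    qed
  qed
  then show ?thesis by simp
qed

section \<open>Entropy of arbitrary finite partitions\<close>

lemma window_approximation:
  fixes \<xi> :: "(int \<Rightarrow> 'e) \<Rightarrow> nat"
  assumes \<xi>: "simple_function \<mu> \<xi>" and "0 < e"
  shows "\<exists>\<zeta> N. simple_function \<mu> \<zeta> \<and> \<zeta> ` space \<mu> \<subseteq> insert 0 (\<xi> ` space \<mu>) \<and>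
    (\<forall>x\<in>two_sided A. \<forall>y\<in>two_sided A. window_agree N x y \<longrightarrow> \<zeta> x = \<zeta> y) \<and>
    prob {x \<in> space \<mu>. \<xi> x \<noteq> \<zeta> x} < e"
proof -
  let ?V = "\<xi> ` space \<mu>"
  have fin: "finite ?V" by (rule simple_functionD(1)[OF \<xi>])
  \<comment> \<open>One more than the number of values makes the total error strictly smaller than
    \<open>e\<close>.\<close>
  define e' where "e' = e / real (Suc (card ?V))"
  have e': "0 < e'" using \<open>0 < e\<close> by (simp add: e'_def)
  let ?D = "\<lambda>v. \<xi> -` {v} \<inter> space \<mu>"
  have D: "?D v \<in> sets \<mu>" for v using \<xi> by (simp only: simple_functionD)
  have "\<exists>S\<in>window_sets A. prob ((?D v - S) \<union> (S - ?D v)) < e'" for v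
    by (rule approximation_by_window_sets[OF D e'])
  then obtain S where S: "\<And>v. S v \<in> window_sets A" "\<And>v. prob ((?D v - S v) \<union> (S v - ?D v)) < e'" by metis
  have S_sets: "S v \<in> sets \<mu>" for v using window_sets_borel[OF S(1)] by (simp add: sets_\<mu>)
  have "\<forall>v. \<exists>N. \<forall>x\<in>two_sided A. \<forall>y\<in>two_sided A. window_agree N x y \<longrightarrow> x \<in> S v \<longrightarrow> y \<in> S v"
    using S(1) unfolding window_sets_def by blast
  then obtain N where N: "\<And>v x y. x \<in> two_sided A \<Longrightarrow> y \<in> two_sided A \<Longrightarrow> window_agree (N v) x y \<Longrightarrow> x \<in> S v \<Longrightarrow> y \<in> S v" by metis
  define M where "M = Max (insert 0 (N ` ?V))"
  have M: "N v \<le> M" if "v \<in> ?V" for v unfolding M_def using that fin by (intro Max_ge) auto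
  have agree: "x \<in> S v \<longleftrightarrow> y \<in> S v" if "x \<in> two_sided A" "y \<in> two_sided A" "window_agree M x y" "v \<in> ?V" for x y v
    using N[of x y v] N[of y x v] window_agree_mono[OF that(3) M[OF that(4)]] window_agree_sym that by blast
  \<comment> \<open>The approximating sets may overlap or leave gaps; the least value decides in the
    first case, 0 in the second. Away from all the errors exactly one set contains \<open>x\<close>,
    the one belonging to \<open>\<xi> x\<close>.\<close>
  define \<zeta> where "\<zeta> x = (if \<exists>v\<in>?V. x \<in> S v then LEAST v. v \<in> ?V \<and> x \<in> S v else 0)" for x
  have \<zeta>V: "\<zeta> x \<in> insert 0 ?V" for x
  proof (cases "\<exists>v\<in>?V. x \<in> S v")
    case True
    then have "(LEAST v. v \<in> ?V \<and> x \<in> S v) \<in> ?V" using LeastI_ex[of "\<lambda>v. v \<in> ?V \<and> x \<in> S v"] by blast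
    then show ?thesis using True by (simp add: \<zeta>_def)
  qed (simp add: \<zeta>_def)
  have \<zeta>_agree: "\<zeta> x = \<zeta> y" if "x \<in> two_sided A" "y \<in> two_sided A" "window_agree M x y" for x y
  proof -
    have "(v \<in> ?V \<and> x \<in> S v) = (v \<in> ?V \<and> y \<in> S v)" for v using agree[OF that] by blast
    then show ?thesis unfolding \<zeta>_def Bex_def by presburger
  qed
  have "simple_function \<mu> \<zeta>"
    unfolding simple_function_def
  proof (intro conjI ballI)
    show "finite (\<zeta> ` space \<mu>)" by (rule finite_subset[OF image_subsetI[OF \<zeta>V]]) (simp only: finite_insert fin)
    fix v
    have "\<zeta> -` {v} \<inter> space \<mu> \<in> window_sets A"
      unfolding window_sets_def mem_Collect_eq
    proof (intro conjI exI[of _ M] ballI impI)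
      fix x y assume "x \<in> two_sided A" "y \<in> two_sided A" "window_agree M x y" "x \<in> \<zeta> -` {v} \<inter> space \<mu>"
      then show "y \<in> \<zeta> -` {v} \<inter> space \<mu>" using \<zeta>_agree[of x y] by simp
    qed simp
    from window_sets_borel[OF this] show "\<zeta> -` {v} \<inter> space \<mu> \<in> sets \<mu>" by (simp add: sets_\<mu>)
  qed
  moreover have "prob {x \<in> space \<mu>. \<xi> x \<noteq> \<zeta> x} < e"
  proof -
    have "{x \<in> space \<mu>. \<xi> x \<noteq> \<zeta> x} \<subseteq> (\<Union>v\<in>?V. (?D v - S v) \<union> (S v - ?D v))"
    proof
      fix x assume x: "x \<in> {x \<in> space \<mu>. \<xi> x \<noteq> \<zeta> x}"
      show "x \<in> (\<Union>v\<in>?V. (?D v - S v) \<union> (S v - ?D v))"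
      proof (rule ccontr)
        assume "x \<notin> (\<Union>v\<in>?V. (?D v - S v) \<union> (S v - ?D v))"
        then have "x \<in> S v \<longleftrightarrow> \<xi> x = v" if "v \<in> ?V" for v using x that by blast
        moreover have "\<xi> x \<in> ?V" using x by simp
        ultimately have "(v \<in> ?V \<and> x \<in> S v) = (v = \<xi> x)" for v by metis
        moreover have "(LEAST v. v = \<xi> x) = \<xi> x" by (rule Least_equality) auto
        ultimately have "\<zeta> x = \<xi> x" unfolding \<zeta>_def Bex_def by simp
        with x show False by simp
      qed
    qed
    then have "prob {x \<in> space \<mu>. \<xi> x \<noteq> \<zeta> x} \<le> prob (\<Union>v\<in>?V. (?D v - S v) \<union> (S v - ?D v))"
      by (rule finite_measure_mono) (intro sets.finite_UN fin sets.Un sets.Diff D S_sets)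
    also have "\<dots> \<le> (\<Sum>v\<in>?V. prob ((?D v - S v) \<union> (S v - ?D v)))"
      by (intro measure_UNION_le fin sets.Un sets.Diff D S_sets)
    also have "\<dots> \<le> (\<Sum>v\<in>?V. e')" using S(2) by (intro sum_mono less_imp_le)
    also have "\<dots> < e" using \<open>0 < e\<close> by (simp add: e'_def field_simps)
    finally show ?thesis .
  qed
  ultimately show ?thesis
    by (intro exI[of _ \<zeta>] exI[of _ M] conjI ballI impI image_subsetI \<zeta>V) (simp_all only: \<zeta>_agree)
qed

text \<open>The partition \<xi> is approximated by window functions \<open>\<zeta> k\<close>, and
  the conditional entropy of \<xi> given \<open>\<zeta> k\<close> tends to 0.\<close>

lemma entropy_rate_le_excess:
  fixes \<xi> :: "(int \<Rightarrow> 'e) \<Rightarrow> nat"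
  assumes \<xi>: "simple_function \<mu> \<xi>"
  shows "forward.entropy_rate \<xi> \<le> excess"
proof -
  define R where "R k \<zeta> N \<longleftrightarrow> simple_function \<mu> \<zeta> \<and> \<zeta> ` space \<mu> \<subseteq> insert 0 (\<xi> ` space \<mu>) \<and>
    (\<forall>x\<in>two_sided A. \<forall>y\<in>two_sided A. window_agree N x y \<longrightarrow> \<zeta> x = \<zeta> y) \<and>
    prob {x \<in> space \<mu>. \<xi> x \<noteq> \<zeta> x} < 1 / real (Suc k)" for k N and \<zeta> :: "(int \<Rightarrow> 'e) \<Rightarrow> nat"
  have "\<forall>k. \<exists>\<zeta> N. R k \<zeta> N"
    unfolding R_def by (intro allI window_approximation[OF \<xi>]) simp
  then obtain \<zeta> N where R: "\<And>k. R k (\<zeta> k) (N k)" by metis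
  have \<zeta>: "\<And>k. simple_function \<mu> (\<zeta> k)" "\<And>k. \<zeta> k ` space \<mu> \<subseteq> insert 0 (\<xi> ` space \<mu>)"
    "\<And>k x y. x\<in>two_sided A \<Longrightarrow> y\<in>two_sided A \<Longrightarrow> window_agree (N k) x y \<Longrightarrow> \<zeta> k x = \<zeta> k y"
    "\<And>k. prob {x \<in> space \<mu>. \<xi> x \<noteq> \<zeta> k x} < 1 / real (Suc k)"
  proof -
    fix k
    note Rk = R[of k, unfolded R_def]
    show "simple_function \<mu> (\<zeta> k)" by (rule conjunct1[OF Rk])
    show "\<zeta> k ` space \<mu> \<subseteq> insert 0 (\<xi> ` space \<mu>)" by (rule conjunct1[OF conjunct2[OF Rk]])
    show "prob {x \<in> space \<mu>. \<xi> x \<noteq> \<zeta> k x} < 1 / real (Suc k)" by (rule conjunct2[OF conjunct2[OF conjunct2[OF Rk]]])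
    fix x y assume "x\<in>two_sided A" "y\<in>two_sided A" "window_agree (N k) x y"
    with conjunct1[OF conjunct2[OF conjunct2[OF Rk]]] show "\<zeta> k x = \<zeta> k y" by blast
  qed
  have "(\<lambda>k. prob {x \<in> space \<mu>. \<xi> x \<noteq> \<zeta> k x}) \<longlonglongrightarrow> 0"
  proof (rule tendsto_sandwich[OF _ _ tendsto_const])
    show "(\<lambda>k. 1 / real (Suc k)) \<longlonglongrightarrow> 0" using LIMSEQ_inverse_real_of_nat by (simp add: inverse_eq_divide)
  qed (use \<zeta>(4) in \<open>auto intro!: always_eventually less_imp_le\<close>)
  then have lim: "(\<lambda>k. shannon (\<lambda>x. (\<xi> x, \<zeta> k x)) - shannon (\<zeta> k)) \<longlonglongrightarrow> 0"
    by (intro conditional_shannon_tendsto_0[where V="insert 0 (\<xi> ` space \<mu>)"] \<xi> \<zeta>) (use simple_functionD(1)[OF \<xi>] in auto)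
  have le: "forward.entropy_rate \<xi> \<le> excess + (shannon (\<lambda>x. (\<xi> x, \<zeta> k x)) - shannon (\<zeta> k))" for k
  proof -
    let ?n = "N k"
    \<comment> \<open>Composition with this power of the shift changes no entropy and moves the
      window into the future, where a forward word of length \<open>2 * ?n + 1\<close> determines
      it.\<close>
    let ?s = "\<lambda>h x. h ((shift ^^ ?n) x)"
    let ?\<eta> = "orbit_word shift (trunc ?n) (Suc (2 * ?n))"
    note sf = forward.simple_function_comp_funpow[OF \<xi>, of ?n] forward.simple_function_comp_funpow[OF \<zeta>(1)[of k], of ?n]
    have "forward.entropy_rate (?s \<xi>) \<le> forward.entropy_rate ?\<eta> + (shannon (\<lambda>x. (?s \<xi> x, ?s (\<zeta> k) x)) - shannon (?s (\<zeta> k)))"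
    proof (rule forward.entropy_rate_le[OF sf(1) forward.simple_function_orbit_word[OF simple_function_trunc] sf(2)])
      fix x y assume xy: "x \<in> space \<mu>" "y \<in> space \<mu>" "?\<eta> x = ?\<eta> y"
      have "window_agree ?n ((shift ^^ ?n) x) ((shift ^^ ?n) y)"
        unfolding window_agree_def
      proof (intro allI impI)
        fix i assume i: "\<bar>i\<bar> \<le> int ?n"
        then have "nat (i + int ?n) < Suc (2 * ?n)" "int (nat (i + int ?n)) = i + int ?n" by auto
        with xy(3)[unfolded trunc_word_eq_iff] have "truncated_letter ?n (x (i + int ?n)) = truncated_letter ?n (y (i + int ?n))" by metis
        then show "truncated_letter ?n ((shift ^^ ?n) x i) = truncated_letter ?n ((shift ^^ ?n) y i)" by (simp add: shift_funpow_apply)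
      qed
      then show "?s (\<zeta> k) x = ?s (\<zeta> k) y" using xy by (intro \<zeta>(3)) auto
    qed
    also have "forward.entropy_rate ?\<eta> \<le> excess"
      by (rule entropy_rate_block_le[OF forward.simple_function_orbit_word[OF simple_function_trunc]])
    also have "shannon (\<lambda>x. (?s \<xi> x, ?s (\<zeta> k) x)) = shannon (\<lambda>x. (\<xi> x, \<zeta> k x))"
      using forward.shannon_comp_funpow[OF simple_function_Pair[OF \<xi> \<zeta>(1)[of k]], of ?n] by simp
    also have "shannon (?s (\<zeta> k)) = shannon (\<zeta> k)" by (rule forward.shannon_comp_funpow[OF \<zeta>(1)])
    also have "forward.entropy_rate (?s \<xi>) = forward.entropy_rate \<xi>"
    proof -
      have "orbit_word shift (?s \<xi>) n = (\<lambda>x. orbit_word shift \<xi> n ((shift ^^ ?n) x))" for n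
        by (auto simp: orbit_word_def fun_eq_iff funpow_add[unfolded comp_def, THEN fun_cong, symmetric] add.commute)
      then show ?thesis
        unfolding forward.entropy_rate_def
        by (simp add: forward.shannon_comp_funpow[OF forward.simple_function_orbit_word[OF \<xi>]])
    qed
    finally show ?thesis by simp
  qed
  have "(\<lambda>k. excess + (shannon (\<lambda>x. (\<xi> x, \<zeta> k x)) - shannon (\<zeta> k))) \<longlonglongrightarrow> excess + 0"
    by (intro tendsto_add tendsto_const lim)
  then have "forward.entropy_rate \<xi> \<le> excess + 0"
    by (rule LIMSEQ_le_const) (use le in blast)
  then show ?thesis by simp
qed

theorem ks_entropy_gibbs: "ks_entropy \<mu> shift = ereal excess"
  unfolding forward.ks_entropy_eq
proof (rule antisym)
  show "(SUP \<xi>\<in>{\<xi> :: (int \<Rightarrow> 'e) \<Rightarrow> nat. simple_function \<mu> \<xi>}. ereal (forward.entropy_rate \<xi>)) \<le> ereal excess"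
    by (rule SUP_least) (use entropy_rate_le_excess in simp)
  show "ereal excess \<le> (SUP \<xi>\<in>{\<xi> :: (int \<Rightarrow> 'e) \<Rightarrow> nat. simple_function \<mu> \<xi>}. ereal (forward.entropy_rate \<xi>))" (is "_ \<le> ?S")
  proof (rule ereal_le_epsilon2)
    fix e :: real assume "0 < e"
    let ?H1 = "LINT x|\<mu>. - ln (prob (cylinder A (word_of x 1)))"
    have "shannon (orbit_word shift (trunc L) 1) = shannon (trunc L)" for L
      by (rule shannon_cong) (auto simp: orbit_word_eq_iff)
    then have "(\<lambda>K. shannon (trunc K)) \<longlonglongrightarrow> ?H1" using shannon_trunc_tendsto[of 1] by simp
    from order_tendstoD(1)[OF this, of "?H1 - e"] \<open>0 < e\<close> obtain K where "?H1 - e < shannon (trunc K)"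
      by (auto simp: eventually_sequentially)
    with entropy_rate_trunc_ge[of K] have "excess \<le> forward.entropy_rate (trunc K) + e" by linarith
    then have "ereal excess \<le> ereal (forward.entropy_rate (trunc K)) + ereal e" by simp
    also have "\<dots> \<le> ?S + ereal e"
      by (intro add_right_mono SUP_upper) (simp add: simple_function_trunc)
    finally show "ereal excess \<le> ?S + ereal e" .
  qed
qed

end

section \<open>Conditional measures of Gibbs states\<close>

text \<open>Each term is at most the sum of the contributions measured from the two ends, and these
  form two geometric series.\<close>

lemma sum_exp_min_le:
  fixes \<beta> :: real assumes "0 < \<beta>"
  shows "(\<Sum>j<n. exp (- \<beta> * real (min j (n - 1 - j)))) \<le> 2 / (1 - exp (- \<beta>))"
proof -
  let ?q = "exp (- \<beta>)"
  have q: "0 < ?q" "?q < 1" using assms by auto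
  have pow: "exp (- \<beta> * real j) = ?q ^ j" for j by (simp add: exp_of_nat_mult[symmetric] mult.commute)
  have geo: "(\<Sum>j<n. ?q ^ j) \<le> 1 / (1 - ?q)"
    using q by (subst sum_gp_strict) (auto simp: divide_right_mono)
  have "(\<Sum>j<n. exp (- \<beta> * real (min j (n - 1 - j)))) \<le> (\<Sum>j<n. ?q ^ j + ?q ^ (n - 1 - j))"
    using q unfolding pow by (intro sum_mono) (auto simp: min_def)
  also have "\<dots> = (\<Sum>j<n. ?q ^ j) + (\<Sum>j<n. ?q ^ (n - 1 - j))" by (rule sum.distrib)
  also have "(\<Sum>j<n. ?q ^ (n - 1 - j)) = (\<Sum>j<n. ?q ^ j)"
    using sum.nat_diff_reindex[of "\<lambda>j. ?q ^ j" n] by simp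
  finally show ?thesis using geo by simp
qed

text \<open>At time \<open>j\<close> the shifted points agree on the window of radius
  \<open>min j (n - 1 - j)\<close>: the free past limits it on one side, the free future on the
  other.\<close>

lemma hoelder_distortion:
  assumes "hoelder A g"
  shows "\<exists>K\<ge>0. \<forall>n. \<forall>x\<in>two_sided A. \<forall>y\<in>two_sided A. (\<forall>j<n. x (int j) = y (int j)) \<longrightarrow>
    \<bar>birkhoff_sum g n x - birkhoff_sum g n y\<bar> \<le> K"
proof -
  obtain \<beta> L where \<beta>: "0 < \<beta>" and L: "\<And>\<omega> \<tau>. \<omega> \<in> two_sided A \<Longrightarrow> \<tau> \<in> two_sided A \<Longrightarrow> \<omega> 0 = \<tau> 0 \<Longrightarrow>
       \<bar>g \<omega> - g \<tau>\<bar> \<le> L * two_sided_dist \<beta> \<omega> \<tau>"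
    using assms unfolding hoelder_def by blast
  let ?K = "\<bar>L\<bar> * (2 / (1 - exp (- \<beta>)))"
  have "\<bar>birkhoff_sum g n x - birkhoff_sum g n y\<bar> \<le> ?K"
    if x: "x \<in> two_sided A" and y: "y \<in> two_sided A" and agree: "\<forall>j<n. x (int j) = y (int j)" for n x y
  proof -
    have "\<bar>birkhoff_sum g n x - birkhoff_sum g n y\<bar> = \<bar>\<Sum>j<n. g ((shift ^^ j) x) - g ((shift ^^ j) y)\<bar>"
      by (simp add: birkhoff_sum_def sum_subtractf)
    also have "\<dots> \<le> (\<Sum>j<n. \<bar>g ((shift ^^ j) x) - g ((shift ^^ j) y)\<bar>)" by (rule sum_abs)
    also have "\<dots> \<le> (\<Sum>j<n. \<bar>L\<bar> * exp (- \<beta> * real (min j (n - 1 - j))))"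
    proof (rule sum_mono)
      fix j assume "j \<in> {..<n}"
      then have j: "j < n" by simp
      have win: "(shift ^^ j) x k = (shift ^^ j) y k" if "\<bar>k\<bar> \<le> int (min j (n - 1 - j))" for k
      proof -
        have "k + int j = int (nat (k + int j))" "nat (k + int j) < n" using that j by auto
        then show ?thesis using agree unfolding shift_funpow_apply by metis
      qed
      have "\<bar>g ((shift ^^ j) x) - g ((shift ^^ j) y)\<bar> \<le> L * two_sided_dist \<beta> ((shift ^^ j) x) ((shift ^^ j) y)"
        using x y win[of 0] by (intro L) auto
      also have "\<dots> \<le> \<bar>L\<bar> * two_sided_dist \<beta> ((shift ^^ j) x) ((shift ^^ j) y)"
        by (intro mult_right_mono) (auto simp: two_sided_dist_eq_one_sided_dist one_sided_dist_nonneg)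
      also have "\<dots> \<le> \<bar>L\<bar> * exp (- \<beta> * real (min j (n - 1 - j)))"
        using \<beta> win by (intro mult_left_mono two_sided_dist_le) auto
      finally show "\<bar>g ((shift ^^ j) x) - g ((shift ^^ j) y)\<bar> \<le> \<bar>L\<bar> * exp (- \<beta> * real (min j (n - 1 - j)))" .
    qed
    also have "\<dots> = \<bar>L\<bar> * (\<Sum>j<n. exp (- \<beta> * real (min j (n - 1 - j))))" by (simp add: sum_distrib_left)
    also have "\<dots> \<le> ?K" by (intro mult_left_mono sum_exp_min_le \<beta>) simp
    finally show ?thesis .
  qed
  moreover have "0 \<le> ?K" using \<beta> by simp
  ultimately show ?thesis by blast
qed

definition one_sided_cylinder :: "('e \<Rightarrow> 'e \<Rightarrow> bool) \<Rightarrow> 'e list \<Rightarrow> (nat \<Rightarrow> 'e) set" where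
  "one_sided_cylinder A w = {x \<in> one_sided A. \<forall>j<length w. x j = w ! j}"

lemma one_sided_cylinder_sets [measurable]: "one_sided_cylinder A w \<in> sets (one_sided_borel A)"
  unfolding one_sided_cylinder_def
  by (rule open_one_sided_borel) (auto intro!: exI[of _ "length w"])

definition prefix_sets :: "('e \<Rightarrow> 'e \<Rightarrow> bool) \<Rightarrow> (nat \<Rightarrow> 'e) set set" where
  "prefix_sets A = {S. S \<subseteq> one_sided A \<and>
    (\<exists>k. \<forall>x\<in>S. \<forall>y\<in>one_sided A. (\<forall>j<k. x j = y j) \<longrightarrow> y \<in> S)}"

lemma algebra_prefix_sets: "algebra (one_sided A) (prefix_sets A)"
  unfolding algebra_iff_Un
proof (intro conjI ballI)
  show "prefix_sets A \<subseteq> Pow (one_sided A)" "{} \<in> prefix_sets A" by (auto simp: prefix_sets_def)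
  fix S assume "S \<in> prefix_sets A"
  then obtain k where S: "S \<subseteq> one_sided A" and k: "\<And>x y. x \<in> S \<Longrightarrow> y \<in> one_sided A \<Longrightarrow> (\<forall>j<k. x j = y j) \<Longrightarrow> y \<in> S"
    unfolding prefix_sets_def by blast
  have "\<forall>x\<in>one_sided A - S. \<forall>y\<in>one_sided A. (\<forall>j<k. x j = y j) \<longrightarrow> y \<in> one_sided A - S"
  proof (intro ballI impI)
    fix x y assume "x \<in> one_sided A - S" "y \<in> one_sided A" "\<forall>j<k. x j = y j"
    then show "y \<in> one_sided A - S" using k[of y x] by auto
  qed
  then show "one_sided A - S \<in> prefix_sets A"
    unfolding prefix_sets_def by blast
  fix S' assume "S' \<in> prefix_sets A"
  then obtain k' where S': "S' \<subseteq> one_sided A" and k': "\<And>x y. x \<in> S' \<Longrightarrow> y \<in> one_sided A \<Longrightarrow> (\<forall>j<k'. x j = y j) \<Longrightarrow> y \<in> S'"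
    unfolding prefix_sets_def by blast
  have "\<forall>x\<in>S \<union> S'. \<forall>y\<in>one_sided A. (\<forall>j<max k k'. x j = y j) \<longrightarrow> y \<in> S \<union> S'"
  proof (intro ballI impI)
    fix x y assume xy: "x \<in> S \<union> S'" "y \<in> one_sided A" "\<forall>j<max k k'. x j = y j"
    then have "\<forall>j<k. x j = y j" "\<forall>j<k'. x j = y j" by simp_all
    then show "y \<in> S \<union> S'" using k[of x y] k'[of x y] xy by blast
  qed
  then show "S \<union> S' \<in> prefix_sets A"
    unfolding prefix_sets_def using S S' by blast
qed

lemma sets_eq_sigma_prefix_sets:
  "sets (one_sided_borel (A :: 'e::countable \<Rightarrow> _)) = sigma_sets (one_sided A) (prefix_sets A)"
proof
  have "range (\<lambda>w. {x \<in> one_sided A. \<forall>j<length w. x j = w ! j}) \<subseteq> prefix_sets A"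
  proof clarify
    fix w
    show "{x \<in> one_sided A. \<forall>j<length w. x j = w ! j} \<in> prefix_sets A"
      unfolding prefix_sets_def by (auto intro!: exI[of _ "length w"])
  qed
  then show "sets (one_sided_borel A) \<subseteq> sigma_sets (one_sided A) (prefix_sets A)"
    unfolding sets_one_sided_borel by (rule sigma_sets_mono')
  have "prefix_sets A \<subseteq> sets (one_sided_borel A)"
  proof
    fix S assume "S \<in> prefix_sets A"
    then show "S \<in> sets (one_sided_borel A)"
      unfolding prefix_sets_def by (intro open_one_sided_borel) blast+
  qed
  from sets.sigma_sets_subset[OF this]
  show "sigma_sets (one_sided A) (prefix_sets A) \<subseteq> sets (one_sided_borel A)" by simp
qed

lemma emeasure_prefix_set_le:
  fixes A :: "'e::countable \<Rightarrow> 'e \<Rightarrow> bool"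
  assumes sets: "sets M = sets (one_sided_borel A)" "sets N = sets (one_sided_borel A)"
    and le: "\<And>w. w \<noteq> [] \<Longrightarrow> emeasure M (one_sided_cylinder A w) \<le> emeasure N (one_sided_cylinder A w)"
    and S: "S \<in> prefix_sets A"
  shows "emeasure M S \<le> emeasure N S"
proof -
  obtain k where SA: "S \<subseteq> one_sided A" and k: "\<And>x y. x \<in> S \<Longrightarrow> y \<in> one_sided A \<Longrightarrow> (\<forall>j<k. x j = y j) \<Longrightarrow> y \<in> S"
    using S unfolding prefix_sets_def by blast
  \<comment> \<open>Length \<open>Suc k\<close> instead of \<open>k\<close> keeps the words
    nonempty, as the hypothesis on cylinders demands.\<close>
  let ?I = "{w. length w = Suc k \<and> one_sided_cylinder A w \<inter> S \<noteq> {}}"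
  have mem: "x \<in> one_sided_cylinder A (map x [0..<Suc k])" if "x \<in> one_sided A" for x
    using that by (simp add: one_sided_cylinder_def del: upt_Suc)
  have eq: "S = (\<Union>w\<in>?I. one_sided_cylinder A w)"
  proof (intro subset_antisym subsetI)
    fix x assume "x \<in> S"
    then show "x \<in> (\<Union>w\<in>?I. one_sided_cylinder A w)"
      using mem[of x] SA by (intro UN_I[of "map x [0..<Suc k]"]) auto
  next
    fix x assume "x \<in> (\<Union>w\<in>?I. one_sided_cylinder A w)"
    then obtain w y where w: "length w = Suc k" "x \<in> one_sided_cylinder A w" "y \<in> one_sided_cylinder A w" "y \<in> S" by auto
    show "x \<in> S" by (rule k[OF w(4)]) (use w in \<open>auto simp: one_sided_cylinder_def\<close>)
  qed
  have disj: "disjoint_family_on (one_sided_cylinder A) ?I"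
    unfolding disjoint_family_on_def
  proof (intro ballI impI, rule ccontr)
    fix v w assume vw: "v \<in> ?I" "w \<in> ?I" "v \<noteq> w" "one_sided_cylinder A v \<inter> one_sided_cylinder A w \<noteq> {}"
    then obtain x where x: "\<forall>j<Suc k. x j = v ! j" "\<forall>j<Suc k. x j = w ! j" by (auto simp: one_sided_cylinder_def)
    have "v = w" by (rule nth_equalityI) (use vw x in auto)
    with vw show False by simp
  qed
  have UN: "emeasure M' S = (\<integral>\<^sup>+w. emeasure M' (one_sided_cylinder A w) \<partial>count_space ?I)"
    if "sets M' = sets (one_sided_borel A)" for M'
    by (subst eq, rule emeasure_UN_countable[OF _ _ disj]) (auto simp: that)
  show ?thesis
    unfolding UN[OF sets(1)] UN[OF sets(2)] by (intro nn_integral_mono le) auto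
qed

text \<open>This replaces a differentiation theorem for measures. The inequality of integrals
  extends from cylinders to prefix sets by additivity, and from these to the set where
  \<open>g < f\<close> by approximation, the functions being bounded. There the integrand
  \<open>g - f\<close> is negative, so the set is null.\<close>

lemma AE_le_of_cylinders:
  fixes A :: "'e::countable \<Rightarrow> 'e \<Rightarrow> bool" and f g :: "(nat \<Rightarrow> 'e) \<Rightarrow> real"
  assumes "finite_measure M" and sets: "sets M = sets (one_sided_borel A)"
    and [measurable]: "f \<in> borel_measurable M" "g \<in> borel_measurable M"
    and b: "0 \<le> b" and f: "\<And>x. x \<in> space M \<Longrightarrow> 0 \<le> f x \<and> f x \<le> b" and g: "\<And>x. x \<in> space M \<Longrightarrow> 0 \<le> g x \<and> g x \<le> b"
    and le: "\<And>w. w \<noteq> [] \<Longrightarrow> (LINT x|M. indicator (one_sided_cylinder A w) x * f x) \<le> (LINT x|M. indicator (one_sided_cylinder A w) x * g x)"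
  shows "AE x in M. f x \<le> g x"
proof -
  interpret finite_measure M by fact
  have space: "space M = one_sided A" using sets_eq_imp_space_eq[OF sets] by simp
  have int: "integrable M (\<lambda>x. indicator S x * h x)" if "S \<in> sets M" and [measurable]: "h \<in> borel_measurable M" and "\<And>x. x \<in> space M \<Longrightarrow> \<bar>h x\<bar> \<le> b" for S h
    by (rule integrable_const_bound[where B="\<bar>b\<bar>"]) (use that in \<open>auto simp: indicator_def intro: order_trans abs_ge_self\<close>)
  have intf: "integrable M (\<lambda>x. indicator S x * f x)" and intg: "integrable M (\<lambda>x. indicator S x * g x)"
    and inth: "integrable M (\<lambda>x. indicator S x * (g x - f x))" if "S \<in> sets M" for S
    using f g by (intro int that; force)+
  have dens: "emeasure (density M (\<lambda>x. ennreal (h x))) S = ennreal (LINT x|M. indicator S x * h x)"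
    if S: "S \<in> sets M" and [measurable]: "h \<in> borel_measurable M" and h: "\<And>x. x \<in> space M \<Longrightarrow> 0 \<le> h x \<and> h x \<le> b" for S h
  proof -
    have "emeasure (density M (\<lambda>x. ennreal (h x))) S = (\<integral>\<^sup>+x. ennreal (indicator S x * h x) \<partial>M)"
      using S by (subst emeasure_density) (auto intro!: nn_integral_cong simp: indicator_def)
    also have "\<dots> = ennreal (LINT x|M. indicator S x * h x)"
      using h by (intro nn_integral_eq_integral int S) (auto simp: indicator_def)
    finally show ?thesis .
  qed
  have prefix: "0 \<le> (LINT x|M. indicator S x * (g x - f x))" if S: "S \<in> prefix_sets A" for S
  proof -
    have S_sets: "S \<in> sets M" using S by (auto simp: sets sets_eq_sigma_prefix_sets)
    have "emeasure (density M (\<lambda>x. ennreal (f x))) S \<le> emeasure (density M (\<lambda>x. ennreal (g x))) S"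
    proof (rule emeasure_prefix_set_le[OF _ _ _ S])
      fix w :: "'e list" assume "w \<noteq> []"
      moreover have "one_sided_cylinder A w \<in> sets M" by (simp add: sets one_sided_cylinder_sets)
      ultimately show "emeasure (density M (\<lambda>x. ennreal (f x))) (one_sided_cylinder A w) \<le> emeasure (density M (\<lambda>x. ennreal (g x))) (one_sided_cylinder A w)"
        using f g le by (subst (1 2) dens) (auto intro!: ennreal_leI)
    qed (simp_all add: sets)
    then have "ennreal (LINT x|M. indicator S x * f x) \<le> ennreal (LINT x|M. indicator S x * g x)"
      using f g S_sets by (subst (asm) (1 2) dens) auto
    moreover have "0 \<le> (LINT x|M. indicator S x * g x)"
      by (rule Bochner_Integration.integral_nonneg_AE) (use g in \<open>auto simp: indicator_def\<close>)
    ultimately have "(LINT x|M. indicator S x * f x) \<le> (LINT x|M. indicator S x * g x)" by (simp add: ennreal_le_iff)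
    then show ?thesis
      using intf[OF S_sets] intg[OF S_sets] by (simp add: right_diff_distrib)
  qed
  define B where "B = {x \<in> space M. g x < f x}"
  have B: "B \<in> sets M" unfolding B_def by measurable
  have approx: "- (b * e) \<le> (LINT x|M. indicator B x * (g x - f x))" if "0 < e" for e
  proof -
    obtain S where S: "S \<in> prefix_sets A" "measure M ((B - S) \<union> (S - B)) < e"
      using approximation_by_algebra[OF _ _ B \<open>0 < e\<close>, of "prefix_sets A"] algebra_prefix_sets[of A] sets_eq_sigma_prefix_sets[of A]
      unfolding space sets by blast
    have S_sets: "S \<in> sets M" using S(1) by (auto simp: sets sets_eq_sigma_prefix_sets)
    let ?D = "(B - S) \<union> (S - B)"
    have D: "?D \<in> sets M" using B S_sets by auto
      have "(LINT x|M. indicator S x * (g x - f x)) - (LINT x|M. indicator B x * (g x - f x)) =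
        (LINT x|M. indicator S x * (g x - f x) - indicator B x * (g x - f x))"
        by (rule Bochner_Integration.integral_diff[symmetric]) (intro inth S_sets B)+
      also have "\<dots> \<le> (LINT x|M. indicator ?D x * b)"
      proof (rule integral_mono)
        show "integrable M (\<lambda>x. indicator ?D x * b)" using D by (auto simp: emeasure_eq_measure)
        fix x assume "x \<in> space M"
        with f[of x] g[of x] show "indicator S x * (g x - f x) - indicator B x * (g x - f x) \<le> indicator ?D x * b"
          by (auto simp: indicator_def)
      qed (intro Bochner_Integration.integrable_diff inth S_sets B)
      also have "\<dots> = b * measure M ?D" using D by (simp add: emeasure_eq_measure)
      also have "\<dots> \<le> b * e" using S(2) b by (intro mult_left_mono) auto
      finally show ?thesis using prefix[OF S(1)] by linarith
  qed
  have "0 \<le> (LINT x|M. indicator B x * (g x - f x))"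
  proof (rule field_le_epsilon)
    fix e :: real assume "0 < e"
    \<comment> \<open>The denominator \<open>\<bar>b\<bar> + 1\<close> also covers
      \<open>b = 0\<close>.\<close>
    have "- (b * (e / (\<bar>b\<bar> + 1))) \<le> (LINT x|M. indicator B x * (g x - f x))"
      using \<open>0 < e\<close> by (intro approx) (simp add: divide_pos_pos add_nonneg_pos)
    moreover have "b * (e / (\<bar>b\<bar> + 1)) \<le> e"
    proof -
      have "b * e \<le> e * (\<bar>b\<bar> + 1)" using \<open>0 < e\<close> b by (simp add: algebra_simps)
      then show ?thesis by (simp add: divide_le_eq add_nonneg_pos)
    qed
    ultimately show "0 \<le> (LINT x|M. indicator B x * (g x - f x)) + e" by linarith
  qed
  moreover have "(LINT x|M. indicator B x * (f x - g x)) = - (LINT x|M. indicator B x * (g x - f x))"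
    by (subst Bochner_Integration.integral_minus[symmetric]) (simp add: algebra_simps)
  moreover have nn: "AE x in M. 0 \<le> indicator B x * (f x - g x)" by (auto simp: B_def indicator_def)
  moreover have "0 \<le> (LINT x|M. indicator B x * (f x - g x))" using nn by (rule Bochner_Integration.integral_nonneg_AE)
  ultimately have "(LINT x|M. indicator B x * (f x - g x)) = 0" by linarith
  moreover have "integrable M (\<lambda>x. indicator B x * (f x - g x))"
  proof -
    have "(\<lambda>x. indicator B x * (f x - g x)) = (\<lambda>x. - (indicator B x * (g x - f x)))" by (simp add: algebra_simps)
    then show ?thesis using Bochner_Integration.integrable_minus[OF inth[OF B]] by (simp only:)
  qed
  ultimately have "AE x in M. indicator B x * (f x - g x) = 0"
    using integral_nonneg_eq_0_iff_AE nn by blast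
  then show ?thesis
    using AE_space by eventually_elim (auto simp: B_def indicator_def split: if_splits)
qed

text \<open>The word \<open>a\<close> is read from left to right at the coordinates
  \<open>- length a, ..., - 1\<close>.\<close>

definition past_cylinder :: "('e \<Rightarrow> 'e \<Rightarrow> bool) \<Rightarrow> 'e list \<Rightarrow> (int \<Rightarrow> 'e) set" where
  "past_cylinder A a = {y \<in> two_sided A. (unshift ^^ length a) y \<in> cylinder A a}"

abbreviation past_word :: "(int \<Rightarrow> 'e) \<Rightarrow> nat \<Rightarrow> 'e list" where
  "past_word \<tau> n \<equiv> word_of ((unshift ^^ n) \<tau>) n"

lemma mem_past_cylinder_iff:
  "y \<in> past_cylinder A a \<longleftrightarrow> y \<in> two_sided A \<and> past_word y (length a) = a"
  by (simp add: past_cylinder_def mem_cylinder_iff)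

lemma past_word_eq_iff:
  "past_word x n = past_word y n \<longleftrightarrow> (\<forall>k. - int n \<le> k \<and> k < 0 \<longrightarrow> x k = y k)"
proof
  assume eq: "past_word x n = past_word y n"
  show "\<forall>k. - int n \<le> k \<and> k < 0 \<longrightarrow> x k = y k"
  proof (intro allI impI)
    fix k assume k: "- int n \<le> k \<and> k < 0"
    then have j: "nat (k + int n) < n" "int (nat (k + int n)) - int n = k" by auto
    have "past_word x n ! nat (k + int n) = past_word y n ! nat (k + int n)" by (simp only: eq)
    then have "x (int (nat (k + int n)) - int n) = y (int (nat (k + int n)) - int n)"
      using j(1) by (simp add: unshift_funpow_apply)
    then show "x k = y k" unfolding j(2) .
  qed
qed (simp add: unshift_funpow_apply)

lemma past_cylinder_sets [measurable]:
  "past_cylinder (A :: 'e::countable \<Rightarrow> _) a \<in> sets (two_sided_borel A)"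
proof (rule open_two_sided_borel)
  fix x assume x: "x \<in> past_cylinder A a"
  have "y \<in> past_cylinder A a" if "y \<in> two_sided A" "agree_upto (length a) x y" for y
  proof -
    have "past_word x (length a) = past_word y (length a)"
      unfolding past_word_eq_iff using that by (auto simp: agree_upto_def)
    with x that show ?thesis by (simp add: mem_past_cylinder_iff)
  qed
  then show "\<exists>n. \<forall>y\<in>two_sided A. agree_upto n x y \<longrightarrow> y \<in> past_cylinder A a" by blast
qed (auto simp: past_cylinder_def)

definition splice :: "(int \<Rightarrow> 'e) \<Rightarrow> (int \<Rightarrow> 'e) \<Rightarrow> int \<Rightarrow> 'e" where
  "splice x y = (\<lambda>k. if k < 0 then x k else y k)"

lemma splice_two_sided:
  assumes "x \<in> two_sided A" "y \<in> two_sided A" "x 0 = y 0" shows "splice x y \<in> two_sided A"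
  unfolding two_sided_def
proof (intro CollectI allI)
  fix k
  have x: "A (x k) (x (k + 1))" and y: "A (y k) (y (k + 1))" using assms by (auto simp: two_sided_def)
  consider "k + 1 < 0" | "k = - 1" | "0 \<le> k" by atomize_elim arith
  then show "A (splice x y k) (splice x y (k + 1))"
  proof cases
    case 2
    with x assms(3) show ?thesis by (simp add: splice_def)
  qed (use x y in \<open>simp_all add: splice_def\<close>)
qed

lemma pi0_apply: "pi0 \<tau> j = \<tau> (int j)"
  by (simp add: tail_from_def)

lemma pi0_eq_iff: "pi0 x = pi0 y \<longleftrightarrow> (\<forall>k\<ge>0. x k = y k)"
  unfolding fun_eq_iff pi0_apply by (metis nonneg_int_cases of_nat_0_le_iff)

lemma pi0_splice: "pi0 (splice x y) = pi0 y"
  by (simp add: fun_eq_iff pi0_apply splice_def)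

lemma past_fiber_sets: "past_fiber (A :: 'e::countable \<Rightarrow> _) \<omega> \<in> sets (two_sided_borel A)"
proof -
  have "past_fiber A \<omega> = (\<Inter>j. {x \<in> two_sided A. x (int j) = \<omega> j})"
    by (auto simp: past_fiber_def fun_eq_iff pi0_apply)
  then show ?thesis by (auto intro!: sets.countable_INT coordinate_set_two_sided)
qed

lemma pi0_vimage_cylinder: "pi0 -` one_sided_cylinder A w \<inter> two_sided A = cylinder A w"
  by (auto simp: one_sided_cylinder_def cylinder_def pi0_apply tail_from_one_sided)

section \<open>The Gibbs property on past cylinders\<close>

context gibbs
begin

abbreviation future :: "(nat \<Rightarrow> 'e) measure" where
  "future \<equiv> distr \<mu> (one_sided_borel A) pi0"

lemma measurable_pi0 [measurable]: "pi0 \<in> measurable \<mu> (one_sided_borel A)"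
  unfolding measurable_cong_sets[OF sets_\<mu> refl] by (rule measurable_tail_from)

lemma prob_space_future: "prob_space future"
  by (rule prob_space_distr) measurable

lemma prob_vimage_unshift: "S \<in> sets \<mu> \<Longrightarrow> prob ((unshift ^^ n) -` S \<inter> two_sided A) = prob S"
  using measure_distr[OF backward.funpow_measurable, of S n] by (simp add: backward.funpow_invariant)

lemma past_cylinder_inter_cylinder:
  "past_cylinder A a \<inter> cylinder A w = (unshift ^^ length a) -` cylinder A (a @ w) \<inter> two_sided A"
proof -
  have "x \<in> cylinder A v \<Longrightarrow> x \<in> two_sided A" for x v by (simp add: cylinder_def)
  then show ?thesis by (auto simp: past_cylinder_def cylinder_append shift_unshift_funpow)
qed

text \<open>It depends on the whole of \<tau> and not just on the last \<open>n\<close> letters of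
  its past; bounded distortion controls the difference.\<close>

definition past_weight :: "nat \<Rightarrow> (int \<Rightarrow> 'e) \<Rightarrow> real" where
  "past_weight n \<tau> = birkhoff_sum \<psi> n ((unshift ^^ n) \<tau>) - P * real n"

text \<open>By invariance the intersection has the mass of the cylinder of \<open>a @ w\<close>. The
  Birkhoff sum over this word splits at the origin, so dividing by the mass of the cylinder of
  \<open>w\<close> leaves the weight of the past word, uniformly in \<open>w\<close>.\<close>

lemma past_cylinder_gibbs:
  obtains D where "1 \<le> D"
    "\<And>a w \<tau>. a \<noteq> [] \<Longrightarrow> w \<noteq> [] \<Longrightarrow> \<tau> \<in> past_cylinder A a \<Longrightarrow> \<tau> 0 = hd w \<Longrightarrow>
      prob (past_cylinder A a \<inter> cylinder A w) \<le> D * exp (past_weight (length a) \<tau>) * prob (cylinder A w) \<and>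
      exp (past_weight (length a) \<tau>) / D * prob (cylinder A w) \<le> prob (past_cylinder A a \<inter> cylinder A w)"
    "\<And>n \<tau> \<tau>'. \<tau> \<in> two_sided A \<Longrightarrow> \<tau>' \<in> two_sided A \<Longrightarrow> past_word \<tau> n = past_word \<tau>' n \<Longrightarrow>
      exp (past_weight n \<tau>) \<le> D * exp (past_weight n \<tau>')"
proof -
  obtain K where K: "0 \<le> K" and dist: "\<And>n x y. x \<in> two_sided A \<Longrightarrow> y \<in> two_sided A \<Longrightarrow> (\<forall>j<n. x (int j) = y (int j)) \<Longrightarrow>
      \<bar>birkhoff_sum \<psi> n x - birkhoff_sum \<psi> n y\<bar> \<le> K"
    using hoelder_distortion[OF \<psi>_hoelder] by blast
  \<comment> \<open>One \<open>C\<close> for the word \<open>a @ w\<close>, one for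
    \<open>w\<close>, and \<open>exp K\<close> for exchanging points with the same past
    word.\<close>
  define D where "D = C\<^sup>2 * exp K"
  have C2: "1 \<le> C\<^sup>2" using C by simp
  have expK: "1 \<le> exp K" using K by simp
  have D1: "1 \<le> D" unfolding D_def using mult_mono[OF C2 expK] by simp
  have weight: "exp (past_weight n \<tau>) \<le> exp K * exp (past_weight n \<tau>')"
    if "\<tau> \<in> two_sided A" "\<tau>' \<in> two_sided A" "past_word \<tau> n = past_word \<tau>' n" for n \<tau> \<tau>'
  proof -
    have "\<bar>birkhoff_sum \<psi> n ((unshift ^^ n) \<tau>) - birkhoff_sum \<psi> n ((unshift ^^ n) \<tau>')\<bar> \<le> K"
      using that by (intro dist) auto
    then show ?thesis unfolding past_weight_def exp_add[symmetric] by simp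
  qed
  show thesis
  proof (rule that[OF D1])
    fix n \<tau> \<tau>' assume "\<tau> \<in> two_sided A" "\<tau>' \<in> two_sided A" "past_word \<tau> n = past_word \<tau>' n"
    from weight[OF this] have "exp (past_weight n \<tau>) \<le> 1 * (exp K * exp (past_weight n \<tau>'))" by simp
    also have "\<dots> \<le> C\<^sup>2 * (exp K * exp (past_weight n \<tau>'))" using C2 by (intro mult_right_mono) auto
    finally show "exp (past_weight n \<tau>) \<le> D * exp (past_weight n \<tau>')" by (simp add: D_def mult.assoc)
  next
    fix a w \<tau> assume ne: "a \<noteq> []" "w \<noteq> []" and \<tau>: "\<tau> \<in> past_cylinder A a" "\<tau> 0 = hd w"
    let ?n = "length a" and ?k = "length w"
    have eq: "prob (past_cylinder A a \<inter> cylinder A w) = prob (cylinder A (a @ w))"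
      unfolding past_cylinder_inter_cylinder by (rule prob_vimage_unshift) simp
    show "prob (past_cylinder A a \<inter> cylinder A w) \<le> D * exp (past_weight ?n \<tau>) * prob (cylinder A w) \<and>
      exp (past_weight ?n \<tau>) / D * prob (cylinder A w) \<le> prob (past_cylinder A a \<inter> cylinder A w)"
    proof (cases "cylinder A w = {}")
      case True
      then show ?thesis by simp
    next
      case False
      then obtain y where y: "y \<in> cylinder A w" by blast
      have \<tau>A: "\<tau> \<in> two_sided A" using \<tau> by (simp add: past_cylinder_def)
      \<comment> \<open>The past of \<tau> joined to the future of a point of the cylinder of
        \<open>w\<close>; shifted back it lies in the cylinder of \<open>a @ w\<close>.\<close>
      let ?x = "splice \<tau> y" and ?z = "(unshift ^^ ?n) (splice \<tau> y)"
      have "y 0 = hd w" using y ne(2) by (auto simp: cylinder_def hd_conv_nth)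
      then have xA: "?x \<in> two_sided A" using \<tau> \<tau>A y by (intro splice_two_sided) (auto simp: cylinder_def)
      have xw: "?x \<in> cylinder A w" using y xA by (auto simp: cylinder_def splice_def)
      have pw: "past_word ?x ?n = past_word \<tau> ?n" by (simp only: past_word_eq_iff) (simp add: splice_def)
      then have xa: "?x \<in> past_cylinder A a" using xA \<tau>(1) unfolding mem_past_cylinder_iff pw by blast
      then have z: "?z \<in> cylinder A (a @ w)" using xw past_cylinder_inter_cylinder[of a w] by blast
      then have zw: "word_of ?z (?n + ?k) = a @ w" by (simp add: mem_cylinder_iff)
      have xw': "word_of ?x ?k = w" using xw by (simp add: mem_cylinder_iff)
      have split: "exp (birkhoff_sum \<psi> (?n + ?k) ?z - P * real (?n + ?k)) =
          exp (past_weight ?n ?x) * exp (birkhoff_sum \<psi> ?k ?x - P * real ?k)"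
        unfolding birkhoff_sum_add exp_add[symmetric] past_weight_def shift_unshift_funpow
        by (simp add: algebra_simps)
      let ?e = "exp (birkhoff_sum \<psi> ?k ?x - P * real ?k)"
      have zA: "?z \<in> two_sided A" using xA by simp
      have n1: "1 \<le> ?n + ?k" "1 \<le> ?k" using ne by (auto simp: Suc_le_eq)
      have up: "prob (cylinder A (a @ w)) \<le> C * (exp (past_weight ?n ?x) * ?e)"
        using gibbs_upper[OF n1(1) zA] unfolding zw split .
      have lo: "(exp (past_weight ?n ?x) * ?e) / C \<le> prob (cylinder A (a @ w))"
        using gibbs_lower[OF n1(1) zA] unfolding zw split .
      have upw: "prob (cylinder A w) \<le> C * ?e" using gibbs_upper[OF n1(2) xA] unfolding xw' .
      have low: "?e \<le> C * prob (cylinder A w)"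
        using gibbs_lower[OF n1(2) xA] C unfolding xw' by (simp add: divide_le_eq mult.commute)
      have "prob (cylinder A (a @ w)) \<le> C * ((exp K * exp (past_weight ?n \<tau>)) * (C * prob (cylinder A w)))"
        by (rule order_trans[OF up]) (use C low weight[OF xA \<tau>A pw] in \<open>intro mult_left_mono mult_mono, auto\<close>)
      moreover have "exp (past_weight ?n \<tau>) * prob (cylinder A w) \<le> (exp K * exp (past_weight ?n ?x)) * (C * ?e)"
        using C upw weight[OF \<tau>A xA pw[symmetric]] by (intro mult_mono) auto
      then have "exp (past_weight ?n \<tau>) / D * prob (cylinder A w) \<le> (exp K * exp (past_weight ?n ?x)) * (C * ?e) / D"
        using D1 by (simp add: divide_right_mono)
      moreover have "(exp K * exp (past_weight ?n ?x)) * (C * ?e) / D = (exp (past_weight ?n ?x) * ?e) / C"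
        using C by (simp add: D_def power2_eq_square)
      ultimately show ?thesis unfolding eq using lo by (simp add: D_def power2_eq_square mult_ac)
    qed
  qed
qed

end

locale gibbs_conditionals = gibbs +
  fixes \<mu>c :: "(nat \<Rightarrow> 'a) \<Rightarrow> (int \<Rightarrow> 'a) measure"
  assumes rokhlin: "rokhlin_conditionals A \<mu> \<mu>c"
begin

lemma measurable_conditional_prob_algebra:
  "\<mu>c \<in> measurable (one_sided_borel A) (prob_algebra (two_sided_borel A))"
  using rokhlin unfolding rokhlin_conditionals_def by (rule conjunct1)

lemma conditional_prob_space: "\<omega> \<in> one_sided A \<Longrightarrow> prob_space (\<mu>c \<omega>)"
  and conditional_sets: "\<omega> \<in> one_sided A \<Longrightarrow> sets (\<mu>c \<omega>) = sets (two_sided_borel A)"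
proof -
  assume "\<omega> \<in> one_sided A"
  then have "\<mu>c \<omega> \<in> space (prob_algebra (two_sided_borel A))"
    using measurable_space[OF measurable_conditional_prob_algebra] by simp
  then show "prob_space (\<mu>c \<omega>)" "sets (\<mu>c \<omega>) = sets (two_sided_borel A)"
    by (auto simp: space_prob_algebra)
qed

lemma conditional_fiber: "AE \<omega> in future. AE \<tau> in \<mu>c \<omega>. \<tau> \<in> past_fiber A \<omega>"
proof -
  have "AE \<omega> in future. emeasure (\<mu>c \<omega>) (past_fiber A \<omega>) = 1" using rokhlin by (simp add: rokhlin_conditionals_def)
  then show ?thesis using AE_space
  proof eventually_elim
    case (elim \<omega>)
    then have \<omega>: "\<omega> \<in> one_sided A" by simp
    interpret c: prob_space "\<mu>c \<omega>" by (rule conditional_prob_space[OF \<omega>])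
    have "past_fiber A \<omega> \<in> sets (\<mu>c \<omega>)" by (simp add: conditional_sets[OF \<omega>] past_fiber_sets)
    moreover have "c.prob (past_fiber A \<omega>) = 1" using elim by (simp add: measure_def)
    ultimately show ?case by (simp add: c.AE_in_set_eq_1)
  qed
qed

lemma measurable_conditional_kernel: "\<mu>c \<in> measurable (one_sided_borel A) (subprob_algebra (two_sided_borel A))"
  by (rule measurable_prob_algebraD[OF measurable_conditional_prob_algebra])

lemma measurable_conditional:
  "E \<in> sets (two_sided_borel A) \<Longrightarrow> (\<lambda>\<omega>. measure (\<mu>c \<omega>) E) \<in> borel_measurable (one_sided_borel A)"
  by (rule measurable_compose[OF measurable_conditional_kernel measurable_measure_subprob_algebra])

text \<open>The conditional measure at \<omega> lives on sequences with future \<omega>, so a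
  condition on the future becomes an indicator in front.\<close>

lemma disintegration:
  assumes E: "E \<in> sets (two_sided_borel A)" and B: "B \<in> sets (one_sided_borel A)"
  shows "(LINT \<omega>|future. indicator B \<omega> * measure (\<mu>c \<omega>) E) = prob (E \<inter> (pi0 -` B \<inter> two_sided A))"
proof -
  let ?F = "E \<inter> (pi0 -` B \<inter> two_sided A)"
  have F: "?F \<in> sets (two_sided_borel A)"
    using E measurable_sets[OF measurable_tail_from B, of 0] by auto
  have "emeasure \<mu> ?F = (\<integral>\<^sup>+\<omega>. emeasure (\<mu>c \<omega>) ?F \<partial>future)"
    using rokhlin F by (simp add: rokhlin_conditionals_def)
  also have "\<dots> = (\<integral>\<^sup>+\<omega>. ennreal (indicator B \<omega> * measure (\<mu>c \<omega>) E) \<partial>future)"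
  proof (rule nn_integral_cong_AE)
    show "AE \<omega> in future. emeasure (\<mu>c \<omega>) ?F = ennreal (indicator B \<omega> * measure (\<mu>c \<omega>) E)"
      using conditional_fiber AE_space
    proof eventually_elim
      case (elim \<omega>)
      then have \<omega>: "\<omega> \<in> one_sided A" by simp
      interpret c: prob_space "\<mu>c \<omega>" by (rule conditional_prob_space[OF \<omega>])
      have "emeasure (\<mu>c \<omega>) ?F = emeasure (\<mu>c \<omega>) (if \<omega> \<in> B then E else {})"
      proof (rule emeasure_eq_AE)
        show "AE \<tau> in \<mu>c \<omega>. \<tau> \<in> ?F \<longleftrightarrow> \<tau> \<in> (if \<omega> \<in> B then E else {})"
          using elim(1) by eventually_elim (auto simp: past_fiber_def)
      qed (use E F in \<open>auto simp: conditional_sets[OF \<omega>]\<close>)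
      then show ?case by (simp add: c.emeasure_eq_measure indicator_def)
    qed
  qed
  also have "\<dots> = ennreal (LINT \<omega>|future. indicator B \<omega> * measure (\<mu>c \<omega>) E)"
  proof (rule nn_integral_eq_integral)
    interpret f: prob_space future by (rule prob_space_future)
    have "measure (\<mu>c \<omega>) E \<le> 1" if "\<omega> \<in> one_sided A" for \<omega>
      using prob_space.prob_le_1[OF conditional_prob_space[OF that]] .
    moreover have "(\<lambda>\<omega>. indicator B \<omega> * measure (\<mu>c \<omega>) E) \<in> borel_measurable future"
      unfolding measurable_distr_eq1
      by (intro borel_measurable_times borel_measurable_indicator B measurable_conditional E)
    ultimately show "integrable future (\<lambda>\<omega>. indicator B \<omega> * measure (\<mu>c \<omega>) E)"
      by (intro f.integrable_const_bound[where B=1] AE_I2) (auto simp: indicator_def)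
  qed simp
  finally have "ennreal (prob ?F) = ennreal (LINT \<omega>|future. indicator B \<omega> * measure (\<mu>c \<omega>) E)"
    by (simp add: emeasure_eq_measure)
  then show ?thesis
    by (subst (asm) ennreal_inj) (auto intro!: Bochner_Integration.integral_nonneg)
qed

lemma AE_conditional:
  assumes "AE \<tau> in \<mu>. Q \<tau>"
  shows "AE \<omega> in future. AE \<tau> in \<mu>c \<omega>. Q \<tau>"
proof -
  from assms obtain N where N: "{\<tau> \<in> space \<mu>. \<not> Q \<tau>} \<subseteq> N" "emeasure \<mu> N = 0" "N \<in> sets \<mu>" by (rule AE_E)
  then have N': "N \<in> sets (two_sided_borel A)" by (simp add: sets_\<mu>)
  have meas: "(\<lambda>\<omega>. emeasure (\<mu>c \<omega>) N) \<in> borel_measurable future"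
    unfolding measurable_distr_eq1
    by (rule measurable_compose[OF measurable_conditional_kernel measurable_emeasure_subprob_algebra[OF N']])
  have "(\<integral>\<^sup>+\<omega>. emeasure (\<mu>c \<omega>) N \<partial>future) = 0"
    using rokhlin N N' by (simp add: rokhlin_conditionals_def)
  then have "AE \<omega> in future. emeasure (\<mu>c \<omega>) N = 0" using meas by (simp add: nn_integral_0_iff_AE)
  then show ?thesis using AE_space
  proof eventually_elim
    case (elim \<omega>)
    then have \<omega>: "\<omega> \<in> one_sided A" by simp
    have "space (\<mu>c \<omega>) = two_sided A" using sets_eq_imp_space_eq[OF conditional_sets[OF \<omega>]] by simp
    moreover have "N \<in> null_sets (\<mu>c \<omega>)" using elim N' by (auto simp: null_sets_def conditional_sets[OF \<omega>])
    ultimately show ?case using N(1) by (intro AE_I'[of N]) auto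
  qed
qed

text \<open>The averages of the conditional mass over one-sided cylinders satisfy the Gibbs bounds
  uniformly, and \<open>AE_le_of_cylinders\<close> localises this to almost every \<omega>.\<close>

theorem conditional_gibbs:
  "\<exists>D\<ge>1. AE \<omega> in future. \<forall>n\<ge>1. \<forall>\<tau>\<in>past_fiber A \<omega>.
      exp (past_weight n \<tau>) / D \<le> measure (\<mu>c \<omega>) (past_cylinder A (past_word \<tau> n)) \<and>
      measure (\<mu>c \<omega>) (past_cylinder A (past_word \<tau> n)) \<le> D * exp (past_weight n \<tau>)"
proof -
  obtain D where D: "1 \<le> D" and bound: "\<And>a w \<tau>. a \<noteq> [] \<Longrightarrow> w \<noteq> [] \<Longrightarrow> \<tau> \<in> past_cylinder A a \<Longrightarrow> \<tau> 0 = hd w \<Longrightarrow>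
      prob (past_cylinder A a \<inter> cylinder A w) \<le> D * exp (past_weight (length a) \<tau>) * prob (cylinder A w) \<and>
      exp (past_weight (length a) \<tau>) / D * prob (cylinder A w) \<le> prob (past_cylinder A a \<inter> cylinder A w)"
    and weight: "\<And>n \<tau> \<tau>'. \<tau> \<in> two_sided A \<Longrightarrow> \<tau>' \<in> two_sided A \<Longrightarrow> past_word \<tau> n = past_word \<tau>' n \<Longrightarrow>
      exp (past_weight n \<tau>) \<le> D * exp (past_weight n \<tau>')"
    by (rule past_cylinder_gibbs) blast
  interpret f: prob_space future by (rule prob_space_future)
  have ae: "AE \<omega> in future. \<omega> 0 = \<tau> 0 \<longrightarrow>
      exp (past_weight (length a) \<tau>) / D \<le> measure (\<mu>c \<omega>) (past_cylinder A a) \<and>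
      measure (\<mu>c \<omega>) (past_cylinder A a) \<le> D * exp (past_weight (length a) \<tau>)"
    if a: "a \<noteq> []" and \<tau>: "\<tau> \<in> past_cylinder A a" for a \<tau>
  proof -
    let ?E = "past_cylinder A a" and ?e = "exp (past_weight (length a) \<tau>)"
    let ?B = "{\<omega> \<in> one_sided A. \<omega> 0 = \<tau> 0}"
    have B: "?B \<in> sets (one_sided_borel A)" by (rule coordinate_set_one_sided)
    define f where "f \<omega> = indicator ?B \<omega> * measure (\<mu>c \<omega>) ?E" for \<omega>
    define g where "g c \<omega> = indicator ?B \<omega> * c" for c :: real and \<omega>
    have [measurable]: "f \<in> borel_measurable future" "g c \<in> borel_measurable future" for c
      unfolding f_def[abs_def] g_def[abs_def] using B measurable_conditional[OF past_cylinder_sets] by (auto intro!: borel_measurable_times)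
    \<comment> \<open>Any common bound for the conditional probability and the two constants
      compared with it.\<close>
    let ?b = "1 + D * ?e + ?e / D"
    have b: "0 \<le> ?b" "1 \<le> ?b" "D * ?e \<le> ?b" "?e / D \<le> ?b" using D by auto
    have f_bounds: "0 \<le> f \<omega> \<and> f \<omega> \<le> ?b" if "\<omega> \<in> space future" for \<omega>
    proof -
      have "measure (\<mu>c \<omega>) ?E \<le> 1" using prob_space.prob_le_1[OF conditional_prob_space] that by simp
      then show ?thesis using b by (auto simp: f_def indicator_def)
    qed
    have g_bounds: "0 \<le> g c \<omega> \<and> g c \<omega> \<le> ?b" if "0 \<le> c" "c \<le> ?b" for c \<omega>
      using that b by (auto simp: g_def indicator_def)
    have int_f: "(LINT \<omega>|future. indicator (one_sided_cylinder A w) \<omega> * f \<omega>) = (if hd w = \<tau> 0 then prob (?E \<inter> cylinder A w) else 0)"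
      and int_g: "(LINT \<omega>|future. indicator (one_sided_cylinder A w) \<omega> * g c \<omega>) = (if hd w = \<tau> 0 then c * prob (cylinder A w) else 0)"
      if w: "w \<noteq> []" for w c
    proof -
      have inter: "indicator (one_sided_cylinder A w) \<omega> * indicator ?B \<omega> = (if hd w = \<tau> 0 then indicator (one_sided_cylinder A w) \<omega> else (0::real))" for \<omega>
        using w by (auto simp: indicator_def one_sided_cylinder_def hd_conv_nth)
      have "(LINT \<omega>|future. indicator (one_sided_cylinder A w) \<omega> * f \<omega>) =
          (LINT \<omega>|future. (if hd w = \<tau> 0 then indicator (one_sided_cylinder A w) \<omega> else 0) * measure (\<mu>c \<omega>) ?E)"
        unfolding f_def mult.assoc[symmetric] inter ..
      also have "\<dots> = (if hd w = \<tau> 0 then prob (?E \<inter> cylinder A w) else 0)"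
        using disintegration[OF past_cylinder_sets[of A a] one_sided_cylinder_sets[of A w]] by (simp add: pi0_vimage_cylinder)
      finally show "(LINT \<omega>|future. indicator (one_sided_cylinder A w) \<omega> * f \<omega>) = (if hd w = \<tau> 0 then prob (?E \<inter> cylinder A w) else 0)" .
      have "(LINT \<omega>|future. indicator (one_sided_cylinder A w) \<omega> * g c \<omega>) =
          (LINT \<omega>|future. (if hd w = \<tau> 0 then indicator (one_sided_cylinder A w) \<omega> else 0) * c)"
        unfolding g_def mult.assoc[symmetric] inter ..
      also have "\<dots> = (if hd w = \<tau> 0 then c * measure future (one_sided_cylinder A w) else 0)"
      proof -
        have "one_sided_cylinder A w \<inter> one_sided A = one_sided_cylinder A w" by (auto simp: one_sided_cylinder_def)
        then show ?thesis by (simp add: one_sided_cylinder_sets)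
      qed
      also have "measure future (one_sided_cylinder A w) = prob (cylinder A w)"
        using pi0_vimage_cylinder[of A w] by (subst measure_distr) (auto simp: one_sided_cylinder_sets)
      finally show "(LINT \<omega>|future. indicator (one_sided_cylinder A w) \<omega> * g c \<omega>) = (if hd w = \<tau> 0 then c * prob (cylinder A w) else 0)" .
    qed
    have up: "AE \<omega> in future. f \<omega> \<le> g (D * ?e) \<omega>"
    proof (rule AE_le_of_cylinders[where b="?b"])
      fix w :: "'a list" assume w: "w \<noteq> []"
      show "(LINT \<omega>|future. indicator (one_sided_cylinder A w) \<omega> * f \<omega>) \<le> (LINT \<omega>|future. indicator (one_sided_cylinder A w) \<omega> * g (D * ?e) \<omega>)"
        unfolding int_f[OF w] int_g[OF w] using bound[OF a w \<tau>] by simp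
    qed (use D b f_bounds g_bounds in \<open>auto simp: f.finite_measure_axioms\<close>)
    have lo: "AE \<omega> in future. g (?e / D) \<omega> \<le> f \<omega>"
    proof (rule AE_le_of_cylinders[where b="?b"])
      fix w :: "'a list" assume w: "w \<noteq> []"
      show "(LINT \<omega>|future. indicator (one_sided_cylinder A w) \<omega> * g (?e / D) \<omega>) \<le> (LINT \<omega>|future. indicator (one_sided_cylinder A w) \<omega> * f \<omega>)"
        unfolding int_f[OF w] int_g[OF w] using bound[OF a w \<tau>] by simp
    qed (use D b f_bounds g_bounds in \<open>auto simp: f.finite_measure_axioms\<close>)
    from up lo show ?thesis
      using AE_space
    proof eventually_elim
      case (elim \<omega>)
      then show ?case by (auto simp: f_def g_def indicator_def)
    qed
  qed
  \<comment> \<open>There are uncountably many \<tau> but only countably many pairs of a past word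
    and a zeroth letter. One representative per pair is treated; replacing it by \<tau> costs the
    second factor \<open>D\<close>.\<close>
  have "AE \<omega> in future. \<forall>a e. a \<noteq> [] \<longrightarrow> (\<forall>\<tau>. \<tau> \<in> past_cylinder A a \<longrightarrow> \<tau> 0 = e \<longrightarrow> \<omega> 0 = e \<longrightarrow>
      exp (past_weight (length a) \<tau>) / (D * D) \<le> measure (\<mu>c \<omega>) (past_cylinder A a) \<and>
      measure (\<mu>c \<omega>) (past_cylinder A a) \<le> D * D * exp (past_weight (length a) \<tau>))"
    unfolding AE_all_countable
  proof (intro allI)
    fix a e
    show "AE \<omega> in future. a \<noteq> [] \<longrightarrow> (\<forall>\<tau>. \<tau> \<in> past_cylinder A a \<longrightarrow> \<tau> 0 = e \<longrightarrow> \<omega> 0 = e \<longrightarrow>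
      exp (past_weight (length a) \<tau>) / (D * D) \<le> measure (\<mu>c \<omega>) (past_cylinder A a) \<and>
      measure (\<mu>c \<omega>) (past_cylinder A a) \<le> D * D * exp (past_weight (length a) \<tau>))"
    proof (cases "a \<noteq> [] \<and> (\<exists>\<tau>. \<tau> \<in> past_cylinder A a \<and> \<tau> 0 = e)")
      case False
      then show ?thesis by auto
    next
      case True
      then obtain \<sigma> where a: "a \<noteq> []" and \<sigma>: "\<sigma> \<in> past_cylinder A a" "\<sigma> 0 = e" by blast
      from ae[OF a \<sigma>(1)] show ?thesis
      proof eventually_elim
        case (elim \<omega>)
        show ?case
        proof (intro impI allI)
          fix \<tau> assume \<tau>: "\<tau> \<in> past_cylinder A a" "\<tau> 0 = e" "\<omega> 0 = e"
          let ?m = "measure (\<mu>c \<omega>) (past_cylinder A a)"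
          have pw: "past_word \<tau> (length a) = past_word \<sigma> (length a)" and A: "\<tau> \<in> two_sided A" "\<sigma> \<in> two_sided A"
            using \<tau>(1) \<sigma>(1) by (simp_all add: mem_past_cylinder_iff)
          have m: "exp (past_weight (length a) \<sigma>) / D \<le> ?m" "?m \<le> D * exp (past_weight (length a) \<sigma>)"
            using elim \<tau> \<sigma> by auto
          have "exp (past_weight (length a) \<tau>) / (D * D) \<le> D * exp (past_weight (length a) \<sigma>) / (D * D)"
            using weight[OF A pw] D by (intro divide_right_mono) auto
          also have "\<dots> = exp (past_weight (length a) \<sigma>) / D" using D by simp
          finally have "exp (past_weight (length a) \<tau>) / (D * D) \<le> ?m" using m by linarith
          moreover have "D * exp (past_weight (length a) \<sigma>) \<le> D * (D * exp (past_weight (length a) \<tau>))"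
            using weight[OF A(2,1) pw[symmetric]] D by (intro mult_left_mono) auto
          ultimately show "exp (past_weight (length a) \<tau>) / (D * D) \<le> ?m \<and> ?m \<le> D * D * exp (past_weight (length a) \<tau>)"
            using m by (simp add: mult.assoc)
        qed
      qed
    qed
  qed
  then have "AE \<omega> in future. \<forall>n\<ge>1. \<forall>\<tau>\<in>past_fiber A \<omega>.
      exp (past_weight n \<tau>) / (D * D) \<le> measure (\<mu>c \<omega>) (past_cylinder A (past_word \<tau> n)) \<and>
      measure (\<mu>c \<omega>) (past_cylinder A (past_word \<tau> n)) \<le> D * D * exp (past_weight n \<tau>)"
  proof eventually_elim
    case (elim \<omega>)
    show ?case
    proof (intro allI impI ballI)
      fix n :: nat and \<tau> assume n: "1 \<le> n" and \<tau>: "\<tau> \<in> past_fiber A \<omega>"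
      then have "\<tau> \<in> past_cylinder A (past_word \<tau> n)" "\<omega> 0 = \<tau> 0" "past_word \<tau> n \<noteq> []" "length (past_word \<tau> n) = n"
        by (auto simp: mem_past_cylinder_iff past_fiber_def pi0_apply)
      with elim[rule_format, of "past_word \<tau> n" \<tau> "\<tau> 0"] show "exp (past_weight n \<tau>) / (D * D) \<le> measure (\<mu>c \<omega>) (past_cylinder A (past_word \<tau> n)) \<and>
        measure (\<mu>c \<omega>) (past_cylinder A (past_word \<tau> n)) \<le> D * D * exp (past_weight n \<tau>)" by simp
    qed
  qed
  moreover have "1 \<le> D * D" using mult_mono[OF D D] D by simp
  ultimately show ?thesis by blast
qed

end

section \<open>The coding map and distortion\<close>

text \<open>Let \<open>q0\<close> be a point of the complement of the open image nearest to
  \<open>f p\<close>, and suppose its distance \<rho> is below \<open>m * \<delta>\<close>. On the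
  convex ball of radius \<rho> the inverse is Lipschitz with constant \<open>1 / m\<close>, so this
  ball is covered by the image of the compact ball of radius \<open>\<rho> / m < \<delta>\<close>.
  That image is closed and contains \<open>q0\<close>, a contradiction.\<close>

lemma expanding_map_covers_ball:
  fixes f :: "'a::euclidean_space \<Rightarrow> 'a"
  assumes inj: "inj_on f (ball p \<delta>)" and "0 < \<delta>" "0 < m"
    and D: "\<And>y. y \<in> ball p \<delta> \<Longrightarrow> \<exists>D. (f has_derivative D) (at y) \<and> (\<forall>v. m * norm v \<le> norm (D v))"
  shows "ball (f p) (m * \<delta>) \<subseteq> f ` ball p \<delta>"
proof (rule ccontr)
  let ?B = "ball p \<delta>"
  let ?V = "f ` ?B"
  assume "\<not> ball (f p) (m * \<delta>) \<subseteq> ?V"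
  then obtain q where q: "q \<in> ball (f p) (m * \<delta>)" "q \<notin> ?V" by blast
  have cont: "continuous_on ?B f"
    using D by (meson continuous_at_imp_continuous_on has_derivative_continuous)
  have openV: "open ?V" by (rule invariance_of_domain[OF cont open_ball inj])
  obtain g where g: "homeomorphism ?B ?V f g"
    by (rule invariance_of_domain_homeomorphism[OF open_ball cont _ inj]) auto
  have gf: "g (f x) = x" if "x \<in> ?B" for x using g that by (simp add: homeomorphism_def)
  have fg: "f (g y) = y" and gB: "g y \<in> ?B" if "y \<in> ?V" for y using g that by (auto simp: homeomorphism_def)
  have contg: "continuous_on ?V g" using g by (simp add: homeomorphism_def)
  have closed: "closed (- ?V)" and ne: "- ?V \<noteq> {}" using openV q by auto
  obtain q0 where q0: "q0 \<in> - ?V" "infdist (f p) (- ?V) = dist (f p) q0"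
    by (rule infdist_attains_inf[OF closed ne])
  define \<rho> where "\<rho> = dist (f p) q0"
  have p: "p \<in> ?B" using \<open>0 < \<delta>\<close> by simp
  have \<rho>: "0 < \<rho>" using q0(1) p by (auto simp: \<rho>_def)
  have \<rho>m: "\<rho> < m * \<delta>" using q infdist_le[of q "- ?V" "f p"] q0(2) by (auto simp: \<rho>_def)
  have sub: "ball (f p) \<rho> \<subseteq> ?V"
  proof
    fix y assume y: "y \<in> ball (f p) \<rho>"
    show "y \<in> ?V"
    proof (rule ccontr)
      assume "y \<notin> ?V"
      then have "infdist (f p) (- ?V) \<le> dist (f p) y" by (intro infdist_le) auto
      with y q0(2) show False by (simp add: \<rho>_def)
    qed
  qed
  have derg: "\<exists>g'. (g has_derivative g') (at y) \<and> onorm g' \<le> 1 / m" if y: "y \<in> ?V" for y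
  proof -
    obtain f' where f': "(f has_derivative f') (at (g y))" "\<And>v. m * norm v \<le> norm (f' v)"
      using D[OF gB[OF y]] by blast
    have lin: "linear f'" using f'(1) by (rule has_derivative_linear)
    have "inj f'"
    proof (rule injI)
      fix v w assume "f' v = f' w"
      then have "f' (v - w) = 0" using lin by (simp add: linear_diff)
      then have "m * norm (v - w) \<le> 0" using f'(2)[of "v - w"] by simp
      then show "v = w" using \<open>0 < m\<close> by (simp add: mult_le_0_iff)
    qed
    then obtain g' where g': "linear g'" "g' \<circ> f' = id" using linear_injective_left_inverse[OF lin] by blast
    have surj: "surj f'" using linear_inj_imp_surj[OF lin \<open>inj f'\<close>] .
    have "(g has_derivative g') (at y)"
    proof (rule has_derivative_inverse_basic[OF f'(1) _ g'(2) _ openV y fg])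
      show "bounded_linear g'" using g'(1) by (simp add: linear_conv_bounded_linear)
      show "continuous (at y) g" using contg openV y continuous_on_eq_continuous_at by blast
    qed
    moreover have "onorm g' \<le> 1 / m"
    proof (rule onorm_le)
      fix w
      obtain v where v: "w = f' v" using surj by blast
      have "g' w = v" using g'(2) by (simp add: v fun_eq_iff)
      then show "norm (g' w) \<le> 1 / m * norm w"
        using f'(2)[of v] \<open>0 < m\<close> by (simp add: v field_simps)
    qed
    ultimately show ?thesis by blast
  qed
  then obtain g' where g': "\<And>y. y \<in> ?V \<Longrightarrow> (g has_derivative g' y) (at y)" "\<And>y. y \<in> ?V \<Longrightarrow> onorm (g' y) \<le> 1 / m"
    by metis
  have "ball (f p) \<rho> \<subseteq> f ` cball p (\<rho> / m)"
  proof
    fix y assume y: "y \<in> ball (f p) \<rho>"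
    have "norm (g y - g (f p)) \<le> 1 / m * norm (y - f p)"
    proof (rule differentiable_bound[of "ball (f p) \<rho>" g g'])
      fix x assume "x \<in> ball (f p) \<rho>"
      then have "x \<in> ?V" using sub by blast
      then show "(g has_derivative g' x) (at x within ball (f p) \<rho>)" "onorm (g' x) \<le> 1 / m"
        using g' has_derivative_at_withinI by blast+
    qed (use y \<rho> in auto)
    also have "\<dots> \<le> \<rho> / m" using y \<open>0 < m\<close> by (simp add: dist_norm norm_minus_commute divide_right_mono)
    finally have "g y \<in> cball p (\<rho> / m)" by (simp add: gf[OF p] dist_norm norm_minus_commute)
    moreover have "f (g y) = y" using sub y by (intro fg) blast
    ultimately show "y \<in> f ` cball p (\<rho> / m)" by force
  qed
  moreover have "\<rho> / m < \<delta>" using \<rho>m \<open>0 < m\<close> by (simp add: pos_divide_less_eq mult.commute)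
  then have small: "cball p (\<rho> / m) \<subseteq> ?B" by auto
  then have "compact (f ` cball p (\<rho> / m))"
    by (intro compact_continuous_image continuous_on_subset[OF cont]) auto
  ultimately have "closure (ball (f p) \<rho>) \<subseteq> f ` cball p (\<rho> / m)"
    by (intro closure_minimal compact_imp_closed)
  moreover have "q0 \<in> closure (ball (f p) \<rho>)" using \<rho> by (simp add: \<rho>_def)
  ultimately show False using small q0(1) by blast
qed

section \<open>Compositions of the fiber maps\<close>

primrec forward_comp :: "((nat \<Rightarrow> 'e) \<Rightarrow> 'a \<Rightarrow> 'a) \<Rightarrow> (nat \<Rightarrow> 'e) \<Rightarrow> nat \<Rightarrow> 'a \<Rightarrow> 'a" where
  "forward_comp T \<omega> 0 = id"
| "forward_comp T \<omega> (Suc n) = T ((shift ^^ n) \<omega>) \<circ> forward_comp T \<omega> n"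

lemma nat_shift_funpow_apply: "(shift ^^ n) \<omega> k = \<omega> (k + n)" for \<omega> :: "nat \<Rightarrow> 'e"
  by (induction n arbitrary: \<omega>) (auto simp: shift_def funpow_swap1 add.commute add.left_commute)

lemma shift_one_sided [simp]: "\<omega> \<in> one_sided A \<Longrightarrow> (shift ^^ n) \<omega> \<in> one_sided A"
  by (simp add: one_sided_def nat_shift_funpow_apply)

lemma forward_comp_add: "forward_comp T \<omega> (m + n) = forward_comp T ((shift ^^ m) \<omega>) n \<circ> forward_comp T \<omega> m"
proof (induction n)
  case (Suc n)
  have "(shift ^^ n) ((shift ^^ m) \<omega>) = (shift ^^ (m + n)) \<omega>"
    by (simp add: fun_eq_iff nat_shift_funpow_apply algebra_simps)
  then show ?case using Suc by (simp add: comp_assoc)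
qed simp

lemma forward_comp_Suc: "forward_comp T \<omega> (Suc n) = forward_comp T (shift \<omega>) n \<circ> T \<omega>"
  using forward_comp_add[of T \<omega> 1 n] by simp

lemma shift_tail_from: "shift (tail_from (Suc k) \<tau>) = tail_from k \<tau>"
  by (simp add: fun_eq_iff shift_def tail_from_def)

lemma shift_funpow_tail_from: "j \<le> k \<Longrightarrow> (shift ^^ j) (tail_from k \<tau>) = tail_from (k - j) \<tau>"
  by (auto simp: fun_eq_iff nat_shift_funpow_apply tail_from_def algebra_simps of_nat_diff)

lemma pi0_shift_funpow: "pi0 ((shift ^^ n) x) = (shift ^^ n) (pi0 x)"
  by (simp add: fun_eq_iff nat_shift_funpow_apply pi0_apply shift_funpow_apply)

lemma pi0_unshift_funpow: "pi0 ((unshift ^^ n) x) = tail_from n x"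
  by (simp add: fun_eq_iff pi0_apply unshift_funpow_apply tail_from_def)

lemma tail_from_shift_funpow: "tail_from n ((shift ^^ n) x) = pi0 x"
  by (simp add: fun_eq_iff pi0_apply shift_funpow_apply tail_from_def)

text \<open>Each step of \<open>past_comp\<close> moves the starting fiber further back. The form on
  the right keeps the start fixed and adds maps on the outside, as the chain rule requires.\<close>

lemma past_comp_eq_forward_comp: "past_comp T \<tau> n = forward_comp T (tail_from n \<tau>) n"
proof (induction n)
  case (Suc n)
  then show ?case by (simp add: forward_comp_Suc shift_tail_from del: forward_comp.simps)
qed simp

context skew_product_smale
begin

lemma forward_comp_maps: "\<omega> \<in> one_sided A \<Longrightarrow> y \<in> Y \<omega> \<Longrightarrow> forward_comp T \<omega> n y \<in> Y ((shift ^^ n) \<omega>)"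
proof (induction n)
  case (Suc n)
  then show ?case using T_maps[of "(shift ^^ n) \<omega>"] by auto
qed simp

lemma forward_comp_continuous: "\<omega> \<in> one_sided A \<Longrightarrow> continuous_on (Y \<omega>) (forward_comp T \<omega> n)"
proof (induction n)
  case (Suc n)
  have "forward_comp T \<omega> n ` Y \<omega> \<subseteq> Y ((shift ^^ n) \<omega>)" using Suc.prems forward_comp_maps by blast
  then show ?case unfolding forward_comp.simps
    using Suc T_continuous[of "(shift ^^ n) \<omega>"] by (intro continuous_on_compose) (auto intro: continuous_on_subset)
qed (simp add: id_def)

lemma forward_comp_inj: "\<omega> \<in> one_sided A \<Longrightarrow> inj_on (forward_comp T \<omega> n) (Y \<omega>)"
proof (induction n)
  case (Suc n)
  have "forward_comp T \<omega> n ` Y \<omega> \<subseteq> Y ((shift ^^ n) \<omega>)" using Suc.prems forward_comp_maps by blast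
  then show ?case unfolding forward_comp.simps
    using Suc T_injective[of "(shift ^^ n) \<omega>"] by (intro comp_inj_on) (auto intro: inj_on_subset)
qed simp

lemma forward_comp_contracting:
  assumes c: "\<forall>\<omega>\<in>one_sided A. \<forall>y\<in>Y \<omega>. \<forall>z\<in>Y \<omega>. norm (T \<omega> y - T \<omega> z) \<le> inverse c * norm (y - z)" "1 < c"
    and "\<omega> \<in> one_sided A" "y \<in> Y \<omega>" "z \<in> Y \<omega>"
  shows "norm (forward_comp T \<omega> n y - forward_comp T \<omega> n z) \<le> inverse c ^ n * norm (y - z)"
proof (induction n)
  case (Suc n)
  have "norm (forward_comp T \<omega> (Suc n) y - forward_comp T \<omega> (Suc n) z) \<le>
      inverse c * norm (forward_comp T \<omega> n y - forward_comp T \<omega> n z)"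
    using assms forward_comp_maps by simp
  also have "\<dots> \<le> inverse c * (inverse c ^ n * norm (y - z))"
    using Suc assms(2) by (intro mult_left_mono) auto
  finally show ?case by (simp add: mult.assoc)
qed simp

end

context hoelder_conformal_smale
begin

abbreviation \<pi> :: "(int \<Rightarrow> 'e) \<Rightarrow> 'a" where "\<pi> \<equiv> pihat2 Y T"

abbreviation g :: "(int \<Rightarrow> 'e) \<Rightarrow> real" where "g \<equiv> log_deriv Y T"

text \<open>A limit point outside the closed neighbourhood of the complement of
  \<open>Y \<omega>\<close> has a ball inside \<open>Y \<omega>\<close>; being a limit point, it has
  a code in the fiber.\<close>

lemma inner_point:
  assumes \<omega>: "\<omega> \<in> one_sided A"
  shows "\<exists>x\<in>past_fiber A \<omega>. \<exists>\<delta>>0. ball (\<pi> x) \<delta> \<subseteq> Y \<omega>"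
proof -
  obtain \<delta> where "0 < \<delta>" "limit_fiber A Y T \<omega> \<inter> (Y \<omega> - closure (set_nbhd (- Y \<omega>) \<delta>)) \<noteq> {}"
    using inner_point_condition \<omega> by blast
  then obtain x where x: "x \<in> past_fiber A \<omega>" "\<pi> x \<notin> closure (set_nbhd (- Y \<omega>) \<delta>)"
    by (auto simp: limit_fiber_def)
  have "ball (\<pi> x) \<delta> \<subseteq> Y \<omega>"
  proof
    fix y assume y: "y \<in> ball (\<pi> x) \<delta>"
    show "y \<in> Y \<omega>"
    proof (rule ccontr)
      assume "y \<notin> Y \<omega>"
      then have "\<pi> x \<in> set_nbhd (- Y \<omega>) \<delta>" using y by (auto simp: set_nbhd_def dist_commute)
      with x(2) show False using closure_subset by blast
    qed
  qed
  with x \<open>0 < \<delta>\<close> show ?thesis by blast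
qed

lemma Y_nonempty: "\<omega> \<in> one_sided A \<Longrightarrow> Y \<omega> \<noteq> {}"
  using inner_point[of \<omega>] by fastforce

lemma Y_compact: "\<omega> \<in> one_sided A \<Longrightarrow> compact (Y \<omega>)"
  using Y_closed Y_bounded by (simp add: compact_eq_bounded_closed)

lemma past_image_compact: "\<tau> \<in> two_sided A \<Longrightarrow> compact (past_comp T \<tau> n ` Y (tail_from n \<tau>))"
  unfolding past_comp_eq_forward_comp
  by (intro compact_continuous_image forward_comp_continuous Y_compact tail_from_one_sided)

lemma past_image_mono:
  assumes "\<tau> \<in> two_sided A" "m \<le> n"
  shows "past_comp T \<tau> n ` Y (tail_from n \<tau>) \<subseteq> past_comp T \<tau> m ` Y (tail_from m \<tau>)"
  using assms(2)
proof (induction n rule: dec_induct)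
  case (step n)
  have "T (tail_from (Suc n) \<tau>) ` Y (tail_from (Suc n) \<tau>) \<subseteq> Y (tail_from n \<tau>)"
    using T_maps[OF tail_from_one_sided[OF assms(1)], of "Suc n"] by (simp add: shift_tail_from)
  then have "past_comp T \<tau> (Suc n) ` Y (tail_from (Suc n) \<tau>) \<subseteq> past_comp T \<tau> n ` Y (tail_from n \<tau>)" by auto
  with step show ?case by blast
qed simp

lemma past_image_diameter:
  "\<exists>c>1. \<exists>b\<ge>0. \<forall>\<tau>\<in>two_sided A. \<forall>n. \<forall>y\<in>past_comp T \<tau> n ` Y (tail_from n \<tau>).
    \<forall>z\<in>past_comp T \<tau> n ` Y (tail_from n \<tau>). norm (y - z) \<le> inverse c ^ n * b"
proof -
  obtain c where c: "1 < c" "\<forall>\<omega>\<in>one_sided A. \<forall>y\<in>Y \<omega>. \<forall>z\<in>Y \<omega>. norm (T \<omega> y - T \<omega> z) \<le> inverse c * norm (y - z)"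
    using T_contracting by blast
  have diam: "norm (y - z) \<le> diameter Y0" if "y \<in> Y0" "z \<in> Y0" for y z
    using diameter_bounded_bound[OF Y0_bounded that] by (simp add: dist_norm)
  show ?thesis
  proof (rule exI[of _ c], rule conjI[OF c(1)], rule exI[of _ "diameter Y0"],
      intro conjI ballI allI diameter_ge_0 Y0_bounded)
    fix \<tau> n y z assume \<tau>: "\<tau> \<in> two_sided A" and "y \<in> past_comp T \<tau> n ` Y (tail_from n \<tau>)" "z \<in> past_comp T \<tau> n ` Y (tail_from n \<tau>)"
    then obtain y' z' where y': "y = past_comp T \<tau> n y'" "y' \<in> Y (tail_from n \<tau>)" and z': "z = past_comp T \<tau> n z'" "z' \<in> Y (tail_from n \<tau>)" by blast
    have "norm (y - z) \<le> inverse c ^ n * norm (y' - z')"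
      unfolding y'(1) z'(1) past_comp_eq_forward_comp
      by (rule forward_comp_contracting[OF c(2,1) tail_from_one_sided[OF \<tau>] y'(2) z'(2)])
    also have "\<dots> \<le> inverse c ^ n * diameter Y0"
    proof -
      have "y' \<in> Y0" "z' \<in> Y0" using Y_subset[OF tail_from_one_sided[OF \<tau>, of n]] y'(2) z'(2) by blast+
      then show ?thesis using c(1) by (intro mult_left_mono diam) auto
    qed
    finally show "norm (y - z) \<le> inverse c ^ n * diameter Y0" .
  qed
qed

lemma pihat2_iff:
  assumes \<tau>: "\<tau> \<in> two_sided A"
  shows "p = \<pi> \<tau> \<longleftrightarrow> (\<forall>n. p \<in> past_comp T \<tau> n ` Y (tail_from n \<tau>))"
proof -
  let ?F = "\<lambda>n. past_comp T \<tau> n ` Y (tail_from n \<tau>)"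
  obtain c b where c: "1 < c" and "0 \<le> b" and diam: "\<And>n y z. y \<in> ?F n \<Longrightarrow> z \<in> ?F n \<Longrightarrow> norm (y - z) \<le> inverse c ^ n * b"
    using past_image_diameter \<tau> by metis
  have "\<Inter>(range ?F) \<noteq> {}"
    by (rule compact_nest) (use past_image_compact[OF \<tau>] past_image_mono[OF \<tau>] Y_nonempty[OF tail_from_one_sided[OF \<tau>]] in auto)
  then obtain q where q: "\<And>n. q \<in> ?F n" by auto
  have uniq: "p = q" if "\<forall>n\<ge>1. p \<in> ?F n" for p
  proof -
    have "(\<lambda>n. inverse c ^ n * b) \<longlonglongrightarrow> 0 * b"
      using c by (intro tendsto_mult tendsto_const LIMSEQ_realpow_zero) (auto simp: inverse_less_1_iff)
    then have "norm (p - q) \<le> 0 * b"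
      by (rule LIMSEQ_le_const) (use diam[OF _ q] that in \<open>auto intro!: exI[of _ 1]\<close>)
    then show ?thesis by simp
  qed
  have closed: "closure (?F n) = ?F n" for n
    using past_image_compact[OF \<tau>] by (simp add: compact_imp_closed)
  have "(\<Inter>n\<in>{1..}. closure (?F n)) = {q}"
    unfolding closed using uniq q by auto
  then have "\<pi> \<tau> = q" by (simp add: pihat2_def)
  with uniq q show ?thesis by metis
qed

lemma pihat2_mem: "\<tau> \<in> two_sided A \<Longrightarrow> \<pi> \<tau> \<in> past_comp T \<tau> n ` Y (tail_from n \<tau>)"
  using pihat2_iff by blast

lemma pihat2_Y: "\<tau> \<in> two_sided A \<Longrightarrow> \<pi> \<tau> \<in> Y (pi0 \<tau>)"
  using pihat2_mem[of \<tau> 0] by simp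

text \<open>The past images of the shifted point are the images of those of \<tau> under the fiber
  map, with the order raised by one; \<open>pihat2_iff\<close> then identifies the point.\<close>

lemma pihat2_shift:
  assumes \<tau>: "\<tau> \<in> two_sided A" shows "\<pi> (shift \<tau>) = T (pi0 \<tau>) (\<pi> \<tau>)"
proof -
  have tail: "tail_from (Suc n) (shift \<tau>) = tail_from n \<tau>" for n
    by (simp add: fun_eq_iff tail_from_def shift_def)
  have comp: "past_comp T (shift \<tau>) (Suc n) = T (pi0 \<tau>) \<circ> past_comp T \<tau> n" for n
  proof (induction n)
    case 0
    then show ?case using tail[of 0] by simp
  next
    case (Suc n)
    have "past_comp T (shift \<tau>) (Suc (Suc n)) = past_comp T (shift \<tau>) (Suc n) \<circ> T (tail_from (Suc n) \<tau>)"
      by (simp add: tail)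
    then show ?case by (simp add: Suc comp_assoc del: past_comp.simps) (simp add: comp_assoc)
  qed
  have "T (pi0 \<tau>) (\<pi> \<tau>) \<in> past_comp T (shift \<tau>) n ` Y (tail_from n (shift \<tau>))" for n
  proof (cases n)
    case 0
    have "T (pi0 \<tau>) (\<pi> \<tau>) \<in> Y (shift (pi0 \<tau>))"
      using T_maps[OF tail_from_one_sided[OF \<tau>]] pihat2_Y[OF \<tau>] by blast
    moreover have "pi0 (shift \<tau>) = shift (pi0 \<tau>)" using pi0_shift_funpow[of 1 \<tau>] by simp
    ultimately show ?thesis using 0 by simp
  next
    case (Suc m)
    show ?thesis unfolding Suc comp tail using pihat2_mem[OF \<tau>, of m] by auto
  qed
  then have "T (pi0 \<tau>) (\<pi> \<tau>) = \<pi> (shift \<tau>)" using \<tau> by (subst pihat2_iff) auto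
  then show ?thesis by simp
qed

lemma pihat2_shift_funpow: "x \<in> two_sided A \<Longrightarrow> \<pi> ((shift ^^ n) x) = forward_comp T (pi0 x) n (\<pi> x)"
  by (induction n) (simp_all add: pihat2_shift pi0_shift_funpow)

lemma pihat2_continuity:
  assumes "0 < e"
  shows "\<exists>n. \<forall>x\<in>two_sided A. \<forall>y\<in>two_sided A. agree_upto n x y \<longrightarrow> dist (\<pi> x) (\<pi> y) < e"
proof -
  let ?R = "\<lambda>x y. one_sided_dist 1 (pi0 x) (pi0 y) + norm (\<pi> x - \<pi> y)"
  have "\<exists>\<beta>>0. \<exists>L. \<forall>\<omega>\<in>two_sided A. \<forall>\<tau>\<in>two_sided A. \<omega> 0 = \<tau> 0 \<longrightarrow> dist (\<pi> \<omega>) (\<pi> \<tau>) \<le> L * two_sided_dist \<beta> \<omega> \<tau>"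
  proof -
    obtain \<beta> L where \<beta>: "0 < \<beta>" and L: "\<And>\<omega> \<tau>. \<omega> \<in> two_sided A \<Longrightarrow> \<tau> \<in> two_sided A \<Longrightarrow> \<omega> 0 = \<tau> 0 \<Longrightarrow>
        one_sided_dist \<beta> (fst (pihat Y T \<omega>)) (fst (pihat Y T \<tau>)) + norm (snd (pihat Y T \<omega>) - snd (pihat Y T \<tau>)) \<le> L * two_sided_dist \<beta> \<omega> \<tau>"
      using pihat_hoelder by blast
    have "dist (\<pi> \<omega>) (\<pi> \<tau>) \<le> L * two_sided_dist \<beta> \<omega> \<tau>" if "\<omega> \<in> two_sided A" "\<tau> \<in> two_sided A" "\<omega> 0 = \<tau> 0" for \<omega> \<tau>
      using L[OF that] one_sided_dist_nonneg[of \<beta> "fst (pihat Y T \<omega>)" "fst (pihat Y T \<tau>)"] by (simp add: pihat_def dist_norm)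
    with \<beta> show ?thesis by blast
  qed
  from hoelder_continuity[OF this assms] show ?thesis .
qed

lemma pihat2_measurable: "\<pi> \<in> borel_measurable (two_sided_borel A)"
  by (rule borel_measurable_two_sidedI) (meson pihat2_continuity)

text \<open>The description by \<open>THE\<close> is meaningful because the value of the derivative
  at one nonzero vector determines the factor.\<close>

lemma similarity_factor_derivative:
  assumes \<omega>: "\<omega> \<in> one_sided A" and y: "y \<in> Ystar \<omega>"
  shows "0 < similarity_factor (T \<omega>) y"
    and "\<exists>D. (T \<omega> has_derivative D) (at y) \<and> (\<forall>v. norm (D v) = similarity_factor (T \<omega>) y * norm v)"
proof -
  obtain D :: "'a \<Rightarrow> 'a \<Rightarrow>\<^sub>L 'a" where D: "\<forall>x\<in>Ystar \<omega>. (T \<omega> has_derivative blinfun_apply (D x)) (at x) \<and>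
      (\<exists>s>0. is_similarity (blinfun_apply (D x)) s)"
    using T_conformal[OF \<omega>] unfolding C1_conformal_embedding_def by blast
  then obtain s where der: "(T \<omega> has_derivative blinfun_apply (D y)) (at y)" and s: "0 < s" "is_similarity (blinfun_apply (D y)) s"
    using y by blast
  have frechet: "frechet_derivative (T \<omega>) (at y) = blinfun_apply (D y)"
    using frechet_derivative_at[OF der] by simp
  obtain v :: 'a where v: "v \<in> Basis" using nonempty_Basis by blast
  have uniq: "s' = s" if "is_similarity (blinfun_apply (D y)) s'" for s'
  proof -
    have "norm (D y v) = s' * norm v" "norm (D y v) = s * norm v"
      using that s(2) unfolding is_similarity_def by blast+
    with v show ?thesis by simp
  qed
  have "similarity_factor (T \<omega>) y = s"
    unfolding similarity_factor_def frechet by (rule the_equality, rule s(2), rule uniq)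
  then show "0 < similarity_factor (T \<omega>) y"
    "\<exists>D. (T \<omega> has_derivative D) (at y) \<and> (\<forall>v. norm (D v) = similarity_factor (T \<omega>) y * norm v)"
    using der s by (auto simp: is_similarity_def)
qed

lemma similarity_factor_le:
  assumes c: "\<forall>\<omega>\<in>one_sided A. \<forall>y\<in>Ystar \<omega>. \<forall>z\<in>Ystar \<omega>. norm (T \<omega> y - T \<omega> z) \<le> inverse c * norm (y - z)"
    and \<omega>: "\<omega> \<in> one_sided A" and y: "y \<in> Ystar \<omega>"
  shows "similarity_factor (T \<omega>) y \<le> inverse c"
proof -
  obtain D where D: "(T \<omega> has_derivative D) (at y)" "\<And>v. norm (D v) = similarity_factor (T \<omega>) y * norm v"
    using similarity_factor_derivative[OF \<omega> y] by blast
  obtain v :: 'a where v: "v \<in> Basis" using nonempty_Basis by blast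
  have "norm (D v) \<le> inverse c"
  proof (rule field_le_epsilon)
    fix e :: real assume "0 < e"
    then obtain d where d: "0 < d" "\<And>z. norm (z - y) < d \<Longrightarrow> norm (T \<omega> z - T \<omega> y - D (z - y)) \<le> e * norm (z - y)"
      using D(1) unfolding has_derivative_at_alt by blast
    obtain d' where d': "0 < d'" "ball y d' \<subseteq> Ystar \<omega>"
      using Ystar_domain[OF \<omega>] y open_contains_ball by metis
    define t where "t = min d d' / 2"
    have t: "0 < t" "t < d" "t < d'" using d(1) d'(1) by (auto simp: t_def)
    let ?z = "y + t *\<^sub>R v"
    have nz: "norm (?z - y) = t" using v t by simp
    have "?z \<in> Ystar \<omega>" using d'(2) t v by (auto simp: dist_norm)
    then have "norm (T \<omega> ?z - T \<omega> y) \<le> inverse c * t" using c \<omega> y nz by metis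
    moreover have "norm (T \<omega> ?z - T \<omega> y - D (?z - y)) \<le> e * t" using d(2)[of ?z] t(2) unfolding nz by blast
    moreover have "norm (D (?z - y)) \<le> norm (T \<omega> ?z - T \<omega> y) + norm (T \<omega> ?z - T \<omega> y - D (?z - y))"
      using norm_triangle_ineq4[of "T \<omega> ?z - T \<omega> y" "T \<omega> ?z - T \<omega> y - D (?z - y)"] by simp
    moreover have "norm (D (?z - y)) = t * norm (D v)"
      unfolding D(2) using v t by simp
    ultimately have "t * norm (D v) \<le> t * (inverse c + e)" by (simp add: algebra_simps)
    then show "norm (D v) \<le> inverse c + e" using t by simp
  qed
  then show ?thesis using D(2)[of v] v by simp
qed

text \<open>The uniform contraction on the open domains passes to derivatives. The gap
  \<open>k = ln c\<close> keeps the Lyapunov exponent away from 0.\<close>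

lemma log_deriv_le: "\<exists>k>0. \<forall>x\<in>two_sided A. g x \<le> - k"
proof -
  obtain c where c: "1 < c" "\<forall>\<omega>\<in>one_sided A. \<forall>y\<in>Ystar \<omega>. \<forall>z\<in>Ystar \<omega>. norm (T \<omega> y - T \<omega> z) \<le> inverse c * norm (y - z)"
    using T_contracting_star by blast
  have "g x \<le> - ln c" if x: "x \<in> two_sided A" for x
  proof -
    have \<omega>: "pi0 x \<in> one_sided A" by (rule tail_from_one_sided[OF x])
    have y: "\<pi> x \<in> Ystar (pi0 x)" using pihat2_Y[OF x] Ystar_superset[OF \<omega>] by blast
    have "ln (similarity_factor (T (pi0 x)) (\<pi> x)) \<le> ln (inverse c)"
      using similarity_factor_le[OF c(2) \<omega> y] similarity_factor_derivative(1)[OF \<omega> y] by (intro ln_mono) auto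
    then show ?thesis using c(1) by (simp add: log_deriv_def ln_inverse)
  qed
  moreover have "0 < ln c" using c by simp
  ultimately show ?thesis by blast
qed

text \<open>The logarithmic scaling factor of \<open>forward_comp\<close> at any point of the fiber
  set; at coded points it is the Birkhoff sum of \<open>g\<close>.\<close>

definition log_expansion :: "(nat \<Rightarrow> 'e) \<Rightarrow> nat \<Rightarrow> 'a \<Rightarrow> real" where
  "log_expansion \<omega> n y = (\<Sum>j<n. ln (similarity_factor (T ((shift ^^ j) \<omega>)) (forward_comp T \<omega> j y)))"

lemma log_expansion_pihat2:
  "x \<in> two_sided A \<Longrightarrow> log_expansion (pi0 x) n (\<pi> x) = birkhoff_sum g n x"
  by (simp add: log_expansion_def birkhoff_sum_def log_deriv_def pihat2_shift_funpow pi0_shift_funpow)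

lemma forward_comp_derivative:
  assumes \<omega>: "\<omega> \<in> one_sided A" and y: "y \<in> Y \<omega>"
  shows "\<exists>D. (forward_comp T \<omega> n has_derivative D) (at y) \<and> (\<forall>v. norm (D v) = exp (log_expansion \<omega> n y) * norm v)"
proof (induction n)
  case 0
  then show ?case by (intro exI[of _ "\<lambda>v. v"]) (simp add: log_expansion_def id_def)
next
  case (Suc n)
  then obtain D where D: "(forward_comp T \<omega> n has_derivative D) (at y)" "\<And>v. norm (D v) = exp (log_expansion \<omega> n y) * norm v" by blast
  let ?\<omega> = "(shift ^^ n) \<omega>" and ?y = "forward_comp T \<omega> n y"
  have \<omega>': "?\<omega> \<in> one_sided A" using \<omega> by simp
  have y': "?y \<in> Ystar ?\<omega>" using forward_comp_maps[OF \<omega> y] Ystar_superset[OF \<omega>'] by blast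
  obtain D' where D': "(T ?\<omega> has_derivative D') (at ?y)" "\<And>v. norm (D' v) = similarity_factor (T ?\<omega>) ?y * norm v"
    using similarity_factor_derivative(2)[OF \<omega>' y'] by blast
  have "exp (log_expansion \<omega> (Suc n) y) = similarity_factor (T ?\<omega>) ?y * exp (log_expansion \<omega> n y)"
    using similarity_factor_derivative(1)[OF \<omega>' y'] by (simp add: log_expansion_def exp_add)
  then show ?case
    unfolding forward_comp.simps
    by (intro exI[of _ "D' \<circ> D"] conjI diff_chain_at[OF D(1) D'(1)]) (simp add: D(2) D'(2))
qed

text \<open>Two orbits in the same fibers approach each other at rate \<open>inverse c ^ j\<close>,
  so the distortion bounds are dominated by a geometric series with ratio
  \<open>inverse c powr \<alpha>\<close>.\<close>

lemma expansion_distortion: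
  "\<exists>K\<ge>1. \<forall>\<omega>\<in>one_sided A. \<forall>n. \<forall>y\<in>Y \<omega>. \<forall>z\<in>Y \<omega>. exp (log_expansion \<omega> n y) \<le> K * exp (log_expansion \<omega> n z)"
proof -
  obtain \<alpha> H where \<alpha>: "0 < \<alpha>" and H: "0 < H" and dist: "\<And>\<omega> y z. \<omega> \<in> one_sided A \<Longrightarrow> y \<in> Ystar \<omega> \<Longrightarrow> z \<in> Ystar \<omega> \<Longrightarrow>
         \<bar>ln (similarity_factor (T \<omega>) y) - ln (similarity_factor (T \<omega>) z)\<bar> \<le> H * norm (y - z) powr \<alpha>"
    using bounded_distortion by blast
  obtain c where c: "1 < c" "\<forall>\<omega>\<in>one_sided A. \<forall>y\<in>Y \<omega>. \<forall>z\<in>Y \<omega>. norm (T \<omega> y - T \<omega> z) \<le> inverse c * norm (y - z)"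
    using T_contracting by blast
  define q where "q = inverse c powr \<alpha>"
  have q: "0 < q" "q < 1"
    using c(1) \<alpha> powr_less_mono2[of \<alpha> "inverse c" 1] by (auto simp: q_def inverse_less_1_iff)
  define k where "k = H * diameter Y0 powr \<alpha> / (1 - q)"
  have k: "0 \<le> k" using H q by (simp add: k_def)
  have "log_expansion \<omega> n y \<le> k + log_expansion \<omega> n z" if \<omega>: "\<omega> \<in> one_sided A" and y: "y \<in> Y \<omega>" and z: "z \<in> Y \<omega>" for \<omega> n y z
  proof -
    have "norm (y - z) \<le> diameter Y0"
      using diameter_bounded_bound[OF Y0_bounded, of y z] Y_subset[OF \<omega>] y z by (auto simp: dist_norm)
    have "log_expansion \<omega> n y - log_expansion \<omega> n z =
      (\<Sum>j<n. ln (similarity_factor (T ((shift ^^ j) \<omega>)) (forward_comp T \<omega> j y)) - ln (similarity_factor (T ((shift ^^ j) \<omega>)) (forward_comp T \<omega> j z)))"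
      by (simp add: log_expansion_def sum_subtractf)
    also have "\<dots> \<le> (\<Sum>j<n. H * diameter Y0 powr \<alpha> * q ^ j)"
    proof (rule sum_mono)
      fix j
      let ?y = "forward_comp T \<omega> j y" and ?z = "forward_comp T \<omega> j z" and ?\<omega> = "(shift ^^ j) \<omega>"
      have "?\<omega> \<in> one_sided A" using \<omega> by simp
      moreover from this have "?y \<in> Ystar ?\<omega>" "?z \<in> Ystar ?\<omega>"
        using forward_comp_maps[OF \<omega>] y z Ystar_superset by blast+
      ultimately have "ln (similarity_factor (T ?\<omega>) ?y) - ln (similarity_factor (T ?\<omega>) ?z) \<le> H * norm (?y - ?z) powr \<alpha>"
        using dist[of ?\<omega> ?y ?z] by linarith
      also have "H * norm (?y - ?z) powr \<alpha> \<le> H * (inverse c ^ j * diameter Y0) powr \<alpha>"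
      proof -
        have "inverse c ^ j * norm (y - z) \<le> inverse c ^ j * diameter Y0"
          using \<open>norm (y - z) \<le> diameter Y0\<close> c(1) by (intro mult_left_mono) auto
        then have "norm (?y - ?z) \<le> inverse c ^ j * diameter Y0"
          using forward_comp_contracting[OF c(2,1) \<omega> y z, of j] by linarith
        then show ?thesis using H \<alpha> by (intro mult_left_mono powr_mono2) auto
      qed
      also have "(inverse c ^ j * diameter Y0) powr \<alpha> = q ^ j * diameter Y0 powr \<alpha>"
        using c(1) diameter_ge_0[OF Y0_bounded] by (simp add: powr_mult q_def powr_realpow[symmetric] powr_powr mult.commute)
      finally show "ln (similarity_factor (T ?\<omega>) ?y) - ln (similarity_factor (T ?\<omega>) ?z) \<le> H * diameter Y0 powr \<alpha> * q ^ j"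
        by (simp add: mult_ac)
    qed
    also have "\<dots> = H * diameter Y0 powr \<alpha> * (\<Sum>j<n. q ^ j)" by (simp add: sum_distrib_left)
    also have "\<dots> \<le> H * diameter Y0 powr \<alpha> * (1 / (1 - q))"
      using q H by (intro mult_left_mono) (subst sum_gp_strict, auto simp: divide_right_mono)
    finally show ?thesis by (simp add: k_def)
  qed
  then have "exp (log_expansion \<omega> n y) \<le> exp k * exp (log_expansion \<omega> n z)"
    if "\<omega> \<in> one_sided A" "y \<in> Y \<omega>" "z \<in> Y \<omega>" for \<omega> n y z
    using that by (simp flip: exp_add)
  moreover have "1 \<le> exp k" using k by simp
  ultimately show ?thesis by blast
qed

end

section \<open>Separation of cylinders at good times\<close>

text \<open>The neighbourhood filter of \<open>x\<close> in the shift, with \<open>x\<close> itself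
  included; it makes the filter calculus of limits available.\<close>

definition near :: "('e \<Rightarrow> 'e \<Rightarrow> bool) \<Rightarrow> (int \<Rightarrow> 'e) \<Rightarrow> (int \<Rightarrow> 'e) filter" where
  "near A x = (INF R. principal {y \<in> two_sided A. agree_upto R x y})"

lemma agree_upto_mono: "agree_upto n x y \<Longrightarrow> m \<le> n \<Longrightarrow> agree_upto m x y"
  by (simp add: agree_upto_def)

lemma eventually_near: "eventually P (near A x) \<longleftrightarrow> (\<exists>R. \<forall>y\<in>two_sided A. agree_upto R x y \<longrightarrow> P y)"
proof -
  have "eventually P (near A x) \<longleftrightarrow> (\<exists>R\<in>UNIV. eventually P (principal {y \<in> two_sided A. agree_upto R x y}))"
    unfolding near_def
  proof (rule eventually_INF_base)
    fix m n :: nat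
    show "\<exists>k\<in>UNIV. principal {y \<in> two_sided A. agree_upto k x y} \<le>
        inf (principal {y \<in> two_sided A. agree_upto m x y}) (principal {y \<in> two_sided A. agree_upto n x y})"
      by (intro bexI[of _ "max m n"]) (auto intro: agree_upto_mono)
  qed simp
  then show ?thesis by (auto simp: eventually_principal)
qed

lemma tendsto_nearI:
  fixes h :: "(int \<Rightarrow> 'e) \<Rightarrow> 'b::metric_space"
  assumes "\<And>e. 0 < e \<Longrightarrow> \<exists>n. \<forall>y\<in>two_sided A. agree_upto n x y \<longrightarrow> dist (h x) (h y) < e"
  shows "(h \<longlongrightarrow> h x) (near A x)"
proof (rule tendstoI)
  fix e :: real assume "0 < e"
  from assms[OF this] show "eventually (\<lambda>y. dist (h y) (h x) < e) (near A x)"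
    unfolding eventually_near by (simp add: dist_commute)
qed

lemma filterlim_near_shift:
  "filterlim (shift ^^ n) (near A ((shift ^^ n) x)) (near A x)" for x :: "int \<Rightarrow> 'e"
  unfolding filterlim_iff eventually_near
proof (intro allI impI)
  fix P assume "\<exists>R. \<forall>y\<in>two_sided A. agree_upto R ((shift ^^ n) x) y \<longrightarrow> P y"
  then obtain R where R: "\<And>y. y \<in> two_sided A \<Longrightarrow> agree_upto R ((shift ^^ n) x) y \<Longrightarrow> P y" by blast
  have "P ((shift ^^ n) y)" if "y \<in> two_sided A" "agree_upto (R + n) x y" for y
    using that by (intro R) (auto simp: agree_upto_def shift_funpow_apply)
  then show "\<exists>R. \<forall>y\<in>two_sided A. agree_upto R x y \<longrightarrow> P ((shift ^^ n) y)" by blast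
qed

text \<open>Keeping the past of \<open>z\<close> while the future varies is continuous. This
  transports a witness from the fiber of \<open>x\<close> to nearby fibers.\<close>

lemma filterlim_near_splice:
  assumes "z \<in> two_sided A" "z 0 = x 0"
  shows "filterlim (splice z) (near A (splice z x)) (near A x)"
  unfolding filterlim_iff eventually_near
proof (intro allI impI)
  fix P assume "\<exists>R. \<forall>y\<in>two_sided A. agree_upto R (splice z x) y \<longrightarrow> P y"
  then obtain R where R: "\<And>y. y \<in> two_sided A \<Longrightarrow> agree_upto R (splice z x) y \<Longrightarrow> P y" by blast
  have "P (splice z y)" if y: "y \<in> two_sided A" "agree_upto R x y" for y
  proof (rule R)
    have "z 0 = y 0" using y assms(2) by (simp add: agree_upto_def)
    then show "splice z y \<in> two_sided A" using assms(1) y by (intro splice_two_sided)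
    show "agree_upto R (splice z x) (splice z y)" using y by (simp add: agree_upto_def splice_def)
  qed
  then show "\<exists>R. \<forall>y\<in>two_sided A. agree_upto R x y \<longrightarrow> P (splice z y)" by blast
qed

lemma splice_eq: "pi0 z = pi0 x \<Longrightarrow> splice z x = z"
  unfolding pi0_eq_iff by (auto simp: splice_def fun_eq_iff)

lemma past_word_splice: "past_word (splice z x) n = past_word z n"
  by (simp only: past_word_eq_iff) (simp add: splice_def)

context hoelder_conformal_smale
begin

text \<open>On a ball inside the fiber set the scaling factor varies by at most \<open>K\<close>.
  The mean value inequality bounds the image from outside and
  \<open>expanding_map_covers_ball\<close> from inside.\<close>

lemma forward_comp_quasi_conformal:
  "\<exists>K\<ge>1. \<forall>\<omega>\<in>one_sided A. \<forall>n p \<delta>. 0 < \<delta> \<longrightarrow> ball p \<delta> \<subseteq> Y \<omega> \<longrightarrow>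
    ball (forward_comp T \<omega> n p) (exp (log_expansion \<omega> n p) / K * \<delta>) \<subseteq> forward_comp T \<omega> n ` ball p \<delta> \<and>
    (\<forall>y\<in>ball p \<delta>. dist (forward_comp T \<omega> n p) (forward_comp T \<omega> n y) \<le> K * exp (log_expansion \<omega> n p) * \<delta>)"
proof -
  obtain K where K: "1 \<le> K" and dist: "\<And>\<omega> n y z. \<omega> \<in> one_sided A \<Longrightarrow> y \<in> Y \<omega> \<Longrightarrow> z \<in> Y \<omega> \<Longrightarrow>
      exp (log_expansion \<omega> n y) \<le> K * exp (log_expansion \<omega> n z)"
    using expansion_distortion by blast
  have "ball (forward_comp T \<omega> n p) (exp (log_expansion \<omega> n p) / K * \<delta>) \<subseteq> forward_comp T \<omega> n ` ball p \<delta> \<and>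
    (\<forall>y\<in>ball p \<delta>. dist (forward_comp T \<omega> n p) (forward_comp T \<omega> n y) \<le> K * exp (log_expansion \<omega> n p) * \<delta>)"
    if \<omega>: "\<omega> \<in> one_sided A" and \<delta>: "0 < \<delta>" and sub: "ball p \<delta> \<subseteq> Y \<omega>" for \<omega> n p \<delta>
  proof
    let ?f = "forward_comp T \<omega> n" and ?e = "exp (log_expansion \<omega> n p)"
    have p: "p \<in> Y \<omega>" using sub \<delta> by auto
    show "ball (?f p) (?e / K * \<delta>) \<subseteq> ?f ` ball p \<delta>"
    proof (rule expanding_map_covers_ball)
      show "inj_on ?f (ball p \<delta>)" using forward_comp_inj[OF \<omega>] sub by (rule inj_on_subset)
      show "0 < ?e / K" using K by simp
      fix y assume "y \<in> ball p \<delta>"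
      then have y: "y \<in> Y \<omega>" using sub by blast
      obtain D where D: "(?f has_derivative D) (at y)" "\<And>v. norm (D v) = exp (log_expansion \<omega> n y) * norm v"
        using forward_comp_derivative[OF \<omega> y] by blast
      have "?e / K \<le> exp (log_expansion \<omega> n y)"
        using dist[OF \<omega> p y, of n] K by (simp add: divide_le_eq mult.commute)
      then have "?e / K * norm v \<le> norm (D v)" for v unfolding D(2) by (rule mult_right_mono) simp
      with D(1) show "\<exists>D. (?f has_derivative D) (at y) \<and> (\<forall>v. ?e / K * norm v \<le> norm (D v))" by blast
    qed (rule \<delta>)
    have "\<forall>y\<in>ball p \<delta>. \<exists>D. (?f has_derivative D) (at y) \<and> onorm D \<le> K * ?e"
    proof
      fix y assume "y \<in> ball p \<delta>"
      then have y: "y \<in> Y \<omega>" using sub by blast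
      obtain D where D: "(?f has_derivative D) (at y)" "\<And>v. norm (D v) = exp (log_expansion \<omega> n y) * norm v"
        using forward_comp_derivative[OF \<omega> y] by blast
      have "norm (D v) \<le> K * ?e * norm v" for v
        unfolding D(2) using dist[OF \<omega> y p, of n] by (rule mult_right_mono) simp
      then have "onorm D \<le> K * ?e" by (rule onorm_le)
      with D(1) show "\<exists>D. (?f has_derivative D) (at y) \<and> onorm D \<le> K * ?e" by blast
    qed
    then obtain D where D: "\<And>y. y \<in> ball p \<delta> \<Longrightarrow> (?f has_derivative D y) (at y)" "\<And>y. y \<in> ball p \<delta> \<Longrightarrow> onorm (D y) \<le> K * ?e"
      by metis
    show "\<forall>y\<in>ball p \<delta>. dist (?f p) (?f y) \<le> K * ?e * \<delta>"
    proof
      fix y assume y: "y \<in> ball p \<delta>"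
      have "norm (?f p - ?f y) \<le> K * ?e * norm (p - y)"
        by (rule differentiable_bound[of "ball p \<delta>" ?f D]) (use D y \<delta> in \<open>auto intro: has_derivative_at_withinI\<close>)
      also have "\<dots> \<le> K * ?e * \<delta>" using y K by (intro mult_left_mono) (auto simp: dist_norm)
      finally show "dist (?f p) (?f y) \<le> K * ?e * \<delta>" by (simp add: dist_norm)
    qed
  qed
  with K show ?thesis by blast
qed

text \<open>Since each \<open>Y \<omega>\<close> is the closure of its interior, an open piece of one branch cannot meet
  the limit points of another branch, not even those on the boundary.\<close>

lemma branches_separated:
  assumes \<omega>: "\<omega> \<in> one_sided A" and "a \<noteq> b" "A a (\<omega> 0)" "A b (\<omega> 0)"
    and w: "w \<in> interior (Y (case_nat a \<omega>))" and z: "z \<in> Y (case_nat b \<omega>)"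
  shows "T (case_nat a \<omega>) w \<noteq> T (case_nat b \<omega>) z"
proof
  let ?a = "case_nat a \<omega>" and ?b = "case_nat b \<omega>"
  assume eq: "T ?a w = T ?b z"
  have one: "case_nat e \<omega> \<in> one_sided A" if "A e (\<omega> 0)" for e
    using that \<omega> by (auto simp: one_sided_def split: nat.split)
  note a = one[OF assms(3)] and b = one[OF assms(4)]
  let ?U = "T ?a ` interior (Y ?a)"
  have openU: "open ?U"
    by (rule invariance_of_domain[OF continuous_on_subset[OF T_continuous[OF a]] _ inj_on_subset[OF T_injective[OF a]]])
       (auto simp: interior_subset)
  have "T ?b z \<in> ?U" using w eq by (metis imageI)
  moreover have "continuous (at z within Y ?b) (T ?b)"
    using T_continuous[OF b] z by (simp add: continuous_on_eq_continuous_within)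
  ultimately have "\<forall>\<^sub>F y in at z within Y ?b. T ?b y \<in> ?U"
    using openU by (simp add: continuous_within tendsto_def)
  then obtain d where d: "0 < d" "\<And>y. y \<in> Y ?b \<Longrightarrow> y \<noteq> z \<Longrightarrow> dist y z < d \<Longrightarrow> T ?b y \<in> ?U"
    by (auto simp: eventually_at)
  \<comment> \<open>An interior point \<open>y\<close> close to \<open>z\<close> is still mapped
    into the open set \<open>?U\<close>, so the images of the two interiors meet.\<close>
  have "z \<in> closure (interior (Y ?b))" using z Y_regular[OF b] by simp
  then obtain y where y: "y \<in> interior (Y ?b)" "dist y z < d" using d(1) unfolding closure_approachable by blast
  have "T ?b y \<in> ?U"
    using d(2)[of y] y interior_subset \<open>T ?b z \<in> ?U\<close> by (cases "y = z") auto
  moreover have "T ?b y \<in> T ?b ` interior (Y ?b)" using y by blast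
  ultimately show False using open_set_condition[OF \<omega> assms(2-4)] by blast
qed

text \<open>At the most recent coordinate where the pasts differ, two different branches are
  entered; afterwards both histories pass through the same injective maps. Equal end points would
  have been equal right after the branching, against \<open>branches_separated\<close>.\<close>

lemma cylinders_separated:
  assumes x: "x \<in> two_sided A" and \<delta>: "ball (\<pi> x) \<delta> \<subseteq> Y (pi0 x)"
    and \<tau>: "\<tau> \<in> two_sided A" "pi0 \<tau> = pi0 ((shift ^^ n) x)" "past_word \<tau> n \<noteq> word_of x n"
  shows "\<pi> \<tau> \<notin> forward_comp T (pi0 x) n ` ball (\<pi> x) \<delta>"
proof
  assume "\<pi> \<tau> \<in> forward_comp T (pi0 x) n ` ball (\<pi> x) \<delta>"
  then obtain w0 where w0: "w0 \<in> ball (\<pi> x) \<delta>" "\<pi> \<tau> = forward_comp T (pi0 x) n w0" by blast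
  let ?s = "(shift ^^ n) x"
  have s: "?s \<in> two_sided A" using x by simp
  have "past_word ?s n = word_of x n" by (simp add: shift_unshift_funpow)
  then have "past_word \<tau> n \<noteq> past_word ?s n" using \<tau>(3) by simp
  then have "\<exists>j. 1 \<le> j \<and> j \<le> n \<and> \<tau> (- int j) \<noteq> ?s (- int j)"
  proof -
    from \<open>past_word \<tau> n \<noteq> past_word ?s n\<close> obtain k where "- int n \<le> k" "k < 0" "\<tau> k \<noteq> ?s k"
      unfolding past_word_eq_iff by blast
    then show ?thesis by (intro exI[of _ "nat (- k)"]) auto
  qed
  define j where "j = (LEAST j. 1 \<le> j \<and> j \<le> n \<and> \<tau> (- int j) \<noteq> ?s (- int j))"
  have j: "1 \<le> j" "j \<le> n" "\<tau> (- int j) \<noteq> ?s (- int j)"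
    using LeastI_ex[OF \<open>\<exists>j. _ j\<close>] unfolding j_def by blast+
  have least: "\<tau> (- int i) = ?s (- int i)" if "1 \<le> i" "i < j" for i
    using not_less_Least[of i "\<lambda>j. 1 \<le> j \<and> j \<le> n \<and> \<tau> (- int j) \<noteq> ?s (- int j)"] that j(2) by (auto simp: j_def)
  obtain i where i: "j = Suc i" using j(1) by (cases j) auto
  have fut: "\<tau> k = ?s k" if "k \<ge> 0" for k using \<tau>(2) that unfolding pi0_eq_iff by blast
  have tail_eq: "tail_from i \<tau> = tail_from i ?s"
  proof
    fix k
    show "tail_from i \<tau> k = tail_from i ?s k"
    proof (cases "int k - int i \<ge> 0")
      case True
      then show ?thesis using fut by (simp add: tail_from_def)
    next
      case False
      then have "int k - int i = - int (i - k)" "1 \<le> i - k" "i - k < j" using i by auto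
      then show ?thesis using least[of "i - k"] by (simp add: tail_from_def)
    qed
  qed
  let ?\<omega> = "tail_from i ?s"
  let ?a = "?s (- int j)" and ?b = "\<tau> (- int j)"
  have \<omega>: "?\<omega> \<in> one_sided A" by (rule tail_from_one_sided[OF s])
  have case_tail: "tail_from (Suc i) t = case_nat (t (- int (Suc i))) (tail_from i t)" for t :: "int \<Rightarrow> 'e"
    by (auto simp: fun_eq_iff tail_from_def split: nat.split)
  have ta: "tail_from j ?s = case_nat ?a ?\<omega>" and tb: "tail_from j \<tau> = case_nat ?b ?\<omega>"
    using case_tail[of ?s] case_tail[of \<tau>] tail_eq by (simp_all only: i)
  have adm: "A (t (- int j)) (tail_from i t 0)" if "t \<in> two_sided A" for t
  proof -
    have "A (t (- int j)) (t (- int j + 1))" using that unfolding two_sided_def by blast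
    then show ?thesis by (simp add: tail_from_def i)
  qed
  have admab: "A ?a (?\<omega> 0)" "A ?b (?\<omega> 0)" using adm[OF s] adm[OF \<tau>(1)] tail_eq by simp_all
  have sj: "(shift ^^ (n - j)) (pi0 x) = tail_from j ?s"
    using shift_funpow_tail_from[of "n - j" n ?s] j(2) by (simp add: tail_from_shift_funpow)
  define w where "w = forward_comp T (pi0 x) (n - j) w0"
  define z where "z = \<pi> ((unshift ^^ j) \<tau>)"
  have px: "pi0 x \<in> one_sided A" by (rule tail_from_one_sided[OF x])
  \<comment> \<open>The image of the open ball under a continuous injective map is open and lies in
    the fiber set, so \<open>w\<close> is an interior point.\<close>
  have w: "w \<in> interior (Y (case_nat ?a ?\<omega>))"
  proof (rule interiorI)
    let ?W = "forward_comp T (pi0 x) (n - j) ` ball (\<pi> x) \<delta>"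
    show "open ?W"
      by (rule invariance_of_domain[OF continuous_on_subset[OF forward_comp_continuous[OF px] \<delta>] open_ball inj_on_subset[OF forward_comp_inj[OF px] \<delta>]])
    show "w \<in> ?W" using w0(1) by (simp add: w_def)
    show "?W \<subseteq> Y (case_nat ?a ?\<omega>)"
      using forward_comp_maps[OF px, of _ "n - j"] \<delta> unfolding sj ta by blast
  qed
  have z: "z \<in> Y (case_nat ?b ?\<omega>)"
    using pihat2_Y[of "(unshift ^^ j) \<tau>"] \<tau>(1) unfolding z_def pi0_unshift_funpow tb[symmetric] by simp
  have "n = (n - j) + j" using j(2) by simp
  then have "\<pi> \<tau> = forward_comp T (pi0 x) ((n - j) + j) w0" using w0(2) by simp
  also have "\<dots> = forward_comp T (tail_from j ?s) (Suc i) w"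
    unfolding forward_comp_add sj w_def by (simp add: i)
  also have "\<dots> = forward_comp T ?\<omega> i (T (case_nat ?a ?\<omega>) w)"
    unfolding forward_comp_Suc using ta shift_tail_from[of i ?s] by (simp add: i)
  finally have eq1: "\<pi> \<tau> = forward_comp T ?\<omega> i (T (case_nat ?a ?\<omega>) w)" .
  have "\<pi> \<tau> = \<pi> ((shift ^^ j) ((unshift ^^ j) \<tau>))" by (simp add: shift_unshift_funpow)
  also have "\<dots> = forward_comp T (tail_from j \<tau>) j z"
    unfolding z_def using \<tau>(1) by (subst pihat2_shift_funpow) (simp_all add: pi0_unshift_funpow)
  also have "\<dots> = forward_comp T ?\<omega> i (T (case_nat ?b ?\<omega>) z)"
    unfolding i forward_comp_Suc using tb shift_tail_from[of i \<tau>] tail_eq by (simp add: i)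
  finally have eq2: "\<pi> \<tau> = forward_comp T ?\<omega> i (T (case_nat ?b ?\<omega>) z)" .
  have maps: "T (case_nat e ?\<omega>) y \<in> Y ?\<omega>" if "A e (?\<omega> 0)" "y \<in> Y (case_nat e ?\<omega>)" for e y
  proof -
    have "case_nat e ?\<omega> \<in> one_sided A" using that(1) \<omega> by (auto simp: one_sided_def split: nat.split)
    moreover have "shift (case_nat e ?\<omega>) = ?\<omega>" by (simp add: fun_eq_iff shift_def)
    ultimately show ?thesis using T_maps[of "case_nat e ?\<omega>"] that(2) by (metis image_subset_iff)
  qed
  have "T (case_nat ?a ?\<omega>) w = T (case_nat ?b ?\<omega>) z"
  proof (rule inj_onD[OF forward_comp_inj[OF \<omega>, of i]])
    show "forward_comp T ?\<omega> i (T (case_nat ?a ?\<omega>) w) = forward_comp T ?\<omega> i (T (case_nat ?b ?\<omega>) z)"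
      using eq1 eq2 by (rule trans[OF sym])
    show "T (case_nat ?a ?\<omega>) w \<in> Y ?\<omega>" by (rule maps[OF admab(1) subsetD[OF interior_subset w]])
    show "T (case_nat ?b ?\<omega>) z \<in> Y ?\<omega>" by (rule maps[OF admab(2) z])
  qed
  moreover have "T (case_nat ?a ?\<omega>) w \<noteq> T (case_nat ?b ?\<omega>) z"
    by (rule branches_separated[OF \<omega> _ admab w z]) (use j(3) in metis)
  ultimately show False by blast
qed

text \<open>The fibers \<open>Y \<omega>\<close> may depend on \<open>\<omega>\<close> in a non-measurable way. The good sets below are therefore
  phrased in terms of the coding map only, which makes them closed: from time \<open>0\<close> on, the cylinders
  around \<open>x\<close> look like balls of radius comparable to the derivative, up to the factor \<open>N + 1\<close>.\<close>

definition well_separated :: "nat \<Rightarrow> nat \<Rightarrow> (int \<Rightarrow> 'e) \<Rightarrow> bool" where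
  "well_separated N n x \<longleftrightarrow> (\<forall>\<tau>\<in>two_sided A. pi0 \<tau> = pi0 ((shift ^^ n) x) \<longrightarrow> past_word \<tau> n \<noteq> word_of x n \<longrightarrow>
    exp (birkhoff_sum g n x) / real (Suc N) \<le> dist (\<pi> ((shift ^^ n) x)) (\<pi> \<tau>))"

text \<open>Here \<open>N\<close> has two roles: it bounds the constant, and it is the number of
  past letters whose agreement puts \<open>y\<close> close enough to \<open>x\<close> at time
  0.\<close>

definition well_contracted :: "nat \<Rightarrow> nat \<Rightarrow> (int \<Rightarrow> 'e) \<Rightarrow> bool" where
  "well_contracted N n x \<longleftrightarrow> (\<forall>y\<in>two_sided A. pi0 y = pi0 x \<longrightarrow> past_word y N = past_word x N \<longrightarrow>
    dist (\<pi> ((shift ^^ n) x)) (\<pi> ((shift ^^ n) y)) \<le> real (Suc N) * exp (birkhoff_sum g n x))"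

definition good_set :: "nat \<Rightarrow> (int \<Rightarrow> 'e) set" where
  "good_set N = {x \<in> two_sided A. \<forall>n. well_separated N n x \<and> well_contracted N n x}"

lemma tendsto_pihat2: "x \<in> two_sided A \<Longrightarrow> (\<pi> \<longlongrightarrow> \<pi> x) (near A x)"
  by (rule tendsto_nearI) (meson pihat2_continuity)

lemma tendsto_pihat2_shift: "x \<in> two_sided A \<Longrightarrow> ((\<lambda>y. \<pi> ((shift ^^ n) y)) \<longlongrightarrow> \<pi> ((shift ^^ n) x)) (near A x)"
  by (rule filterlim_compose[OF tendsto_pihat2 filterlim_near_shift]) simp

lemma tendsto_birkhoff_log_deriv:
  assumes x: "x \<in> two_sided A"
  shows "(birkhoff_sum g n \<longlongrightarrow> birkhoff_sum g n x) (near A x)"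
proof -
  have lim: "(g \<longlongrightarrow> g y) (near A y)" if "y \<in> two_sided A" for y
  proof (rule tendsto_nearI)
    fix e :: real assume "0 < e"
    from hoelder_continuity[OF log_deriv_hoelder[unfolded hoelder_def] this] that
    show "\<exists>n. \<forall>z\<in>two_sided A. agree_upto n y z \<longrightarrow> dist (g y) (g z) < e"
      unfolding dist_real_def by blast
  qed
  show ?thesis
    unfolding birkhoff_sum_def
    by (intro tendsto_sum filterlim_compose[OF lim filterlim_near_shift]) (simp add: x)
qed

text \<open>Both failures are open conditions: the past of a violating point is spliced to the
  future of a nearby point, and the strict inequality persists by continuity of the coding map and
  of the Birkhoff sums.\<close>

lemma good_set_measurable: "good_set N \<in> sets (two_sided_borel A)"
proof -
  have sep: "{x \<in> two_sided A. \<not> well_separated N n x} \<in> sets (two_sided_borel A)" for n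
  proof (rule open_two_sided_borel)
    fix x assume "x \<in> {x \<in> two_sided A. \<not> well_separated N n x}"
    then obtain \<tau> where x: "x \<in> two_sided A" and \<tau>: "\<tau> \<in> two_sided A" "pi0 \<tau> = pi0 ((shift ^^ n) x)" "past_word \<tau> n \<noteq> word_of x n"
      and less: "dist (\<pi> ((shift ^^ n) x)) (\<pi> \<tau>) < exp (birkhoff_sum g n x) / real (Suc N)"
      unfolding well_separated_def by (auto simp: not_le)
    have "\<forall>k\<ge>0. \<tau> k = (shift ^^ n) x k" using \<tau>(2) unfolding pi0_eq_iff .
    then have \<tau>0: "\<tau> 0 = (shift ^^ n) x 0" by simp
    let ?s = "\<lambda>y. splice \<tau> ((shift ^^ n) y)"
    have sx: "?s x = \<tau>" by (rule splice_eq[OF \<tau>(2)])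
    have "filterlim ?s (near A (?s x)) (near A x)"
      by (rule filterlim_compose[OF filterlim_near_splice[where x="(shift ^^ n) x"] filterlim_near_shift])
         (use \<tau>(1) \<tau>0 in auto)
    then have "((\<lambda>y. \<pi> (?s y)) \<longlongrightarrow> \<pi> \<tau>) (near A x)"
      unfolding sx by (rule filterlim_compose[OF tendsto_pihat2[OF \<tau>(1)]])
    then have "((\<lambda>y. exp (birkhoff_sum g n y) / real (Suc N) - dist (\<pi> ((shift ^^ n) y)) (\<pi> (?s y))) \<longlongrightarrow>
        exp (birkhoff_sum g n x) / real (Suc N) - dist (\<pi> ((shift ^^ n) x)) (\<pi> \<tau>)) (near A x)"
      by (intro tendsto_diff tendsto_divide tendsto_exp tendsto_const tendsto_dist tendsto_pihat2_shift tendsto_birkhoff_log_deriv x) auto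
    from order_tendstoD(1)[OF this, of 0] less obtain R where
      R: "\<And>y. y \<in> two_sided A \<Longrightarrow> agree_upto R x y \<Longrightarrow> dist (\<pi> ((shift ^^ n) y)) (\<pi> (?s y)) < exp (birkhoff_sum g n y) / real (Suc N)"
      unfolding eventually_near by auto
    have "\<not> well_separated N n y" if y: "y \<in> two_sided A" "agree_upto (max R n) x y" for y
    proof -
      have "(shift ^^ n) y 0 = \<tau> 0" using y \<tau>0 by (simp add: agree_upto_def shift_funpow_apply)
      then have "?s y \<in> two_sided A" using \<tau>(1) y(1) by (intro splice_two_sided) auto
      moreover have "pi0 (?s y) = pi0 ((shift ^^ n) y)" by (rule pi0_splice)
      moreover have "past_word (?s y) n \<noteq> word_of y n"
      proof -
        have eq: "word_of y n = word_of x n" using y(2) by (auto simp: agree_upto_def)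
        show ?thesis using \<tau>(3) unfolding past_word_splice eq .
      qed
      moreover have "dist (\<pi> ((shift ^^ n) y)) (\<pi> (?s y)) < exp (birkhoff_sum g n y) / real (Suc N)"
        by (intro R agree_upto_mono[OF y(2)] y(1)) simp
      ultimately show ?thesis unfolding well_separated_def not_le[symmetric] by blast
    qed
    then show "\<exists>R. \<forall>y\<in>two_sided A. agree_upto R x y \<longrightarrow> y \<in> {x \<in> two_sided A. \<not> well_separated N n x}" by blast
  qed simp
  have con: "{x \<in> two_sided A. \<not> well_contracted N n x} \<in> sets (two_sided_borel A)" for n
  proof (rule open_two_sided_borel)
    fix x assume "x \<in> {x \<in> two_sided A. \<not> well_contracted N n x}"
    then obtain z where x: "x \<in> two_sided A" and z: "z \<in> two_sided A" "pi0 z = pi0 x" "past_word z N = past_word x N"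
      and less: "real (Suc N) * exp (birkhoff_sum g n x) < dist (\<pi> ((shift ^^ n) x)) (\<pi> ((shift ^^ n) z))"
      unfolding well_contracted_def by (auto simp: not_le)
    have "\<forall>k\<ge>0. z k = x k" using z(2) unfolding pi0_eq_iff .
    then have z0: "z 0 = x 0" by simp
    have sx: "splice z x = z" by (rule splice_eq[OF z(2)])
    have "filterlim (splice z) (near A (splice z x)) (near A x)"
      by (rule filterlim_near_splice, rule z(1), rule z0)
    then have "((\<lambda>y. \<pi> ((shift ^^ n) (splice z y))) \<longlongrightarrow> \<pi> ((shift ^^ n) z)) (near A x)"
      unfolding sx by (rule filterlim_compose[OF tendsto_pihat2_shift[OF z(1)]])
    then have "((\<lambda>y. dist (\<pi> ((shift ^^ n) y)) (\<pi> ((shift ^^ n) (splice z y))) - real (Suc N) * exp (birkhoff_sum g n y)) \<longlongrightarrow>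
        dist (\<pi> ((shift ^^ n) x)) (\<pi> ((shift ^^ n) z)) - real (Suc N) * exp (birkhoff_sum g n x)) (near A x)"
      by (intro tendsto_diff tendsto_mult tendsto_exp tendsto_const tendsto_dist tendsto_pihat2_shift tendsto_birkhoff_log_deriv x)
    from order_tendstoD(1)[OF this, of 0] less obtain R where
      R: "\<And>y. y \<in> two_sided A \<Longrightarrow> agree_upto R x y \<Longrightarrow> real (Suc N) * exp (birkhoff_sum g n y) < dist (\<pi> ((shift ^^ n) y)) (\<pi> ((shift ^^ n) (splice z y)))"
      unfolding eventually_near by auto
    have "\<not> well_contracted N n y" if y: "y \<in> two_sided A" "agree_upto (max R N) x y" for y
    proof -
      have "z 0 = y 0" using y z0 by (simp add: agree_upto_def)
      then have "splice z y \<in> two_sided A" using z(1) y(1) by (intro splice_two_sided)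
      moreover have "pi0 (splice z y) = pi0 y" by (rule pi0_splice)
      moreover have "past_word (splice z y) N = past_word y N"
      proof -
        have "past_word x N = past_word y N" unfolding past_word_eq_iff using y(2) by (auto simp: agree_upto_def)
        then show ?thesis using z(3) by (simp only: past_word_splice)
      qed
      moreover have "real (Suc N) * exp (birkhoff_sum g n y) < dist (\<pi> ((shift ^^ n) y)) (\<pi> ((shift ^^ n) (splice z y)))"
        by (intro R agree_upto_mono[OF y(2)] y(1)) simp
      ultimately show ?thesis unfolding well_contracted_def not_le[symmetric] by blast
    qed
    then show "\<exists>R. \<forall>y\<in>two_sided A. agree_upto R x y \<longrightarrow> y \<in> {x \<in> two_sided A. \<not> well_contracted N n x}" by blast
  qed simp
  have "good_set N = two_sided A - (\<Union>n. {x \<in> two_sided A. \<not> well_separated N n x} \<union> {x \<in> two_sided A. \<not> well_contracted N n x})"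
    by (auto simp: good_set_def)
  also have "\<dots> \<in> sets (two_sided_borel A)"
    using sep con sets.top[of "two_sided_borel A"] by (intro sets.Diff sets.countable_UN' sets.Un) auto
  finally show ?thesis .
qed

text \<open>Agreement with an inner point \<open>x\<close> in \<open>M\<close> past letters places
  the coded point within \<open>\<delta> / 2\<close>, so it keeps a ball of radius
  \<open>\<delta> / 2\<close> in the fiber set. Both estimates follow for all times from the
  quasi-conformal bounds.\<close>

lemma good_set_contains_cylinder:
  assumes \<omega>: "\<omega> \<in> one_sided A"
  shows "\<exists>N M. \<exists>x\<in>past_fiber A \<omega>. 1 \<le> M \<and> past_fiber A \<omega> \<inter> past_cylinder A (past_word x M) \<subseteq> good_set N"
proof -
  obtain x \<delta> where x: "x \<in> past_fiber A \<omega>" and \<delta>: "0 < \<delta>" "ball (\<pi> x) \<delta> \<subseteq> Y \<omega>" using inner_point[OF \<omega>] by blast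
  obtain M0 where M0: "\<And>x y. x \<in> two_sided A \<Longrightarrow> y \<in> two_sided A \<Longrightarrow> agree_upto M0 x y \<Longrightarrow> dist (\<pi> x) (\<pi> y) < \<delta> / 2"
    using pihat2_continuity[of "\<delta> / 2"] \<delta> by auto
  define M where "M = Suc M0"
  have close: "dist (\<pi> y) (\<pi> z) < \<delta> / 2"
    if "y \<in> two_sided A" "z \<in> two_sided A" "pi0 y = pi0 z" "past_word y m = past_word z m" "M \<le> m" for y z m
  proof (rule M0[OF that(1,2)])
    have fut: "\<forall>k\<ge>0. y k = z k" using that(3) unfolding pi0_eq_iff .
    have past: "\<forall>k. - int m \<le> k \<and> k < 0 \<longrightarrow> y k = z k" using that(4) unfolding past_word_eq_iff .
    show "agree_upto M0 y z"
      unfolding agree_upto_def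
    proof (intro allI impI)
      fix k assume "\<bar>k\<bar> \<le> int M0"
      then show "y k = z k" using fut past that(5) by (cases "k \<ge> 0") (auto simp: M_def)
    qed
  qed
  obtain K where K: "1 \<le> K" and conf: "\<And>\<omega> n p \<delta>. \<omega> \<in> one_sided A \<Longrightarrow> 0 < \<delta> \<Longrightarrow> ball p \<delta> \<subseteq> Y \<omega> \<Longrightarrow>
    ball (forward_comp T \<omega> n p) (exp (log_expansion \<omega> n p) / K * \<delta>) \<subseteq> forward_comp T \<omega> n ` ball p \<delta> \<and>
    (\<forall>y\<in>ball p \<delta>. dist (forward_comp T \<omega> n p) (forward_comp T \<omega> n y) \<le> K * exp (log_expansion \<omega> n p) * \<delta>)"
    using forward_comp_quasi_conformal by blast
  \<comment> \<open>One integer absorbs the constants of both estimates; the maximum with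
    \<open>M\<close> makes agreement in \<open>N\<close> letters imply agreement in
    \<open>M\<close>.\<close>
  obtain N0 :: nat where N0: "max (K / (\<delta> / 2)) (K * (\<delta> / 2)) \<le> real N0" using real_arch_simple by blast
  define N where "N = max N0 M"
  have N: "K / (\<delta> / 2) \<le> real (Suc N)" "K * (\<delta> / 2) \<le> real (Suc N)" "M \<le> N" using N0 by (auto simp: N_def)
  have "y \<in> good_set N" if y: "y \<in> past_fiber A \<omega>" "past_word y M = past_word x M" for y
  proof -
    have yA: "y \<in> two_sided A" and xA: "x \<in> two_sided A" and y0: "pi0 y = \<omega>" and x0: "pi0 x = \<omega>"
      using x y by (auto simp: past_fiber_def)
    have "dist (\<pi> x) (\<pi> y) < \<delta> / 2" using x0 y0 y(2) by (intro close[OF xA yA, of M]) auto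
    then have "ball (\<pi> y) (\<delta> / 2) \<subseteq> ball (\<pi> x) \<delta>"
      by (intro ball_subset_ball_iff[THEN iffD2]) (auto simp: dist_commute)
    then have sub: "ball (\<pi> y) (\<delta> / 2) \<subseteq> Y (pi0 y)" using \<delta>(2) y0 by blast
    have \<delta>2: "0 < \<delta> / 2" using \<delta> by simp
    note conf_y = conf[OF tail_from_one_sided[OF yA] \<delta>2 sub, unfolded log_expansion_pihat2[OF yA] pihat2_shift_funpow[OF yA, symmetric]]
    have "well_separated N n y" for n
      unfolding well_separated_def
    proof (intro ballI impI)
      fix \<tau> assume \<tau>: "\<tau> \<in> two_sided A" "pi0 \<tau> = pi0 ((shift ^^ n) y)" "past_word \<tau> n \<noteq> word_of y n"
      have "\<pi> \<tau> \<notin> ball (\<pi> ((shift ^^ n) y)) (exp (birkhoff_sum g n y) / K * (\<delta> / 2))"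
        using cylinders_separated[OF yA sub \<tau>] conf_y[of n] by blast
      then have "exp (birkhoff_sum g n y) / K * (\<delta> / 2) \<le> dist (\<pi> ((shift ^^ n) y)) (\<pi> \<tau>)" by simp
      moreover have "exp (birkhoff_sum g n y) / real (Suc N) \<le> exp (birkhoff_sum g n y) / (K / (\<delta> / 2))"
        using N(1) K \<delta> by (intro divide_left_mono) auto
      ultimately show "exp (birkhoff_sum g n y) / real (Suc N) \<le> dist (\<pi> ((shift ^^ n) y)) (\<pi> \<tau>)" by simp
    qed
    moreover have "well_contracted N n y" for n
      unfolding well_contracted_def
    proof (intro ballI impI)
      fix z assume z: "z \<in> two_sided A" "pi0 z = pi0 y" "past_word z N = past_word y N"
      have "dist (\<pi> y) (\<pi> z) < \<delta> / 2" using z N(3) by (intro close[OF yA z(1), of N]) auto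
      then have "dist (\<pi> ((shift ^^ n) y)) (forward_comp T (pi0 y) n (\<pi> z)) \<le> K * exp (birkhoff_sum g n y) * (\<delta> / 2)"
        using conf_y[of n] by simp
      then have "dist (\<pi> ((shift ^^ n) y)) (\<pi> ((shift ^^ n) z)) \<le> K * exp (birkhoff_sum g n y) * (\<delta> / 2)"
        unfolding pihat2_shift_funpow[OF z(1)] z(2) .
      also have "\<dots> = (K * (\<delta> / 2)) * exp (birkhoff_sum g n y)" by simp
      also have "\<dots> \<le> real (Suc N) * exp (birkhoff_sum g n y)" using N(2) by (intro mult_right_mono) auto
      finally show "dist (\<pi> ((shift ^^ n) y)) (\<pi> ((shift ^^ n) z)) \<le> real (Suc N) * exp (birkhoff_sum g n y)" .
    qed
    ultimately show ?thesis using yA by (simp add: good_set_def)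
  qed
  then have "past_fiber A \<omega> \<inter> past_cylinder A (past_word x M) \<subseteq> good_set N"
    by (auto simp: mem_past_cylinder_iff)
  moreover have "1 \<le> M" by (simp add: M_def)
  ultimately show ?thesis using x by blast
qed

end

section \<open>Dimension along subsequences of scales\<close>

text \<open>If \<open>s\<close> enumerates \<open>S\<close> increasingly, exactly \<open>k\<close>
  elements lie below \<open>s k\<close>, so \<open>k / s k\<close> tends to \<theta>. Since \<theta>
  is not 0, quotients of consecutive terms tend to 1.\<close>

lemma infinite_times_of_positive_frequency:
  fixes S :: "nat set"
  assumes lim: "(\<lambda>n. real (card (S \<inter> {..<n})) / real n) \<longlonglongrightarrow> \<theta>" and "0 < \<theta>"
  shows "\<exists>s. strict_mono s \<and> (\<forall>k. s k \<in> S) \<and> (\<lambda>k. real (s (Suc k)) / real (s k)) \<longlonglongrightarrow> 1"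
proof -
  have inf: "infinite S"
  proof
    assume fin: "finite S"
    have "(\<lambda>n. real (card S) / real n) \<longlonglongrightarrow> 0"
      by (intro tendsto_divide_0[OF tendsto_const] filterlim_at_top_imp_at_infinity filterlim_real_sequentially)
    then have "\<theta> \<le> 0"
      by (rule LIMSEQ_le[OF lim]) (auto intro!: exI[of _ 0] divide_right_mono card_mono fin)
    with \<open>0 < \<theta>\<close> show False by simp
  qed
  let ?s = "enumerate S"
  have mono: "strict_mono ?s" by (rule strict_mono_enumerate[OF inf])
  have cnt: "card (S \<inter> {..<?s k}) = k" for k
  proof -
    have "S \<inter> {..<?s k} = ?s ` {..<k}"
    proof (intro subset_antisym subsetI)
      fix n assume n: "n \<in> S \<inter> {..<?s k}"
      then obtain i where "n = ?s i" using range_enumerate[OF inf] by auto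
      with n show "n \<in> ?s ` {..<k}" using mono by (auto simp: strict_mono_less)
    qed (use mono enumerate_in_set[OF inf] in \<open>auto simp: strict_mono_less\<close>)
    then show ?thesis using mono by (simp add: card_image strict_mono_imp_inj_on inj_on_subset)
  qed
  have r: "(\<lambda>k. real k / real (?s k)) \<longlonglongrightarrow> \<theta>"
    using LIMSEQ_subseq_LIMSEQ[OF lim mono] by (simp add: comp_def cnt)
  have "(\<lambda>k. (real k / real (?s k)) / (real (Suc k) / real (?s (Suc k))) * (real (Suc k) / real k)) \<longlonglongrightarrow> \<theta> / \<theta> * 1"
    using \<open>0 < \<theta>\<close> by (intro tendsto_mult tendsto_divide r LIMSEQ_Suc[OF r]) (simp, real_asymp)
  moreover have "\<forall>\<^sub>F k in sequentially. (real k / real (?s k)) / (real (Suc k) / real (?s (Suc k))) * (real (Suc k) / real k) =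
      real (?s (Suc k)) / real (?s k)"
    using eventually_gt_at_top[of 0]
  proof eventually_elim
    case (elim k)
    then have "0 < ?s k" "0 < ?s (Suc k)"
      using strict_mono_imp_increasing[OF mono, of k] strict_mono_imp_increasing[OF mono, of "Suc k"] by linarith+
    with elim show ?case by (simp del: of_nat_Suc)
  qed
  ultimately have "(\<lambda>k. real (?s (Suc k)) / real (?s k)) \<longlonglongrightarrow> \<theta> / \<theta> * 1"
    by (rule Lim_transform_eventually)
  then show ?thesis using mono enumerate_in_set[OF inf] \<open>0 < \<theta>\<close> by auto
qed

text \<open>Here \<open>a\<close> and \<open>b\<close> are the negative logarithms of size and mass.
  At the times \<open>s k\<close> they control \<open>ball_log\<close> up to additive constants, and
  the quotients at neighbouring times have the same limit because the times do; the delay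
  \<open>N\<close> is negligible. In the infinite case the lower estimate is trivial.\<close>

lemma local_dim_from_times:
  fixes \<nu> :: "'a::euclidean_space measure" and a b :: "nat \<Rightarrow> real" and s :: "nat \<Rightarrow> nat"
  assumes prob: "prob_space \<nu>" and sets: "sets \<nu> = sets borel"
    and s: "strict_mono s" "(\<lambda>k. real (s (Suc k)) / real (s k)) \<longlonglongrightarrow> 1"
    and cpos: "0 < c" "0 < c'" "0 < d"
    and up: "\<forall>\<^sub>F k in sequentially. measure \<nu> (ball z (exp (- a (s k)) / c)) \<le> d * exp (- b (s k))"
    and lo: "\<forall>\<^sub>F k in sequentially. exp (- b (s k + N)) / d \<le> measure \<nu> (ball z (c' * exp (- a (s k))))"
    and b: "(\<lambda>n. b n / real n) \<longlonglongrightarrow> h" "0 \<le> h"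
    and a: "(((\<lambda>n. a n / real n) \<longlonglongrightarrow> \<kappa>) \<and> 0 < \<kappa> \<and> D = h / \<kappa>) \<or>
      (filterlim (\<lambda>n. a n / real n) at_top sequentially \<and> D = 0)"
  shows "\<forall>r>0. 0 < measure \<nu> (ball z r)" and "(local_dim_ratio \<nu> z \<longlongrightarrow> D) (at_right 0)"
proof -
  interpret prob_space \<nu> by fact
  have s_top: "filterlim s at_top sequentially" by (rule filterlim_subseq[OF s(1)])
  have s_real: "filterlim (\<lambda>k. real (s k)) at_top sequentially"
    by (rule filterlim_compose[OF filterlim_real_sequentially s_top])
  have s_pos: "\<forall>\<^sub>F k in sequentially. 0 < s k"
    by (rule eventually_compose_filterlim[OF eventually_gt_at_top s_top])
  have small: "(\<lambda>k. t / real (s k)) \<longlonglongrightarrow> 0" for t :: real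
    by (intro tendsto_divide_0[OF tendsto_const] filterlim_at_top_imp_at_infinity s_real)
  have bs: "(\<lambda>k. b (s k) / real (s k)) \<longlonglongrightarrow> h" by (rule filterlim_compose[OF b(1) s_top])
  have sN: "(\<lambda>k. real (s (Suc k) + N) / real (s k)) \<longlonglongrightarrow> 1"
    using tendsto_add[OF s(2) small[of "real N"]] by (simp add: add_divide_distrib)
  have bsN: "(\<lambda>k. b (s (Suc k) + N) / real (s k)) \<longlonglongrightarrow> h"
  proof (rule Lim_transform_eventually)
    have "filterlim (\<lambda>k. s (Suc k) + N) at_top sequentially"
      by (rule filterlim_at_top_mono[OF s_top]) (intro always_eventually allI trans_le_add1 less_imp_le strict_monoD[OF s(1)] lessI)
    from tendsto_mult[OF filterlim_compose[OF b(1) this] sN]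
    show "(\<lambda>k. b (s (Suc k) + N) / real (s (Suc k) + N) * (real (s (Suc k) + N) / real (s k))) \<longlonglongrightarrow> h" by simp
    show "\<forall>\<^sub>F k in sequentially. b (s (Suc k) + N) / real (s (Suc k) + N) * (real (s (Suc k) + N) / real (s k)) = b (s (Suc k) + N) / real (s k)"
      using s_pos
    proof eventually_elim
      case (elim k)
      then have "real (s (Suc k) + N) \<noteq> 0" using strict_monoD[OF s(1) lessI, of k] by linarith
      then show ?case by (simp del: of_nat_add)
    qed
  qed
  have a_top: "filterlim (\<lambda>k. a (s k) + t) at_top sequentially" for t
  proof -
    have "filterlim (\<lambda>n. a n / real n * real n) at_top sequentially"
      using a filterlim_tendsto_pos_mult_at_top[OF _ _ filterlim_real_sequentially, of "\<lambda>n. a n / real n" \<kappa>]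
        filterlim_at_top_mult_at_top[OF _ filterlim_real_sequentially, of "\<lambda>n. a n / real n"] by blast
    moreover have "\<forall>\<^sub>F n in sequentially. a n / real n * real n = a n"
      by (rule eventually_mono[OF eventually_gt_at_top[of 0]]) simp
    ultimately have "filterlim a at_top sequentially" by (subst (asm) filterlim_cong) auto
    then have "filterlim (\<lambda>k. a (s k)) at_top sequentially" by (rule filterlim_compose[OF _ s_top])
    then show ?thesis using filterlim_tendsto_add_at_top[OF tendsto_const[of t]] by (simp add: add.commute)
  qed
  show pos: "\<forall>r>0. 0 < measure \<nu> (ball z r)"
  proof (intro allI impI)
    fix r :: real assume "0 < r"
    have "\<forall>\<^sub>F k in sequentially. a (s k) + ln (r / c') > 0"
      using a_top[of "ln (r / c')"] unfolding filterlim_at_top_dense by blast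
    with lo have "\<forall>\<^sub>F k in sequentially. 0 < measure \<nu> (ball z r)"
    proof eventually_elim
      case (elim k)
      have "c' * exp (- a (s k)) \<le> c' * exp (ln (r / c'))" using elim cpos by (intro mult_left_mono) auto
      also have "\<dots> = r" using \<open>0 < r\<close> cpos by simp
      finally have "measure \<nu> (ball z (c' * exp (- a (s k)))) \<le> measure \<nu> (ball z r)"
        by (intro finite_measure_mono subset_ball) (auto simp: sets)
      moreover have "0 < exp (- b (s k + N)) / d" using cpos by simp
      ultimately show ?case using elim by linarith
    qed
    then show "0 < measure \<nu> (ball z r)" by simp
  qed
  note F = mono_ball_log[OF prob sets pos]
  \<comment> \<open>The pair \<open>x\<close>, \<open>y\<close> encodes the upper bounds on masses,
    the pair \<open>x'\<close>, \<open>y'\<close> the lower ones.\<close>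
  define x where "x k = a (s k) + ln c" for k
  define y where "y k = b (s k) - ln d" for k
  define x' where "x' k = a (s k) + - ln c'" for k
  define y' where "y' k = b (s k + N) + ln d" for k
  have x: "filterlim x at_top sequentially" and x': "filterlim x' at_top sequentially"
    unfolding x_def[abs_def] x'_def[abs_def] by (rule a_top)+
  have le: "\<forall>\<^sub>F k in sequentially. y k \<le> ball_log \<nu> z (x k)"
    using up
  proof eventually_elim
    case (elim k)
    have "exp (- x k) = exp (- a (s k)) / c" using cpos by (simp add: x_def exp_diff exp_minus field_simps exp_add)
    with elim have "measure \<nu> (ball z (exp (- x k))) \<le> d * exp (- b (s k))" by simp
    then have "ln (measure \<nu> (ball z (exp (- x k)))) \<le> ln (d * exp (- b (s k)))"
      using pos by (intro ln_mono) auto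
    then show ?case using cpos by (simp add: ball_log_def y_def ln_mult)
  qed
  have le': "\<forall>\<^sub>F k in sequentially. ball_log \<nu> z (x' k) \<le> y' k"
    using lo
  proof eventually_elim
    case (elim k)
    have "exp (- x' k) = c' * exp (- a (s k))" using cpos by (simp add: x'_def exp_diff exp_minus field_simps)
    with elim have "exp (- b (s k + N)) / d \<le> measure \<nu> (ball z (exp (- x' k)))" by simp
    then have "ln (exp (- b (s k + N)) / d) \<le> ln (measure \<nu> (ball z (exp (- x' k))))"
      using cpos by (intro ln_mono) auto
    then show ?case using cpos by (simp add: ball_log_def y'_def ln_div)
  qed
  have num: "(\<lambda>k. y k / real (s k)) \<longlonglongrightarrow> h"
    using tendsto_diff[OF bs small[of "ln d"]] by (simp add: y_def diff_divide_distrib)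
  have num': "(\<lambda>k. y' (Suc k) / real (s k)) \<longlonglongrightarrow> h"
    using tendsto_add[OF bsN small[of "ln d"]] by (simp add: y'_def add_divide_distrib)
  have cancel: "(u / t) / (v / t) = u / v" if "0 < t" for u v t :: real using that by simp
  show "(local_dim_ratio \<nu> z \<longlongrightarrow> D) (at_right 0)"
    using a
  proof (elim disjE conjE)
    assume lim: "(\<lambda>n. a n / real n) \<longlonglongrightarrow> \<kappa>" and \<kappa>: "0 < \<kappa>" and D: "D = h / \<kappa>"
    have as: "(\<lambda>k. a (s k) / real (s k)) \<longlonglongrightarrow> \<kappa>" by (rule filterlim_compose[OF lim s_top])
    have den': "(\<lambda>k. x' k / real (s k)) \<longlonglongrightarrow> \<kappa>"
      using tendsto_add[OF as small[of "- ln c'"]] by (simp add: x'_def diff_divide_distrib)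
    have "(\<lambda>k. x k / real (s k)) \<longlonglongrightarrow> \<kappa>"
      using tendsto_add[OF as small[of "ln c"]] by (simp add: x_def add_divide_distrib)
    from tendsto_mult[OF LIMSEQ_Suc[OF this] s(2)]
    have "(\<lambda>k. x (Suc k) / real (s (Suc k)) * (real (s (Suc k)) / real (s k))) \<longlonglongrightarrow> \<kappa>" by simp
    moreover have "\<forall>\<^sub>F k in sequentially. x (Suc k) / real (s (Suc k)) * (real (s (Suc k)) / real (s k)) = x (Suc k) / real (s k)"
      using s_pos
    proof eventually_elim
      case (elim k)
      then have "0 < s (Suc k)" using s(1) by (meson strict_mono_less lessI order_less_trans)
      then show ?case by simp
    qed
    ultimately have den: "(\<lambda>k. x (Suc k) / real (s k)) \<longlonglongrightarrow> \<kappa>" by (rule Lim_transform_eventually)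
    have l: "(\<lambda>k. y k / x (Suc k)) \<longlonglongrightarrow> D"
    proof (rule Lim_transform_eventually)
      show "(\<lambda>k. (y k / real (s k)) / (x (Suc k) / real (s k))) \<longlonglongrightarrow> D"
        unfolding D by (intro tendsto_divide num den) (use \<kappa> in simp)
      show "\<forall>\<^sub>F k in sequentially. (y k / real (s k)) / (x (Suc k) / real (s k)) = y k / x (Suc k)"
        using s_pos by eventually_elim (simp add: cancel)
    qed
    have l': "(\<lambda>k. y' (Suc k) / x' k) \<longlonglongrightarrow> D"
    proof (rule Lim_transform_eventually)
      show "(\<lambda>k. (y' (Suc k) / real (s k)) / (x' k / real (s k))) \<longlonglongrightarrow> D"
        unfolding D by (intro tendsto_divide num' den') (use \<kappa> in simp)
      show "\<forall>\<^sub>F k in sequentially. (y' (Suc k) / real (s k)) / (x' k / real (s k)) = y' (Suc k) / x' k"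
        using s_pos by eventually_elim (simp add: cancel)
    qed
    have D0: "0 \<le> D" using b(2) \<kappa> D by simp
    show ?thesis
      by (intro local_dim_ratio_tendstoI mono_growth_lower[OF F x le l] mono_growth_upper[OF F(1) x' le' l' D0])
  next
    assume lim: "filterlim (\<lambda>n. a n / real n) at_top sequentially" and D: "D = 0"
    have "filterlim (\<lambda>k. a (s k) / real (s k)) at_top sequentially" by (rule filterlim_compose[OF lim s_top])
    from filterlim_tendsto_add_at_top[OF small[of "- ln c'"] this]
    have den': "filterlim (\<lambda>k. x' k / real (s k)) at_top sequentially"
      by (simp add: x'_def diff_divide_distrib)
    have l': "(\<lambda>k. y' (Suc k) / x' k) \<longlonglongrightarrow> 0"
    proof (rule Lim_transform_eventually)
      show "(\<lambda>k. (y' (Suc k) / real (s k)) / (x' k / real (s k))) \<longlonglongrightarrow> 0"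
        by (intro tendsto_divide_0[OF num'] filterlim_at_top_imp_at_infinity den')
      show "\<forall>\<^sub>F k in sequentially. (y' (Suc k) / real (s k)) / (x' k / real (s k)) = y' (Suc k) / x' k"
        using s_pos by eventually_elim (simp add: cancel)
    qed
    show ?thesis
    proof (rule local_dim_ratio_tendstoI)
      fix e :: real assume "0 < e"
      show "\<forall>\<^sub>F t in at_top. D - e \<le> ball_log \<nu> z t / t"
        using eventually_gt_at_top[of 0]
      proof eventually_elim
        case (elim t)
        have "0 \<le> ball_log \<nu> z t / t" using F(2)[of t] elim by simp
        then show ?case using D \<open>0 < e\<close> by linarith
      qed
      show "\<forall>\<^sub>F t in at_top. ball_log \<nu> z t / t \<le> D + e"
        unfolding D by (rule mono_growth_upper[OF F(1) x' le' l' order_refl \<open>0 < e\<close>])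
    qed
  qed
qed

section \<open>Local dimension of the fiber measures\<close>

text \<open>The starting point moves with \<open>n\<close>, but the sum runs over the backward orbit
  of the fixed point \<tau>, to which the ergodic theorem applies.\<close>

lemma birkhoff_sum_unshift:
  "birkhoff_sum h n ((unshift ^^ n) \<tau>) = ergodic_sum unshift (\<lambda>x. h (unshift x)) n \<tau>"
proof (induction n)
  case (Suc n)
  have "birkhoff_sum h (1 + n) (unshift ((unshift ^^ n) \<tau>)) = h (unshift ((unshift ^^ n) \<tau>)) + birkhoff_sum h n ((unshift ^^ n) \<tau>)"
    by (subst birkhoff_sum_add) (simp add: birkhoff_sum_def)
  with Suc show ?case by (simp add: ergodic_sum_def)
qed (simp add: birkhoff_sum_def)

context gibbs
begin

lemma AE_past_average:
  assumes h: "integrable \<mu> h"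
  shows "AE \<tau> in \<mu>. (\<lambda>n. birkhoff_sum h n ((unshift ^^ n) \<tau>) / real n) \<longlonglongrightarrow> (LINT x|\<mu>. h x)"
proof -
  have "(LINT x|\<mu>. h (unshift x)) = (LINT x|\<mu>. h x)" using h by (intro backward.integral_comp) auto
  then show ?thesis
    using backward.birkhoff_ergodic[OF ergodic_backward backward.integrable_comp[OF h]]
    by (simp add: birkhoff_sum_unshift)
qed

lemma AE_past_frequency:
  assumes [measurable]: "G \<in> sets \<mu>"
  shows "AE \<tau> in \<mu>. (\<lambda>n. real (card ({j. (unshift ^^ j) \<tau> \<in> G} \<inter> {..<n})) / real n) \<longlonglongrightarrow> prob G"
proof -
  have "ergodic_sum unshift (indicator G) n \<tau> = real (card ({j. (unshift ^^ j) \<tau> \<in> G} \<inter> {..<n}))" for n \<tau>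
  proof -
    have "ergodic_sum unshift (indicator G) n \<tau> = (\<Sum>j<n. if (unshift ^^ j) \<tau> \<in> G then 1 else 0)"
      unfolding ergodic_sum_def by (intro sum.cong) (auto simp: indicator_def)
    then show ?thesis by (simp add: sum.If_cases Int_commute)
  qed
  moreover have "integrable \<mu> (indicator G :: _ \<Rightarrow> real)" by (simp add: emeasure_eq_measure)
  ultimately show ?thesis using backward.birkhoff_ergodic[OF ergodic_backward, of "indicator G"]
      sets.sets_into_space[OF assms] by (simp add: Int_absorb2)
qed

text \<open>Cutting \<open>h\<close> off at \<open>- m\<close> makes it integrable, and by monotone
  convergence the integrals decrease to minus infinity.\<close>

lemma truncation_below:
  fixes h :: "(int \<Rightarrow> 'e) \<Rightarrow> real"
  assumes [measurable]: "h \<in> borel_measurable \<mu>" and neg: "\<And>x. x \<in> two_sided A \<Longrightarrow> h x \<le> 0"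
    and inf: "\<not> integrable \<mu> h"
  shows "\<exists>h'. integrable \<mu> h' \<and> (\<forall>x\<in>two_sided A. h x \<le> h' x) \<and> (LINT x|\<mu>. h' x) < - K"
proof -
  let ?h = "\<lambda>m x. min (- h x) (real m)"
  have int: "integrable \<mu> (?h m)" for m
    by (rule integrable_const_bound[where B="real m"]) (use neg in \<open>auto intro!: AE_I2 simp: min_def\<close>)
  have "(\<integral>\<^sup>+x. ennreal (- h x) \<partial>\<mu>) = (\<integral>\<^sup>+x. (SUP m. ennreal (?h m x)) \<partial>\<mu>)"
  proof (rule nn_integral_cong)
    fix x
    obtain m where "- h x \<le> real m" using real_arch_simple by blast
    then have "ennreal (- h x) \<le> (SUP m. ennreal (?h m x))" by (intro SUP_upper2[of m]) auto
    moreover have "(SUP m. ennreal (?h m x)) \<le> ennreal (- h x)" by (intro SUP_least ennreal_leI) simp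
    ultimately show "ennreal (- h x) = (SUP m. ennreal (?h m x))" by (rule antisym)
  qed
  also have "\<dots> = (SUP m. \<integral>\<^sup>+x. ennreal (?h m x) \<partial>\<mu>)"
    by (rule nn_integral_monotone_convergence_SUP) (auto intro!: incseq_SucI le_funI ennreal_leI)
  also have "(\<lambda>m. \<integral>\<^sup>+x. ennreal (?h m x) \<partial>\<mu>) = (\<lambda>m. ennreal (LINT x|\<mu>. ?h m x))"
    by (intro ext nn_integral_eq_integral int AE_I2) (use neg in simp)
  finally have eq: "(\<integral>\<^sup>+x. ennreal (- h x) \<partial>\<mu>) = (SUP m. ennreal (LINT x|\<mu>. ?h m x))" .
  have "\<not> integrable \<mu> (\<lambda>x. - h x)" using inf by simp
  moreover have "AE x in \<mu>. 0 \<le> - h x" using neg by (intro AE_I2) simp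
  ultimately have "(\<integral>\<^sup>+x. ennreal (- h x) \<partial>\<mu>) = \<infinity>"
    using integrableI_nonneg[of "\<lambda>x. - h x" \<mu>] by (fastforce simp: less_top[symmetric])
  then have "ennreal \<bar>K\<bar> < (SUP m. ennreal (LINT x|\<mu>. ?h m x))" unfolding eq[symmetric] by simp
  then obtain m where "ennreal \<bar>K\<bar> < ennreal (LINT x|\<mu>. ?h m x)" by (auto simp: less_SUP_iff)
  then have "\<bar>K\<bar> < (LINT x|\<mu>. ?h m x)" by (auto simp: ennreal_less_iff)
  then have "K < (LINT x|\<mu>. ?h m x)" by linarith
  then show ?thesis
    by (intro exI[of _ "\<lambda>x. - ?h m x"]) (auto intro!: integrable_minus int)
qed

text \<open>The averages are compared with those of truncations, one for each of countably many
  levels.\<close>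

lemma AE_past_average_infinite:
  assumes "h \<in> borel_measurable \<mu>" "\<And>x. x \<in> two_sided A \<Longrightarrow> h x \<le> 0" "\<not> integrable \<mu> h"
  shows "AE \<tau> in \<mu>. filterlim (\<lambda>n. - birkhoff_sum h n ((unshift ^^ n) \<tau>) / real n) at_top sequentially"
proof -
  have "AE \<tau> in \<mu>. \<forall>\<^sub>F n in sequentially. real K \<le> - birkhoff_sum h n ((unshift ^^ n) \<tau>) / real n" for K :: nat
  proof -
    obtain h' where h': "integrable \<mu> h'" "\<And>x. x \<in> two_sided A \<Longrightarrow> h x \<le> h' x" "(LINT x|\<mu>. h' x) < - real K"
      using truncation_below[OF assms] by blast
    have "(LINT x|\<mu>. h' (unshift x)) < - real K" using h' by (subst backward.integral_comp) auto
    from backward.ergodic_average_upper[OF ergodic_backward backward.integrable_comp[OF h'(1)] this] AE_space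
    show ?thesis
    proof eventually_elim
      case (elim \<tau>)
      from elim(1) eventually_gt_at_top[of 0] show ?case
      proof eventually_elim
        case (elim n)
        have "birkhoff_sum h n ((unshift ^^ n) \<tau>) \<le> birkhoff_sum h' n ((unshift ^^ n) \<tau>)"
          unfolding birkhoff_sum_def using \<open>\<tau> \<in> space \<mu>\<close> by (intro sum_mono h'(2)) simp
        also have "\<dots> \<le> - real K * real n" using elim by (simp add: birkhoff_sum_unshift)
        finally show ?case using elim by (simp add: field_simps)
      qed
    qed
  qed
  then have "AE \<tau> in \<mu>. \<forall>K. \<forall>\<^sub>F n in sequentially. real K \<le> - birkhoff_sum h n ((unshift ^^ n) \<tau>) / real n"
    by (simp add: AE_all_countable)
  then show ?thesis
  proof eventually_elim
    case (elim \<tau>)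
    show ?case unfolding filterlim_at_top
    proof
      fix Z :: real
      obtain K where "Z \<le> real K" using real_arch_simple by blast
      then show "\<forall>\<^sub>F n in sequentially. Z \<le> - birkhoff_sum h n ((unshift ^^ n) \<tau>) / real n"
        by (intro eventually_mono[OF spec[OF elim, of K]]) auto
    qed
  qed
qed

text \<open>Entropies of words are nonnegative and at most \<open>ln C + real n * excess\<close>;
  divide by \<open>n\<close>.\<close>

lemma excess_nonneg: "0 \<le> excess"
proof -
  have "(\<lambda>n. - ln C / real n) \<longlonglongrightarrow> 0" by real_asymp
  then show ?thesis
  proof (rule LIMSEQ_le_const2)
    have "- ln C / real n \<le> excess" if "1 \<le> n" for n
    proof -
      have "0 \<le> ln C + real n * excess"
        using shannon_nonneg shannon_trunc_le[OF that] by (rule order_trans)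
      with that show ?thesis by (simp add: field_simps)
    qed
    then show "\<exists>N. \<forall>n\<ge>N. - ln C / real n \<le> excess" by blast
  qed
qed

end

locale smale_gibbs = hoelder_conformal_smale A Y0 Y T Ystar + state?: gibbs_conditionals \<mu> A \<psi> P C \<mu>c
  for A :: "'e :: countable \<Rightarrow> 'e \<Rightarrow> bool"
    and Y0 :: "'a :: euclidean_space set"
    and Y Ystar :: "(nat \<Rightarrow> 'e) \<Rightarrow> 'a set"
    and T :: "(nat \<Rightarrow> 'e) \<Rightarrow> 'a \<Rightarrow> 'a"
    and \<psi> :: "(int \<Rightarrow> 'e) \<Rightarrow> real"
    and P C :: real
    and \<mu> :: "(int \<Rightarrow> 'e) measure"
    and \<mu>c :: "(nat \<Rightarrow> 'e) \<Rightarrow> (int \<Rightarrow> 'e) measure"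
begin

lemma good_set_sets [measurable]: "good_set N \<in> sets \<mu>"
  by (simp add: sets_\<mu> good_set_measurable)

lemma g_measurable [measurable]: "g \<in> borel_measurable \<mu>"
  using hoelder_measurable[OF log_deriv_hoelder] by (simp cong: measurable_cong_sets add: sets_\<mu>)

text \<open>Otherwise almost every conditional measure would ignore all good sets at once. But in
  each fiber one of them, with \<open>N\<close> depending on \<omega>, contains a past cylinder,
  whose conditional mass is positive.\<close>

lemma good_set_positive: "\<exists>N. 0 < prob (good_set N)"
proof (rule ccontr)
  assume "\<nexists>N. 0 < prob (good_set N)"
  then have "prob (good_set N) = 0" for N by (metis measure_nonneg less_le)
  then have "AE \<tau> in \<mu>. \<tau> \<notin> good_set N" for N
    using AE_iff_measurable[of "good_set N" \<mu>] sets.sets_into_space[OF good_set_sets[of N]]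
    by (auto simp: emeasure_eq_measure prob_eq_0)
  then have "AE \<tau> in \<mu>. \<forall>N. \<tau> \<notin> good_set N" by (simp add: AE_all_countable)
  from AE_conditional[OF this] have no: "AE \<omega> in future. AE \<tau> in \<mu>c \<omega>. \<forall>N. \<tau> \<notin> good_set N" .
  obtain D where D: "1 \<le> D" "AE \<omega> in future. \<forall>n\<ge>1. \<forall>\<tau>\<in>past_fiber A \<omega>.
      exp (past_weight n \<tau>) / D \<le> measure (\<mu>c \<omega>) (past_cylinder A (past_word \<tau> n)) \<and>
      measure (\<mu>c \<omega>) (past_cylinder A (past_word \<tau> n)) \<le> D * exp (past_weight n \<tau>)"
    using conditional_gibbs by blast
  from D(2) no conditional_fiber AE_space have "AE \<omega> in future. False"
  proof eventually_elim
    case (elim \<omega>)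
    then have \<omega>: "\<omega> \<in> one_sided A" by simp
    interpret c: prob_space "\<mu>c \<omega>" by (rule conditional_prob_space[OF \<omega>])
    obtain N M x where x: "x \<in> past_fiber A \<omega>" "1 \<le> M" "past_fiber A \<omega> \<inter> past_cylinder A (past_word x M) \<subseteq> good_set N"
      using good_set_contains_cylinder[OF \<omega>] by blast
    have "0 < exp (past_weight M x) / D" using D(1) by simp
    also have "\<dots> \<le> c.prob (past_cylinder A (past_word x M))" using elim(1) x by blast
    finally have pos: "0 < c.prob (past_cylinder A (past_word x M))" .
    have "AE \<tau> in \<mu>c \<omega>. \<tau> \<notin> past_cylinder A (past_word x M)"
      using elim(2,3) by eventually_elim (use x(3) in blast)
    moreover have "past_cylinder A (past_word x M) \<in> c.events" by (simp add: conditional_sets[OF \<omega>] past_cylinder_sets)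
    ultimately have "c.prob (past_cylinder A (past_word x M)) = 0" using c.prob_eq_0 by blast
    with pos show ?case by simp
  qed
  then show False using prob_space_future by (simp add: prob_space.AE_False)
qed

lemma \<pi>_measurable: "\<omega> \<in> one_sided A \<Longrightarrow> \<pi> \<in> borel_measurable (\<mu>c \<omega>)"
  using pihat2_measurable by (simp cong: measurable_cong_sets add: conditional_sets)

lemma measure_fiber_ball:
  "\<omega> \<in> one_sided A \<Longrightarrow> measure (fiber_measure Y T \<mu>c \<omega>) (ball z r) = measure (\<mu>c \<omega>) (\<pi> -` ball z r \<inter> two_sided A)"
  using sets_eq_imp_space_eq[OF conditional_sets] by (simp add: fiber_measure_def measure_distr \<pi>_measurable)

lemma fiber_ball_sets:
  "\<omega> \<in> one_sided A \<Longrightarrow> \<pi> -` ball z r \<inter> two_sided A \<in> sets (\<mu>c \<omega>)"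
  using measurable_sets[OF \<pi>_measurable, of \<omega> "ball z r"] sets_eq_imp_space_eq[OF conditional_sets, of \<omega>] by simp

section \<open>Balls and past cylinders at good times\<close>

text \<open>Points of the fiber with another past word are at least one radius away by
  \<open>well_separated\<close>, so the ball lies in the cylinder up to a null set.\<close>

lemma fiber_ball_le:
  assumes \<omega>: "\<omega> \<in> one_sided A" and fib: "AE \<tau> in \<mu>c \<omega>. \<tau> \<in> past_fiber A \<omega>"
    and \<tau>: "\<tau> \<in> past_fiber A \<omega>" and good: "(unshift ^^ n) \<tau> \<in> good_set N"
  shows "measure (fiber_measure Y T \<mu>c \<omega>) (ball (\<pi> \<tau>) (exp (birkhoff_sum g n ((unshift ^^ n) \<tau>)) / real (Suc N)))
    \<le> measure (\<mu>c \<omega>) (past_cylinder A (past_word \<tau> n))"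
proof -
  interpret c: prob_space "\<mu>c \<omega>" by (rule conditional_prob_space[OF \<omega>])
  show ?thesis unfolding measure_fiber_ball[OF \<omega>]
  proof (rule c.finite_measure_mono_AE)
    show "AE x in \<mu>c \<omega>. x \<in> \<pi> -` ball (\<pi> \<tau>) (exp (birkhoff_sum g n ((unshift ^^ n) \<tau>)) / real (Suc N)) \<inter> two_sided A
      \<longrightarrow> x \<in> past_cylinder A (past_word \<tau> n)"
      using fib
    proof eventually_elim
      case (elim x)
      have "well_separated N n ((unshift ^^ n) \<tau>)" using good by (simp add: good_set_def)
      then have "past_word x n = past_word \<tau> n \<or> exp (birkhoff_sum g n ((unshift ^^ n) \<tau>)) / real (Suc N) \<le> dist (\<pi> \<tau>) (\<pi> x)"
        using elim \<tau> unfolding well_separated_def shift_unshift_funpow by (auto simp: past_fiber_def)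
      then show ?case using elim by (auto simp: mem_past_cylinder_iff past_fiber_def)
    qed
  qed (simp add: conditional_sets[OF \<omega>] past_cylinder_sets)
qed

text \<open>The \<open>N\<close> additional letters make the two backward points at time
  \<open>n\<close> agree in \<open>N\<close> past letters, so \<open>well_contracted\<close>
  applies. The factor 2 turns its estimate into a strict one for the open ball.\<close>

lemma fiber_ball_ge:
  assumes \<omega>: "\<omega> \<in> one_sided A" and fib: "AE \<tau> in \<mu>c \<omega>. \<tau> \<in> past_fiber A \<omega>"
    and \<tau>: "\<tau> \<in> past_fiber A \<omega>" and good: "(unshift ^^ n) \<tau> \<in> good_set N"
  shows "measure (\<mu>c \<omega>) (past_cylinder A (past_word \<tau> (n + N)))
    \<le> measure (fiber_measure Y T \<mu>c \<omega>) (ball (\<pi> \<tau>) (2 * real (Suc N) * exp (birkhoff_sum g n ((unshift ^^ n) \<tau>))))"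
proof -
  interpret c: prob_space "\<mu>c \<omega>" by (rule conditional_prob_space[OF \<omega>])
  let ?e = "exp (birkhoff_sum g n ((unshift ^^ n) \<tau>))"
  show ?thesis unfolding measure_fiber_ball[OF \<omega>]
  proof (rule c.finite_measure_mono_AE)
    show "AE x in \<mu>c \<omega>. x \<in> past_cylinder A (past_word \<tau> (n + N))
      \<longrightarrow> x \<in> \<pi> -` ball (\<pi> \<tau>) (2 * real (Suc N) * ?e) \<inter> two_sided A"
      using fib
    proof (eventually_elim, intro impI)
      fix x assume x: "x \<in> past_fiber A \<omega>" "x \<in> past_cylinder A (past_word \<tau> (n + N))"
      have w: "past_word x (n + N) = past_word \<tau> (n + N)" using x(2) by (simp add: mem_past_cylinder_iff)
      have "pi0 x = pi0 \<tau>" using x(1) \<tau> by (simp add: past_fiber_def)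
      then have eq: "x k = \<tau> k" if "- int (n + N) \<le> k" for k
        using w that unfolding past_word_eq_iff pi0_eq_iff by (cases "k < 0") auto
      let ?y = "(unshift ^^ n) x"
      have "?y \<in> two_sided A" using x(1) by (simp add: past_fiber_def)
      moreover have "pi0 ?y = pi0 ((unshift ^^ n) \<tau>)"
        unfolding pi0_eq_iff by (auto simp: unshift_funpow_apply intro!: eq)
      moreover have "past_word ?y N = past_word ((unshift ^^ n) \<tau>) N"
        unfolding past_word_eq_iff by (auto simp: unshift_funpow_apply intro!: eq)
      moreover have "well_contracted N n ((unshift ^^ n) \<tau>)" using good by (simp add: good_set_def)
      ultimately have "dist (\<pi> \<tau>) (\<pi> x) \<le> real (Suc N) * ?e"
        unfolding well_contracted_def using shift_unshift_funpow(1) by metis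
      also have "\<dots> < 2 * real (Suc N) * ?e" by simp
      finally show "x \<in> \<pi> -` ball (\<pi> \<tau>) (2 * real (Suc N) * ?e) \<inter> two_sided A"
        using x(1) by (simp add: past_fiber_def)
    qed
  qed (rule fiber_ball_sets[OF \<omega>])
qed

text \<open>Since \<open>g\<close> is bounded above by a negative constant, its positive part has
  integral 0, and the exponent is either infinite or finite and positive.\<close>

lemma lyapunov_exponent_cases:
  obtains (finite) \<kappa> where "0 < \<kappa>" "lyapunov_exponent Y T \<mu> = ereal \<kappa>" "integrable \<mu> g" "(LINT x|\<mu>. g x) = - \<kappa>"
  | (infinite) "lyapunov_exponent Y T \<mu> = \<infinity>" "\<not> integrable \<mu> g"
proof -
  obtain k where k: "0 < k" "\<And>x. x \<in> two_sided A \<Longrightarrow> g x \<le> - k" using log_deriv_le by blast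
  have neg: "g x \<le> 0" if "x \<in> two_sided A" for x using k(2)[OF that] k(1) by simp
  have "(\<integral>\<^sup>+x. ennreal (g x) \<partial>\<mu>) = (\<integral>\<^sup>+x. 0 \<partial>\<mu>)"
    by (intro nn_integral_cong) (use neg in \<open>simp add: ennreal_neg\<close>)
  then have l: "lyapunov_exponent Y T \<mu> = enn2ereal (\<integral>\<^sup>+x. ennreal (- g x) \<partial>\<mu>)"
    by (simp add: lyapunov_exponent_def ext_integral_def zero_ennreal.rep_eq minus_ereal_def)
  show thesis
  proof (cases "integrable \<mu> g")
    case True
    have "(\<integral>\<^sup>+x. ennreal (- g x) \<partial>\<mu>) = ennreal (LINT x|\<mu>. - g x)"
      by (rule nn_integral_eq_integral) (use True neg in auto)
    moreover have "k \<le> (LINT x|\<mu>. - g x)"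
    proof -
      have "(LINT x|\<mu>. k) \<le> (LINT x|\<mu>. - g x)"
        using True k(2) by (intro integral_mono) (auto simp: le_minus_iff)
      then show ?thesis by (simp add: prob_space)
    qed
    ultimately show thesis using True k(1) l by (intro finite[of "LINT x|\<mu>. - g x"]) auto
  next
    case False
    then have "\<not> integrable \<mu> (\<lambda>x. - g x)" by simp
    moreover have "AE x in \<mu>. 0 \<le> - g x" using neg by (intro AE_I2) simp
    ultimately have "(\<integral>\<^sup>+x. ennreal (- g x) \<partial>\<mu>) = \<infinity>"
      using integrableI_nonneg[of "\<lambda>x. - g x" \<mu>] by (fastforce simp: less_top[symmetric])
    then show thesis using False l by (intro infinite) simp_all
  qed
qed

text \<open>The almost sure limits and visit frequencies for \<mu> hold almost surely for almost
  every conditional measure. There, the ball estimates at visits to the good set and the conditional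
  Gibbs bounds feed \<open>local_dim_from_times\<close>.\<close>

lemma fiber_local_dim:
  "\<exists>D\<ge>0. ks_entropy \<mu> shift / lyapunov_exponent Y T \<mu> = ereal D \<and>
    (AE \<omega> in future. AE z in fiber_measure Y T \<mu>c \<omega>. (local_dim_ratio (fiber_measure Y T \<mu>c \<omega>) z \<longlongrightarrow> D) (at_right 0))"
proof -
  define a where "a \<tau> n = - birkhoff_sum g n ((unshift ^^ n) \<tau>)" for \<tau> n
  have "\<exists>D\<ge>0. ks_entropy \<mu> shift / lyapunov_exponent Y T \<mu> = ereal D \<and> (\<exists>\<kappa>. AE \<tau> in \<mu>.
      (((\<lambda>n. a \<tau> n / real n) \<longlonglongrightarrow> \<kappa>) \<and> 0 < \<kappa> \<and> D = excess / \<kappa>) \<or> (filterlim (\<lambda>n. a \<tau> n / real n) at_top sequentially \<and> D = 0))"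
  proof (cases rule: lyapunov_exponent_cases)
    case (finite \<kappa>)
    have "AE \<tau> in \<mu>. (\<lambda>n. a \<tau> n / real n) \<longlonglongrightarrow> \<kappa>"
      using AE_past_average[OF finite(3)]
    proof eventually_elim
      case (elim \<tau>)
      show ?case using tendsto_minus[OF elim] by (simp add: a_def finite(4))
    qed
    then show ?thesis using finite(1,2) excess_nonneg
      by (intro exI[of _ "excess / \<kappa>"] conjI exI[of _ \<kappa>]) (auto simp: ks_entropy_gibbs)
  next
    case infinite
    have "AE \<tau> in \<mu>. filterlim (\<lambda>n. a \<tau> n / real n) at_top sequentially"
      unfolding a_def by (rule AE_past_average_infinite) (use log_deriv_le infinite(2) in \<open>auto intro: order_trans\<close>)
    \<comment> \<open>A finite entropy divided by the infinite exponent is 0, which is the value of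
      \<open>D\<close> here.\<close>
    then show ?thesis using infinite(1)
      by (intro exI[of _ 0] conjI exI[of _ 0]) (auto simp: ks_entropy_gibbs)
  qed
  then obtain D \<kappa> where D: "0 \<le> D" "ks_entropy \<mu> shift / lyapunov_exponent Y T \<mu> = ereal D"
    and a: "AE \<tau> in \<mu>. (((\<lambda>n. a \<tau> n / real n) \<longlonglongrightarrow> \<kappa>) \<and> 0 < \<kappa> \<and> D = excess / \<kappa>) \<or> (filterlim (\<lambda>n. a \<tau> n / real n) at_top sequentially \<and> D = 0)"
    by blast
  obtain N where N: "0 < prob (good_set N)" using good_set_positive by blast
  have b: "AE \<tau> in \<mu>. (\<lambda>n. - past_weight n \<tau> / real n) \<longlonglongrightarrow> excess"
    using AE_past_average[OF \<psi>_integrable]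
  proof eventually_elim
    case (elim \<tau>)
    have "\<forall>\<^sub>F n in sequentially. P - birkhoff_sum \<psi> n ((unshift ^^ n) \<tau>) / real n = - past_weight n \<tau> / real n"
      using eventually_gt_at_top[of 0] by eventually_elim (simp add: past_weight_def field_simps)
    with tendsto_diff[OF tendsto_const elim, of P] show ?case by (rule Lim_transform_eventually)
  qed
  obtain d where d: "1 \<le> d" "AE \<omega> in future. \<forall>n\<ge>1. \<forall>\<tau>\<in>past_fiber A \<omega>.
      exp (past_weight n \<tau>) / d \<le> measure (\<mu>c \<omega>) (past_cylinder A (past_word \<tau> n)) \<and>
      measure (\<mu>c \<omega>) (past_cylinder A (past_word \<tau> n)) \<le> d * exp (past_weight n \<tau>)"
    using conditional_gibbs by blast
  from d(2) AE_conditional[OF a] AE_conditional[OF b] AE_conditional[OF AE_past_frequency[OF good_set_sets[of N]]] conditional_fiber AE_space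
  have "AE \<omega> in future. AE z in fiber_measure Y T \<mu>c \<omega>. (local_dim_ratio (fiber_measure Y T \<mu>c \<omega>) z \<longlongrightarrow> D) (at_right 0)"
  proof eventually_elim
    case (elim \<omega>)
    then have \<omega>: "\<omega> \<in> one_sided A" by simp
    interpret c: prob_space "\<mu>c \<omega>" by (rule conditional_prob_space[OF \<omega>])
    have gibbs: "exp (past_weight n \<tau>) / d \<le> measure (\<mu>c \<omega>) (past_cylinder A (past_word \<tau> n))"
      "measure (\<mu>c \<omega>) (past_cylinder A (past_word \<tau> n)) \<le> d * exp (past_weight n \<tau>)" if "1 \<le> n" "\<tau> \<in> past_fiber A \<omega>" for n \<tau>
      using elim(1) that by blast+
    note fib = elim(5)
    let ?\<nu> = "fiber_measure Y T \<mu>c \<omega>"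
    have "AE \<tau> in \<mu>c \<omega>. (\<forall>r>0. 0 < measure ?\<nu> (ball (\<pi> \<tau>) r)) \<and> (local_dim_ratio ?\<nu> (\<pi> \<tau>) \<longlongrightarrow> D) (at_right 0)"
      using elim(2-5)
    proof eventually_elim
      case (elim \<tau>)
      note a = elim(1) and b = elim(2) and freq = elim(3) and \<tau> = elim(4)
      obtain s where s: "strict_mono s" "\<And>k. (unshift ^^ s k) \<tau> \<in> good_set N" "(\<lambda>k. real (s (Suc k)) / real (s k)) \<longlonglongrightarrow> 1"
        using infinite_times_of_positive_frequency[OF freq N] by blast
      have large: "\<forall>\<^sub>F k in sequentially. 1 \<le> s k"
        by (rule eventually_compose_filterlim[OF eventually_ge_at_top filterlim_subseq[OF s(1)]])
      have prob: "prob_space ?\<nu>" unfolding fiber_measure_def by (rule c.prob_space_distr[OF \<pi>_measurable[OF \<omega>]])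
      have sets: "sets ?\<nu> = sets borel" by (simp add: fiber_measure_def)
      have up: "\<forall>\<^sub>F k in sequentially. measure ?\<nu> (ball (\<pi> \<tau>) (exp (- a \<tau> (s k)) / real (Suc N))) \<le> d * exp (- (- past_weight (s k) \<tau>))"
        using large
      proof eventually_elim
        case (elim k)
        show ?case using order_trans[OF fiber_ball_le[OF \<omega> fib \<tau> s(2)] gibbs(2)[OF elim \<tau>]] by (simp add: a_def del: of_nat_Suc)
      qed
      have lo: "\<forall>\<^sub>F k in sequentially. exp (- (- past_weight (s k + N) \<tau>)) / d \<le> measure ?\<nu> (ball (\<pi> \<tau>) (2 * real (Suc N) * exp (- a \<tau> (s k))))"
        using large
      proof eventually_elim
        case (elim k)
        then have "1 \<le> s k + N" by simp
        from order_trans[OF gibbs(1)[OF this \<tau>] fiber_ball_ge[OF \<omega> fib \<tau> s(2)]]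
        show ?case by (simp add: a_def del: of_nat_Suc)
      qed
      have pos: "0 < real (Suc N)" "0 < 2 * real (Suc N)" "0 < d" using d(1) by auto
      from local_dim_from_times[OF prob sets s(1,3) pos up lo b excess_nonneg a]
      show ?case by blast
    qed
    then show ?case unfolding fiber_measure_def
      by (rule AE_distr_local_dim[OF conditional_prob_space[OF \<omega>] \<pi>_measurable[OF \<omega>] D(1)])
  qed
  with D show ?thesis by blast
qed

end

theorem theorem6p2:
  fixes A :: "'e :: countable \<Rightarrow> 'e \<Rightarrow> bool"
    and Y0 :: "'a :: euclidean_space set"
    and Y Ystar :: "(nat \<Rightarrow> 'e) \<Rightarrow> 'a set"
    and T :: "(nat \<Rightarrow> 'e) \<Rightarrow> 'a \<Rightarrow> 'a"
    and \<psi> :: "(int \<Rightarrow> 'e) \<Rightarrow> real"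
    and \<mu> :: "(int \<Rightarrow> 'e) measure"
    and \<mu>c :: "(nat \<Rightarrow> 'e) \<Rightarrow> (int \<Rightarrow> 'e) measure"
  assumes "hoelder_conformal_smale A Y0 Y T Ystar"
    and "hoelder A \<psi>"
    and "summable_potential A \<psi>"
    and "gibbs_state A \<psi> \<mu>"
    and "integrable \<mu> \<psi>"
    and "rokhlin_conditionals A \<mu> \<mu>c"
  shows "(AE \<omega> in distr \<mu> (one_sided_borel A) pi0.
            measure_dim (fiber_measure Y T \<mu>c \<omega>) = ks_entropy \<mu> shift / lyapunov_exponent Y T \<mu>) \<and>
         ks_entropy \<mu> shift / lyapunov_exponent Y T \<mu>
           = ereal (pressure A \<psi> - (LINT \<tau>|\<mu>. \<psi> \<tau>)) / lyapunov_exponent Y T \<mu> \<and>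
         (AE \<omega> in distr \<mu> (one_sided_borel A) pi0. exact_dimensional (fiber_measure Y T \<mu>c \<omega>)) \<and>
         (AE \<omega> in distr \<mu> (one_sided_borel A) pi0. AE z in fiber_measure Y T \<mu>c \<omega>.
            ((\<lambda>r. ereal (local_dim_ratio (fiber_measure Y T \<mu>c \<omega>) z r))
               \<longlongrightarrow> ks_entropy \<mu> shift / lyapunov_exponent Y T \<mu>) (at_right 0))"
proof -
  interpret hoelder_conformal_smale A Y0 Y T Ystar by fact
  obtain C where C: "1 \<le> C" and q: "\<And>n \<omega>. 1 \<le> n \<Longrightarrow> \<omega> \<in> two_sided A \<Longrightarrow>
      1 / C \<le> measure \<mu> (cylinder A (map (\<lambda>j. \<omega> (int j)) [0..<n])) / exp (birkhoff_sum \<psi> n \<omega> - pressure A \<psi> * real n) \<and>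
      measure \<mu> (cylinder A (map (\<lambda>j. \<omega> (int j)) [0..<n])) / exp (birkhoff_sum \<psi> n \<omega> - pressure A \<psi> * real n) \<le> C"
    using assms(4) unfolding gibbs_state_def Let_def by blast
  interpret prob_space \<mu> using assms(4) by (simp add: gibbs_state_def)
  interpret smale_gibbs A Y0 Y Ystar T \<psi> "pressure A \<psi>" C \<mu> \<mu>c
  proof
    show "exp (birkhoff_sum \<psi> n x - pressure A \<psi> * real n) / C \<le> measure \<mu> (cylinder A (word_of x n))"
      "measure \<mu> (cylinder A (word_of x n)) \<le> C * exp (birkhoff_sum \<psi> n x - pressure A \<psi> * real n)"
      if "1 \<le> n" "x \<in> two_sided A" for n x
      using q[OF that] C by (simp_all add: pos_le_divide_eq pos_divide_le_eq)
  qed (use assms C irreducible in \<open>simp_all add: gibbs_state_def\<close>)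
  \<comment> \<open>The quotient in the statement is a real number \<open>D\<close>, so every claim
    follows from the local dimension or from the value of the entropy.\<close>
  obtain D where D: "0 \<le> D" "ks_entropy \<mu> shift / lyapunov_exponent Y T \<mu> = ereal D"
    and local_dim: "AE \<omega> in future. AE z in fiber_measure Y T \<mu>c \<omega>. (local_dim_ratio (fiber_measure Y T \<mu>c \<omega>) z \<longlongrightarrow> D) (at_right 0)"
    using fiber_local_dim by blast
  have "AE \<omega> in future. measure_dim (fiber_measure Y T \<mu>c \<omega>) = ereal D"
    using local_dim AE_space
  proof eventually_elim
    case (elim \<omega>)
    then have \<omega>: "\<omega> \<in> one_sided A" by simp
    have "prob_space (fiber_measure Y T \<mu>c \<omega>)"
      unfolding fiber_measure_def by (rule prob_space.prob_space_distr[OF conditional_prob_space[OF \<omega>] \<pi>_measurable[OF \<omega>]])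
    then show ?case by (rule measure_dim_eq_local_dim) (use D(1) elim(1) in \<open>simp_all add: fiber_measure_def\<close>)
  qed
  moreover have "AE \<omega> in future. exact_dimensional (fiber_measure Y T \<mu>c \<omega>)"
    using local_dim by eventually_elim (auto simp: exact_dimensional_def)
  moreover have "AE \<omega> in future. AE z in fiber_measure Y T \<mu>c \<omega>.
      ((\<lambda>r. ereal (local_dim_ratio (fiber_measure Y T \<mu>c \<omega>) z r)) \<longlongrightarrow> ereal D) (at_right 0)"
    using local_dim by simp
  ultimately show ?thesis unfolding D(2) by (simp add: D(2)[symmetric] ks_entropy_gibbs)
qed

end
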